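(* Let $L>0$, $h>0$, and let $\alpha\in\mathbb{R}$, $\beta>0$ satisfy $0<2\alpha^2+\frac32\beta<\frac12$. Then there exists $r$ with $0<r<\frac{3}{16L^{3/2}}$ such that for every initial data $(u_0,v_0,z_0)\in H$ with $\|(u_0,v_0,z_0)\|_H\le r$, the energy $E(t)$ of the solution of the Hirota-Satsuma system (see context) decays exponentially. More precisely, for all sufficiently small positive constants $\mu_1,\mu_2$, setting $\kappa=1+\max\{\mu_1L,\mu_2\}$ and taking any $\lambda>0$ with $$\lambda\le\min\left\{\frac{\pi^2\mu_1\,(3-16L^{3/2}r)}{2L^2(1+L\mu_1)},\ \frac{\mu_2}{h(1+\mu_2)}\right\},$$ one has $E(t)\le\kappa E(0)e^{-\lambda t}$ for all $t\ge0$.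
   Context: All functions are real valued. The Hirota-Satsuma system with boundary time-delay feedback (delay $h>0$, feedback gains $\alpha,\beta$) on $(0,L)$ is $$\begin{cases}u_t-\frac12u_{xxx}-3uu_x-3vv_x=0,& x\in(0,L),\ t>0,\\ v_t+v_{xxx}+3uv_x=0,& x\in(0,L),\ t>0,\\ u(t,0)=u(t,L)=v(t,0)=v(t,L)=u_x(t,0)=0,& t>0,\\ v_x(t,L)=\alpha u_x(t,L)+\beta u_x(t-h,L),& t>0,\\ u(0,x)=u_0(x),\ v(0,x)=v_0(x),& x\in(0,L),\\ u_x(t-h,L)=z_0(t-h),& t\in(0,h).\end{cases}$$ The delay is represented by $z(t,\rho)=u_x(t-h\rho,L)$, $\rho\in(0,1)$, which satisfies $hz_t+z_\rho=0$, $z(t,0)=u_x(t,L)$, $z(0,\rho)=z_0(-h\rho)$. Spaces: $X_0=[L^2(0,L)]^2$, $H=X_0\times L^2(0,1)$, with $\|(u,v,z)\|_H^2=\|(u,v)\|_{X_0}^2+\beta h\|z\|_{L^2(0,1)}^2$. The notation $(u_0,v_0,z_0)\in H$ means $(u_0,v_0,z_0(-h\,\cdot))\in H$, and $\|(u_0,v_0,z_0)\|_H$ is the norm of this element. Solutions are mild solutions, with $(u,v,z)\in C([0,T];H)$ and $(u,v)\in C([0,T];X_0)\cap L^2(0,T;[H^1(0,L)]^2)$ for every $T>0$; they exist globally for small data. The energy is $$E(t)=\frac12\int_0^L\big(u^2(t,x)+v^2(t,x)\big)\,dx+\frac{\beta h}{2}\int_0^1u_x^2(t-h\rho,L)\,d\rho.$$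 *)

theory Defs
  imports "HOL-Analysis.Analysis"
begin

section \<open>Sobolev spaces on a bounded open interval\<close>

text \<open>
  Elements of \<open>L\<^sup>2(a,b)\<close> are represented by functions on the real line, of which only the values
  on \<open>(a,b)\<close> matter, and only up to null sets.
\<close>

definition L2 :: "real \<Rightarrow> real \<Rightarrow> (real \<Rightarrow> real) set" where
  "L2 a b = {f. f \<in> borel_measurable (lebesgue_on {a<..<b}) \<and>
                integrable (lebesgue_on {a<..<b}) (\<lambda>x. (f x)\<^sup>2)}"

definition inner_L2 :: "real \<Rightarrow> real \<Rightarrow> (real \<Rightarrow> real) \<Rightarrow> (real \<Rightarrow> real) \<Rightarrow> real" where
  "inner_L2 a b f g = (\<integral>x. f x * g x \<partial>lebesgue_on {a<..<b})"

text \<open>Weak derivatives are tested against \<open>C\<^sup>1\<close> functions with compact support in \<open>(a,b)\<close>.\<close>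

definition has_weak_deriv ::
    "real \<Rightarrow> real \<Rightarrow> (real \<Rightarrow> real) \<Rightarrow> (real \<Rightarrow> real) \<Rightarrow> bool" where
  "has_weak_deriv a b f g \<longleftrightarrow>
     (\<forall>\<phi> \<phi>'. (\<forall>x. (\<phi> has_real_derivative \<phi>' x) (at x)) \<and> continuous_on UNIV \<phi>' \<and>
            (\<exists>c d. a < c \<and> d < b \<and> (\<forall>x. x \<notin> {c..d} \<longrightarrow> \<phi> x = 0))
        \<longrightarrow> inner_L2 a b f \<phi>' = - inner_L2 a b g \<phi>)"

definition H1 :: "real \<Rightarrow> real \<Rightarrow> (real \<Rightarrow> real) set" where
  "H1 a b = {f \<in> L2 a b. \<exists>g \<in> L2 a b. has_weak_deriv a b f g}"

text \<open>The weak derivative is unique up to null sets; \<open>wderiv\<close> picks a representative.\<close>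

definition wderiv :: "real \<Rightarrow> real \<Rightarrow> (real \<Rightarrow> real) \<Rightarrow> real \<Rightarrow> real" where
  "wderiv a b f = (SOME g. g \<in> L2 a b \<and> has_weak_deriv a b f g)"

definition H3 :: "real \<Rightarrow> real \<Rightarrow> (real \<Rightarrow> real) set" where
  "H3 a b = {f \<in> H1 a b. wderiv a b f \<in> H1 a b \<and> wderiv a b (wderiv a b f) \<in> H1 a b}"

text \<open>
  The value at \<open>p \<in> [a,b]\<close> of an \<open>H\<^sup>1\<close> function is the value of its unique continuous representative.
\<close>

definition trace_at :: "real \<Rightarrow> real \<Rightarrow> (real \<Rightarrow> real) \<Rightarrow> real \<Rightarrow> real" where
  "trace_at a b f p =
     (THE y. \<exists>w. continuous_on {a..b} w \<and> (AE x in lebesgue_on {a<..<b}. f x = w x) \<and> w p = y)"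

section \<open>The state space \<open>H\<close>\<close>

text \<open>States \<open>(u, v, z)\<close>, with \<open>u\<close>, \<open>v\<close> on \<open>(0,L)\<close> and \<open>z\<close> on \<open>(0,1)\<close>.\<close>

type_synonym state = "(real \<Rightarrow> real) \<times> (real \<Rightarrow> real) \<times> (real \<Rightarrow> real)"

definition H_space :: "real \<Rightarrow> state set" where
  "H_space L = {(u, v, z). u \<in> L2 0 L \<and> v \<in> L2 0 L \<and> z \<in> L2 0 1}"

fun inner_H :: "real \<Rightarrow> real \<Rightarrow> real \<Rightarrow> state \<Rightarrow> state \<Rightarrow> real" where
  "inner_H L h \<beta> (u1, v1, z1) (u2, v2, z2) =
     inner_L2 0 L u1 u2 + inner_L2 0 L v1 v2 + \<beta> * h * inner_L2 0 1 z1 z2"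

definition norm_H :: "real \<Rightarrow> real \<Rightarrow> real \<Rightarrow> state \<Rightarrow> real" where
  "norm_H L h \<beta> X = sqrt (inner_H L h \<beta> X X)"

fun lincomb :: "real \<Rightarrow> state \<Rightarrow> real \<Rightarrow> state \<Rightarrow> state" where
  "lincomb a (u1, v1, z1) b (u2, v2, z2) =
     ((\<lambda>x. a * u1 x + b * u2 x), (\<lambda>x. a * v1 x + b * v2 x), (\<lambda>x. a * z1 x + b * z2 x))"

text \<open>For \<open>\<beta>, h > 0\<close>, two states are the same element of \<open>H\<close> iff their \<open>dist_H\<close> is \<open>0\<close>.\<close>

definition dist_H :: "real \<Rightarrow> real \<Rightarrow> real \<Rightarrow> state \<Rightarrow> state \<Rightarrow> real" where
  "dist_H L h \<beta> X Y = norm_H L h \<beta> (lincomb 1 X (-1) Y)"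

text \<open>
  Bochner integral of an \<open>H\<close>-valued function over \<open>(0,t)\<close>.  As \<open>H\<close> is a separable Hilbert space,
  Bochner integrability is weak measurability together with integrability of the norm, and the
  value of the integral is determined by its inner products with the elements of \<open>H\<close>.
\<close>

definition has_integral_H ::
    "real \<Rightarrow> real \<Rightarrow> real \<Rightarrow> (real \<Rightarrow> state) \<Rightarrow> real \<Rightarrow> state \<Rightarrow> bool" where
  "has_integral_H L h \<beta> f t W \<longleftrightarrow>
     W \<in> H_space L \<and>
     (AE s in lebesgue_on {0<..<t}. f s \<in> H_space L) \<and>
     integrable (lebesgue_on {0<..<t}) (\<lambda>s. norm_H L h \<beta> (f s)) \<and>
     (\<forall>\<Phi> \<in> H_space L.
        integrable (lebesgue_on {0<..<t}) (\<lambda>s. inner_H L h \<beta> (f s) \<Phi>) \<and>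
        inner_H L h \<beta> W \<Phi> = (\<integral>s. inner_H L h \<beta> (f s) \<Phi> \<partial>lebesgue_on {0<..<t}))"

section \<open>Strongly continuous semigroups on \<open>H\<close>\<close>

definition C0_semigroup :: "real \<Rightarrow> real \<Rightarrow> real \<Rightarrow> (real \<Rightarrow> state \<Rightarrow> state) \<Rightarrow> bool" where
  "C0_semigroup L h \<beta> S \<longleftrightarrow>
     (\<forall>t\<ge>0. \<forall>X \<in> H_space L. S t X \<in> H_space L) \<and>
     (\<forall>t\<ge>0. \<forall>X \<in> H_space L. \<forall>Y \<in> H_space L. \<forall>a b.
        dist_H L h \<beta> (S t (lincomb a X b Y)) (lincomb a (S t X) b (S t Y)) = 0) \<and>
     (\<forall>t\<ge>0. \<exists>M. \<forall>X \<in> H_space L. norm_H L h \<beta> (S t X) \<le> M * norm_H L h \<beta> X) \<and>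
     (\<forall>X \<in> H_space L. dist_H L h \<beta> (S 0 X) X = 0) \<and>
     (\<forall>s\<ge>0. \<forall>t\<ge>0. \<forall>X \<in> H_space L. dist_H L h \<beta> (S (s + t) X) (S s (S t X)) = 0) \<and>
     (\<forall>X \<in> H_space L. ((\<lambda>t. dist_H L h \<beta> (S t X) X) \<longlongrightarrow> 0) (at_right 0))"

definition has_generator ::
    "real \<Rightarrow> real \<Rightarrow> real \<Rightarrow> (real \<Rightarrow> state \<Rightarrow> state) \<Rightarrow> state set \<Rightarrow> (state \<Rightarrow> state) \<Rightarrow> bool" where
  "has_generator L h \<beta> S D A \<longleftrightarrow>
     (\<forall>X \<in> H_space L. \<forall>Y \<in> H_space L.
        ((\<lambda>t. dist_H L h \<beta> (lincomb (1 / t) (S t X) (- 1 / t) X) Y) \<longlongrightarrow> 0) (at_right 0) \<longleftrightarrow>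
        X \<in> D \<and> dist_H L h \<beta> (A X) Y = 0)"

section \<open>The delayed Hirota-Satsuma system\<close>

text \<open>
  With \<open>z(t,\<rho>) = u\<^sub>x(t - h\<rho>, L)\<close> the system is \<open>U' = A U + F U\<close> for \<open>U = (u, v, z)\<close>; all the
  boundary conditions, including the delayed feedback, are part of the domain of \<open>A\<close>.
\<close>

definition HS_domain :: "real \<Rightarrow> real \<Rightarrow> real \<Rightarrow> state set" where
  "HS_domain L \<alpha> \<beta> = {(u, v, z).
     u \<in> H3 0 L \<and> v \<in> H3 0 L \<and> z \<in> H1 0 1 \<and>
     trace_at 0 L u 0 = 0 \<and> trace_at 0 L u L = 0 \<and>
     trace_at 0 L v 0 = 0 \<and> trace_at 0 L v L = 0 \<and>
     trace_at 0 L (wderiv 0 L u) 0 = 0 \<and>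
     trace_at 0 1 z 0 = trace_at 0 L (wderiv 0 L u) L \<and>
     trace_at 0 L (wderiv 0 L v) L
       = \<alpha> * trace_at 0 L (wderiv 0 L u) L + \<beta> * trace_at 0 1 z 1}"

fun HS_operator :: "real \<Rightarrow> real \<Rightarrow> state \<Rightarrow> state" where
  "HS_operator L h (u, v, z) =
     ((\<lambda>x. 1 / 2 * wderiv 0 L (wderiv 0 L (wderiv 0 L u)) x),
      (\<lambda>x. - wderiv 0 L (wderiv 0 L (wderiv 0 L v)) x),
      (\<lambda>\<rho>. - (1 / h) * wderiv 0 1 z \<rho>))"

fun HS_nonlinearity :: "real \<Rightarrow> state \<Rightarrow> state" where
  "HS_nonlinearity L (u, v, z) =
     ((\<lambda>x. 3 * u x * wderiv 0 L u x + 3 * v x * wderiv 0 L v x),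
      (\<lambda>x. - 3 * u x * wderiv 0 L v x),
      (\<lambda>\<rho>. 0))"

definition norm_H1_sq :: "real \<Rightarrow> real \<Rightarrow> (real \<Rightarrow> real) \<Rightarrow> real" where
  "norm_H1_sq a b f = inner_L2 a b f f + inner_L2 a b (wderiv a b f) (wderiv a b f)"

text \<open>
  A function that is continuous into \<open>L\<^sup>2\<close> and lies in \<open>H\<^sup>1\<close> for almost every time is automatically
  strongly measurable into \<open>H\<^sup>1\<close>, so that membership in \<open>L\<^sup>2(0,T; H\<^sup>1)\<close> is integrability of the
  squared norm.
\<close>

definition L2_time_H1 :: "real \<Rightarrow> real \<Rightarrow> (real \<Rightarrow> real \<Rightarrow> real) \<Rightarrow> bool" where
  "L2_time_H1 L T w \<longleftrightarrow>
     (AE t in lebesgue_on {0<..<T}. w t \<in> H1 0 L) \<and>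
     integrable (lebesgue_on {0<..<T}) (\<lambda>t. norm_H1_sq 0 L (w t))"

text \<open>
  Global mild solutions: the variation-of-constants formula
  \<open>U(t) = S(t) U\<^sub>0 + \<integral>\<^sub>0\<^sup>t S(t-s) F(U(s)) ds\<close>, where \<open>S\<close> is the \<open>C\<^sub>0\<close>-semigroup generated by \<open>A\<close>
  (which is determined by \<open>A\<close>).
\<close>

definition mild_solution ::
    "real \<Rightarrow> real \<Rightarrow> real \<Rightarrow> real \<Rightarrow> state \<Rightarrow> (real \<Rightarrow> state) \<Rightarrow> bool" where
  "mild_solution L h \<alpha> \<beta> U0 U \<longleftrightarrow>
     (\<forall>t\<ge>0. U t \<in> H_space L) \<and>
     (\<forall>t\<ge>0. ((\<lambda>s. dist_H L h \<beta> (U s) (U t)) \<longlongrightarrow> 0) (at t within {0..})) \<and>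
     (\<forall>T>0. L2_time_H1 L T (\<lambda>t. fst (U t)) \<and> L2_time_H1 L T (\<lambda>t. fst (snd (U t)))) \<and>
     (\<exists>S. C0_semigroup L h \<beta> S \<and>
          has_generator L h \<beta> S (HS_domain L \<alpha> \<beta>) (HS_operator L h) \<and>
          (\<forall>t\<ge>0. \<exists>W.
             has_integral_H L h \<beta> (\<lambda>s. S (t - s) (HS_nonlinearity L (U s))) t W \<and>
             dist_H L h \<beta> (U t) (lincomb 1 (S t U0) 1 W) = 0))"

text \<open>The initial state \<open>(u\<^sub>0, v\<^sub>0, z\<^sub>0(-h \<cdot>))\<close>; \<open>z\<^sub>0\<close> is a function on \<open>(-h,0)\<close>.\<close>

definition initial_state ::
    "real \<Rightarrow> (real \<Rightarrow> real) \<Rightarrow> (real \<Rightarrow> real) \<Rightarrow> (real \<Rightarrow> real) \<Rightarrow> state" where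
  "initial_state h u0 v0 z0 = (u0, v0, (\<lambda>\<rho>. z0 (- h * \<rho>)))"

text \<open>
  For mild solutions \<open>u(t)\<close> is only in \<open>L\<^sup>2\<close> at a given time, and \<open>u\<^sub>x(t - h\<rho>, L)\<close> in the energy is
  the component \<open>z(t,\<rho>)\<close> of the state.
\<close>

fun state_energy :: "real \<Rightarrow> real \<Rightarrow> real \<Rightarrow> state \<Rightarrow> real" where
  "state_energy L h \<beta> (u, v, z) =
     1 / 2 * (\<integral>x. (u x)\<^sup>2 + (v x)\<^sup>2 \<partial>lebesgue_on {0<..<L})
     + \<beta> * h / 2 * (\<integral>\<rho>. (z \<rho>)\<^sup>2 \<partial>lebesgue_on {0<..<1})"

end

theory Submission
  imports Defs
begin

text \<open>
  The energy is compared with the Lyapunov functional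
  \<open>V = 1/2 \<integral>(1 + \<mu>1 (L - x)) u\<^sup>2 + 1/2 \<integral>(1 + \<mu>1 x) v\<^sup>2 + \<beta> h / 2 \<integral>(1 + \<mu>2 (1 - \<rho>)) z\<^sup>2\<close>, which
  satisfies \<open>E \<le> V \<le> \<kappa> E\<close>. The dispersive terms of the two equations have opposite signs, so the
  weights in \<open>u\<close> and in \<open>v\<close> run in opposite directions; the weight in \<open>z\<close> decreases along the
  transport. Integration by parts (\<open>third_order_identity\<close>, \<open>first_order_identity\<close>) shows that
  along the linear flow \<open>V' \<le> - D\<close> with \<open>D = \<mu>1 (3/4 \<parallel>u\<^sub>x\<parallel>\<^sup>2 + 3/2 \<parallel>v\<^sub>x\<parallel>\<^sup>2) + \<beta> \<mu>2 / 2 \<parallel>z\<parallel>\<^sup>2\<close>: the gain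
  condition leaves room to absorb all the boundary terms when \<open>\<mu>1\<close> and \<open>\<mu>2\<close> are small
  (\<open>boundary_feedback_estimate\<close>, \<open>HS_dissipative\<close>). The nonlinearity does no work in the
  unweighted energy, so the norm of the state never exceeds \<open>r\<close>. In \<open>V\<close> it contributes cubic terms
  of at most \<open>\<mu>1 L sqrt L r (5/2 \<parallel>u\<^sub>x\<parallel>\<^sup>2 + 3/2 \<parallel>v\<^sub>x\<parallel>\<^sup>2)\<close> (\<open>cubic_bound\<close>, \<open>transport_bound\<close>), which \<open>D\<close>
  dominates for small \<open>r\<close>. The Wirtinger inequality with the optimal constant \<open>L\<^sup>2 / \<pi>\<^sup>2\<close> turns the
  rest of \<open>D\<close> into a multiple of \<open>V\<close> (\<open>lyapunov_rate\<close>), and \<open>V' \<le> - \<lambda> V\<close> gives the decay. The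
  choice \<open>r = 1 / (16 L sqrt L)\<close> works.

  A mild solution is not in the domain of the linear operator, so the computation of \<open>V'\<close> has to
  be justified. The pairs \<open>(x, A x)\<close> of the generator satisfy a quadratic inequality; it passes to
  orbits by density of the domain and to mild solutions by restarting the variation of constants
  formula on the intervals of a partition and refining the partition (\<open>mild_energy_inequality\<close>).
  This needs a dissipation that is continuous on the state space, while \<open>\<parallel>u\<^sub>x\<parallel>\<^sup>2\<close> is not. Therefore
  \<open>\<parallel>u\<^sub>x\<parallel>\<^sup>2\<close> is written as an increasing limit of the continuous functionals \<open>dirichlet_approx\<close>, each
  a maximum of finitely many expressions \<open>- 2 \<langle>u, \<phi>'\<rangle> - \<parallel>\<phi>\<parallel>\<^sup>2\<close> with polynomials \<open>\<phi>\<close>. Nothing forces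
  these \<open>\<phi>\<close> to vanish at the ends, so for \<open>u\<close> in \<open>H\<^sup>1\<close> the limit is finite only if \<open>u\<close> has zero
  boundary values (\<open>bounded_dirichlet_approx_trace\<close>): the energy inequality itself shows that a
  mild solution satisfies the Dirichlet conditions at almost every time (\<open>in_H1_0_ae\<close>).

  The abstract argument runs in a genuine Hilbert space type. States are representatives of
  classes of functions; they are embedded by \<open>emb\<close> into a product of three copies of \<open>L\<^sup>2(\<real>)\<close>,
  which is constructed as a quotient type and shown to be complete. One-dimensional Sobolev theory
  is reduced to absolutely continuous functions (\<open>H1_ac\<close>, \<open>ac_H1\<close>), for which everything follows
  from the density of polynomials.
\<close>

section \<open>Integrals over open intervals\<close>

lemma AE_lebesgue_on_iff:
  "S \<in> sets lebesgue \<Longrightarrow> (AE x in lebesgue_on S. P x) \<longleftrightarrow> (AE x in lebesgue. x \<in> S \<longrightarrow> P x)"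
  by (simp add: AE_restrict_space_iff)

lemma integrable_lebesgue_on_iff:
  fixes f :: "real \<Rightarrow> real"
  shows "S \<in> sets lebesgue \<Longrightarrow> integrable (lebesgue_on S) f \<longleftrightarrow> integrable lebesgue (\<lambda>x. indicator S x * f x)"
  by (simp add: integrable_restrict_space)

lemma integral_lebesgue_on_eq:
  fixes f :: "real \<Rightarrow> real"
  shows "S \<in> sets lebesgue \<Longrightarrow> integral\<^sup>L (lebesgue_on S) f = integral\<^sup>L lebesgue (\<lambda>x. indicator S x * f x)"
  by (simp add: integral_restrict_space)

lemma borel_measurable_lebesgue_on_iff:
  fixes f :: "real \<Rightarrow> real"
  shows "S \<in> sets lebesgue \<Longrightarrow> f \<in> borel_measurable (lebesgue_on S) \<longleftrightarrow> (\<lambda>x. indicator S x * f x) \<in> borel_measurable lebesgue"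
  by (simp add: borel_measurable_restrict_space_iff mult.commute)

text \<open>
  Lebesgue measure is complete, so the property holds for every function that agrees with \<open>f\<close> off
  a null set, not only for measurable ones.
\<close>

lemma borel_measurable_AE_cong:
  fixes f g :: "real \<Rightarrow> real"
  assumes f: "f \<in> borel_measurable lebesgue" and ae: "AE x in lebesgue. f x = g x"
  shows "g \<in> borel_measurable lebesgue"
proof (rule borel_measurableI)
  fix A :: "real set" assume A: "open A"
  have 1: "f -` A \<in> sets lebesgue" using measurable_sets[OF f, of A] A by simp
  have 2: "AE x in lebesgue. x \<in> f -` A \<longleftrightarrow> x \<in> g -` A" using ae by eventually_elim simp
  have "g -` A \<in> sets lebesgue"
    by (rule completion.in_sets_AE[OF 2 1]) simp
  then show "g -` A \<inter> space lebesgue \<in> sets lebesgue" by simp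
qed

lemma borel_measurable_lebesgue_on_AE_cong:
  fixes f g :: "real \<Rightarrow> real"
  assumes S: "S \<in> sets lebesgue" and f: "f \<in> borel_measurable (lebesgue_on S)"
    and ae: "AE x in lebesgue_on S. f x = g x"
  shows "g \<in> borel_measurable (lebesgue_on S)"
proof -
  have 1: "(\<lambda>x. indicator S x * f x) \<in> borel_measurable lebesgue"
    using f by (simp add: borel_measurable_lebesgue_on_iff[OF S])
  have "AE x in lebesgue. indicator S x * f x = indicator S x * g x"
    using ae unfolding AE_lebesgue_on_iff[OF S] by eventually_elim (auto simp: indicator_def)
  then show ?thesis
    using borel_measurable_AE_cong[OF 1] by (simp add: borel_measurable_lebesgue_on_iff[OF S])
qed

lemma integrable_lebesgue_on_AE_cong:
  fixes f g :: "real \<Rightarrow> real"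
  assumes S: "S \<in> sets lebesgue" and f: "integrable (lebesgue_on S) f"
    and ae: "AE x in lebesgue_on S. f x = g x"
  shows "integrable (lebesgue_on S) g" "integral\<^sup>L (lebesgue_on S) g = integral\<^sup>L (lebesgue_on S) f"
proof -
  have m: "f \<in> borel_measurable (lebesgue_on S)" using f by simp
  have g: "g \<in> borel_measurable (lebesgue_on S)"
    using borel_measurable_lebesgue_on_AE_cong[OF S m ae] .
  show "integrable (lebesgue_on S) g" using f ae by (simp add: integrable_cong_AE[OF m g])
  show "integral\<^sup>L (lebesgue_on S) g = integral\<^sup>L (lebesgue_on S) f"
    using ae by (intro integral_cong_AE g m) (auto elim: eventually_mono)
qed

lemma integrable_Ioo_subinterval:
  fixes f :: "real \<Rightarrow> real"
  assumes f: "integrable (lebesgue_on {a<..<b}) f" and "a \<le> c" "d \<le> b"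
  shows "integrable (lebesgue_on {c<..<d}) f"
proof -
  have "integrable lebesgue (\<lambda>x. indicator {c<..<d} x *\<^sub>R (indicator {a<..<b} x * f x))"
    using f by (intro integrable_mult_indicator) (auto simp: integrable_lebesgue_on_iff)
  also have "(\<lambda>x. indicator {c<..<d} x *\<^sub>R (indicator {a<..<b} x * f x)) = (\<lambda>x. indicator {c<..<d} x * f x)"
    using assms by (auto simp: indicator_def fun_eq_iff)
  finally show ?thesis by (simp add: integrable_lebesgue_on_iff)
qed

lemma AE_Ioo_subinterval:
  fixes a b c d :: real
  assumes "AE x in lebesgue_on {a<..<b}. P x" and "a \<le> c" "d \<le> b"
  shows "AE x in lebesgue_on {c<..<d}. P x"
proof -
  have "AE x in lebesgue. x \<in> {a<..<b} \<longrightarrow> P x" using assms(1) by (simp add: AE_lebesgue_on_iff)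
  then have "AE x in lebesgue. x \<in> {c<..<d} \<longrightarrow> P x"
    by eventually_elim (use assms(2,3) in simp)
  then show ?thesis by (simp add: AE_lebesgue_on_iff)
qed

lemma AE_lebesgue_neq: "AE x in lebesgue. x \<noteq> (c::real)"
  using AE_completion[OF AE_lborel_singleton[of c]] .

lemma integral_Ioo_split:
  fixes f :: "real \<Rightarrow> real"
  assumes f: "integrable (lebesgue_on {a<..<b}) f" and c: "a \<le> c" "c \<le> b"
  shows "integral\<^sup>L (lebesgue_on {a<..<b}) f =
    integral\<^sup>L (lebesgue_on {a<..<c}) f + integral\<^sup>L (lebesgue_on {c<..<b}) f"
proof -
  have 1: "integrable lebesgue (\<lambda>x. indicator {a<..<c} x * f x)"
    using integrable_Ioo_subinterval[OF f, of a c] c by (simp add: integrable_lebesgue_on_iff)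
  have 2: "integrable lebesgue (\<lambda>x. indicator {c<..<b} x * f x)"
    using integrable_Ioo_subinterval[OF f, of c b] c by (simp add: integrable_lebesgue_on_iff)
  have "integral\<^sup>L lebesgue (\<lambda>x. indicator {a<..<b} x * f x) =
    integral\<^sup>L lebesgue (\<lambda>x. indicator {a<..<c} x * f x + indicator {c<..<b} x * f x)"
  proof (rule integral_cong_AE)
    show "(\<lambda>x. indicator {a<..<b} x * f x) \<in> borel_measurable lebesgue"
      using f by (simp add: integrable_lebesgue_on_iff)
    show "(\<lambda>x. indicator {a<..<c} x * f x + indicator {c<..<b} x * f x) \<in> borel_measurable lebesgue"
      using 1 2 by (intro borel_measurable_add) auto
    show "AE x in lebesgue. indicator {a<..<b} x * f x = indicator {a<..<c} x * f x + indicator {c<..<b} x * f x"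
      using AE_lebesgue_neq[of c] by eventually_elim (use c in \<open>auto simp: indicator_def\<close>)
  qed
  also have "\<dots> = integral\<^sup>L lebesgue (\<lambda>x. indicator {a<..<c} x * f x) + integral\<^sup>L lebesgue (\<lambda>x. indicator {c<..<b} x * f x)"
    by (rule Bochner_Integration.integral_add[OF 1 2])
  finally show ?thesis by (simp add: integral_lebesgue_on_eq)
qed

lemma continuous_integrable_Ioo:
  fixes f :: "real \<Rightarrow> real"
  assumes f: "continuous_on {a..b} f"
  shows "integrable (lebesgue_on {a<..<b}) f"
    and "integral\<^sup>L (lebesgue_on {a<..<b}) f = integral {a..b} f"
proof -
  have "f absolutely_integrable_on {a..b}" by (rule absolutely_integrable_continuous_real[OF f])
  then have "f absolutely_integrable_on {a<..<b}" by (rule set_integrable_subset) auto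
  then show 1: "integrable (lebesgue_on {a<..<b}) f"
    by (simp add: integrable_lebesgue_on_iff set_integrable_def)
  show "integral\<^sup>L (lebesgue_on {a<..<b}) f = integral {a..b} f"
    using lebesgue_integral_eq_integral[OF 1] by (simp add: integral_open_interval_real)
qed

lemma continuous_indefinite_integral_Ioo:
  fixes g :: "real \<Rightarrow> real"
  assumes g: "integrable (lebesgue_on {a<..<b}) g"
  shows "continuous_on {a..b} (\<lambda>x. integral\<^sup>L (lebesgue_on {a<..<x}) g)"
proof -
  define h where "h x = indicator {a<..<b} x * g x" for x
  have "integrable lebesgue h" using g by (simp add: h_def[abs_def] integrable_lebesgue_on_iff)
  then have "integrable lebesgue (\<lambda>x. indicator {a..b} x *\<^sub>R h x)" by (intro integrable_mult_indicator) auto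
  then have "h integrable_on {a..b}"
    by (intro integrable_on_lebesgue_on) (auto simp: integrable_lebesgue_on_iff)
  then have "continuous_on {a..b} (\<lambda>x. integral {a..x} h)" by (rule indefinite_integral_continuous_1)
  moreover have "integral {a..x} h = integral\<^sup>L (lebesgue_on {a<..<x}) g" if "x \<in> {a..b}" for x
  proof -
    have i: "integrable (lebesgue_on {a<..<x}) g"
      by (rule integrable_Ioo_subinterval[OF g]) (use that in auto)
    have "integral\<^sup>L (lebesgue_on {a<..<x}) g = integral {a<..<x} g"
      using lebesgue_integral_eq_integral[OF i] by simp
    also have "\<dots> = integral {a<..<x} h" using that by (intro integral_cong) (auto simp: h_def)
    finally show ?thesis by (simp add: integral_open_interval_real)
  qed
  ultimately show ?thesis by (rule continuous_on_eq)
qed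

text \<open>
  An increment that is bounded on every short interval by an integral is bounded by the integral
  of the limiting integrand: on the \<open>n\<close>-th equidistant partition the bounds add up to the integral
  of a single function \<open>e n\<close>, and the \<open>e n\<close> converge dominatedly. The integrand \<open>E s t\<close> may depend
  on the interval; it only has to converge when the interval shrinks to a point.
\<close>

lemma subadditive_le_integral_limit:
  fixes \<Psi> :: "real \<Rightarrow> real \<Rightarrow> real" and E :: "real \<Rightarrow> real \<Rightarrow> real \<Rightarrow> real"
  assumes ab: "a < b"
    and sub: "\<And>s t u. a \<le> s \<Longrightarrow> s < t \<Longrightarrow> t < u \<Longrightarrow> u \<le> b \<Longrightarrow> \<Psi> s u \<le> \<Psi> s t + \<Psi> t u"
    and int: "\<And>s t. a \<le> s \<Longrightarrow> s < t \<Longrightarrow> t \<le> b \<Longrightarrow> integrable (lebesgue_on {s<..<t}) (E s t)"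
    and le: "\<And>s t. a \<le> s \<Longrightarrow> s < t \<Longrightarrow> t \<le> b \<Longrightarrow> \<Psi> s t \<le> integral\<^sup>L (lebesgue_on {s<..<t}) (E s t)"
    and g: "integrable (lebesgue_on {a<..<b}) g"
    and bound: "\<And>s t. a \<le> s \<Longrightarrow> s < t \<Longrightarrow> t \<le> b \<Longrightarrow> AE x in lebesgue_on {s<..<t}. \<bar>E s t x\<bar> \<le> g x"
    and lim: "AE x in lebesgue_on {a<..<b}. \<forall>e>0. \<exists>d>0. \<forall>s t. a \<le> s \<longrightarrow> t \<le> b \<longrightarrow> s < x \<longrightarrow> x < t \<longrightarrow> t - s < d \<longrightarrow>
                \<bar>E s t x - E' x\<bar> < e"
  shows "integrable (lebesgue_on {a<..<b}) E' \<and> \<Psi> a b \<le> integral\<^sup>L (lebesgue_on {a<..<b}) E'"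
proof -
  \<comment> \<open>The partition has \<open>Suc n\<close> intervals, so that no case distinction for \<open>n = 0\<close> is needed.\<close>
  define p where "p n k = a + real k * ((b - a) / real (Suc n))" for n k
  have p0: "p n 0 = a" and pn: "p n (Suc n) = b" for n by (simp_all add: p_def)
  have plt: "p n k < p n (Suc k)" for n k using ab by (simp add: p_def divide_strict_right_mono)
  have pmono: "p n j \<le> p n k" if "j \<le> k" for n j k
    unfolding p_def using that ab by (intro add_left_mono mult_right_mono) auto
  have pa: "a \<le> p n k" for n k using pmono[of 0 k n] p0 by simp
  have pb: "p n k \<le> b" if "k \<le> Suc n" for n k using pmono[OF that, of n] pn by simp
  define I where "I n k = {p n k<..<p n (Suc k)}" for n k
  define e where "e n x = (\<Sum>k\<le>n. indicator (I n k) x * E (p n k) (p n (Suc k)) x)" for n x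
  have Iint: "integrable lebesgue (\<lambda>x. indicator (I n k) x * E (p n k) (p n (Suc k)) x)" if "k \<le> n" for n k
    using int[OF pa plt pb, of k n] that by (simp add: I_def integrable_lebesgue_on_iff)
  have eint: "integrable lebesgue (e n)" for n
    unfolding e_def by (intro Bochner_Integration.integrable_sum Iint) auto
  have disj: "j = k" if "x \<in> I n j" "x \<in> I n k" for n j k x
  proof (rule ccontr)
    assume "j \<noteq> k"
    then have "Suc j \<le> k \<or> Suc k \<le> j" by arith
    then show False using pmono[of "Suc j" k n] pmono[of "Suc k" j n] that by (auto simp: I_def)
  qed
  have e_eq: "e n x = E (p n k) (p n (Suc k)) x" if "x \<in> I n k" "k \<le> n" for n k x
  proof -
    have "e n x = (\<Sum>j\<le>n. if j = k then E (p n k) (p n (Suc k)) x else 0)"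
      unfolding e_def using disj that by (intro sum.cong refl) (auto simp: indicator_def)
    then show ?thesis using that by simp
  qed
  have e_0: "e n x = 0" if "\<And>k. k \<le> n \<Longrightarrow> x \<notin> I n k" for n x
    unfolding e_def using that by (intro sum.neutral) (auto simp: indicator_def)
  have I_sub: "I n k \<subseteq> {a<..<b}" if "k \<le> n" for n k
    using pa[of n k] pb[of "Suc k" n] that by (force simp: I_def)
  have \<Psi>_le: "\<Psi> a (p n (Suc m)) \<le> (\<Sum>k\<le>m. \<Psi> (p n k) (p n (Suc k)))" if "m \<le> n" for n m
    using that
  proof (induction m)
    case (Suc m)
    have "\<Psi> a (p n (Suc (Suc m))) \<le> \<Psi> a (p n (Suc m)) + \<Psi> (p n (Suc m)) (p n (Suc (Suc m)))"
      using Suc.prems pb[of "Suc (Suc m)" n] plt[of n "Suc m"] plt[of n m] pa[of n m]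
      by (intro sub) auto
    then show ?case using Suc by simp
  qed (simp add: p0)
  have \<Psi>_e: "\<Psi> a b \<le> integral\<^sup>L lebesgue (e n)" for n
  proof -
    have "\<Psi> a b \<le> (\<Sum>k\<le>n. \<Psi> (p n k) (p n (Suc k)))" using \<Psi>_le[of n n] pn by simp
    also have "\<dots> \<le> (\<Sum>k\<le>n. integral\<^sup>L lebesgue (\<lambda>x. indicator (I n k) x * E (p n k) (p n (Suc k)) x))"
      using le[OF pa plt pb] by (intro sum_mono) (simp add: I_def integral_lebesgue_on_eq)
    also have "\<dots> = integral\<^sup>L lebesgue (e n)"
      unfolding e_def by (intro Bochner_Integration.integral_sum[symmetric] Iint) auto
    finally show ?thesis .
  qed
  have ae_p: "AE x in lebesgue. \<forall>n k. x \<noteq> p n k"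
    unfolding AE_all_countable using AE_lebesgue_neq by blast
  have ae_b: "AE x in lebesgue. \<forall>n k. k \<le> n \<longrightarrow> x \<in> I n k \<longrightarrow> \<bar>E (p n k) (p n (Suc k)) x\<bar> \<le> g x"
    unfolding AE_all_countable
  proof (intro allI)
    fix n k
    show "AE x in lebesgue. k \<le> n \<longrightarrow> x \<in> I n k \<longrightarrow> \<bar>E (p n k) (p n (Suc k)) x\<bar> \<le> g x"
    proof (cases "k \<le> n")
      case True
      then show ?thesis using bound[OF pa plt pb, of k n] by (simp add: AE_lebesgue_on_iff I_def)
    qed simp
  qed
  have find: "\<exists>k\<le>n. x \<in> I n k" if x: "a < x" "x < b" "\<forall>n k. x \<noteq> p n k" for n x
  proof -
    define k where "k = (LEAST k. x < p n (Suc k))"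
    have ex: "x < p n (Suc n)" using x pn by simp
    have k1: "x < p n (Suc k)" unfolding k_def by (rule LeastI[of _ n]) (rule ex)
    have k2: "k \<le> n" unfolding k_def by (rule Least_le) (rule ex)
    have "p n k \<le> x"
    proof (cases k)
      case 0 then show ?thesis using x p0 by simp
    next
      case (Suc j)
      then have "\<not> x < p n (Suc j)" unfolding k_def using not_less_Least[of j] by (metis lessI k_def)
      then show ?thesis using Suc by simp
    qed
    then show ?thesis using k1 k2 x(3) by (intro exI[of _ k]) (auto simp: I_def less_le)
  qed
  have gint: "integrable lebesgue (\<lambda>x. indicator {a<..<b} x * g x)"
    using g by (simp add: integrable_lebesgue_on_iff)
  have ae_bound: "AE x in lebesgue. norm (e n x) \<le> indicator {a<..<b} x * g x" for n
    using ae_p ae_b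
  proof eventually_elim
    case (elim x)
    show ?case
    proof (cases "a < x \<and> x < b")
      case True
      then obtain k where "k \<le> n" "x \<in> I n k" using find elim(1) by blast
      then show ?thesis using e_eq elim(2) True by auto
    next
      case False
      then have "e n x = 0" using subsetD[OF I_sub, of _ n x] by (intro e_0) (metis greaterThanLessThan_iff)
      then show ?thesis using False by (auto simp: indicator_def)
    qed
  qed
  have Slb: "{a<..<b} \<in> sets lebesgue" by simp
  note lim' = lim[unfolded AE_lebesgue_on_iff[OF Slb]]
  have ae_lim: "AE x in lebesgue. (\<lambda>n. e n x) \<longlonglongrightarrow> indicator {a<..<b} x * E' x"
    using ae_p lim'
  proof eventually_elim
    case (elim x)
    show ?case
    proof (cases "a < x \<and> x < b")
      case True
      have "(\<lambda>n. e n x) \<longlonglongrightarrow> E' x"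
      proof (rule LIMSEQ_I)
        fix r :: real assume "0 < r"
        then obtain d where d: "d > 0" "\<And>s t. a \<le> s \<Longrightarrow> t \<le> b \<Longrightarrow> s < x \<Longrightarrow> x < t \<Longrightarrow> t - s < d \<Longrightarrow> \<bar>E s t x - E' x\<bar> < r"
          using elim(2) True by (metis greaterThanLessThan_iff)
        obtain N :: nat where N: "(b - a) / d < real N" using reals_Archimedean2 by blast
        show "\<exists>no. \<forall>n\<ge>no. norm (e n x - E' x) < r"
        proof (intro exI allI impI)
          fix n assume n: "N \<le> n"
          obtain k where k: "k \<le> n" "x \<in> I n k" using find elim(1) True by blast
          have "(b - a) / d < real (Suc n)" using N n by linarith
          then have "(b - a) / real (Suc n) < d" using d(1) by (simp add: field_simps)
          moreover have "p n (Suc k) - p n k = (b - a) / real (Suc n)"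
            by (simp add: p_def distrib_right diff_divide_distrib[symmetric])
          ultimately have "\<bar>E (p n k) (p n (Suc k)) x - E' x\<bar> < r"
            using k pa[of n k] pb[of "Suc k" n] by (intro d(2)) (auto simp: I_def)
          then show "norm (e n x - E' x) < r" using e_eq[OF k(2,1)] by simp
        qed
      qed
      then show ?thesis using True by simp
    next
      case False
      then have "e n x = 0" for n
        using subsetD[OF I_sub, of _ n x] by (intro e_0) (metis greaterThanLessThan_iff)
      then show ?thesis using False by (auto simp: indicator_def)
    qed
  qed
  have meas: "(\<lambda>x. indicator {a<..<b} x * E' x) \<in> borel_measurable lebesgue"
  proof -
    have "(\<lambda>x. lim (\<lambda>n. e n x)) \<in> borel_measurable lebesgue"
      using eint by (intro borel_measurable_lim_metric) auto
    moreover have "AE x in lebesgue. lim (\<lambda>n. e n x) = indicator {a<..<b} x * E' x"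
      using ae_lim by eventually_elim (rule limI)
    ultimately show ?thesis by (rule borel_measurable_AE_cong)
  qed
  have em: "e n \<in> borel_measurable lebesgue" for n using eint by simp
  have "integrable (lebesgue_on {a<..<b}) E'"
    using integrable_dominated_convergence[OF meas em gint ae_lim ae_bound]
    by (simp add: integrable_lebesgue_on_iff)
  moreover have "(\<lambda>n. integral\<^sup>L lebesgue (e n)) \<longlonglongrightarrow> integral\<^sup>L lebesgue (\<lambda>x. indicator {a<..<b} x * E' x)"
    by (rule integral_dominated_convergence[OF meas em gint ae_lim ae_bound])
  then have "\<Psi> a b \<le> integral\<^sup>L lebesgue (\<lambda>x. indicator {a<..<b} x * E' x)"
    by (rule LIMSEQ_le_const) (use \<Psi>_e in auto)
  ultimately show ?thesis by (simp add: integral_lebesgue_on_eq)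
qed

section \<open>Strongly continuous semigroups on a Hilbert space\<close>

text \<open>
  The representing vector minimises \<open>x \<bullet> x / 2 - f x\<close>. A minimising sequence is Cauchy by the
  parallelogram law.
\<close>

lemma riesz_representation:
  fixes f :: "'h::{real_inner,complete_space} \<Rightarrow> real"
  assumes f: "bounded_linear f"
  shows "\<exists>p. \<forall>y. f y = y \<bullet> p"
proof -
  interpret f: bounded_linear f by (rule f)
  obtain K where K: "\<And>x. norm (f x) \<le> norm x * K" using f.bounded by blast
  define J where "J x = x \<bullet> x / 2 - f x" for x
  have Jbelow: "- K\<^sup>2 / 2 \<le> J x" for x
  proof -
    have "f x \<le> norm x * K" using K[of x] by auto
    moreover have "0 \<le> (norm x - K)\<^sup>2" by simp
    ultimately show ?thesis
      by (simp add: J_def power2_eq_square algebra_simps dot_square_norm)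
  qed
  define m where "m = Inf (range J)"
  have bdd: "bdd_below (range J)" using Jbelow by (auto intro!: bdd_belowI2)
  have m_le: "m \<le> J x" for x
    unfolding m_def by (rule cInf_lower) (auto intro: bdd)
  have "\<exists>x. J x < m + 1 / real (Suc n)" for n
  proof -
    have "Inf (range J) < m + 1 / real (Suc n)" unfolding m_def by simp
    then show ?thesis using cInf_lessD[of "range J"] by blast
  qed
  then obtain X where X: "\<And>n. J (X n) < m + 1 / real (Suc n)" by metis
  \<comment> \<open>Parallelogram law: near-minimisers of a strictly convex functional are close to each other.\<close>
  have par: "(norm (x - y))\<^sup>2 / 4 = J x + J y - 2 * J ((1/2) *\<^sub>R (x + y))" for x y
    unfolding J_def power2_norm_eq_inner
    by (simp add: f.scaleR f.add inner_diff_left inner_diff_right inner_add_left inner_add_right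
        inner_commute field_simps)
  have close: "(norm (X i - X j))\<^sup>2 \<le> 4 * (1 / real (Suc i) + 1 / real (Suc j))" for i j
  proof -
    have "(norm (X i - X j))\<^sup>2 / 4 \<le> 1 / real (Suc i) + 1 / real (Suc j)"
      unfolding par using add_strict_mono[OF X[of i] X[of j]] m_le[of "(1/2) *\<^sub>R (X i + X j)"]
      by (simp only: )
    then show ?thesis by (simp only: pos_divide_le_eq zero_less_numeral mult.commute)
  qed
  have "Cauchy X"
  proof (rule CauchyI)
    fix e :: real assume e: "0 < e"
    obtain N where N: "8 / e\<^sup>2 < real N" using reals_Archimedean2 by blast
    show "\<exists>M. \<forall>m\<ge>M. \<forall>n\<ge>M. norm (X m - X n) < e"
    proof (intro exI allI impI)
      fix i j assume ij: "N \<le> i" "N \<le> j"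
      have "1 / real (Suc i) \<le> 1 / real (Suc N)" "1 / real (Suc j) \<le> 1 / real (Suc N)"
        using ij by (auto intro!: divide_left_mono)
      then have "(norm (X i - X j))\<^sup>2 \<le> 8 / real (Suc N)" using close[of i j] by simp
      also have "\<dots> < e\<^sup>2"
      proof -
        have "8 < real N * e\<^sup>2" using N e by (simp add: pos_divide_less_eq)
        also have "\<dots> \<le> real (Suc N) * e\<^sup>2" by (rule mult_right_mono) auto
        finally show ?thesis by (simp add: pos_divide_less_eq mult.commute)
      qed
      finally show "norm (X i - X j) < e" using e by (simp add: power2_less_imp_less)
    qed
  qed
  then obtain p where p: "X \<longlonglongrightarrow> p" using Cauchy_convergent convergent_def by blast
  have "(\<lambda>n. J (X n)) \<longlonglongrightarrow> J p" unfolding J_def by (intro tendsto_intros f.tendsto p) auto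
  moreover have "(\<lambda>n. m + 1 / real (Suc n)) \<longlonglongrightarrow> m + 0"
    by (intro tendsto_intros LIMSEQ_Suc[OF lim_1_over_n])
  ultimately have Jp: "J p \<le> m"
    by (metis (no_types, lifting) LIMSEQ_le X add.right_neutral less_imp_le)
  have "f y = y \<bullet> p" for y
  proof (rule ccontr)
    define d where "d = p \<bullet> y - f y"
    assume "f y \<noteq> y \<bullet> p"
    then have d: "d \<noteq> 0" by (simp add: d_def inner_commute)
    then have y: "y \<bullet> y > 0" by (auto simp: d_def f.zero)
    define t where "t = - d / (y \<bullet> y)"
    have "J (p + t *\<^sub>R y) = J p + t * d + t\<^sup>2 * (y \<bullet> y) / 2"
      by (simp add: J_def d_def f.add f.scaleR inner_add_left inner_add_right inner_commute
          power2_eq_square field_simps)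
    moreover have "t * d + t\<^sup>2 * (y \<bullet> y) / 2 = - d\<^sup>2 / (2 * (y \<bullet> y))"
      using y by (simp add: t_def power2_eq_square field_simps)
    ultimately have "J (p + t *\<^sub>R y) = J p - d\<^sup>2 / (2 * (y \<bullet> y))"
      by linarith
    moreover have "d\<^sup>2 / (2 * (y \<bullet> y)) > 0" using d y by simp
    ultimately show False using m_le[of "p + t *\<^sub>R y"] Jp by linarith
  qed
  then show ?thesis by blast
qed

text \<open>
  The generator controls difference quotients from the right, so monotonicity has to be concluded
  from them alone.
\<close>

lemma antimono_of_right_slope:
  fixes k :: "real \<Rightarrow> real"
  assumes ab: "a \<le> b" and cont: "continuous_on {a..b} k"
    and slope: "\<And>t e. a \<le> t \<Longrightarrow> t < b \<Longrightarrow> 0 < e \<Longrightarrow> \<exists>s. t < s \<and> s \<le> b \<and> k s \<le> k t + e * (s - t)"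
  shows "k b \<le> k a"
proof (rule field_le_epsilon)
  fix e' :: real assume e': "0 < e'"
  define e where "e = e' / (b - a + 1)"
  have e: "0 < e" using e' ab by (simp add: e_def)
  define P where "P = {t \<in> {a..b}. k t - e * (t - a) \<le> k a}"
  have "closed P" unfolding P_def
    by (intro continuous_closed_preimage_constant continuous_intros cont closed_atLeastAtMost
        continuous_on_closed_Collect_le)
  moreover have "P \<noteq> {}" "bdd_above P" using ab by (auto simp: P_def intro!: bdd_aboveI[of _ b])
  ultimately have SP: "Sup P \<in> P" using closed_contains_Sup by blast
  have "\<not> Sup P < b"
  proof
    assume "Sup P < b"
    then obtain s where s: "Sup P < s" "s \<le> b" "k s \<le> k (Sup P) + e * (s - Sup P)"
      using slope[of "Sup P" e] SP e by (auto simp: P_def)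
    then have "s \<in> P" using SP by (auto simp: P_def algebra_simps)
    then show False using s(1) cSup_upper[OF _ \<open>bdd_above P\<close>] by force
  qed
  then have "b \<in> P" using SP by (auto simp: P_def)
  then have "k b \<le> k a + e * (b - a)" by (simp add: P_def)
  also have "e * (b - a) \<le> e'" using e' ab by (simp add: e_def field_simps)
  finally show "k b \<le> k a + e'" by simp
qed

text \<open>
  \<open>T 0\<close> is a projection instead of the identity: the state space is a closed subspace of the
  ambient Hilbert space type, and the semigroup vanishes on the kernel of \<open>T 0\<close>. Elements of the
  subspace are those with \<open>T 0 x = x\<close>.
\<close>

locale hilbert_semigroup =
  fixes T :: "real \<Rightarrow> 'h::{real_inner,complete_space} \<Rightarrow> 'h"
  assumes bounded_linear_T: "0 \<le> t \<Longrightarrow> bounded_linear (T t)"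
    and T_add: "0 \<le> s \<Longrightarrow> 0 \<le> t \<Longrightarrow> T (s + t) x = T s (T t x)"
    and T_right_cont: "((\<lambda>t. T t x) \<longlongrightarrow> T 0 x) (at_right 0)"
begin

lemma T_0_T: "0 \<le> t \<Longrightarrow> T 0 (T t x) = T t x"
  using T_add[of 0 t] by simp

lemma T_T_0: "0 \<le> t \<Longrightarrow> T t (T 0 x) = T t x"
  using T_add[of t 0] by simp

lemma T_diff: "0 \<le> t \<Longrightarrow> T t (x - y) = T t x - T t y"
  using bounded_linear_T by (simp add: bounded_linear.linear linear_diff)

lemma T_scale: "0 \<le> t \<Longrightarrow> T t (c *\<^sub>R x) = c *\<^sub>R T t x"
  using bounded_linear_T by (simp add: bounded_linear.linear linear_scale)

text \<open>
  The operators are bounded one at a time, with no bound that is uniform in \<open>t\<close>. Every orbit is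
  bounded for short times, so by Baire's theorem some set \<open>C n\<close> of vectors with orbit bounded by
  \<open>n\<close> up to time \<open>1 / Suc n\<close> has interior points, and linearity transfers the bound to a ball
  around \<open>0\<close>.
\<close>

lemma locally_bounded:
  "\<exists>M \<delta>. 0 < M \<and> 0 < \<delta> \<and> (\<forall>t\<in>{0..\<delta>}. \<forall>x. norm (T t x) \<le> M * norm x)"
proof -
  define C where "C n = (\<Inter>t\<in>{0..1 / real (Suc n)}. {x. norm (T t x) \<le> real n})" for n
  have closedC: "closed (C n)" for n
  proof -
    have "closed {x. norm (T t x) \<le> real n}" if "t \<ge> 0" for t
      by (intro closed_Collect_le continuous_intros
          bounded_linear.continuous_on[OF bounded_linear_T[OF that]])
    then show ?thesis unfolding C_def by (intro closed_INT) auto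
  qed
  have "x \<in> (\<Union>n. C n)" for x
  proof -
    have "eventually (\<lambda>t. dist (T t x) (T 0 x) < 1) (at_right 0)"
      using T_right_cont[of x] tendstoD zero_less_one by blast
    then obtain d where d: "d > 0" "\<And>t. 0 < t \<Longrightarrow> t < d \<Longrightarrow> dist (T t x) (T 0 x) < 1"
      unfolding eventually_at_right_field by auto
    obtain n :: nat where n: "max (1 / d) (norm (T 0 x) + 1) < real n" using reals_Archimedean2 by blast
    have "1 / real (Suc n) < d" using n d(1) by (simp add: field_simps)
    have "norm (T t x) \<le> real n" if "t \<in> {0..1 / real (Suc n)}" for t
    proof (cases "t = 0")
      case False
      then have "dist (T t x) (T 0 x) < 1" using that d(2) \<open>1 / real (Suc n) < d\<close> by force
      then have "norm (T t x) \<le> norm (T 0 x) + 1"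
        using norm_triangle_ineq2[of "T t x" "T 0 x"] by (simp add: dist_norm)
      then show ?thesis using n by simp
    qed (use n in simp)
    then have "x \<in> C n" by (auto simp: C_def)
    then show ?thesis by blast
  qed
  then have "interior (\<Union>n. C n) \<noteq> {}" by (metis UNIV_I UNIV_eq_I empty_iff interior_UNIV)
  then have "\<exists>n. interior (C n) \<noteq> {}"
    using Met_TC.metric_Baire_category_alt[where ?\<G>="range C" and ?'a='h] closedC
      complete_UNIV[where 'a='h] by (auto simp: Met_TC.mcomplete_def Cauchy_convergent_iff convergent_def)
  then obtain n x0 e where e: "e > 0" "ball x0 e \<subseteq> C n"
    by (metis all_not_in_conv mem_interior)
  show ?thesis
  proof (intro exI conjI ballI allI)
    show "0 < 4 * (real n + 1) / e" using e by simp
    show "0 < 1 / real (Suc n)" by simp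
    fix t x assume t: "t \<in> {0..1 / real (Suc n)}"
    have lin: "linear (T t)" using bounded_linear_T t by (simp add: bounded_linear.linear)
    show "norm (T t x) \<le> 4 * (real n + 1) / e * norm x"
    proof (cases "x = 0")
      case True then show ?thesis by (simp add: linear_0[OF lin])
    next
      case False
      define c where "c = e / (2 * norm x)"
      have c: "c > 0" using False e by (simp add: c_def)
      have "x0 \<in> C n" "x0 + c *\<^sub>R x \<in> C n"
        using e False by (auto simp: c_def dist_norm intro!: subsetD[OF e(2)])
      then have "norm (T t x0) \<le> n" "norm (T t (x0 + c *\<^sub>R x)) \<le> n"
        using t by (auto simp: C_def)
      then have "norm (T t x0) \<le> n" "norm (T t x0 + c *\<^sub>R T t x) \<le> n"
        by (simp_all add: linear_add[OF lin] linear_scale[OF lin])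
      then have "norm (c *\<^sub>R T t x) \<le> 2 * n"
        using norm_triangle_ineq4[of "T t x0 + c *\<^sub>R T t x" "T t x0"] by simp
      then have "c * norm (T t x) \<le> 2 * n" using c by simp
      moreover have "2 * real n \<le> 2 * (real n + 1)" by simp
      ultimately have "norm (T t x) \<le> 2 * (real n + 1) / c" using c by (simp add: field_simps)
      also have "\<dots> = 4 * (real n + 1) / e * norm x" using e False by (simp add: c_def field_simps)
      finally show ?thesis .
    qed
  qed
qed

text \<open>
  Right continuity is immediate from the semigroup law. For left continuity at \<open>t0\<close> one compares
  \<open>T (t - s0) (T 0 y)\<close> with \<open>T (t - s0) (T (t0 - t) y)\<close>, where \<open>y = T s0 x\<close> with \<open>s0\<close> slightly
  before \<open>t0\<close>; this uses the uniform bound of the operators for short times.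
\<close>

lemma orbit_continuous: "continuous_on {0..} (\<lambda>t. T t x)"
proof -
  obtain M \<delta> where M: "0 < M" "0 < \<delta>" "\<And>t x. 0 \<le> t \<Longrightarrow> t \<le> \<delta> \<Longrightarrow> norm (T t x) \<le> M * norm x"
    using locally_bounded by auto
  have small: "\<exists>d>0. \<forall>t. 0 \<le> t \<longrightarrow> t < d \<longrightarrow> norm (T t y - T 0 y) < e" if "e > 0" for y e
  proof -
    have "eventually (\<lambda>t. dist (T t y) (T 0 y) < e) (at_right 0)"
      using T_right_cont[of y] tendstoD that by blast
    then obtain d where d: "d > 0" "\<And>t. 0 < t \<Longrightarrow> t < d \<Longrightarrow> dist (T t y) (T 0 y) < e"
      unfolding eventually_at_right_field by auto
    have "norm (T t y - T 0 y) < e" if "0 \<le> t" "t < d" for t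
      using d(2)[of t] that \<open>e > 0\<close> by (cases "t = 0") (auto simp: dist_norm)
    then show ?thesis using d(1) by blast
  qed
  show ?thesis
  proof (rule continuous_onI)
    fix t0 e :: real assume t0: "t0 \<in> {0..}" and e: "e > 0"
    obtain N where N: "N > 0" "\<And>y. norm (T t0 y) \<le> norm y * N"
      using bounded_linear.pos_bounded[OF bounded_linear_T[of t0]] t0 by auto
    obtain d1 where d1: "d1 > 0" "\<And>t. 0 \<le> t \<Longrightarrow> t < d1 \<Longrightarrow> norm (T t x - T 0 x) < e / N"
      using small[of "e / N"] e N(1) by force
    define s0 where "s0 = max 0 (t0 - \<delta>)"
    have s0: "0 \<le> s0" "s0 \<le> t0" "t0 - s0 \<le> \<delta>" using t0 M by (auto simp: s0_def)
    define y where "y = T s0 x"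
    obtain d2 where d2: "d2 > 0" "\<And>t. 0 \<le> t \<Longrightarrow> t < d2 \<Longrightarrow> norm (T t y - T 0 y) < e / M"
      using small[of "e / M"] e M(1) by force
    have right: "norm (T t x - T t0 x) < e" if "t0 \<le> t" "t < t0 + d1" for t
    proof -
      have "T t x = T t0 (T (t - t0) x)" "T t0 x = T t0 (T 0 x)"
        using T_add[of t0 "t - t0" x] T_T_0 t0 that by auto
      then have "T t x - T t0 x = T t0 (T (t - t0) x - T 0 x)" using t0 by (simp add: T_diff)
      then have "norm (T t x - T t0 x) \<le> norm (T (t - t0) x - T 0 x) * N" using N by simp
      also have "\<dots> < e" using d1(2)[of "t - t0"] that N(1) by (simp add: field_simps)
      finally show ?thesis .
    qed
    have left: "norm (T t x - T t0 x) < e" if t: "t < t0" "s0 < t" "t0 - d2 < t" for t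
    proof -
      have a: "0 \<le> t - s0" "t - s0 \<le> \<delta>" using s0 t by auto
      have "T t0 x = T (t - s0) (T (t0 - t) y)"
        using T_add[of "t - s0" "t0 - t" y] T_add[of "t0 - s0" s0 x] s0 t a by (simp add: y_def)
      moreover have "T t x = T (t - s0) (T 0 y)"
        using T_add[of "t - s0" s0 x] T_0_T[of s0] s0 a by (simp add: y_def)
      ultimately have "T t0 x - T t x = T (t - s0) (T (t0 - t) y - T 0 y)" using a by (simp add: T_diff)
      then have "norm (T t0 x - T t x) \<le> M * norm (T (t0 - t) y - T 0 y)" using M(3)[OF a] by simp
      also have "\<dots> < e" using d2(2)[of "t0 - t"] t M(1) by (simp add: field_simps)
      finally show ?thesis by (simp add: norm_minus_commute)
    qed
    define d where "d = (if t0 = 0 then d1 else min d1 (min d2 (t0 - s0)))"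
    have d0: "d > 0" using d1(1) d2(1) t0 M(2) by (auto simp: d_def s0_def)
    have "dist (T t x) (T t0 x) \<le> e" if "t \<in> {0..}" "dist t t0 < d" for t
    proof (cases "t0 \<le> t")
      case True
      then show ?thesis using right[of t] that by (auto simp: dist_norm d_def split: if_splits)
    next
      case False
      then show ?thesis using left[of t] that t0 by (auto simp: dist_norm d_def split: if_splits)
    qed
    then show "\<exists>d>0. \<forall>x'\<in>{0..}. dist x' t0 < d \<longrightarrow> dist (T x' x) (T t0 x) \<le> e" using d0 by blast
  qed
qed

text \<open>
  The graph of the infinitesimal generator.
\<close>

definition gen :: "'h \<Rightarrow> 'h \<Rightarrow> bool" where
  "gen x y \<longleftrightarrow> T 0 x = x \<and> ((\<lambda>t. (1 / t) *\<^sub>R (T t x - x)) \<longlongrightarrow> y) (at_right 0)"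

lemma gen_T:
  assumes "gen x y" "0 \<le> t"
  shows "gen (T t x) (T t y)"
proof -
  have "((\<lambda>s. T t ((1 / s) *\<^sub>R (T s x - x))) \<longlongrightarrow> T t y) (at_right 0)"
    using assms bounded_linear.tendsto[OF bounded_linear_T] by (auto simp: gen_def)
  moreover have "eventually (\<lambda>s. T t ((1 / s) *\<^sub>R (T s x - x)) = (1 / s) *\<^sub>R (T s (T t x) - T t x)) (at_right 0)"
    unfolding eventually_at_right_field
  proof (intro exI conjI allI impI)
    show "(0::real) < 1" by simp
    fix s :: real assume "0 < s"
    then show "T t ((1 / s) *\<^sub>R (T s x - x)) = (1 / s) *\<^sub>R (T s (T t x) - T t x)"
      using assms T_add[of s t x] T_add[of t s x] by (simp add: T_scale T_diff add.commute)
  qed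
  ultimately have "((\<lambda>s. (1 / s) *\<^sub>R (T s (T t x) - T t x)) \<longlongrightarrow> T t y) (at_right 0)"
    by (rule Lim_transform_eventually)
  then show ?thesis using assms T_0_T by (simp add: gen_def)
qed

text \<open>
  \<open>B\<close> is a quadratic energy that decreases at rate at least \<open>D\<close> along the generator. Continuity
  and local boundedness of \<open>D\<close> on the whole space are what makes it possible to pass from the
  domain of the generator to all orbits and to mild solutions.
\<close>

definition dissipation :: "('h \<Rightarrow> 'h \<Rightarrow> real) \<Rightarrow> ('h \<Rightarrow> real) \<Rightarrow> bool" where
  "dissipation B D \<longleftrightarrow> bounded_bilinear B \<and> (\<forall>x y. B x y = B y x) \<and> continuous_on UNIV D \<and>
     (\<forall>r. \<exists>C. \<forall>x. norm x \<le> r \<longrightarrow> \<bar>D x\<bar> \<le> C) \<and> (\<forall>x y. gen x y \<longrightarrow> B y x \<le> - D x)"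

lemma dissipationD:
  assumes "dissipation B D"
  shows "bounded_bilinear B" "B x y = B y x" "continuous_on UNIV D"
    "\<exists>C. \<forall>x. norm x \<le> r \<longrightarrow> \<bar>D x\<bar> \<le> C" "gen x y \<Longrightarrow> B y x \<le> - D x"
  using assms[unfolded dissipation_def, THEN conjunct1]
    assms[unfolded dissipation_def, THEN conjunct2, THEN conjunct1, rule_format, of x y]
    assms[unfolded dissipation_def, THEN conjunct2, THEN conjunct2, THEN conjunct1]
    assms[unfolded dissipation_def, THEN conjunct2, THEN conjunct2, THEN conjunct2, THEN conjunct1, THEN spec, of r]
    assms[unfolded dissipation_def, THEN conjunct2, THEN conjunct2, THEN conjunct2, THEN conjunct2, rule_format, of x y]
  by - (assumption | blast)+

lemma orbit_dissipation_gen: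
  assumes diss: "dissipation B D" and xy: "gen x y" and t: "0 \<le> t"
  shows "B (T t x) (T t x) / 2 + integral {0..t} (\<lambda>s. D (T s x)) \<le> B x x / 2"
proof -
  have B: "bounded_bilinear B" and Bs: "\<And>x y. B x y = B y x" and Dc: "continuous_on UNIV D"
    and BD: "\<And>x y. gen x y \<Longrightarrow> B y x \<le> - D x"
    by (fact dissipationD[OF diss])+
  have cT: "continuous_on {0..t} (\<lambda>s. T s x)"
    by (rule continuous_on_subset[OF orbit_continuous]) auto
  have cD: "continuous_on {0..t} (\<lambda>s. D (T s x))"
    by (rule continuous_on_compose2[OF Dc cT]) auto
  define k where "k s = B (T s x) (T s x) / 2 + integral {0..s} (\<lambda>s. D (T s x))" for s
  have "k t \<le> k 0"
  proof (rule antimono_of_right_slope[where k=k and a=0 and b=t])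
    show "continuous_on {0..t} k" unfolding k_def
      by (intro continuous_on_add continuous_on_divide continuous_on_const
          bounded_bilinear.continuous_on[OF B] cT
          indefinite_integral_continuous_1 integrable_continuous_interval cD) auto
    fix s e :: real assume s: "0 \<le> s" "s < t" and e: "0 < e"
    have g: "gen (T s x) (T s y)" using gen_T[OF xy s(1)] .
    have vd: "((\<lambda>r. T r x) has_vector_derivative T s y) (at s within {s..t})"
    proof -
      have "((\<lambda>r. (1 / r) *\<^sub>R (T r (T s x) - T s x)) \<longlongrightarrow> T s y) (at_right 0)"
        using g by (simp add: gen_def)
      then have "((\<lambda>r. (1 / (r - s)) *\<^sub>R (T (r - s) (T s x) - T s x)) \<longlongrightarrow> T s y) (at_right s)"
        by (subst filterlim_at_right_to_0) simp
      moreover have "eventually (\<lambda>r. (1 / (r - s)) *\<^sub>R (T (r - s) (T s x) - T s x)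
            = (1 / (r - s)) *\<^sub>R (T r x - T s x)) (at_right s)"
        unfolding eventually_at_right_field
        by (intro exI[of _ "s + 1"]) (auto simp: s T_add[symmetric])
      ultimately have "((\<lambda>r. (1 / (r - s)) *\<^sub>R (T r x - T s x)) \<longlongrightarrow> T s y) (at_right s)"
        by (rule Lim_transform_eventually)
      then have "((\<lambda>r. (1 / (r - s)) *\<^sub>R (T r x - T s x)) \<longlongrightarrow> T s y) (at s within {s..t})"
        using s(2) by (simp add: at_within_Icc_at_right)
      then have "((\<lambda>r. (1 / norm (r - s)) *\<^sub>R (T r x - (T s x + (r - s) *\<^sub>R T s y))) \<longlongrightarrow> 0) (at s within {s..t})"
      proof -
        assume "((\<lambda>r. (1 / (r - s)) *\<^sub>R (T r x - T s x)) \<longlongrightarrow> T s y) (at s within {s..t})"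
        then have "((\<lambda>r. (1 / (r - s)) *\<^sub>R (T r x - T s x) - T s y) \<longlongrightarrow> 0) (at s within {s..t})"
          using LIM_zero by blast
        moreover have "eventually (\<lambda>r. (1 / (r - s)) *\<^sub>R (T r x - T s x) - T s y =
            (1 / norm (r - s)) *\<^sub>R (T r x - (T s x + (r - s) *\<^sub>R T s y))) (at s within {s..t})"
          unfolding eventually_at
          by (intro exI[of _ 1]) (auto simp: scaleR_diff_right diff_diff_eq[symmetric])
        ultimately show ?thesis by (rule Lim_transform_eventually)
      qed
      then show ?thesis
        unfolding has_vector_derivative_def has_derivative_within
        by (simp add: bounded_linear_scaleR_left diff_diff_eq)
    qed
    have "((\<lambda>r. B (T r x) (T r x)) has_vector_derivative (B (T s x) (T s y) + B (T s y) (T s x))) (at s within {s..t})"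
      by (rule bounded_bilinear.has_vector_derivative[OF B vd vd])
    then have d1: "((\<lambda>r. B (T r x) (T r x)) has_real_derivative 2 * B (T s y) (T s x)) (at s within {s..t})"
      using Bs[of "T s x" "T s y"] by (simp add: has_real_derivative_iff_has_vector_derivative)
    have "((\<lambda>r. integral {0..r} (\<lambda>s. D (T s x))) has_vector_derivative D (T s x)) (at s within {0..t})"
      by (rule integral_has_vector_derivative[OF cD]) (use s in auto)
    then have d2: "((\<lambda>r. integral {0..r} (\<lambda>s. D (T s x))) has_real_derivative D (T s x)) (at s within {s..t})"
      unfolding has_real_derivative_iff_has_vector_derivative[symmetric]
      by (rule has_field_derivative_subset) (use s in auto)
    define q where "q = B (T s y) (T s x) + D (T s x)"
    have "(k has_real_derivative q) (at s within {s..t})"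
      unfolding k_def q_def by (auto intro!: derivative_eq_intros d1 d2)
    moreover have q: "q \<le> 0" using BD[OF g] by (simp add: q_def)
    ultimately have "((\<lambda>r. (k r - k s) / (r - s)) \<longlongrightarrow> q) (at_right s)"
      using s(2) by (simp add: has_field_derivative_iff at_within_Icc_at_right)
    then have "eventually (\<lambda>r. (k r - k s) / (r - s) < e) (at_right s)"
      by (rule order_tendstoD(2)) (use q e in linarith)
    then obtain b where b: "b > s" "\<And>r. s < r \<Longrightarrow> r < b \<Longrightarrow> (k r - k s) / (r - s) < e"
      unfolding eventually_at_right_field by blast
    define r where "r = min t ((s + b) / 2)"
    have r: "s < r" "r \<le> t" "r < b" using b(1) s(2) by (auto simp: r_def min_def)
    then have "k r - k s < e * (r - s)" using b(2)[of r] by (simp add: field_simps)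
    then show "\<exists>r. s < r \<and> r \<le> t \<and> k r \<le> k s + e * (r - s)" using r by (intro exI[of _ r]) simp
  qed (use t in auto)
  then show ?thesis using xy by (simp add: k_def gen_def)
qed

end

section \<open>Energy inequalities for dissipative semigroups\<close>

locale dissipative_semigroup = hilbert_semigroup +
  assumes gen_dense: "T 0 x = x \<Longrightarrow> x \<in> closure {x. \<exists>y. gen x y}"
    and gen_dissipative: "gen x y \<Longrightarrow> y \<bullet> x \<le> 0"
begin

text \<open>
  The inner product itself is a dissipated energy with rate \<open>0\<close>, and the estimate extends from the
  dense domain by continuity of \<open>T t\<close>.
\<close>

lemma contraction:
  assumes x: "T 0 x = x" and t: "0 \<le> t"
  shows "norm (T t x) \<le> norm x"
proof -
  have d: "dissipation (\<bullet>) (\<lambda>_. 0)"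
    unfolding dissipation_def using gen_dissipative
    by (auto intro: bounded_bilinear_inner inner_commute)
  have "{x. \<exists>y. gen x y} \<subseteq> {x. norm (T t x) \<le> norm x}"
  proof clarsimp
    fix x y assume "gen x y"
    from orbit_dissipation_gen[OF d this t] show "norm (T t x) \<le> norm x"
      by (simp add: norm_eq_sqrt_inner)
  qed
  moreover have "closed {x. norm (T t x) \<le> norm x}"
    by (intro closed_Collect_le continuous_intros bounded_linear.continuous_on[OF bounded_linear_T[OF t]])
  ultimately have "closure {x. \<exists>y. gen x y} \<subseteq> {x. norm (T t x) \<le> norm x}"
    by (rule closure_minimal)
  then show ?thesis using gen_dense[OF x] by blast
qed

lemma orbit_dissipation:
  assumes diss: "dissipation B D" and x: "T 0 x = x" and t: "0 \<le> t"
  shows "B (T t x) (T t x) / 2 + integral {0..t} (\<lambda>s. D (T s x)) \<le> B x x / 2"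
proof -
  note B = dissipationD(1)[OF diss] and Dc = dissipationD(3)[OF diss]
  obtain X where X: "\<And>n. X n \<in> {x. \<exists>y. gen x y}" "X \<longlonglongrightarrow> x"
    using gen_dense[OF x] closure_sequential[of x] by auto
  have TX: "T 0 (X n) = X n" for n using X(1)[of n] by (auto simp: gen_def)
  obtain R where R: "\<And>n. norm (X n) \<le> R"
    using X(2) convergent_imp_Bseq[of X] by (auto simp: convergent_def Bseq_def)
  obtain C where C: "\<And>x. norm x \<le> R \<Longrightarrow> \<bar>D x\<bar> \<le> C" using dissipationD(4)[OF diss, of R] by blast
  have lim: "(\<lambda>n. T s (X n)) \<longlonglongrightarrow> T s x" if "0 \<le> s" for s
    using bounded_linear.tendsto[OF bounded_linear_T[OF that] X(2)] .
  have "(\<lambda>n. integral {0..t} (\<lambda>s. D (T s (X n)))) \<longlonglongrightarrow> integral {0..t} (\<lambda>s. D (T s x))"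
  proof (rule dominated_convergence(2)[where h="\<lambda>_. C"])
    show "(\<lambda>s. D (T s (X n))) integrable_on {0..t}" for n
      by (intro integrable_continuous_interval continuous_on_compose2[OF Dc]
          continuous_on_subset[OF orbit_continuous]) auto
    show "norm (D (T s (X n))) \<le> C" if "s \<in> {0..t}" for n s
      using C[of "T s (X n)"] contraction[OF TX, of s n] R[of n] that by fastforce
    show "(\<lambda>n. D (T s (X n))) \<longlonglongrightarrow> D (T s x)" if "s \<in> {0..t}" for s
      using continuous_on_tendsto_compose[OF Dc lim[of s]] that by simp
  qed auto
  then have l1: "(\<lambda>n. B (T t (X n)) (T t (X n)) / 2 + integral {0..t} (\<lambda>s. D (T s (X n))))
      \<longlonglongrightarrow> B (T t x) (T t x) / 2 + integral {0..t} (\<lambda>s. D (T s x))"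
    by (intro tendsto_intros bounded_bilinear.tendsto[OF B] lim t) auto
  have l2: "(\<lambda>n. B (X n) (X n) / 2) \<longlonglongrightarrow> B x x / 2"
    by (intro tendsto_intros bounded_bilinear.tendsto[OF B] X(2)) auto
  have "B (T t (X n)) (T t (X n)) / 2 + integral {0..t} (\<lambda>s. D (T s (X n))) \<le> B (X n) (X n) / 2" for n
    using X(1)[of n] orbit_dissipation_gen[OF diss _ t] by blast
  then show ?thesis using LIMSEQ_le[OF l1 l2] by blast
qed

text \<open>
  Contractivity makes the continuity at time \<open>0\<close> uniform in the initial vector.
\<close>

lemma orbit_jointly_continuous:
  assumes y: "T 0 y = y" and e: "0 < e"
  shows "\<exists>d>0. \<forall>x \<tau>. T 0 x = x \<longrightarrow> norm (x - y) < d \<longrightarrow> 0 \<le> \<tau> \<longrightarrow> \<tau> < d \<longrightarrow> norm (T \<tau> x - y) < e"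
proof -
  have "eventually (\<lambda>t. dist (T t y) y < e / 2) (at_right 0)"
    using T_right_cont[of y] tendstoD[of "\<lambda>t. T t y" y "at_right 0" "e / 2"] e y by simp
  then obtain d where d: "d > 0" "\<And>t. 0 < t \<Longrightarrow> t < d \<Longrightarrow> dist (T t y) y < e / 2"
    unfolding eventually_at_right_field by auto
  show ?thesis
  proof (intro exI[of _ "min d (e / 2)"] conjI allI impI)
    show "0 < min d (e / 2)" using d(1) e by simp
    fix x \<tau> assume a: "T 0 x = x" "norm (x - y) < min d (e / 2)" "0 \<le> \<tau>" "\<tau> < min d (e / 2)"
    have "T 0 (x - y) = x - y" using a(1) y by (simp add: T_diff)
    then have "norm (T \<tau> (x - y)) \<le> norm (x - y)" using contraction a(3) by blast
    then have "norm (T \<tau> x - T \<tau> y) < e / 2" using a by (simp add: T_diff)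
    moreover have "norm (T \<tau> y - y) < e / 2"
      using d(2)[of \<tau>] a(3,4) y e by (cases "\<tau> = 0") (auto simp: dist_norm)
    ultimately show "norm (T \<tau> x - y) < e"
      using norm_triangle_ineq[of "T \<tau> x - T \<tau> y" "T \<tau> y - y"] by simp
  qed
qed

text \<open>
  Formally the derivative of \<open>B (U, U) / 2\<close> is \<open>B (A U + F, U) \<le> B (U, F) - D U\<close>. To prove the
  integrated form, one compares \<open>U t\<close> on a short interval \<open>[s, t]\<close> with the orbit
  \<open>T (t - s) (U s)\<close>: their difference \<open>G s t\<close> is the weak integral of \<open>T (t - r) (F r)\<close>, hence of
  norm at most \<open>N s t\<close>, the integral of \<open>g\<close>. The energy inequality for the orbit and the expansion
  of \<open>B\<close> give an increment bound with integrand \<open>E s t\<close>, whose last term \<open>K / 2 * N s t * g\<close>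
  accounts for \<open>B (G s t, G s t)\<close> and disappears as the interval shrinks. Then
  \<open>subadditive_le_integral_limit\<close> applies.
\<close>

lemma mild_energy_inequality:
  assumes diss: "dissipation B D"
    and UK: "\<And>t. 0 \<le> t \<Longrightarrow> T 0 (U t) = U t" and Uc: "continuous_on {0..} U"
    and g: "\<And>t. 0 \<le> t \<Longrightarrow> integrable (lebesgue_on {0<..<t}) g"
    and F: "\<And>t. 0 \<le> t \<Longrightarrow> AE s in lebesgue_on {0<..<t}. T 0 (F s) = F s \<and> norm (F s) \<le> g s"
    and mint: "\<And>t \<Phi>. 0 \<le> t \<Longrightarrow> integrable (lebesgue_on {0<..<t}) (\<lambda>s. T (t - s) (F s) \<bullet> \<Phi>)"
    and mild: "\<And>t \<Phi>. 0 \<le> t \<Longrightarrow> (U t - T t \<xi>) \<bullet> \<Phi> = integral\<^sup>L (lebesgue_on {0<..<t}) (\<lambda>s. T (t - s) (F s) \<bullet> \<Phi>)"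
    and ab: "0 \<le> a" "a < b"
  shows "integrable (lebesgue_on {a<..<b}) (\<lambda>s. B (U s) (F s) - D (U s))" (is ?int)
    and "B (U b) (U b) / 2 - B (U a) (U a) / 2 \<le> integral\<^sup>L (lebesgue_on {a<..<b}) (\<lambda>s. B (U s) (F s) - D (U s))" (is ?le)
proof -
  note B = dissipationD(1)[OF diss] and Bs = dissipationD(2)[OF diss] and Dc = dissipationD(3)[OF diss]
  interpret B: bounded_bilinear B by (rule B)
  obtain K where K: "0 < K" "\<And>x y. norm (B x y) \<le> norm x * norm y * K" using B.pos_bounded by blast
  have Ucab: "continuous_on {a..b} U" by (rule continuous_on_subset[OF Uc]) (use ab in auto)
  obtain R where R: "0 < R" "\<And>s. s \<in> {a..b} \<Longrightarrow> norm (U s) \<le> R"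
    using compact_imp_bounded[OF compact_continuous_image[OF Ucab compact_Icc]]
    by (auto simp: bounded_pos)
  obtain C where C: "\<And>x. norm x \<le> R \<Longrightarrow> \<bar>D x\<bar> \<le> C" using dissipationD(4)[OF diss, of R] by blast
  have gab: "integrable (lebesgue_on {s<..<t}) g" if "a \<le> s" "t \<le> b" for s t
    by (rule integrable_Ioo_subinterval[OF g[of b]]) (use ab that in auto)
  have Fab: "AE x in lebesgue_on {s<..<t}. T 0 (F x) = F x \<and> norm (F x) \<le> g x" if "a \<le> s" "t \<le> b" for s t
    by (rule AE_Ioo_subinterval[OF F[of b]]) (use ab that in auto)
  define N where "N s t = integral\<^sup>L (lebesgue_on {s<..<t}) g" for s t
  define G where "G s t = U t - T (t - s) (U s)" for s t
  \<comment> \<open>Restarting the variation-of-constants formula at time \<open>s\<close>; the semigroup is moved through the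
    weak integral by Riesz representation.\<close>
  have restart: "integrable (lebesgue_on {s<..<t}) (\<lambda>r. T (t - r) (F r) \<bullet> \<Phi>) \<and>
      G s t \<bullet> \<Phi> = integral\<^sup>L (lebesgue_on {s<..<t}) (\<lambda>r. T (t - r) (F r) \<bullet> \<Phi>)"
    if st: "0 \<le> s" "s < t" for s t \<Phi>
  proof -
    have bl: "bounded_linear (\<lambda>x. T (t - s) x \<bullet> \<Phi>)"
      using bounded_linear_compose[OF bounded_linear_inner_left bounded_linear_T] st by simp
    obtain p where p: "\<And>x. T (t - s) x \<bullet> \<Phi> = x \<bullet> p" using riesz_representation[OF bl] by blast
    have i: "integrable (lebesgue_on {0<..<t}) (\<lambda>r. T (t - r) (F r) \<bullet> \<Phi>)" using mint st by simp
    have "(U t - T t \<xi>) \<bullet> \<Phi> = integral\<^sup>L (lebesgue_on {0<..<s}) (\<lambda>r. T (t - r) (F r) \<bullet> \<Phi>)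
        + integral\<^sup>L (lebesgue_on {s<..<t}) (\<lambda>r. T (t - r) (F r) \<bullet> \<Phi>)"
      using mild[of t \<Phi>] integral_Ioo_split[OF i, of s] st by simp
    moreover have "T (t - s) (U s - T s \<xi>) \<bullet> \<Phi> = integral\<^sup>L (lebesgue_on {0<..<s}) (\<lambda>r. T (t - r) (F r) \<bullet> \<Phi>)"
    proof -
      have "T (t - s) (U s - T s \<xi>) \<bullet> \<Phi> = integral\<^sup>L (lebesgue_on {0<..<s}) (\<lambda>r. T (s - r) (F r) \<bullet> p)"
        using mild[of s p] st by (simp add: p)
      also have "\<dots> = integral\<^sup>L (lebesgue_on {0<..<s}) (\<lambda>r. T (t - r) (F r) \<bullet> \<Phi>)"
      proof (rule Bochner_Integration.integral_cong[OF refl])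
        fix r assume "r \<in> space (lebesgue_on {0<..<s})"
        then have "T (t - r) (F r) = T (t - s) (T (s - r) (F r))"
          using T_add[of "t - s" "s - r" "F r"] st by simp
        then show "T (s - r) (F r) \<bullet> p = T (t - r) (F r) \<bullet> \<Phi>" by (simp add: p)
      qed
      finally show ?thesis .
    qed
    moreover have "T (t - s) (U s - T s \<xi>) = T (t - s) (U s) - T t \<xi>"
      using T_add[of "t - s" s \<xi>] st by (simp add: T_diff)
    moreover have "integrable (lebesgue_on {s<..<t}) (\<lambda>r. T (t - r) (F r) \<bullet> \<Phi>)"
      using integrable_Ioo_subinterval[OF i, of s t] st by simp
    ultimately show ?thesis by (simp add: G_def inner_diff_left)
  qed
  have F_T: "AE r in lebesgue_on {s<..<t}. norm (T (t - r) (F r)) \<le> g r" if "a \<le> s" "t \<le> b" for s t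
  proof -
    have "AE r in lebesgue_on {s<..<t}. r \<in> {s<..<t}"
      using AE_space[of "lebesgue_on {s<..<t}"] by (simp only: space_lebesgue_on)
    then show ?thesis using Fab[OF that]
    proof eventually_elim
      case (elim r)
      then show ?case using contraction[of "F r" "t - r"] by (auto intro: order_trans)
    qed
  qed
  have Gle: "norm (G s t) \<le> N s t" and N0: "0 \<le> N s t" if st: "a \<le> s" "s < t" "t \<le> b" for s t
  proof -
    have s0: "0 \<le> s" using ab st by simp
    note r = restart[OF s0 st(2), of "G s t"]
    have "G s t \<bullet> G s t = integral\<^sup>L (lebesgue_on {s<..<t}) (\<lambda>r. T (t - r) (F r) \<bullet> G s t)" using r by simp
    also have "\<dots> \<le> integral\<^sup>L (lebesgue_on {s<..<t}) (\<lambda>r. g r * norm (G s t))"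
    proof (rule integral_mono_AE)
      show "AE r in lebesgue_on {s<..<t}. T (t - r) (F r) \<bullet> G s t \<le> g r * norm (G s t)"
        using F_T[OF st(1,3)]
      proof eventually_elim
        case (elim r)
        have "T (t - r) (F r) \<bullet> G s t \<le> norm (T (t - r) (F r)) * norm (G s t)" by (rule norm_cauchy_schwarz)
        also have "\<dots> \<le> g r * norm (G s t)" using elim by (rule mult_right_mono) simp
        finally show ?case .
      qed
    qed (use r gab[OF st(1,3)] in auto)
    also have "\<dots> = N s t * norm (G s t)" by (simp add: N_def)
    finally have le: "norm (G s t) * norm (G s t) \<le> N s t * norm (G s t)"
      by (simp add: dot_square_norm power2_eq_square)
    show N0: "0 \<le> N s t" unfolding N_def
      using F_T[OF st(1,3)] by (intro integral_nonneg_AE) (auto elim!: eventually_mono intro: order_trans[OF norm_ge_zero])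
    show "norm (G s t) \<le> N s t"
    proof (cases "G s t = 0")
      case False
      then show ?thesis using le by simp
    qed (use N0 in simp)
  qed
  define E where "E s t x = B (T (t - s) (U s)) (T (t - x) (F x)) - D (T (x - s) (U s)) + K / 2 * N s t * g x" for s t x
  have D_int: "integrable (lebesgue_on {s<..<t}) (\<lambda>x. D (T (x - s) (U s)))"
      "integral\<^sup>L (lebesgue_on {s<..<t}) (\<lambda>x. D (T (x - s) (U s))) = integral {0..t-s} (\<lambda>x. D (T x (U s)))"
    if "s < t" for s t
  proof -
    have c: "continuous_on {s..t} (\<lambda>x. D (T (x - s) (U s)))"
      by (intro continuous_on_compose2[OF Dc] continuous_on_compose2[OF orbit_continuous] continuous_intros) auto
    show "integrable (lebesgue_on {s<..<t}) (\<lambda>x. D (T (x - s) (U s)))" by (rule continuous_integrable_Ioo[OF c])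
    have "integral {0..t-s} ((\<lambda>x. D (T (x - s) (U s))) \<circ> (+) s) = integral {0+s..t-s+s} (\<lambda>x. D (T (x - s) (U s)))"
      by (rule integral_shift_Icc_real)
    then show "integral\<^sup>L (lebesgue_on {s<..<t}) (\<lambda>x. D (T (x - s) (U s))) = integral {0..t-s} (\<lambda>x. D (T x (U s)))"
      using continuous_integrable_Ioo(2)[OF c] by (simp add: o_def)
  qed
  have B_int: "integrable (lebesgue_on {s<..<t}) (\<lambda>r. B y (T (t - r) (F r)))"
      "integral\<^sup>L (lebesgue_on {s<..<t}) (\<lambda>r. B y (T (t - r) (F r))) = B y (G s t)"
    if st: "0 \<le> s" "s < t" for s t y
  proof -
    obtain p where p: "\<And>x. B y x = x \<bullet> p" using riesz_representation[OF B.bounded_linear_right[of y]] by blast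
    show "integrable (lebesgue_on {s<..<t}) (\<lambda>r. B y (T (t - r) (F r)))"
      "integral\<^sup>L (lebesgue_on {s<..<t}) (\<lambda>r. B y (T (t - r) (F r))) = B y (G s t)"
      using restart[OF st, of p] by (simp_all add: p)
  qed
  have TU: "norm (T \<tau> (U s)) \<le> R" if "s \<in> {a..b}" "0 \<le> \<tau>" for s \<tau>
    using contraction[OF UK, of s \<tau>] R(2)[of s] that ab by auto
  have N_mono: "N s t \<le> N a b" if st: "a \<le> s" "s < t" "t \<le> b" for s t
  proof -
    have "N a b = N a t + N t b" "N a t = N a s + N s t" unfolding N_def
      using gab[of a b] gab[of a t] st by (auto intro: integral_Ioo_split)
    moreover have "0 \<le> N t b" using N0[of t b] st by (cases "t = b") (auto simp: N_def)
    moreover have "0 \<le> N a s" using N0[of a s] st by (cases "a = s") (auto simp: N_def)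
    ultimately show ?thesis by linarith
  qed
  have main: "integrable (lebesgue_on {a<..<b}) (\<lambda>s. B (U s) (F s) - D (U s)) \<and>
    B (U b) (U b) / 2 - B (U a) (U a) / 2 \<le> integral\<^sup>L (lebesgue_on {a<..<b}) (\<lambda>s. B (U s) (F s) - D (U s))"
  proof (rule subadditive_le_integral_limit[where E=E and g="\<lambda>x. (R * K + K / 2 * N a b) * g x + C" and a=a and b=b and \<Psi>="\<lambda>s t. B (U t) (U t) / 2 - B (U s) (U s) / 2", rotated])
    fix s t assume st: "a \<le> s" "s < t" "t \<le> b"
    have s0: "0 \<le> s" using st ab by simp
    show iE: "integrable (lebesgue_on {s<..<t}) (E s t)"
      unfolding E_def using gab[OF st(1,3)]
      by (intro Bochner_Integration.integrable_add Bochner_Integration.integrable_diff B_int s0 st D_int) auto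
    have IE: "integral\<^sup>L (lebesgue_on {s<..<t}) (E s t) = B (T (t - s) (U s)) (G s t)
        - integral {0..t-s} (\<lambda>x. D (T x (U s))) + K / 2 * N s t * N s t"
    proof -
      have "integral\<^sup>L (lebesgue_on {s<..<t}) (E s t) =
          integral\<^sup>L (lebesgue_on {s<..<t}) (\<lambda>x. B (T (t - s) (U s)) (T (t - x) (F x)) - D (T (x - s) (U s)))
          + integral\<^sup>L (lebesgue_on {s<..<t}) (\<lambda>x. K / 2 * N s t * g x)"
        unfolding E_def using gab[OF st(1,3)]
        by (intro Bochner_Integration.integral_add Bochner_Integration.integrable_diff B_int s0 st D_int) auto
      also have "integral\<^sup>L (lebesgue_on {s<..<t}) (\<lambda>x. B (T (t - s) (U s)) (T (t - x) (F x)) - D (T (x - s) (U s)))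
          = B (T (t - s) (U s)) (G s t) - integral {0..t-s} (\<lambda>x. D (T x (U s)))"
        by (subst Bochner_Integration.integral_diff) (use s0 st in \<open>auto simp: B_int D_int\<close>)
      finally show ?thesis by (simp add: N_def)
    qed
    have "B (U t) (U t) = B (T (t - s) (U s)) (T (t - s) (U s)) + 2 * B (T (t - s) (U s)) (G s t) + B (G s t) (G s t)"
    proof -
      have "U t = T (t - s) (U s) + G s t" by (simp add: G_def)
      then show ?thesis using Bs[of "G s t" "T (t - s) (U s)"] by (simp add: B.add_left B.add_right)
    qed
    moreover have "B (G s t) (G s t) \<le> K * (N s t * N s t)"
    proof -
      have "B (G s t) (G s t) \<le> norm (G s t) * norm (G s t) * K" using K(2)[of "G s t" "G s t"] by simp
      also have "\<dots> \<le> N s t * N s t * K"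
        using Gle[OF st] N0[OF st] K(1) by (intro mult_right_mono mult_mono) auto
      finally show ?thesis by (simp add: mult_ac)
    qed
    moreover have "B (T (t - s) (U s)) (T (t - s) (U s)) / 2 + integral {0..t-s} (\<lambda>x. D (T x (U s))) \<le> B (U s) (U s) / 2"
      using orbit_dissipation[OF diss UK[OF s0], of "t - s"] st by simp
    ultimately show "B (U t) (U t) / 2 - B (U s) (U s) / 2 \<le> integral\<^sup>L (lebesgue_on {s<..<t}) (E s t)"
      unfolding IE mult.assoc[of "K / 2"] times_divide_eq_left by linarith
    have "AE r in lebesgue_on {s<..<t}. r \<in> {s<..<t}"
      using AE_space[of "lebesgue_on {s<..<t}"] by (simp only: space_lebesgue_on)
    then show "AE x in lebesgue_on {s<..<t}. \<bar>E s t x\<bar> \<le> (R * K + K / 2 * N a b) * g x + C"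
      using F_T[OF st(1,3)]
    proof eventually_elim
      case (elim x)
      have g0: "0 \<le> g x" using elim(2) norm_ge_zero order_trans by blast
      have "\<bar>B (T (t - s) (U s)) (T (t - x) (F x))\<bar> \<le> norm (T (t - s) (U s)) * norm (T (t - x) (F x)) * K"
        using K(2) by simp
      also have "\<dots> \<le> R * g x * K"
        using TU[of s "t - s"] st elim K(1) R(1) by (intro mult_right_mono mult_mono) auto
      finally have 1: "\<bar>B (T (t - s) (U s)) (T (t - x) (F x))\<bar> \<le> R * K * g x" by (simp add: mult_ac)
      have 2: "\<bar>D (T (x - s) (U s))\<bar> \<le> C" using TU[of s "x - s"] st elim by (intro C) auto
      have "\<bar>K / 2 * N s t * g x\<bar> = K / 2 * N s t * g x" using K(1) N0[OF st] g0 by simp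
      also have "\<dots> \<le> K / 2 * N a b * g x"
        using N_mono[OF st] K(1) g0 by (intro mult_right_mono mult_left_mono) auto
      finally show ?case using 1 2 unfolding E_def distrib_right by linarith
    qed
  next
    show "integrable (lebesgue_on {a<..<b}) (\<lambda>x. (R * K + K / 2 * N a b) * g x + C)"
      using gab[of a b] continuous_integrable_Ioo(1)[of a b "\<lambda>_. C"]
      by (intro Bochner_Integration.integrable_add) auto
    have sp: "AE r in lebesgue_on {a<..<b}. r \<in> {a<..<b}"
      using AE_space[of "lebesgue_on {a<..<b}"] by (simp only: space_lebesgue_on)
    have contN: "continuous_on {a..b} (\<lambda>x. N a x)" unfolding N_def
      by (rule continuous_indefinite_integral_Ioo) (rule gab; simp)
    show "AE x in lebesgue_on {a<..<b}. \<forall>e>0. \<exists>d>0. \<forall>s t. a \<le> s \<longrightarrow> t \<le> b \<longrightarrow> s < x \<longrightarrow> x < t \<longrightarrow> t - s < d \<longrightarrow>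
                \<bar>E s t x - (B (U x) (F x) - D (U x))\<bar> < e"
      using sp Fab[OF order_refl order_refl]
    proof eventually_elim
      case (elim x)
      have x: "a < x" "x < b" and Fx: "T 0 (F x) = F x" using elim by auto
      have Ux: "T 0 (U x) = U x" using UK x ab by simp
      show ?case
      proof (intro allI impI)
        fix e :: real assume e: "0 < e"
        \<comment> \<open>All three terms are continuous in \<open>(T (t - s) (U s), T (t - x) (F x), T (x - s) (U s), N s t)\<close>.\<close>
        have "isCont D (U x)" using Dc by (simp add: continuous_on_eq_continuous_at)
        then obtain d1 where d1: "d1 > 0" "\<And>z. norm (z - U x) < d1 \<Longrightarrow> \<bar>D z - D (U x)\<bar> < e / 3"
          unfolding continuous_at_eps_delta dist_norm using e by (metis divide_pos_pos real_norm_def zero_less_numeral)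
        have "((\<lambda>z. B (fst z) (snd z)) \<longlongrightarrow> B (fst (U x, F x)) (snd (U x, F x))) (at (U x, F x))"
          by (intro B.tendsto tendsto_fst tendsto_snd tendsto_ident_at)
        then have "isCont (\<lambda>z. B (fst z) (snd z)) (U x, F x)" by (simp add: isCont_def)
        then obtain d2 where d2: "d2 > 0" "\<And>z. dist z (U x, F x) < d2 \<Longrightarrow> \<bar>B (fst z) (snd z) - B (U x) (F x)\<bar> < e / 3"
          unfolding continuous_at_eps_delta using e
          by (metis divide_pos_pos dist_real_def fst_conv snd_conv zero_less_numeral)
        obtain d3 where d3: "d3 > 0" "\<And>y \<tau>. T 0 y = y \<Longrightarrow> norm (y - U x) < d3 \<Longrightarrow> 0 \<le> \<tau> \<Longrightarrow> \<tau> < d3 \<Longrightarrow> norm (T \<tau> y - U x) < min d1 (d2 / 2)"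
          using orbit_jointly_continuous[OF Ux, of "min d1 (d2 / 2)"] d1(1) d2(1) by force
        obtain d4 where d4: "d4 > 0" "\<And>y \<tau>. T 0 y = y \<Longrightarrow> norm (y - F x) < d4 \<Longrightarrow> 0 \<le> \<tau> \<Longrightarrow> \<tau> < d4 \<Longrightarrow> norm (T \<tau> y - F x) < d2 / 2"
          using orbit_jointly_continuous[OF Fx, of "d2 / 2"] d2(1) by force
        obtain d5 where d5: "d5 > 0" "\<And>s. s \<in> {a..b} \<Longrightarrow> \<bar>s - x\<bar> < d5 \<Longrightarrow> norm (U s - U x) < d3"
          using Ucab[unfolded continuous_on_iff, rule_format, of x d3] x d3(1) by (auto simp: dist_norm)
        define k where "k = e / (3 * (K / 2 * (\<bar>g x\<bar> + 1)))"
        have k: "0 < k" using e K(1) by (simp add: k_def add_nonneg_pos)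
        obtain d6 where d6: "d6 > 0" "\<And>s. s \<in> {a..b} \<Longrightarrow> \<bar>s - x\<bar> < d6 \<Longrightarrow> \<bar>N a s - N a x\<bar> < k / 2"
          using contN[unfolded continuous_on_iff, rule_format, of x "k / 2"] x k by (auto simp: dist_norm)
        define d where "d = min (min d3 d4) (min d5 d6)"
        show "\<exists>d>0. \<forall>s t. a \<le> s \<longrightarrow> t \<le> b \<longrightarrow> s < x \<longrightarrow> x < t \<longrightarrow> t - s < d \<longrightarrow>
                \<bar>E s t x - (B (U x) (F x) - D (U x))\<bar> < e"
        proof (intro exI[of _ d] conjI allI impI)
          show "0 < d" using d3(1) d4(1) d5(1) d6(1) by (simp add: d_def)
          fix s t assume st: "a \<le> s" "t \<le> b" "s < x" "x < t" "t - s < d"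
          have dd: "t - s < d3" "t - s < d4" "t - s < d5" "t - s < d6" using st(5) by (auto simp: d_def)
          have Us: "T 0 (U s) = U s" "norm (U s - U x) < d3"
            using UK[of s] d5(2)[of s] st x ab dd by auto
          have t1: "norm (T (t - s) (U s) - U x) < d2 / 2" and t2: "norm (T (x - s) (U s) - U x) < d1"
            using d3(2)[OF Us, of "t - s"] d3(2)[OF Us, of "x - s"] st dd by auto
          have t3: "norm (T (t - x) (F x) - F x) < d2 / 2"
            using d4(2)[OF Fx, of "t - x"] st dd d4(1) by auto
          have "dist (T (t - s) (U s), T (t - x) (F x)) (U x, F x) < d2"
            using norm_Pair_le[of "T (t - s) (U s) - U x" "T (t - x) (F x) - F x"] t1 t3 by (simp add: dist_norm)
          then have e1: "\<bar>B (T (t - s) (U s)) (T (t - x) (F x)) - B (U x) (F x)\<bar> < e / 3" using d2(2) by fastforce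
          have e2: "\<bar>D (T (x - s) (U s)) - D (U x)\<bar> < e / 3" using d1(2) t2 .
          have "N a t = N a s + N s t" unfolding N_def
            using gab[of a t] st by (auto intro: integral_Ioo_split)
          moreover have "\<bar>N a s - N a x\<bar> < k / 2" "\<bar>N a t - N a x\<bar> < k / 2"
            using st x dd by (intro d6(2); simp)+
          ultimately have "N s t < k" by linarith
          then have "K / 2 * (N s t * \<bar>g x\<bar>) \<le> K / 2 * (k * \<bar>g x\<bar>)"
            using K(1) by (intro mult_left_mono mult_right_mono) auto
          also have "\<dots> < K / 2 * (k * (\<bar>g x\<bar> + 1))"
            using K(1) k by simp
          also have "\<dots> = e / 3"
          proof -
            have "K * (\<bar>g x\<bar> + 1) \<noteq> 0" using K(1) by (simp add: add_nonneg_eq_0_iff)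
            then show ?thesis by (simp add: k_def)
          qed
          finally have "\<bar>K / 2 * N s t * g x\<bar> < e / 3"
            using K(1) N0[of s t] st by (simp add: abs_mult mult_ac)
          then show "\<bar>E s t x - (B (U x) (F x) - D (U x))\<bar> < e" using e1 e2 unfolding E_def by linarith
        qed
      qed
    qed
    show "a < b" by (rule ab)
    show "B (U u) (U u) / 2 - B (U s) (U s) / 2 \<le> B (U t) (U t) / 2 - B (U s) (U s) / 2 + (B (U u) (U u) / 2 - B (U t) (U t) / 2)" for s t u
      by simp
  qed
  then show ?int ?le by simp_all
qed

end

section \<open>Square integrable functions on an interval\<close>

lemma lebesgue_on_ae_space: "AE x in lebesgue_on S. x \<in> S"
  using AE_space[of "lebesgue_on S"] by (simp only: space_lebesgue_on)

lemma L2_iff: "f \<in> L2 a b \<longleftrightarrow> f \<in> borel_measurable (lebesgue_on {a<..<b}) \<and> integrable (lebesgue_on {a<..<b}) (\<lambda>x. (f x)\<^sup>2)"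
  by (simp add: L2_def)

lemma L2_mult_integrable:
  assumes "f \<in> L2 a b" "g \<in> L2 a b"
  shows "integrable (lebesgue_on {a<..<b}) (\<lambda>x. f x * g x)"
proof (rule Bochner_Integration.integrable_bound)
  show "integrable (lebesgue_on {a<..<b}) (\<lambda>x. (f x)\<^sup>2 + (g x)\<^sup>2)"
    using assms by (auto simp: L2_iff)
  show "(\<lambda>x. f x * g x) \<in> borel_measurable (lebesgue_on {a<..<b})"
    using assms by (auto simp: L2_iff)
  show "AE x in lebesgue_on {a<..<b}. norm (f x * g x) \<le> norm ((f x)\<^sup>2 + (g x)\<^sup>2)"
  proof (rule AE_I2)
    fix x
    have "2 * (\<bar>f x\<bar> * \<bar>g x\<bar>) \<le> (f x)\<^sup>2 + (g x)\<^sup>2" using sum_squares_bound[of "\<bar>f x\<bar>" "\<bar>g x\<bar>"] by simp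
    moreover have "0 \<le> \<bar>f x\<bar> * \<bar>g x\<bar>" by simp
    ultimately have "\<bar>f x\<bar> * \<bar>g x\<bar> \<le> (f x)\<^sup>2 + (g x)\<^sup>2" by linarith
    then show "norm (f x * g x) \<le> norm ((f x)\<^sup>2 + (g x)\<^sup>2)" by (simp add: abs_mult)
  qed
qed

lemma L2_add: "f \<in> L2 a b \<Longrightarrow> g \<in> L2 a b \<Longrightarrow> (\<lambda>x. f x + g x) \<in> L2 a b"
  using L2_mult_integrable[of f a b g] by (auto simp: L2_iff power2_sum mult.assoc)

lemma L2_cmult: "f \<in> L2 a b \<Longrightarrow> (\<lambda>x. c * f x) \<in> L2 a b"
  by (auto simp: L2_iff power_mult_distrib)

lemma L2_diff: "f \<in> L2 a b \<Longrightarrow> g \<in> L2 a b \<Longrightarrow> (\<lambda>x. f x - g x) \<in> L2 a b"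
  using L2_add[of f a b "\<lambda>x. - 1 * g x"] L2_cmult[of g a b "-1"] by simp

lemma L2_bounded_mult:
  assumes f: "f \<in> L2 a b" and p: "p \<in> borel_measurable (lebesgue_on {a<..<b})"
    and K: "\<And>x. x \<in> {a<..<b} \<Longrightarrow> \<bar>p x\<bar> \<le> K"
  shows "(\<lambda>x. p x * f x) \<in> L2 a b"
proof -
  have "integrable (lebesgue_on {a<..<b}) (\<lambda>x. (p x * f x)\<^sup>2)"
  proof (rule Bochner_Integration.integrable_bound)
    show "integrable (lebesgue_on {a<..<b}) (\<lambda>x. K\<^sup>2 * (f x)\<^sup>2)" using f by (simp add: L2_iff)
    show "(\<lambda>x. (p x * f x)\<^sup>2) \<in> borel_measurable (lebesgue_on {a<..<b})" using f p by (auto simp: L2_iff)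
    show "AE x in lebesgue_on {a<..<b}. norm ((p x * f x)\<^sup>2) \<le> norm (K\<^sup>2 * (f x)\<^sup>2)"
    proof (rule AE_I2)
      fix x assume "x \<in> space (lebesgue_on {a<..<b})"
      then have "\<bar>p x\<bar> \<le> \<bar>K\<bar>" using K[of x] by simp
      then have "(p x)\<^sup>2 \<le> K\<^sup>2" by (simp add: abs_le_square_iff)
      then show "norm ((p x * f x)\<^sup>2) \<le> norm (K\<^sup>2 * (f x)\<^sup>2)"
        by (simp add: power_mult_distrib mult_right_mono)
    qed
  qed
  then show ?thesis using f p by (auto simp: L2_iff)
qed

lemma continuous_measurable_Ioo:
  fixes f :: "real \<Rightarrow> real"
  assumes "continuous_on {a..b} f"
  shows "f \<in> borel_measurable (lebesgue_on {a<..<b})"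
  using continuous_integrable_Ioo(1)[OF assms] by simp

lemma continuous_bounded_Icc:
  fixes f :: "real \<Rightarrow> real"
  assumes "continuous_on {a..b} f"
  shows "\<exists>K. \<forall>x\<in>{a..b}. \<bar>f x\<bar> \<le> K"
  using compact_imp_bounded[OF compact_continuous_image[OF assms compact_Icc]]
  by (auto simp: bounded_iff)

lemma L2_continuous_mult:
  assumes f: "f \<in> L2 a b" and p: "continuous_on {a..b} p"
  shows "(\<lambda>x. p x * f x) \<in> L2 a b"
proof -
  obtain K where "\<forall>x\<in>{a..b}. \<bar>p x\<bar> \<le> K" using continuous_bounded_Icc[OF p] by blast
  then show ?thesis by (intro L2_bounded_mult[OF f continuous_measurable_Ioo[OF p], of K]) auto
qed

lemma L2_continuous: "continuous_on {a..b} f \<Longrightarrow> f \<in> L2 a b"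
  unfolding L2_iff by (intro conjI continuous_measurable_Ioo continuous_integrable_Ioo(1) continuous_intros)

lemma L2_integrable: "f \<in> L2 a b \<Longrightarrow> integrable (lebesgue_on {a<..<b}) f"
  using L2_mult_integrable[of "\<lambda>_. 1" a b f] L2_continuous[of a b "\<lambda>_. 1"] by simp

lemma L2_subinterval:
  assumes f: "f \<in> L2 a b" and "a \<le> c" "d \<le> b"
  shows "f \<in> L2 c d"
  using integrable_Ioo_subinterval[of a b "\<lambda>x. (f x)\<^sup>2" c d] integrable_Ioo_subinterval[OF L2_integrable[OF f], of c d] assms
  by (auto simp: L2_iff)

lemma L2_AE_cong:
  assumes f: "f \<in> L2 a b" and ae: "AE x in lebesgue_on {a<..<b}. f x = g x"
  shows "g \<in> L2 a b"
proof -
  have "g \<in> borel_measurable (lebesgue_on {a<..<b})"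
    by (rule borel_measurable_lebesgue_on_AE_cong[OF _ _ ae]) (use f in \<open>auto simp: L2_iff\<close>)
  moreover have "integrable (lebesgue_on {a<..<b}) (\<lambda>x. (g x)\<^sup>2)"
    by (rule integrable_lebesgue_on_AE_cong(1)[of _ "\<lambda>x. (f x)\<^sup>2"]) (use f ae in \<open>auto simp: L2_iff elim!: eventually_mono\<close>)
  ultimately show ?thesis by (simp add: L2_iff)
qed

lemma inner_L2_commute: "inner_L2 a b f g = inner_L2 a b g f"
  by (simp add: inner_L2_def mult.commute)

lemma inner_L2_AE_cong:
  assumes "f \<in> L2 a b" "g \<in> L2 a b" "AE x in lebesgue_on {a<..<b}. f x = f' x" "AE x in lebesgue_on {a<..<b}. g x = g' x"
  shows "inner_L2 a b f g = inner_L2 a b f' g'"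
proof -
  have "AE x in lebesgue_on {a<..<b}. f x * g x = f' x * g' x"
    using assms(3,4) by eventually_elim simp
  from integrable_lebesgue_on_AE_cong(2)[OF _ L2_mult_integrable[OF assms(1,2)] this]
  show ?thesis by (simp add: inner_L2_def)
qed

lemma inner_L2_add_left: "f \<in> L2 a b \<Longrightarrow> g \<in> L2 a b \<Longrightarrow> h \<in> L2 a b \<Longrightarrow>
   inner_L2 a b (\<lambda>x. f x + g x) h = inner_L2 a b f h + inner_L2 a b g h"
  unfolding inner_L2_def by (subst Bochner_Integration.integral_add[symmetric]) (auto intro: L2_mult_integrable simp: distrib_right)

lemma inner_L2_diff_left: "f \<in> L2 a b \<Longrightarrow> g \<in> L2 a b \<Longrightarrow> h \<in> L2 a b \<Longrightarrow>
   inner_L2 a b (\<lambda>x. f x - g x) h = inner_L2 a b f h - inner_L2 a b g h"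
  unfolding inner_L2_def by (subst Bochner_Integration.integral_diff[symmetric]) (auto intro: L2_mult_integrable simp: left_diff_distrib)

lemma inner_L2_cmult_left: "inner_L2 a b (\<lambda>x. c * f x) h = c * inner_L2 a b f h"
  unfolding inner_L2_def by (simp add: mult.assoc)

lemma inner_L2_add_right: "f \<in> L2 a b \<Longrightarrow> g \<in> L2 a b \<Longrightarrow> h \<in> L2 a b \<Longrightarrow>
   inner_L2 a b h (\<lambda>x. f x + g x) = inner_L2 a b h f + inner_L2 a b h g"
  using inner_L2_add_left[of f a b g h] by (simp only: inner_L2_commute[of a b h])

lemma inner_L2_diff_right: "f \<in> L2 a b \<Longrightarrow> g \<in> L2 a b \<Longrightarrow> h \<in> L2 a b \<Longrightarrow>
   inner_L2 a b h (\<lambda>x. f x - g x) = inner_L2 a b h f - inner_L2 a b h g"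
  using inner_L2_diff_left[of f a b g h] by (simp only: inner_L2_commute[of a b h])

lemma inner_L2_cmult_right: "inner_L2 a b h (\<lambda>x. c * f x) = c * inner_L2 a b h f"
  using inner_L2_cmult_left[of a b c f h] by (simp only: inner_L2_commute[of a b h])

lemma inner_L2_nonneg: "0 \<le> inner_L2 a b f f"
  unfolding inner_L2_def by (rule integral_nonneg_AE) simp

lemma inner_L2_mono_interval:
  assumes f: "f \<in> L2 a b" and "a \<le> c" "d \<le> b"
  shows "inner_L2 c d f f \<le> inner_L2 a b f f"
proof -
  have "integrable lebesgue (\<lambda>x. indicator {a<..<b} x * (f x * f x))"
    using L2_mult_integrable[OF f f] by (simp add: integrable_lebesgue_on_iff)
  moreover have "integrable lebesgue (\<lambda>x. indicator {c<..<d} x * (f x * f x))"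
    using L2_mult_integrable[OF L2_subinterval[OF assms] L2_subinterval[OF assms]] by (simp add: integrable_lebesgue_on_iff)
  ultimately have "integral\<^sup>L lebesgue (\<lambda>x. indicator {c<..<d} x * (f x * f x)) \<le> integral\<^sup>L lebesgue (\<lambda>x. indicator {a<..<b} x * (f x * f x))"
    by (intro Bochner_Integration.integral_mono) (use assms in \<open>auto simp: indicator_def\<close>)
  then show ?thesis by (simp add: inner_L2_def integral_lebesgue_on_eq)
qed

lemma inner_L2_zero_iff: "f \<in> L2 a b \<Longrightarrow> inner_L2 a b f f = 0 \<longleftrightarrow> (AE x in lebesgue_on {a<..<b}. f x = 0)"
  unfolding inner_L2_def using integral_nonneg_eq_0_iff_AE[OF L2_mult_integrable[of f a b f]] by simp

lemma inner_L2_Cauchy_Schwarz: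
  assumes f: "f \<in> L2 a b" and g: "g \<in> L2 a b"
  shows "(inner_L2 a b f g)\<^sup>2 \<le> inner_L2 a b f f * inner_L2 a b g g"
proof -
  let ?A = "inner_L2 a b f f" and ?B = "inner_L2 a b f g" and ?C = "inner_L2 a b g g"
  have q: "0 \<le> ?A - 2 * t * ?B + t\<^sup>2 * ?C" for t
  proof -
    have "0 \<le> inner_L2 a b (\<lambda>x. f x - t * g x) (\<lambda>x. f x - t * g x)" by (rule inner_L2_nonneg)
    also have "\<dots> = ?A - 2 * t * ?B + t\<^sup>2 * ?C"
      using f g by (simp add: inner_L2_diff_left inner_L2_diff_right L2_cmult L2_diff inner_L2_cmult_left inner_L2_cmult_right
          inner_L2_commute[of a b g f] power2_eq_square algebra_simps)
    finally show ?thesis .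
  qed
  show ?thesis
  proof (cases "?C = 0")
    case True
    have "?B = 0"
    proof (rule ccontr)
      assume B: "?B \<noteq> 0"
      from q[of "(?A + 1) / (2 * ?B)"] True B show False by simp
    qed
    then show ?thesis using True by simp
  next
    case False
    then have C: "?C > 0" using inner_L2_nonneg[of a b g] by linarith
    from q[of "?B / ?C"] have "0 \<le> ?A - ?B\<^sup>2 / ?C" using C by (simp add: power2_eq_square field_simps)
    then show ?thesis using C by (simp add: field_simps)
  qed
qed

definition norm_L2 :: "real \<Rightarrow> real \<Rightarrow> (real \<Rightarrow> real) \<Rightarrow> real" where
  "norm_L2 a b f = sqrt (inner_L2 a b f f)"

lemma norm_L2_nonneg: "0 \<le> norm_L2 a b f" by (simp add: norm_L2_def inner_L2_nonneg)

lemma norm_L2_power2: "(norm_L2 a b f)\<^sup>2 = inner_L2 a b f f" by (simp add: norm_L2_def inner_L2_nonneg)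

lemma inner_L2_le_norms:
  assumes "f \<in> L2 a b" "g \<in> L2 a b"
  shows "\<bar>inner_L2 a b f g\<bar> \<le> norm_L2 a b f * norm_L2 a b g"
proof -
  have "(inner_L2 a b f g)\<^sup>2 \<le> (norm_L2 a b f * norm_L2 a b g)\<^sup>2"
    using inner_L2_Cauchy_Schwarz[OF assms] by (simp add: power_mult_distrib norm_L2_power2)
  then show ?thesis using abs_le_square_iff[of "inner_L2 a b f g" "norm_L2 a b f * norm_L2 a b g"]
    by (simp add: norm_L2_nonneg)
qed

definition L2_lim :: "real \<Rightarrow> real \<Rightarrow> (nat \<Rightarrow> real \<Rightarrow> real) \<Rightarrow> (real \<Rightarrow> real) \<Rightarrow> bool" where
  "L2_lim a b F f \<longleftrightarrow> (\<forall>n. F n \<in> L2 a b) \<and> f \<in> L2 a b \<and>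
     (\<lambda>n. inner_L2 a b (\<lambda>x. F n x - f x) (\<lambda>x. F n x - f x)) \<longlonglongrightarrow> 0"

lemma L2_limD: "L2_lim a b F f \<Longrightarrow> F n \<in> L2 a b" "L2_lim a b F f \<Longrightarrow> f \<in> L2 a b"
  "L2_lim a b F f \<Longrightarrow> (\<lambda>n. norm_L2 a b (\<lambda>x. F n x - f x)) \<longlonglongrightarrow> 0"
  unfolding L2_lim_def norm_L2_def using tendsto_real_sqrt by fastforce+

lemma L2_lim_inner:
  assumes F: "L2_lim a b F f" and G: "L2_lim a b G g"
  shows "(\<lambda>n. inner_L2 a b (F n) (G n)) \<longlonglongrightarrow> inner_L2 a b f g"
proof -
  note Fn = L2_limD(1)[OF F] and f = L2_limD(2)[OF F] and Gn = L2_limD(1)[OF G] and g = L2_limD(2)[OF G]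
  let ?F = "\<lambda>n x. F n x - f x" and ?G = "\<lambda>n x. G n x - g x"
  have eq: "inner_L2 a b (F n) (G n) - inner_L2 a b f g =
      inner_L2 a b (?F n) (?G n) + inner_L2 a b (?F n) g + inner_L2 a b f (?G n)" for n
    using Fn[of n] f Gn[of n] g by (simp add: inner_L2_diff_left inner_L2_diff_right L2_diff)
  have F0: "(\<lambda>n. norm_L2 a b (?F n)) \<longlonglongrightarrow> 0" and G0: "(\<lambda>n. norm_L2 a b (?G n)) \<longlonglongrightarrow> 0"
    using L2_limD(3) F G by auto
  have "(\<lambda>n. norm_L2 a b (?F n) * norm_L2 a b (?G n) + norm_L2 a b (?F n) * norm_L2 a b g + norm_L2 a b f * norm_L2 a b (?G n)) \<longlonglongrightarrow> 0 * 0 + 0 * norm_L2 a b g + norm_L2 a b f * 0"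
    by (intro tendsto_intros F0 G0)
  then have z: "(\<lambda>n. norm_L2 a b (?F n) * norm_L2 a b (?G n) + norm_L2 a b (?F n) * norm_L2 a b g + norm_L2 a b f * norm_L2 a b (?G n)) \<longlonglongrightarrow> 0" by simp
  have "(\<lambda>n. inner_L2 a b (F n) (G n) - inner_L2 a b f g) \<longlonglongrightarrow> 0"
  proof (rule Lim_null_comparison[OF always_eventually z], rule allI)
    fix n
    show "norm (inner_L2 a b (F n) (G n) - inner_L2 a b f g) \<le> norm_L2 a b (?F n) * norm_L2 a b (?G n) + norm_L2 a b (?F n) * norm_L2 a b g + norm_L2 a b f * norm_L2 a b (?G n)"
      unfolding eq using inner_L2_le_norms[of "?F n" a b "?G n"] inner_L2_le_norms[of "?F n" a b g] inner_L2_le_norms[of f a b "?G n"]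
        L2_diff[OF Fn f, of n] L2_diff[OF Gn g, of n] f g by simp
  qed
  then show ?thesis using Lim_null by blast
qed

lemma L2_lim_const: "f \<in> L2 a b \<Longrightarrow> L2_lim a b (\<lambda>_. f) f"
  by (simp add: L2_lim_def inner_L2_def)

text \<open>
  Dominated convergence, applied to the squares.
\<close>

lemma L2_lim_dominated:
  assumes F: "\<And>n. F n \<in> borel_measurable (lebesgue_on {a<..<b})" and f: "f \<in> L2 a b"
    and lim: "AE x in lebesgue_on {a<..<b}. (\<lambda>n. F n x) \<longlonglongrightarrow> f x"
    and g: "g \<in> L2 a b" and bound: "\<And>n. AE x in lebesgue_on {a<..<b}. \<bar>F n x - f x\<bar> \<le> g x"
  shows "L2_lim a b F f"
proof -
  have m: "(\<lambda>x. (F n x - f x) * (F n x - f x)) \<in> borel_measurable (lebesgue_on {a<..<b})" for n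
    using F[of n] f by (auto simp: L2_iff)
  have ae: "AE x in lebesgue_on {a<..<b}. (\<lambda>n. (F n x - f x) * (F n x - f x)) \<longlonglongrightarrow> 0"
    using lim
  proof eventually_elim
    case (elim x)
    have "(\<lambda>n. (F n x - f x) * (F n x - f x)) \<longlonglongrightarrow> (f x - f x) * (f x - f x)" by (intro tendsto_intros elim)
    then show ?case by simp
  qed
  have bd: "AE x in lebesgue_on {a<..<b}. norm ((F n x - f x) * (F n x - f x)) \<le> g x * g x" for n
    using bound[of n]
  proof eventually_elim
    case (elim x)
    then have "\<bar>F n x - f x\<bar> * \<bar>F n x - f x\<bar> \<le> g x * g x" by (intro mult_mono) auto
    then show ?case by (simp add: abs_mult)
  qed
  have z: "(\<lambda>x. 0::real) \<in> borel_measurable (lebesgue_on {a<..<b})" by simp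
  have i: "integrable (lebesgue_on {a<..<b}) (\<lambda>x. (F n x - f x) * (F n x - f x))" for n
    by (rule integrable_dominated_convergence2[OF z m L2_mult_integrable[OF g g] ae bd])
  have "(\<lambda>n. integral\<^sup>L (lebesgue_on {a<..<b}) (\<lambda>x. (F n x - f x) * (F n x - f x))) \<longlonglongrightarrow> 0"
    using integral_dominated_convergence[OF z m L2_mult_integrable[OF g g] ae bd] by simp
  moreover have "F n \<in> L2 a b" for n
  proof -
    have "(\<lambda>x. F n x - f x) \<in> L2 a b" using i[of n] F[of n] f by (auto simp: L2_iff power2_eq_square)
    from L2_add[OF this f] show ?thesis by simp
  qed
  ultimately show ?thesis using f by (simp add: L2_lim_def inner_L2_def)
qed

text \<open>
  The triangle inequality for squared distances; the factor \<open>2\<close> avoids square roots.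
\<close>

lemma L2_approx_trans:
  assumes f: "f \<in> L2 a b" and h: "h \<in> L2 a b" and q: "q \<in> L2 a b"
  shows "inner_L2 a b (\<lambda>x. f x - q x) (\<lambda>x. f x - q x) \<le>
    2 * inner_L2 a b (\<lambda>x. f x - h x) (\<lambda>x. f x - h x) + 2 * inner_L2 a b (\<lambda>x. h x - q x) (\<lambda>x. h x - q x)"
proof -
  have i: "integrable (lebesgue_on {a<..<b}) (\<lambda>x. (f x - q x) * (f x - q x))"
     "integrable (lebesgue_on {a<..<b}) (\<lambda>x. (f x - h x) * (f x - h x))"
     "integrable (lebesgue_on {a<..<b}) (\<lambda>x. (h x - q x) * (h x - q x))"
    using assms by (auto intro!: L2_mult_integrable L2_diff)
  have "integral\<^sup>L (lebesgue_on {a<..<b}) (\<lambda>x. (f x - q x) * (f x - q x)) \<le>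
     integral\<^sup>L (lebesgue_on {a<..<b}) (\<lambda>x. 2 * ((f x - h x) * (f x - h x)) + 2 * ((h x - q x) * (h x - q x)))"
  proof (rule Bochner_Integration.integral_mono)
    fix x
    have "0 \<le> (f x - h x - (h x - q x))\<^sup>2" by simp
    then show "(f x - q x) * (f x - q x) \<le> 2 * ((f x - h x) * (f x - h x)) + 2 * ((h x - q x) * (h x - q x))"
      by (simp add: power2_eq_square algebra_simps)
  qed (use i in auto)
  also have "\<dots> = 2 * inner_L2 a b (\<lambda>x. f x - h x) (\<lambda>x. f x - h x) + 2 * inner_L2 a b (\<lambda>x. h x - q x) (\<lambda>x. h x - q x)"
    unfolding inner_L2_def using i by simp
  finally show ?thesis by (simp add: inner_L2_def)
qed

lemma inner_L2_diff_commute: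
  "inner_L2 a b (\<lambda>x. f x - g x) (\<lambda>x. f x - g x) = inner_L2 a b (\<lambda>x. g x - f x) (\<lambda>x. g x - f x)"
  by (simp add: inner_L2_def algebra_simps)

lemma continuous_real_polynomial: "real_polynomial_function (q::real\<Rightarrow>real) \<Longrightarrow> continuous_on S q"
  by (metis continuous_on_polymonial_function real_polynomial_function_eq)

text \<open>
  In turn \<open>f\<close> is approximated by its truncation at a height \<open>k\<close>, the truncation by a truncated
  continuous function (as limits of continuous functions almost everywhere, bounded by \<open>k\<close>), and
  that one uniformly by a polynomial. The errors \<open>e / 8\<close>, \<open>e / 16\<close> and \<open>e / 32\<close> compensate for the
  factors of \<open>L2_approx_trans\<close>.
\<close>

lemma polynomials_dense_L2:
  assumes ab: "a < b" and f: "f \<in> L2 a b" and e: "0 < e"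
  shows "\<exists>q. real_polynomial_function q \<and> inner_L2 a b (\<lambda>x. f x - q x) (\<lambda>x. f x - q x) < e"
proof -
  define c where "c K x = max (- K) (min K x)" for K x :: real
  have c_bound: "\<bar>c K x\<bar> \<le> K" if "0 \<le> K" for K x using that by (auto simp: c_def)
  have c_cont: "continuous_on UNIV (c K)" for K unfolding c_def by (intro continuous_intros)
  have c_meas: "(\<lambda>x. c K (f x)) \<in> borel_measurable (lebesgue_on {a<..<b})" for K
    using f unfolding c_def by (auto simp: L2_iff)
  have f_ae: "(\<lambda>n. c (real n) y) \<longlonglongrightarrow> y" for y
  proof (rule tendsto_eventually)
    obtain N :: nat where "\<bar>y\<bar> < real N" using reals_Archimedean2 by blast
    then show "\<forall>\<^sub>F n in sequentially. c (real n) y = y"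
      unfolding eventually_sequentially c_def by (intro exI[of _ N]) (auto simp: min_def max_def)
  qed
  have absf: "(\<lambda>x. \<bar>f x\<bar>) \<in> L2 a b" using f by (auto simp: L2_iff)
  have "L2_lim a b (\<lambda>n x. c (real n) (f x)) f"
  proof (rule L2_lim_dominated[OF c_meas f _ absf])
    show "AE x in lebesgue_on {a<..<b}. \<bar>c (real n) (f x) - f x\<bar> \<le> \<bar>f x\<bar>" for n
      by (rule AE_I2) (auto simp: c_def min_def max_def)
  qed (simp add: f_ae)
  then have "(\<lambda>n. inner_L2 a b (\<lambda>x. c (real n) (f x) - f x) (\<lambda>x. c (real n) (f x) - f x)) \<longlonglongrightarrow> 0"
    by (simp add: L2_lim_def)
  then have "eventually (\<lambda>n. inner_L2 a b (\<lambda>x. c (real n) (f x) - f x) (\<lambda>x. c (real n) (f x) - f x) < e / 8) sequentially"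
    by (rule order_tendstoD(2)) (use e in simp)
  then obtain k where k: "inner_L2 a b (\<lambda>x. c (real k) (f x) - f x) (\<lambda>x. c (real k) (f x) - f x) < e / 8"
    using eventually_happens'[OF sequentially_bot] by blast
  define h where "h x = c (real k) (f x)" for x
  have const: "(\<lambda>_. K) \<in> L2 a b" for K by (rule L2_continuous) simp
  have hm: "h \<in> borel_measurable (lebesgue_on {a<..<b})" using c_meas[of "real k"] by (simp add: h_def[abs_def])
  have h: "h \<in> L2 a b"
    using L2_bounded_mult[OF const[of 1] hm, of "real k"] c_bound[of "real k"] by (simp add: h_def[abs_def])
  have "(\<lambda>x. indicator {a<..<b} x * f x) measurable_on {a<..<b}"
    using f by (intro lebesgue_measurable_imp_measurable_on_real) (auto simp: L2_iff borel_measurable_lebesgue_on_iff)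
  then obtain N g where N: "negligible N" and g: "\<And>n. continuous_on UNIV (g n)"
    "\<And>x. x \<notin> N \<Longrightarrow> (\<lambda>n. g n x) \<longlonglongrightarrow> (if x \<in> {a<..<b} then indicator {a<..<b} x * f x else 0)"
    unfolding measurable_on_def by blast
  have cg: "continuous_on S (\<lambda>x. c (real k) (g n x))" for n S
    by (rule continuous_on_compose2[OF c_cont, of _ "g n"]) (auto intro: continuous_on_subset[OF g(1)])
  have "L2_lim a b (\<lambda>n x. c (real k) (g n x)) h"
  proof (rule L2_lim_dominated[OF continuous_measurable_Ioo[OF cg] h _ const[of "2 * real k"]])
    have "AE x in lebesgue. x \<notin> N" using N by (simp add: negligible_iff_null_sets AE_not_in)
    then show "AE x in lebesgue_on {a<..<b}. (\<lambda>n. c (real k) (g n x)) \<longlonglongrightarrow> h x"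
      unfolding AE_lebesgue_on_iff[OF lmeasurable_interval(2)[THEN fmeasurableD]]
    proof eventually_elim
      case (elim x)
      show ?case
      proof
        assume "x \<in> {a<..<b}"
        then have "(\<lambda>n. g n x) \<longlonglongrightarrow> f x" using g(2)[OF elim] by simp
        then show "(\<lambda>n. c (real k) (g n x)) \<longlonglongrightarrow> h x"
          unfolding h_def using continuous_on_tendsto_compose[OF c_cont] by fastforce
      qed
    qed
    show "AE x in lebesgue_on {a<..<b}. \<bar>c (real k) (g n x) - h x\<bar> \<le> 2 * real k" for n
    proof (rule AE_I2)
      fix x show "\<bar>c (real k) (g n x) - h x\<bar> \<le> 2 * real k"
        using c_bound[of "real k" "g n x"] c_bound[of "real k" "f x"] unfolding h_def by linarith
    qed
  qed
  then have "(\<lambda>n. inner_L2 a b (\<lambda>x. c (real k) (g n x) - h x) (\<lambda>x. c (real k) (g n x) - h x)) \<longlonglongrightarrow> 0"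
    by (simp add: L2_lim_def)
  then have "eventually (\<lambda>n. inner_L2 a b (\<lambda>x. c (real k) (g n x) - h x) (\<lambda>x. c (real k) (g n x) - h x) < e / 16) sequentially"
    by (rule order_tendstoD(2)) (use e in simp)
  then obtain n where n: "inner_L2 a b (\<lambda>x. c (real k) (g n x) - h x) (\<lambda>x. c (real k) (g n x) - h x) < e / 16"
    using eventually_happens'[OF sequentially_bot] by blast
  define u where "u x = c (real k) (g n x)" for x
  have u: "u \<in> L2 a b" unfolding u_def by (rule L2_continuous[OF cg])
  define d where "d = sqrt (e / (32 * (b - a)))"
  have d: "0 < d" using e ab by (simp add: d_def)
  obtain q where q: "real_polynomial_function q" "\<And>x. x \<in> {a..b} \<Longrightarrow> \<bar>u x - q x\<bar> < d"
    using Stone_Weierstrass_real_polynomial_function[OF compact_Icc, of a b u d] cg d by (auto simp: u_def)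
  have qL: "q \<in> L2 a b" by (rule L2_continuous[OF continuous_real_polynomial[OF q(1)]])
  have "inner_L2 a b (\<lambda>x. u x - q x) (\<lambda>x. u x - q x) \<le> integral\<^sup>L (lebesgue_on {a<..<b}) (\<lambda>x. d\<^sup>2)"
    unfolding inner_L2_def
  proof (rule integral_mono_AE)
    show "integrable (lebesgue_on {a<..<b}) (\<lambda>x. (u x - q x) * (u x - q x))"
      using L2_mult_integrable[OF L2_diff[OF u qL] L2_diff[OF u qL]] .
    show "integrable (lebesgue_on {a<..<b}) (\<lambda>x. d\<^sup>2)" by (rule continuous_integrable_Ioo) simp
    show "AE x in lebesgue_on {a<..<b}. (u x - q x) * (u x - q x) \<le> d\<^sup>2"
      using lebesgue_on_ae_space[of "{a<..<b}"]
    proof eventually_elim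
      case (elim x)
      then have "\<bar>u x - q x\<bar> \<le> \<bar>d\<bar>" using q(2)[of x] d by auto
      then show ?case unfolding abs_le_square_iff by (simp add: power2_eq_square)
    qed
  qed
  also have "\<dots> = d\<^sup>2 * (b - a)" using continuous_integrable_Ioo(2)[of a b "\<lambda>_. d\<^sup>2"] ab by simp
  also have "\<dots> = e / 32"
  proof -
    have "d\<^sup>2 = e / 32 / (b - a)" using e ab by (simp add: d_def)
    moreover have "b - a \<noteq> 0" using ab by simp
    ultimately show ?thesis using nonzero_eq_divide_eq[of "b - a" "d\<^sup>2" "e / 32"] by blast
  qed
  finally have uq: "inner_L2 a b (\<lambda>x. u x - q x) (\<lambda>x. u x - q x) \<le> e / 32" .
  have "inner_L2 a b (\<lambda>x. h x - q x) (\<lambda>x. h x - q x) \<le> 2 * (e / 16) + 2 * (e / 32)"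
    using L2_approx_trans[OF h u qL] uq n inner_L2_diff_commute[of a b h u] by (simp add: u_def)
  then have "inner_L2 a b (\<lambda>x. f x - q x) (\<lambda>x. f x - q x) < 2 * (e / 8) + 2 * (2 * (e / 16) + 2 * (e / 32))"
    using L2_approx_trans[OF f h qL] k inner_L2_diff_commute[of a b f h] by (simp add: h_def)
  also have "\<dots> \<le> e" using e by simp
  finally show ?thesis using q(1) by blast
qed

lemma polynomials_dense_L2_lim:
  assumes ab: "a < b" and f: "f \<in> L2 a b"
  shows "\<exists>Q. (\<forall>n. real_polynomial_function (Q n)) \<and> L2_lim a b Q f"
proof -
  have "\<exists>q. real_polynomial_function q \<and> inner_L2 a b (\<lambda>x. f x - q x) (\<lambda>x. f x - q x) < 1 / real (Suc n)" for n
    by (rule polynomials_dense_L2[OF ab f]) simp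
  then have "\<forall>n. \<exists>q. real_polynomial_function q \<and> inner_L2 a b (\<lambda>x. f x - q x) (\<lambda>x. f x - q x) < 1 / real (Suc n)"
    by (rule allI)
  from choice[OF this] obtain Q where Q': "\<forall>n. real_polynomial_function (Q n) \<and>
      inner_L2 a b (\<lambda>x. f x - Q n x) (\<lambda>x. f x - Q n x) < 1 / real (Suc n)" ..
  note Q = Q'[THEN spec, THEN conjunct1] Q'[THEN spec, THEN conjunct2]
  have "(\<lambda>n. inner_L2 a b (\<lambda>x. Q n x - f x) (\<lambda>x. Q n x - f x)) \<longlonglongrightarrow> 0"
  proof (rule Lim_null_comparison[OF always_eventually LIMSEQ_Suc[OF lim_1_over_n]], rule allI)
    fix n show "norm (inner_L2 a b (\<lambda>x. Q n x - f x) (\<lambda>x. Q n x - f x)) \<le> 1 / real (Suc n)"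
      using Q(2)[of n] inner_L2_nonneg[of a b "\<lambda>x. Q n x - f x"] inner_L2_diff_commute[of a b f "Q n"] by simp
  qed
  then have "L2_lim a b Q f"
    using f L2_continuous[OF continuous_real_polynomial[OF Q(1)]] by (simp add: L2_lim_def)
  then show ?thesis using Q(1) by blast
qed

lemma L2_zero_if_orthogonal_polynomials:
  assumes ab: "a < b" and f: "f \<in> L2 a b" and orth: "\<And>q. real_polynomial_function q \<Longrightarrow> inner_L2 a b f q = 0"
  shows "AE x in lebesgue_on {a<..<b}. f x = 0"
proof -
  obtain Q where Q: "\<And>n. real_polynomial_function (Q n)" "L2_lim a b Q f"
    using polynomials_dense_L2_lim[OF ab f] by blast
  have "(\<lambda>n. inner_L2 a b f (Q n)) \<longlonglongrightarrow> inner_L2 a b f f"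
    by (rule L2_lim_inner[OF L2_lim_const[OF f] Q(2)])
  then have "inner_L2 a b f f = 0" using orth Q(1) by (simp add: LIMSEQ_const_iff)
  then show ?thesis using inner_L2_zero_iff[OF f] by simp
qed

text \<open>
  Let \<open>y\<close> be the \<open>k\<close>-th power of \<open>(x - a) (b - x)\<close>, scaled to take values in \<open>(0, 1]\<close> inside the
  interval. Then \<open>q0 (1 - (1 - y)^n)\<close> is divisible by \<open>y\<close>, and it converges dominatedly to \<open>q0\<close>
  because \<open>0 \<le> 1 - y < 1\<close>.
\<close>

lemma vanishing_polynomials_dense_L2:
  assumes ab: "a < b" and f: "f \<in> L2 a b" and e: "0 < e"
  shows "\<exists>q. real_polynomial_function q \<and>
     inner_L2 a b (\<lambda>x. f x - ((x - a) * (b - x)) ^ k * q x) (\<lambda>x. f x - ((x - a) * (b - x)) ^ k * q x) < e"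
proof -
  obtain q0 where q0: "real_polynomial_function q0" "inner_L2 a b (\<lambda>x. f x - q0 x) (\<lambda>x. f x - q0 x) < e / 4"
    using polynomials_dense_L2[OF ab f, of "e / 4"] e by auto
  define y where "y x = (4 / (b - a)\<^sup>2) ^ k * ((x - a) * (b - x)) ^ k" for x
  define p where "p n x = (4 / (b - a)\<^sup>2) ^ k * q0 x * (\<Sum>i<n. (1 - y x) ^ i)" for n x
  have lin: "real_polynomial_function (\<lambda>x::real. x)"
    using real_polynomial_function.intros(1)[OF bounded_linear_ident] .
  have yp: "real_polynomial_function y" unfolding y_def
    by (intro real_polynomial_function.intros(3,4) real_polynomial_function.intros(2) real_polynomial_function_power real_polynomial_function_diff lin)
  have pp: "real_polynomial_function (p n)" for n unfolding p_def
    by (intro real_polynomial_function.intros(4) real_polynomial_function.intros(2) real_polynomial_function_sum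
        real_polynomial_function_power real_polynomial_function_diff yp q0(1)) auto
  have key: "((x - a) * (b - x)) ^ k * p n x = q0 x * (1 - (1 - y x) ^ n)" for n x
  proof -
    have "((x - a) * (b - x)) ^ k * p n x = q0 x * (y x * (\<Sum>i<n. (1 - y x) ^ i))"
      by (simp add: p_def y_def mult_ac)
    also have "y x * (\<Sum>i<n. (1 - y x) ^ i) = 1 - (1 - y x) ^ n"
      using one_diff_power_eq[of "1 - y x" n] by simp
    finally show ?thesis .
  qed
  have y01: "0 < y x" "y x \<le> 1" if x: "x \<in> {a<..<b}" for x
  proof -
    have "0 < (x - a) * (b - x)" using x by simp
    then show "0 < y x" using ab by (simp add: y_def)
    have "0 \<le> (2 * x - a - b)\<^sup>2" by simp
    then have "4 * ((x - a) * (b - x)) \<le> (b - a)\<^sup>2" by (simp add: power2_eq_square algebra_simps)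
    then have "4 / (b - a)\<^sup>2 * ((x - a) * (b - x)) \<le> 1" using ab by (simp add: field_simps)
    moreover have "0 \<le> 4 / (b - a)\<^sup>2 * ((x - a) * (b - x))" using \<open>0 < (x - a) * (b - x)\<close> by simp
    ultimately show "y x \<le> 1" unfolding y_def power_mult_distrib[symmetric] by (rule power_le_one[rotated])
  qed
  have q0L: "q0 \<in> L2 a b" by (rule L2_continuous[OF continuous_real_polynomial[OF q0(1)]])
  have ppL: "(\<lambda>x. ((x - a) * (b - x)) ^ k * p n x) \<in> L2 a b" for n
    by (intro L2_continuous continuous_intros continuous_real_polynomial pp)
  have "L2_lim a b (\<lambda>n x. ((x - a) * (b - x)) ^ k * p n x) q0"
  proof (rule L2_lim_dominated[where g="\<lambda>x. \<bar>q0 x\<bar>"])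
    show "(\<lambda>x. ((x - a) * (b - x)) ^ k * p n x) \<in> borel_measurable (lebesgue_on {a<..<b})" for n
      using ppL[of n] by (simp add: L2_iff)
    show "AE x in lebesgue_on {a<..<b}. (\<lambda>n. ((x - a) * (b - x)) ^ k * p n x) \<longlonglongrightarrow> q0 x"
      using lebesgue_on_ae_space[of "{a<..<b}"]
    proof eventually_elim
      case (elim x)
      have "(\<lambda>n. (1 - y x) ^ n) \<longlonglongrightarrow> 0" by (rule LIMSEQ_realpow_zero) (use y01[OF elim] in auto)
      then have "(\<lambda>n. q0 x * (1 - (1 - y x) ^ n)) \<longlonglongrightarrow> q0 x * (1 - 0)"
        by (rule tendsto_mult[OF tendsto_const tendsto_diff[OF tendsto_const]])
      then show ?case by (simp add: key)
    qed
    show "AE x in lebesgue_on {a<..<b}. \<bar>((x - a) * (b - x)) ^ k * p n x - q0 x\<bar> \<le> \<bar>q0 x\<bar>" for n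
      using lebesgue_on_ae_space[of "{a<..<b}"]
    proof eventually_elim
      case (elim x)
      have "0 \<le> (1 - y x) ^ n" "(1 - y x) ^ n \<le> 1" using y01[OF elim] by (auto intro: power_le_one)
      then have "\<bar>q0 x\<bar> * (1 - y x) ^ n \<le> \<bar>q0 x\<bar>" by (simp add: mult_left_le)
      moreover have "((x - a) * (b - x)) ^ k * p n x - q0 x = - (q0 x * (1 - y x) ^ n)"
        unfolding key by (simp add: algebra_simps)
      ultimately show ?case using \<open>0 \<le> (1 - y x) ^ n\<close> by (simp add: abs_mult)
    qed
    show "(\<lambda>x. \<bar>q0 x\<bar>) \<in> L2 a b" using q0L by (auto simp: L2_iff)
  qed (rule q0L)
  then have "(\<lambda>n. inner_L2 a b (\<lambda>x. ((x - a) * (b - x)) ^ k * p n x - q0 x) (\<lambda>x. ((x - a) * (b - x)) ^ k * p n x - q0 x)) \<longlonglongrightarrow> 0"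
    by (simp add: L2_lim_def)
  then have "eventually (\<lambda>n. inner_L2 a b (\<lambda>x. ((x - a) * (b - x)) ^ k * p n x - q0 x) (\<lambda>x. ((x - a) * (b - x)) ^ k * p n x - q0 x) < e / 4) sequentially"
    by (rule order_tendstoD(2)) (use e in simp)
  then obtain n where n: "inner_L2 a b (\<lambda>x. ((x - a) * (b - x)) ^ k * p n x - q0 x) (\<lambda>x. ((x - a) * (b - x)) ^ k * p n x - q0 x) < e / 4"
    using eventually_happens'[OF sequentially_bot] by blast
  have "inner_L2 a b (\<lambda>x. f x - ((x - a) * (b - x)) ^ k * p n x) (\<lambda>x. f x - ((x - a) * (b - x)) ^ k * p n x) < 2 * (e / 4) + 2 * (e / 4)"
    using L2_approx_trans[OF f q0L ppL[of n]] q0(2) n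
      inner_L2_diff_commute[of a b q0 "\<lambda>x. ((x - a) * (b - x)) ^ k * p n x"] by linarith
  then show ?thesis using pp[of n] by (intro exI[of _ "p n"]) simp
qed

section \<open>Absolutely continuous functions with square integrable derivative\<close>

text \<open>
  \<open>w\<close> is absolutely continuous on \<open>[a, b]\<close> with derivative \<open>g\<close> in \<open>L\<^sup>2\<close>. Carrying the derivative as
  an argument avoids the choice of representatives that \<open>wderiv\<close> makes.
\<close>

definition ac :: "real \<Rightarrow> real \<Rightarrow> (real \<Rightarrow> real) \<Rightarrow> (real \<Rightarrow> real) \<Rightarrow> bool" where
  "ac a b w g \<longleftrightarrow> g \<in> L2 a b \<and> (\<forall>x\<in>{a..b}. w x = w a + integral\<^sup>L (lebesgue_on {a<..<x}) g)"

lemma ac_L2: "ac a b w g \<Longrightarrow> g \<in> L2 a b" unfolding ac_def by (rule conjunct1)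

lemma ac_formula: "ac a b w g \<Longrightarrow> x \<in> {a..b} \<Longrightarrow> w x = w a + integral\<^sup>L (lebesgue_on {a<..<x}) g"
  unfolding ac_def by (elim conjE) (rule bspec)

lemma ac_continuous: assumes "ac a b w g" shows "continuous_on {a..b} w"
proof -
  have "continuous_on {a..b} (\<lambda>x. w a + integral\<^sup>L (lebesgue_on {a<..<x}) g)"
    by (intro continuous_intros continuous_indefinite_integral_Ioo L2_integrable ac_L2[OF assms])
  then show ?thesis by (rule continuous_on_eq) (rule ac_formula[OF assms, symmetric])
qed

lemma ac_fun_L2: "ac a b w g \<Longrightarrow> w \<in> L2 a b"
  by (intro L2_continuous ac_continuous)

lemma ac_diff_integral:
  assumes w: "ac a b w g" and "a \<le> c" "c \<le> d" "d \<le> b"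
  shows "w d - w c = integral\<^sup>L (lebesgue_on {c<..<d}) g"
proof -
  have "integral\<^sup>L (lebesgue_on {a<..<d}) g = integral\<^sup>L (lebesgue_on {a<..<c}) g + integral\<^sup>L (lebesgue_on {c<..<d}) g"
    by (rule integral_Ioo_split[OF integrable_Ioo_subinterval[OF L2_integrable[OF ac_L2[OF w]]]]) (use assms in auto)
  moreover have "w d = w a + integral\<^sup>L (lebesgue_on {a<..<d}) g" "w c = w a + integral\<^sup>L (lebesgue_on {a<..<c}) g"
    using assms by (intro ac_formula[OF w]; simp)+
  ultimately show ?thesis by simp
qed

lemma ac_subinterval:
  assumes w: "ac a b w g" and "a \<le> c" "d \<le> b"
  shows "ac c d w g"
  unfolding ac_def
proof (intro conjI ballI)
  show "g \<in> L2 c d" using L2_subinterval[OF ac_L2[OF w]] assms by simp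
  fix x assume "x \<in> {c..d}"
  then show "w x = w c + integral\<^sup>L (lebesgue_on {c<..<x}) g"
    using ac_diff_integral[OF w, of c x] assms by auto
qed

lemma ac_C1:
  assumes d: "\<And>x. x \<in> {a..b} \<Longrightarrow> (w has_real_derivative g x) (at x within {a..b})" and g: "continuous_on {a..b} g"
  shows "ac a b w g"
  unfolding ac_def
proof (intro conjI ballI)
  show "g \<in> L2 a b" by (rule L2_continuous[OF g])
  fix x assume x: "x \<in> {a..b}"
  have "(g has_integral (w x - w a)) {a..x}"
  proof (rule fundamental_theorem_of_calculus)
    fix y assume y: "y \<in> {a..x}"
    then have "(w has_real_derivative g y) (at y within {a..x})"
      using has_field_derivative_subset[OF d[of y]] x by auto
    then show "(w has_vector_derivative g y) (at y within {a..x})"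
      by (simp add: has_real_derivative_iff_has_vector_derivative)
  qed (use x in auto)
  moreover have "continuous_on {a..x} g" by (rule continuous_on_subset[OF g]) (use x in auto)
  ultimately show "w x = w a + integral\<^sup>L (lebesgue_on {a<..<x}) g"
    using continuous_integrable_Ioo(2)[of a x g] by (simp add: integral_unique)
qed

lemma ac_add:
  assumes 1: "ac a b w1 g1" and 2: "ac a b w2 g2"
  shows "ac a b (\<lambda>x. w1 x + w2 x) (\<lambda>x. g1 x + g2 x)"
  unfolding ac_def
proof (intro conjI ballI)
  show "(\<lambda>x. g1 x + g2 x) \<in> L2 a b" by (intro L2_add ac_L2[OF 1] ac_L2[OF 2])
  fix x assume x: "x \<in> {a..b}"
  have "integrable (lebesgue_on {a<..<x}) g1" "integrable (lebesgue_on {a<..<x}) g2"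
    using x integrable_Ioo_subinterval[OF L2_integrable[OF ac_L2[OF 1]], of a x]
      integrable_Ioo_subinterval[OF L2_integrable[OF ac_L2[OF 2]], of a x] by auto
  then have "integral\<^sup>L (lebesgue_on {a<..<x}) (\<lambda>x. g1 x + g2 x) = integral\<^sup>L (lebesgue_on {a<..<x}) g1 + integral\<^sup>L (lebesgue_on {a<..<x}) g2"
    by (rule Bochner_Integration.integral_add)
  then show "w1 x + w2 x = w1 a + w2 a + integral\<^sup>L (lebesgue_on {a<..<x}) (\<lambda>x. g1 x + g2 x)"
    using ac_formula[OF 1 x] ac_formula[OF 2 x] by linarith
qed

lemma ac_cmult:
  assumes 1: "ac a b w g"
  shows "ac a b (\<lambda>x. c * w x) (\<lambda>x. c * g x)"
  unfolding ac_def
proof (intro conjI ballI)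
  show "(\<lambda>x. c * g x) \<in> L2 a b" by (intro L2_cmult ac_L2[OF 1])
  fix x assume x: "x \<in> {a..b}"
  have "c * w x = c * (w a + integral\<^sup>L (lebesgue_on {a<..<x}) g)"
    by (rule arg_cong[OF ac_formula[OF 1 x]])
  then show "c * w x = c * w a + integral\<^sup>L (lebesgue_on {a<..<x}) (\<lambda>x. c * g x)"
    by (simp add: distrib_left)
qed

lemma ac_minus: "ac a b w1 g1 \<Longrightarrow> ac a b w2 g2 \<Longrightarrow> ac a b (\<lambda>x. w1 x - w2 x) (\<lambda>x. g1 x - g2 x)"
  using ac_add[of a b w1 g1 "\<lambda>x. - 1 * w2 x" "\<lambda>x. - 1 * g2 x"] ac_cmult[of a b w2 g2 "-1"] by simp

text \<open>
  The Cauchy-Schwarz inequality for the integral of \<open>g\<close> between \<open>x\<close> and \<open>y\<close>.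
\<close>

lemma ac_oscillation:
  assumes w: "ac a b w g" and xy: "x \<in> {a..b}" "y \<in> {a..b}"
  shows "(w x - w y)\<^sup>2 \<le> (b - a) * inner_L2 a b g g"
proof -
  have *: "(w d - w c)\<^sup>2 \<le> (b - a) * inner_L2 a b g g" if cd: "a \<le> c" "c \<le> d" "d \<le> b" for c d
  proof -
    have g: "g \<in> L2 c d" using L2_subinterval[OF ac_L2[OF w]] cd by simp
    have one: "(\<lambda>_. 1) \<in> L2 c d" by (rule L2_continuous) simp
    have "inner_L2 c d (\<lambda>_. 1) (\<lambda>_. 1) = d - c"
      using continuous_integrable_Ioo(2)[of c d "\<lambda>_. 1"] cd by (simp add: inner_L2_def)
    moreover have "w d - w c = inner_L2 c d (\<lambda>_. 1) g" using ac_diff_integral[OF w cd] by (simp add: inner_L2_def)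
    ultimately have "(w d - w c)\<^sup>2 \<le> (d - c) * inner_L2 c d g g"
      using inner_L2_Cauchy_Schwarz[OF one g] by simp
    also have "\<dots> \<le> (b - a) * inner_L2 a b g g"
      using inner_L2_mono_interval[OF ac_L2[OF w], of c d] cd inner_L2_nonneg[of c d g] by (intro mult_mono) auto
    finally show ?thesis .
  qed
  show ?thesis
  proof (cases "x \<le> y")
    case True then show ?thesis using *[of x y] xy by (simp add: power2_commute)
  next
    case False then show ?thesis using *[of y x] xy by simp
  qed
qed

definition C1_approx :: "real \<Rightarrow> real \<Rightarrow> (real \<Rightarrow> real) \<Rightarrow> (real \<Rightarrow> real) \<Rightarrow> (nat \<Rightarrow> real \<Rightarrow> real) \<Rightarrow> (nat \<Rightarrow> real \<Rightarrow> real) \<Rightarrow> bool" where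
  "C1_approx a b w g W G \<longleftrightarrow> (\<forall>n. continuous_on {a..b} (G n)) \<and>
     (\<forall>n. \<forall>x\<in>{a..b}. (W n has_real_derivative G n x) (at x within {a..b})) \<and>
     L2_lim a b G g \<and> L2_lim a b W w \<and> (\<forall>x\<in>{a..b}. (\<lambda>n. W n x) \<longlonglongrightarrow> w x)"

lemma C1_approxD:
  assumes "C1_approx a b w g W G"
  shows "continuous_on {a..b} (G n)" "x \<in> {a..b} \<Longrightarrow> (W n has_real_derivative G n x) (at x within {a..b})"
    "L2_lim a b G g" "L2_lim a b W w" "x \<in> {a..b} \<Longrightarrow> (\<lambda>n. W n x) \<longlonglongrightarrow> w x"
  using assms unfolding C1_approx_def by simp_all

text \<open>
  The derivative is approximated by polynomials, which are then integrated from \<open>a\<close>; by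
  \<open>ac_oscillation\<close> the primitives converge uniformly.
\<close>

lemma ac_approx:
  assumes ab: "a < b" and w: "ac a b w g"
  shows "\<exists>W G. C1_approx a b w g W G"
proof -
  obtain G where G: "\<And>n. real_polynomial_function (G n)" "L2_lim a b G g"
    using polynomials_dense_L2_lim[OF ab ac_L2[OF w]] by blast
  have Gc: "continuous_on {a..b} (G n)" for n by (rule continuous_real_polynomial[OF G(1)])
  define W where "W n x = w a + integral {a..x} (G n)" for n x
  have Wd: "(W n has_real_derivative G n x) (at x within {a..b})" if "x \<in> {a..b}" for n x
    unfolding W_def using integral_has_real_derivative[OF Gc that] by (auto intro!: derivative_eq_intros)
  have Wac: "ac a b (W n) (G n)" for n by (rule ac_C1[OF Wd Gc])
  have dac: "ac a b (\<lambda>x. W n x - w x) (\<lambda>x. G n x - g x)" for n by (rule ac_minus[OF Wac w])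
  let ?e = "\<lambda>n. (b - a) * inner_L2 a b (\<lambda>x. G n x - g x) (\<lambda>x. G n x - g x)"
  have e: "?e \<longlonglongrightarrow> 0"
    using tendsto_mult[OF tendsto_const[of "b - a"], of "\<lambda>n. inner_L2 a b (\<lambda>x. G n x - g x) (\<lambda>x. G n x - g x)" 0] G(2)
    by (simp add: L2_lim_def)
  have sup: "(W n x - w x)\<^sup>2 \<le> ?e n" if "x \<in> {a..b}" for n x
    using ac_oscillation[OF dac that, of a n] ab by (simp add: W_def)
  have pt: "(\<lambda>n. W n x) \<longlonglongrightarrow> w x" if x: "x \<in> {a..b}" for x
  proof -
    have "(\<lambda>n. (W n x - w x)\<^sup>2) \<longlonglongrightarrow> 0"
      by (rule Lim_null_comparison[OF always_eventually e]) (use sup[OF x] in auto)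
    then have "(\<lambda>n. sqrt ((W n x - w x)\<^sup>2)) \<longlonglongrightarrow> sqrt 0" by (rule tendsto_real_sqrt)
    then have "(\<lambda>n. \<bar>W n x - w x\<bar>) \<longlonglongrightarrow> 0" by simp
    then have "(\<lambda>n. W n x - w x) \<longlonglongrightarrow> 0" by (simp add: tendsto_rabs_zero_iff)
    then show ?thesis using Lim_null by blast
  qed
  have WL: "W n \<in> L2 a b" for n by (rule ac_fun_L2[OF Wac])
  have wL: "w \<in> L2 a b" by (rule ac_fun_L2[OF w])
  have b1: "inner_L2 a b (\<lambda>x. W n x - w x) (\<lambda>x. W n x - w x) \<le> ?e n * (b - a)" for n
  proof -
    have "inner_L2 a b (\<lambda>x. W n x - w x) (\<lambda>x. W n x - w x) \<le> integral\<^sup>L (lebesgue_on {a<..<b}) (\<lambda>x. ?e n)"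
      unfolding inner_L2_def
    proof (rule integral_mono_AE)
      show "integrable (lebesgue_on {a<..<b}) (\<lambda>x. (W n x - w x) * (W n x - w x))"
        by (intro L2_mult_integrable L2_diff WL wL)
      show "integrable (lebesgue_on {a<..<b}) (\<lambda>x. (b - a) * integral\<^sup>L (lebesgue_on {a<..<b}) (\<lambda>x. (G n x - g x) * (G n x - g x)))"
        by (rule continuous_integrable_Ioo) simp
      show "AE x in lebesgue_on {a<..<b}. (W n x - w x) * (W n x - w x) \<le> (b - a) * integral\<^sup>L (lebesgue_on {a<..<b}) (\<lambda>x. (G n x - g x) * (G n x - g x))"
        using lebesgue_on_ae_space[of "{a<..<b}"]
      proof eventually_elim
        case (elim x)
        then show ?case using sup[of x n] by (simp add: power2_eq_square inner_L2_def)
      qed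
    qed
    also have "\<dots> = ?e n * (b - a)" using continuous_integrable_Ioo(2)[of a b "\<lambda>_. ?e n"] ab by simp
    finally show ?thesis .
  qed
  have b2: "(\<lambda>n. ?e n * (b - a)) \<longlonglongrightarrow> 0" using tendsto_mult[OF e tendsto_const[of "b - a"]] by simp
  have "(\<lambda>n. inner_L2 a b (\<lambda>x. W n x - w x) (\<lambda>x. W n x - w x)) \<longlonglongrightarrow> 0"
  proof (rule Lim_null_comparison[OF always_eventually b2], rule allI)
    fix n show "norm (inner_L2 a b (\<lambda>x. W n x - w x) (\<lambda>x. W n x - w x)) \<le> ?e n * (b - a)"
      using b1[of n] inner_L2_nonneg[of a b "\<lambda>x. W n x - w x"] by simp
  qed
  then have "L2_lim a b W w" using WL wL by (simp add: L2_lim_def)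
  then have "C1_approx a b w g W G"
    unfolding C1_approx_def using Gc Wd G(2) pt by simp
  then show ?thesis by blast
qed

text \<open>
  The formula holds for \<open>C\<^sup>1\<close> functions by the fundamental theorem of calculus, and all its terms
  are continuous under the convergence of \<open>ac_approx\<close>.
\<close>

lemma ac_integration_by_parts:
  assumes ab: "a < b" and 1: "ac a b w1 g1" and 2: "ac a b w2 g2"
  shows "inner_L2 a b w1 g2 + inner_L2 a b g1 w2 = w1 b * w2 b - w1 a * w2 a"
proof -
  obtain W1 G1 where "C1_approx a b w1 g1 W1 G1" using ac_approx[OF ab 1] by blast
  note A = C1_approxD[OF this]
  obtain W2 G2 where "C1_approx a b w2 g2 W2 G2" using ac_approx[OF ab 2] by blast
  note B = C1_approxD[OF this]
  have eq: "inner_L2 a b (W1 n) (G2 n) + inner_L2 a b (G1 n) (W2 n) = W1 n b * W2 n b - W1 n a * W2 n a" for n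
  proof -
    have cW: "continuous_on {a..b} (W1 n)" "continuous_on {a..b} (W2 n)"
      using DERIV_continuous_on[of "{a..b}", OF A(2)] DERIV_continuous_on[of "{a..b}", OF B(2)] by simp_all
    have "ac a b (\<lambda>x. W1 n x * W2 n x) (\<lambda>x. W1 n x * G2 n x + G1 n x * W2 n x)"
      by (rule ac_C1) (use A(1,2) B(1,2) cW in \<open>auto intro!: derivative_eq_intros continuous_intros\<close>)
    from ac_diff_integral[OF this, of a b] have "W1 n b * W2 n b - W1 n a * W2 n a =
        integral\<^sup>L (lebesgue_on {a<..<b}) (\<lambda>x. W1 n x * G2 n x + G1 n x * W2 n x)" using ab by simp
    also have "\<dots> = inner_L2 a b (W1 n) (G2 n) + inner_L2 a b (G1 n) (W2 n)"
      unfolding inner_L2_def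
      by (rule Bochner_Integration.integral_add) (intro L2_mult_integrable L2_limD(1)[OF A(3)] L2_limD(1)[OF A(4)] L2_limD(1)[OF B(3)] L2_limD(1)[OF B(4)])+
    finally show ?thesis by simp
  qed
  have "(\<lambda>n. inner_L2 a b (W1 n) (G2 n) + inner_L2 a b (G1 n) (W2 n)) \<longlonglongrightarrow> inner_L2 a b w1 g2 + inner_L2 a b g1 w2"
    by (intro tendsto_intros L2_lim_inner A B)
  moreover have "(\<lambda>n. W1 n b * W2 n b - W1 n a * W2 n a) \<longlonglongrightarrow> w1 b * w2 b - w1 a * w2 a"
    using ab by (intro tendsto_intros A(5) B(5)) auto
  ultimately show ?thesis unfolding eq by (rule LIMSEQ_unique)
qed

lemma ac_mult:
  assumes 1: "ac a b w1 g1" and 2: "ac a b w2 g2"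
  shows "ac a b (\<lambda>x. w1 x * w2 x) (\<lambda>x. w1 x * g2 x + g1 x * w2 x)"
  unfolding ac_def
proof (intro conjI ballI)
  have "(\<lambda>x. w1 x * g2 x) \<in> L2 a b" by (rule L2_continuous_mult[OF ac_L2[OF 2] ac_continuous[OF 1]])
  moreover have "(\<lambda>x. g1 x * w2 x) \<in> L2 a b"
    using L2_continuous_mult[OF ac_L2[OF 1] ac_continuous[OF 2]] by (simp add: mult.commute)
  ultimately show "(\<lambda>x. w1 x * g2 x + g1 x * w2 x) \<in> L2 a b" by (rule L2_add)
  fix x assume x: "x \<in> {a..b}"
  show "w1 x * w2 x = w1 a * w2 a + integral\<^sup>L (lebesgue_on {a<..<x}) (\<lambda>x. w1 x * g2 x + g1 x * w2 x)"
  proof (cases "a < x")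
    case True
    have r1: "ac a x w1 g1" and r2: "ac a x w2 g2" using ac_subinterval[OF 1] ac_subinterval[OF 2] x by auto
    have "integral\<^sup>L (lebesgue_on {a<..<x}) (\<lambda>x. w1 x * g2 x + g1 x * w2 x) = inner_L2 a x w1 g2 + inner_L2 a x g1 w2"
      unfolding inner_L2_def
      by (rule Bochner_Integration.integral_add) (intro L2_mult_integrable ac_L2[OF r1] ac_L2[OF r2] ac_fun_L2[OF r1] ac_fun_L2[OF r2])+
    then show ?thesis using ac_integration_by_parts[OF True r1 r2] by simp
  next
    case False
    then have "x = a" using x by simp
    then show ?thesis by simp
  qed
qed

text \<open>
  Integration by parts against polynomials determines \<open>g\<close> up to null sets, since polynomials are
  dense.
\<close>

lemma ac_unique:
  assumes ab: "a < b" and 1: "ac a b w g1" and 2: "ac a b w g2"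
  shows "AE x in lebesgue_on {a<..<b}. g1 x = g2 x"
proof -
  have d: "ac a b (\<lambda>x. w x - w x) (\<lambda>x. g1 x - g2 x)" by (rule ac_minus[OF 1 2])
  have "AE x in lebesgue_on {a<..<b}. g1 x - g2 x = 0"
  proof (rule L2_zero_if_orthogonal_polynomials[OF ab ac_L2[OF d]])
    fix q :: "real \<Rightarrow> real" assume q: "real_polynomial_function q"
    then obtain q' where q': "real_polynomial_function q'" "\<And>x. (q has_real_derivative q' x) (at x)"
      using has_real_derivative_polynomial_function by blast
    have "ac a b q q'"
      by (rule ac_C1) (auto intro: has_field_derivative_at_within q' continuous_real_polynomial)
    from ac_integration_by_parts[OF ab d this] show "inner_L2 a b (\<lambda>x. g1 x - g2 x) q = 0"
      by (simp add: inner_L2_def)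
  qed
  then show ?thesis by eventually_elim simp
qed

lemma continuous_AE_eq:
  fixes w1 w2 :: "real \<Rightarrow> real"
  assumes ab: "a < b" and c: "continuous_on {a..b} w1" "continuous_on {a..b} w2"
    and ae: "AE x in lebesgue_on {a<..<b}. w1 x = w2 x" and x: "x \<in> {a..b}"
  shows "w1 x = w2 x"
proof -
  let ?C = "{x \<in> {a..b}. w1 x - w2 x = 0}"
  have C: "closed ?C"
    by (rule continuous_closed_preimage_constant) (auto intro: continuous_intros c)
  have ae': "AE x \<in> {a<..<b} in lebesgue. x \<in> ?C"
    using ae by (auto simp: AE_lebesgue_on_iff elim!: eventually_mono)
  have "{a<..<b} \<subseteq> ?C"
    using mem_closed_if_AE_lebesgue_open[OF open_greaterThanLessThan C ae'] by blast
  then have "closure {a<..<b} \<subseteq> ?C" using C by (rule closure_minimal)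
  then have "x \<in> ?C" using x ab by auto
  then show ?thesis by simp
qed

text \<open>
  Continuous functions that agree almost everywhere agree, hence the definite description in
  \<open>trace_at\<close> is well defined.
\<close>

lemma trace_at_eq:
  assumes ab: "a < b" and w: "continuous_on {a..b} w" and ae: "AE x in lebesgue_on {a<..<b}. f x = w x" and p: "p \<in> {a..b}"
  shows "trace_at a b f p = w p"
  unfolding trace_at_def
proof (rule the_equality)
  show "\<exists>v. continuous_on {a..b} v \<and> (AE x in lebesgue_on {a<..<b}. f x = v x) \<and> v p = w p"
    using w ae by blast
  fix y assume "\<exists>v. continuous_on {a..b} v \<and> (AE x in lebesgue_on {a<..<b}. f x = v x) \<and> v p = y"
  then obtain v where v: "continuous_on {a..b} v" "AE x in lebesgue_on {a<..<b}. f x = v x" "v p = y" by blast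
  have "AE x in lebesgue_on {a<..<b}. v x = w x" using v(2) ae by eventually_elim simp
  from continuous_AE_eq[OF ab v(1) w this p] show "y = w p" using v(3) by simp
qed

definition test_fun :: "real \<Rightarrow> real \<Rightarrow> (real \<Rightarrow> real) \<Rightarrow> (real \<Rightarrow> real) \<Rightarrow> bool" where
  "test_fun a b \<phi> \<phi>' \<longleftrightarrow> (\<forall>x. (\<phi> has_real_derivative \<phi>' x) (at x)) \<and> continuous_on UNIV \<phi>' \<and>
            (\<exists>c d. a < c \<and> d < b \<and> (\<forall>x. x \<notin> {c..d} \<longrightarrow> \<phi> x = 0))"

lemma has_weak_deriv_iff: "has_weak_deriv a b f g \<longleftrightarrow> (\<forall>\<phi> \<phi>'. test_fun a b \<phi> \<phi>' \<longrightarrow> inner_L2 a b f \<phi>' = - inner_L2 a b g \<phi>)"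
  unfolding has_weak_deriv_def test_fun_def by blast

lemma test_fun_ac:
  assumes "test_fun a b \<phi> \<phi>'"
  shows "ac a b \<phi> \<phi>'" "\<phi> a = 0" "\<phi> b = 0"
proof -
  show "ac a b \<phi> \<phi>'"
    by (rule ac_C1) (use assms in \<open>auto simp: test_fun_def intro: has_field_derivative_at_within continuous_on_subset\<close>)
  show "\<phi> a = 0" "\<phi> b = 0" using assms unfolding test_fun_def by fastforce+
qed

lemma ac_weak_deriv:
  assumes ab: "a < b" and w: "ac a b w g" shows "has_weak_deriv a b w g"
  unfolding has_weak_deriv_iff
proof (intro allI impI)
  fix \<phi> \<phi>' assume t: "test_fun a b \<phi> \<phi>'"
  show "inner_L2 a b w \<phi>' = - inner_L2 a b g \<phi>"
    using ac_integration_by_parts[OF ab w test_fun_ac(1)[OF t]] test_fun_ac(2,3)[OF t] by simp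
qed

lemma has_weak_deriv_AE_cong:
  assumes "f \<in> L2 a b" "AE x in lebesgue_on {a<..<b}. f x = f' x"
  shows "has_weak_deriv a b f g \<longleftrightarrow> has_weak_deriv a b f' g"
proof -
  have "inner_L2 a b f \<phi>' = inner_L2 a b f' \<phi>'" if "test_fun a b \<phi> \<phi>'" for \<phi> \<phi>'
    by (rule inner_L2_AE_cong[OF assms(1) ac_L2[OF test_fun_ac(1)[OF that]] assms(2)]) simp
  then show ?thesis unfolding has_weak_deriv_iff by (metis (no_types, lifting))
qed

text \<open>
  Every function of this form with zero mean is the derivative of a test function, namely of its
  primitive.
\<close>

lemma bump_test_fun:
  assumes cd: "a < c" "c < d" "d < b" and q: "continuous_on UNIV q"
    and z: "integral\<^sup>L (lebesgue_on {c<..<d}) (\<lambda>x. (x - c) * (d - x) * q x) = 0"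
  shows "\<exists>\<phi> \<phi>'. test_fun a b \<phi> \<phi>' \<and> (\<forall>x. \<phi>' x = indicator {c<..<d} x * ((x - c) * (d - x) * q x))"
proof -
  \<comment> \<open>Clamping the argument to \<open>[c, d]\<close> makes the function vanish outside without a case
      distinction, because the factor \<open>(x - c) * (d - x)\<close> is zero at both ends; continuity is then
      automatic.\<close>
  define k where "k x = max c (min d x)" for x
  define \<psi> where "\<psi> x = (k x - c) * (d - k x) * q (k x)" for x
  have k: "k x = x" if "x \<in> {c..d}" for x using that by (auto simp: k_def)
  have kc: "continuous_on UNIV k" unfolding k_def by (intro continuous_intros)
  have \<psi>c: "continuous_on UNIV \<psi>" unfolding \<psi>_def
    by (intro continuous_intros kc continuous_on_compose2[OF q]) auto
  have \<psi>: "\<psi> x = indicator {c<..<d} x * ((x - c) * (d - x) * q x)" for x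
  proof (cases "x \<in> {c<..<d}")
    case True then show ?thesis using k[of x] by (simp add: \<psi>_def)
  next
    case False
    then have "k x = c \<or> k x = d" using cd by (auto simp: k_def)
    then show ?thesis using False by (auto simp: \<psi>_def)
  qed
  obtain F where F: "\<And>x. (F has_vector_derivative \<psi> x) (at x)"
    using einterval_antiderivative[of "-\<infinity>" "\<infinity>" \<psi>] \<psi>c by (auto simp: continuous_on_eq_continuous_at)
  define \<phi> where "\<phi> x = F x - F c" for x
  have d\<phi>: "(\<phi> has_real_derivative \<psi> x) (at x)" for x
    unfolding \<phi>_def using F[of x] by (auto intro!: derivative_eq_intros simp: has_real_derivative_iff_has_vector_derivative)
  have FTC: "\<phi> y - \<phi> x = integral\<^sup>L (lebesgue_on {x<..<y}) \<psi>" if "x \<le> y" for x y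
  proof (rule ac_diff_integral[where a=x and b=y])
    show "ac x y \<phi> \<psi>" by (rule ac_C1) (auto intro: has_field_derivative_at_within d\<phi> continuous_on_subset[OF \<psi>c])
  qed (use that in auto)
  have dc: "\<phi> d = 0"
  proof -
    have "integral\<^sup>L (lebesgue_on {c<..<d}) \<psi> = integral\<^sup>L (lebesgue_on {c<..<d}) (\<lambda>x. (x - c) * (d - x) * q x)"
      by (rule Bochner_Integration.integral_cong) (auto simp: \<psi>)
    then show ?thesis using FTC[of c d] z cd by (simp add: \<phi>_def)
  qed
  have zero: "integral\<^sup>L (lebesgue_on {x<..<y}) \<psi> = 0" if "y \<le> c \<or> d \<le> x" for x y
  proof -
    have "integral\<^sup>L (lebesgue_on {x<..<y}) \<psi> = integral\<^sup>L (lebesgue_on {x<..<y}) (\<lambda>_. 0)"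
      by (rule Bochner_Integration.integral_cong) (use that in \<open>auto simp: \<psi>\<close>)
    then show ?thesis by simp
  qed
  have "\<phi> x = 0" if "x \<notin> {c..d}" for x
  proof (cases "x < c")
    case True
    then show ?thesis using FTC[of x c] zero[of c x] by (simp add: \<phi>_def)
  next
    case False
    then show ?thesis using FTC[of d x] zero[of x d] that dc by simp
  qed
  then have "test_fun a b \<phi> \<psi>" using cd d\<phi> \<psi>c unfolding test_fun_def by blast
  then show ?thesis using \<psi> by blast
qed

text \<open>
  Subtract from \<open>e\<close> its mean \<open>m\<close> with respect to the weight \<open>(x - c) (d - x)\<close>. For every
  continuous \<open>q\<close> one can subtract a constant from \<open>q\<close> so that the weighted \<open>q\<close> has mean zero and
  hence is admissible in \<open>bump_test_fun\<close>; it follows that \<open>e - m\<close> is orthogonal to all weighted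
  polynomials. These are dense, so \<open>e = m\<close>.
\<close>

lemma du_Bois_Reymond_interior:
  assumes cd: "a < c" "c < d" "d < b" and e: "e \<in> L2 a b"
    and orth: "\<And>\<phi> \<phi>'. test_fun a b \<phi> \<phi>' \<Longrightarrow> inner_L2 a b e \<phi>' = 0"
  shows "\<exists>m. AE x in lebesgue_on {c<..<d}. e x = m"
proof -
  have eL: "e \<in> L2 c d" using L2_subinterval[OF e, of c d] cd by simp
  define wt where "wt x = (x - c) * (d - x)" for x
  have wc: "continuous_on S wt" for S unfolding wt_def by (intro continuous_intros)
  have qL: "(\<lambda>x. wt x * q x) \<in> L2 c d" if "continuous_on UNIV q" for q
    by (intro L2_continuous continuous_intros wc continuous_on_subset[OF that]) auto
  have one: "(\<lambda>_. 1) \<in> L2 c d" by (rule L2_continuous) simp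
  have z: "inner_L2 c d e (\<lambda>x. wt x * q x) = 0" if q: "continuous_on UNIV q" and "inner_L2 c d (\<lambda>_. 1) (\<lambda>x. wt x * q x) = 0" for q
  proof -
    have "integral\<^sup>L (lebesgue_on {c<..<d}) (\<lambda>x. (x - c) * (d - x) * q x) = 0"
      using that by (simp add: inner_L2_def wt_def)
    from bump_test_fun[OF cd q this] obtain \<phi> \<phi>' where t: "test_fun a b \<phi> \<phi>'"
      "\<And>x. \<phi>' x = indicator {c<..<d} x * ((x - c) * (d - x) * q x)" by blast
    have "0 = inner_L2 a b e \<phi>'" using orth[OF t(1)] by simp
    also have "\<dots> = integral\<^sup>L lebesgue (\<lambda>x. indicator {a<..<b} x * (e x * \<phi>' x))"
      by (simp add: inner_L2_def integral_lebesgue_on_eq)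
    also have "\<dots> = integral\<^sup>L lebesgue (\<lambda>x. indicator {c<..<d} x * (e x * (wt x * q x)))"
      by (rule Bochner_Integration.integral_cong) (use cd in \<open>auto simp: t(2) wt_def indicator_def\<close>)
    also have "\<dots> = inner_L2 c d e (\<lambda>x. wt x * q x)" by (simp add: inner_L2_def integral_lebesgue_on_eq)
    finally show ?thesis by simp
  qed
  define J where "J = inner_L2 c d (\<lambda>_. 1) (\<lambda>x. wt x * 1)"
  have J: "J \<noteq> 0"
  proof
    assume "J = 0"
    then have "integral\<^sup>L (lebesgue_on {c<..<d}) wt = 0" by (simp add: J_def inner_L2_def)
    moreover have "AE x in lebesgue_on {c<..<d}. 0 \<le> wt x"
      using lebesgue_on_ae_space[of "{c<..<d}"] by eventually_elim (simp add: wt_def)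
    ultimately have "AE x in lebesgue_on {c<..<d}. wt x = 0"
      using integral_nonneg_eq_0_iff_AE[OF continuous_integrable_Ioo(1)[OF wc[of "{c..d}"]]] by blast
    then have "wt x = (\<lambda>_. 0) x" if "x \<in> {c..d}" for x
      using continuous_AE_eq[OF cd(2) wc continuous_on_const _ that, of 0] by simp
    from this[of "(c + d) / 2"] have "wt ((c + d) / 2) = 0" using cd by simp
    moreover have "wt ((c + d) / 2) = ((d - c) / 2)\<^sup>2" by (simp add: wt_def power2_eq_square field_simps)
    ultimately show False using cd by simp
  qed
  define m where "m = inner_L2 c d e (\<lambda>x. wt x * 1) / J"
  have orth2: "inner_L2 c d (\<lambda>x. e x - m) (\<lambda>x. wt x * q x) = 0" if q: "continuous_on UNIV q" for q
  proof -
    define s where "s = inner_L2 c d (\<lambda>_. 1) (\<lambda>x. wt x * q x) / J"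
    have qs: "continuous_on UNIV (\<lambda>x. q x - s * 1)" by (intro continuous_intros q)
    have split: "inner_L2 c d f (\<lambda>x. wt x * (q x - s * 1)) = inner_L2 c d f (\<lambda>x. wt x * q x) - s * inner_L2 c d f (\<lambda>x. wt x * 1)"
      if "f \<in> L2 c d" for f
    proof -
      have "(\<lambda>x. wt x * (q x - s * 1)) = (\<lambda>x. wt x * q x - s * (wt x * 1))" by (auto simp: algebra_simps)
      then show ?thesis using that qL[OF q] qL[of "\<lambda>_. 1"]
        by (simp only: inner_L2_diff_right inner_L2_cmult_right L2_cmult continuous_on_const simp_thms)
    qed
    have "inner_L2 c d (\<lambda>_. 1) (\<lambda>x. wt x * (q x - s * 1)) = 0"
      using J by (simp only: split[OF one] J_def[symmetric]) (simp add: s_def)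
    from z[OF qs this] have "inner_L2 c d e (\<lambda>x. wt x * q x) = s * inner_L2 c d e (\<lambda>x. wt x * 1)"
      by (simp only: split[OF eL])
    also have "\<dots> = m * inner_L2 c d (\<lambda>_. 1) (\<lambda>x. wt x * q x)" using J by (simp add: m_def s_def)
    also have "\<dots> = inner_L2 c d (\<lambda>_. m) (\<lambda>x. wt x * q x)"
      using inner_L2_cmult_left[of c d m "\<lambda>_. 1"] by simp
    finally show ?thesis
      using inner_L2_diff_left[OF eL _ qL[OF q], of "\<lambda>_. m"] L2_continuous[of c d "\<lambda>_. m"] by simp
  qed
  have em: "(\<lambda>x. e x - m) \<in> L2 c d" by (rule L2_diff[OF eL L2_continuous]) simp
  have "\<forall>n. \<exists>q. real_polynomial_function q \<and> inner_L2 c d (\<lambda>x. (e x - m) - ((x - c) * (d - x)) ^ 1 * q x) (\<lambda>x. (e x - m) - ((x - c) * (d - x)) ^ 1 * q x) < 1 / real (Suc n)"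
    by (intro allI vanishing_polynomials_dense_L2[OF cd(2) em]) simp
  from choice[OF this] obtain Q where Q': "\<forall>n. real_polynomial_function (Q n) \<and> inner_L2 c d (\<lambda>x. (e x - m) - ((x - c) * (d - x)) ^ 1 * Q n x) (\<lambda>x. (e x - m) - ((x - c) * (d - x)) ^ 1 * Q n x) < 1 / real (Suc n)" ..
  have Qc: "continuous_on UNIV (Q n)" for n using Q' continuous_real_polynomial by blast
  have bd: "inner_L2 c d (\<lambda>x. wt x * Q n x - (e x - m)) (\<lambda>x. wt x * Q n x - (e x - m)) < 1 / real (Suc n)" for n
  proof -
    have "inner_L2 c d (\<lambda>x. (e x - m) - wt x * Q n x) (\<lambda>x. (e x - m) - wt x * Q n x) < 1 / real (Suc n)"
      using Q'[THEN spec, of n, THEN conjunct2] by (simp add: wt_def)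
    then show ?thesis by (simp only: inner_L2_diff_commute[of c d "\<lambda>x. e x - m"])
  qed
  have "(\<lambda>n. inner_L2 c d (\<lambda>x. wt x * Q n x - (e x - m)) (\<lambda>x. wt x * Q n x - (e x - m))) \<longlonglongrightarrow> 0"
  proof (rule Lim_null_comparison[OF always_eventually LIMSEQ_Suc[OF lim_1_over_n]], rule allI)
    fix n show "norm (inner_L2 c d (\<lambda>x. wt x * Q n x - (e x - m)) (\<lambda>x. wt x * Q n x - (e x - m))) \<le> 1 / real (Suc n)"
      using bd[of n] inner_L2_nonneg[of c d "\<lambda>x. wt x * Q n x - (e x - m)"] by simp
  qed
  then have lim: "L2_lim c d (\<lambda>n x. wt x * Q n x) (\<lambda>x. e x - m)"
    using em qL[OF Qc] by (simp add: L2_lim_def)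
  have "(\<lambda>n. inner_L2 c d (\<lambda>x. e x - m) (\<lambda>x. wt x * Q n x)) \<longlonglongrightarrow> inner_L2 c d (\<lambda>x. e x - m) (\<lambda>x. e x - m)"
    by (rule L2_lim_inner[OF L2_lim_const[OF em] lim])
  then have "inner_L2 c d (\<lambda>x. e x - m) (\<lambda>x. e x - m) = 0"
    using orth2[OF Qc] by (simp add: LIMSEQ_const_iff)
  then have "AE x in lebesgue_on {c<..<d}. e x - m = 0" using inner_L2_zero_iff[OF em] by simp
  then show ?thesis by (intro exI[of _ m]) (auto elim: eventually_mono)
qed

section \<open>Weak derivatives and traces\<close>

text \<open>
  Exhaust \<open>(a, b)\<close> by inner intervals; the constants agree because the intervals overlap.
\<close>

lemma du_Bois_Reymond:
  assumes ab: "a < b" and e: "e \<in> L2 a b"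
    and orth: "\<And>\<phi> \<phi>'. test_fun a b \<phi> \<phi>' \<Longrightarrow> inner_L2 a b e \<phi>' = 0"
  shows "\<exists>m. AE x in lebesgue_on {a<..<b}. e x = m"
proof -
  \<comment> \<open>The denominator \<open>n + 3\<close> keeps the intervals \<open>(a + r n, b - r n)\<close> nonempty and all of them
      contain the one for \<open>n = 0\<close>.\<close>
  define r where "r n = (b - a) / real (n + 3)" for n
  have r: "0 < r n" "r n \<le> (b - a) / 3" for n
  proof -
    show "0 < r n" using ab by (simp add: r_def)
    show "r n \<le> (b - a) / 3" unfolding r_def by (rule divide_left_mono) (use ab in auto)
  qed
  have cd: "a < a + r n" "a + r n < b - r n" "b - r n < b" for n
    using r[of n] ab by (auto simp: field_simps)
  have "\<forall>n. \<exists>m. AE x in lebesgue_on {a + r n<..<b - r n}. e x = m"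
    by (intro allI du_Bois_Reymond_interior[OF cd e] orth)
  from choice[OF this] obtain m where m: "\<forall>n. AE x in lebesgue_on {a + r n<..<b - r n}. e x = m n" ..
  have rmono: "r n \<le> r 0" for n using r(2)[of n] by (simp add: r_def)
  have m0: "m n = m 0" for n
  proof -
    have "AE x in lebesgue_on {a + r 0<..<b - r 0}. e x = m n"
      using AE_Ioo_subinterval[OF m[THEN spec, of n], of "a + r 0" "b - r 0"] rmono[of n] by simp
    then have "AE x in lebesgue_on {a + r 0<..<b - r 0}. m n = m 0"
      using m[THEN spec, of 0] by eventually_elim simp
    from continuous_AE_eq[OF cd(2) continuous_on_const continuous_on_const this, of "a + r 0"]
    show ?thesis using cd(2)[of 0] by simp
  qed
  have "\<forall>n. AE x in lebesgue. x \<in> {a + r n<..<b - r n} \<longrightarrow> e x = m 0"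
  proof
    fix n show "AE x in lebesgue. x \<in> {a + r n<..<b - r n} \<longrightarrow> e x = m 0"
      using m[THEN spec, of n] unfolding m0[of n] by (simp add: AE_lebesgue_on_iff)
  qed
  then have "AE x in lebesgue. \<forall>n. x \<in> {a + r n<..<b - r n} \<longrightarrow> e x = m 0"
    unfolding AE_all_countable .
  then have "AE x in lebesgue. x \<in> {a<..<b} \<longrightarrow> e x = m 0"
  proof eventually_elim
    case (elim x)
    show ?case
    proof
      assume x: "x \<in> {a<..<b}"
      define s where "s = min (x - a) (b - x)"
      have s: "0 < s" using x by (simp add: s_def)
      obtain n :: nat where "(b - a) / s < real n" using reals_Archimedean2 by blast
      then have "(b - a) / s < real (n + 3)" by linarith
      then have "r n < s" using s by (simp add: r_def field_simps)
      then have "x \<in> {a + r n<..<b - r n}" by (simp add: s_def)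
      then show "e x = m 0" using elim by blast
    qed
  qed
  then show ?thesis by (intro exI[of _ "m 0"]) (simp add: AE_lebesgue_on_iff)
qed

lemma ac_cong:
  assumes w: "ac a b w g" and "\<And>x. x \<in> {a..b} \<Longrightarrow> w x = w' x" and ae: "AE x in lebesgue_on {a<..<b}. g x = g' x"
  shows "ac a b w' g'"
  unfolding ac_def
proof (intro conjI ballI)
  show "g' \<in> L2 a b" by (rule L2_AE_cong[OF ac_L2[OF w] ae])
  fix x assume x: "x \<in> {a..b}"
  have gx: "integrable (lebesgue_on {a<..<x}) g"
    using integrable_Ioo_subinterval[OF L2_integrable[OF ac_L2[OF w]], of a x] x by simp
  have "AE x in lebesgue_on {a<..<x}. g x = g' x" using AE_Ioo_subinterval[OF ae, of a x] x by simp
  from integrable_lebesgue_on_AE_cong(2)[OF _ gx this]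
  have "integral\<^sup>L (lebesgue_on {a<..<x}) g' = integral\<^sup>L (lebesgue_on {a<..<x}) g" by simp
  moreover have "w' x = w x" "w' a = w a" using assms(2)[of x] assms(2)[of a] x by auto
  ultimately show "w' x = w' a + integral\<^sup>L (lebesgue_on {a<..<x}) g'" using ac_formula[OF w x] by linarith
qed

lemma wderiv_weak:
  assumes "f \<in> H1 a b"
  shows "wderiv a b f \<in> L2 a b" "has_weak_deriv a b f (wderiv a b f)"
proof -
  have "\<exists>g. g \<in> L2 a b \<and> has_weak_deriv a b f g" using assms by (auto simp: H1_def)
  from someI_ex[OF this] show "wderiv a b f \<in> L2 a b" "has_weak_deriv a b f (wderiv a b f)"
    unfolding wderiv_def by auto
qed

lemma H1_L2: "f \<in> H1 a b \<Longrightarrow> f \<in> L2 a b" by (simp add: H1_def)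

lemma primitive_ac:
  assumes "g \<in> L2 a b" shows "ac a b (\<lambda>x. integral\<^sup>L (lebesgue_on {a<..<x}) g) g"
  using assms by (simp add: ac_def)

text \<open>
  The difference of \<open>f\<close> and a primitive of \<open>g\<close> has weak derivative zero, so it is constant.
\<close>

lemma weak_deriv_ac_rep:
  assumes ab: "a < b" and f: "f \<in> L2 a b" and g: "g \<in> L2 a b" and fg: "has_weak_deriv a b f g"
  shows "\<exists>w. ac a b w g \<and> (AE x in lebesgue_on {a<..<b}. f x = w x)"
proof -
  define G where "G x = integral\<^sup>L (lebesgue_on {a<..<x}) g" for x
  have G: "ac a b G g" unfolding G_def by (rule primitive_ac[OF g])
  have eL: "(\<lambda>x. f x - G x) \<in> L2 a b" by (rule L2_diff[OF f ac_fun_L2[OF G]])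
  have "\<exists>m. AE x in lebesgue_on {a<..<b}. f x - G x = m"
  proof (rule du_Bois_Reymond[OF ab eL])
    fix \<phi> \<phi>' assume t: "test_fun a b \<phi> \<phi>'"
    have "inner_L2 a b f \<phi>' = inner_L2 a b G \<phi>'"
      using fg ac_weak_deriv[OF ab G] t unfolding has_weak_deriv_iff by metis
    then show "inner_L2 a b (\<lambda>x. f x - G x) \<phi>' = 0"
      using inner_L2_diff_left[OF f ac_fun_L2[OF G] ac_L2[OF test_fun_ac(1)[OF t]]] by simp
  qed
  then obtain m where m: "AE x in lebesgue_on {a<..<b}. f x - G x = m" by blast
  have "ac a b (\<lambda>x. m + G x) (\<lambda>x. 0 + g x)"
    by (rule ac_add[OF ac_C1 G]) (auto intro!: derivative_eq_intros)
  moreover have "AE x in lebesgue_on {a<..<b}. f x = m + G x" using m by eventually_elim simp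
  ultimately show ?thesis by auto
qed

lemma H1_ac:
  assumes ab: "a < b" and f: "f \<in> H1 a b"
  shows "ac a b (trace_at a b f) (wderiv a b f)" "AE x in lebesgue_on {a<..<b}. f x = trace_at a b f x"
proof -
  obtain w where w: "ac a b w (wderiv a b f)" "AE x in lebesgue_on {a<..<b}. f x = w x"
    using weak_deriv_ac_rep[OF ab H1_L2[OF f] wderiv_weak[OF f]] by blast
  have tr: "trace_at a b f x = w x" if "x \<in> {a..b}" for x
    by (rule trace_at_eq[OF ab ac_continuous[OF w(1)] w(2) that])
  show "ac a b (trace_at a b f) (wderiv a b f)" by (rule ac_cong[OF w(1)]) (auto simp: tr)
  show "AE x in lebesgue_on {a<..<b}. f x = trace_at a b f x"
    using w(2) lebesgue_on_ae_space[of "{a<..<b}"] by eventually_elim (simp add: tr)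
qed

lemma ac_H1:
  assumes ab: "a < b" and w: "ac a b w g" and ae: "AE x in lebesgue_on {a<..<b}. w x = f x"
  shows "f \<in> H1 a b" "AE x in lebesgue_on {a<..<b}. g x = wderiv a b f x"
    "x \<in> {a..b} \<Longrightarrow> trace_at a b f x = w x"
proof -
  have f: "f \<in> L2 a b" by (rule L2_AE_cong[OF ac_fun_L2[OF w] ae])
  have "has_weak_deriv a b f g"
    using ac_weak_deriv[OF ab w] has_weak_deriv_AE_cong[OF ac_fun_L2[OF w] ae] by simp
  then show H: "f \<in> H1 a b" using f ac_L2[OF w] by (auto simp: H1_def)
  have ae': "AE x in lebesgue_on {a<..<b}. f x = w x" using ae by eventually_elim simp
  have tr: "trace_at a b f x = w x" if "x \<in> {a..b}" for x
    by (rule trace_at_eq[OF ab ac_continuous[OF w] ae' that])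
  then show "x \<in> {a..b} \<Longrightarrow> trace_at a b f x = w x" .
  have "ac a b w (wderiv a b f)" by (rule ac_cong[OF H1_ac(1)[OF ab H]]) (auto simp: tr)
  then show "AE x in lebesgue_on {a<..<b}. g x = wderiv a b f x" by (rule ac_unique[OF ab w])
qed

lemma H3_ac:
  fixes u :: "real \<Rightarrow> real"
  assumes ab: "a < b" and u: "u \<in> H3 a b"
  defines "u1 \<equiv> wderiv a b u" and "u2 \<equiv> wderiv a b (wderiv a b u)" and "u3 \<equiv> wderiv a b (wderiv a b (wderiv a b u))"
  shows "ac a b (trace_at a b u) (trace_at a b u1)" "ac a b (trace_at a b u1) (trace_at a b u2)"
    "ac a b (trace_at a b u2) u3"
    "AE x in lebesgue_on {a<..<b}. u x = trace_at a b u x"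
    "AE x in lebesgue_on {a<..<b}. u1 x = trace_at a b u1 x"
    "u3 \<in> L2 a b"
proof -
  have H: "u \<in> H1 a b" "u1 \<in> H1 a b" "u2 \<in> H1 a b"
    using u by (auto simp: H3_def u1_def u2_def)
  have w1: "wderiv a b u = u1" and w2: "wderiv a b u1 = u2" and w3: "wderiv a b u2 = u3"
    by (simp_all add: u1_def u2_def u3_def)
  note A0 = H1_ac[OF ab H(1), unfolded w1] and A1 = H1_ac[OF ab H(2), unfolded w2] and A2 = H1_ac[OF ab H(3), unfolded w3]
  show "ac a b (trace_at a b u) (trace_at a b u1)" by (rule ac_cong[OF A0(1) refl A1(2)])
  show "ac a b (trace_at a b u1) (trace_at a b u2)" by (rule ac_cong[OF A1(1) refl A2(2)])
  show "ac a b (trace_at a b u2) u3" by (rule A2(1))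
  show "AE x in lebesgue_on {a<..<b}. u x = trace_at a b u x" by (rule A0(2))
  show "AE x in lebesgue_on {a<..<b}. u1 x = trace_at a b u1 x" by (rule A1(2))
  show "u3 \<in> L2 a b" by (rule ac_L2[OF A2(1)])
qed

lemma ac_H3:
  assumes ab: "a < b" and w: "ac a b w0 w1" "ac a b w1 w2" "ac a b w2 w3"
  shows "w0 \<in> H3 a b" "x \<in> {a..b} \<Longrightarrow> trace_at a b w0 x = w0 x"
    "x \<in> {a..b} \<Longrightarrow> trace_at a b (wderiv a b w0) x = w1 x"
proof -
  note A0 = ac_H1[OF ab w(1), of w0, simplified]
  note A1 = ac_H1[OF ab w(2) A0(2)]
  note A2 = ac_H1[OF ab w(3) A1(2)]
  show "w0 \<in> H3 a b" using A0(1) A1(1) A2(1) by (simp add: H3_def)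
  show "x \<in> {a..b} \<Longrightarrow> trace_at a b w0 x = w0 x" by (rule A0(3)) simp
  show "x \<in> {a..b} \<Longrightarrow> trace_at a b (wderiv a b w0) x = w1 x" by (rule A1(3))
qed

lemma ac_sup_bound:
  assumes w: "ac a b w g" and "w a = 0" and x: "x \<in> {a..b}"
  shows "(w x)\<^sup>2 \<le> (b - a) * inner_L2 a b g g"
  using ac_oscillation[OF w x, of a] assms by simp

text \<open>
  For \<open>k < \<pi> / L\<close> the function \<open>T = - k tan (k (x - L / 2))\<close> is smooth on \<open>[0, L]\<close> and solves
  \<open>T' = - k\<^sup>2 - T\<^sup>2\<close>. Expanding \<open>0 \<le> \<parallel>g - T w\<parallel>\<^sup>2\<close>, the mixed terms combine with \<open>T'\<close> to the integral
  of the derivative of \<open>T w\<^sup>2\<close>, which vanishes since \<open>w\<close> is zero at both ends.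
\<close>

lemma wirtinger_subcritical:
  assumes L: "0 < L" and w: "ac 0 L w g" "w 0 = 0" "w L = 0" and k: "0 < k" "k < pi / L"
  shows "k\<^sup>2 * inner_L2 0 L w w \<le> inner_L2 0 L g g"
proof -
  define T where "T x = - k * tan (k * (x - L / 2))" for x
  define T' where "T' x = - (k\<^sup>2) - (T x)\<^sup>2" for x
  have cos: "cos (k * (x - L / 2)) \<noteq> 0" if "x \<in> {0..L}" for x
  proof -
    have "k * L < pi" using k L by (simp add: field_simps)
    moreover have "k * x \<le> k * L" "0 \<le> k * x" using that k by auto
    ultimately have "- (pi / 2) < k * (x - L / 2)" "k * (x - L / 2) < pi / 2" by (auto simp: algebra_simps)
    then have "0 < cos (k * (x - L / 2))" by (rule cos_gt_zero_pi)
    then show ?thesis by simp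
  qed
  have Td: "(T has_real_derivative T' x) (at x within {0..L})" if "x \<in> {0..L}" for x
  proof -
    have "(T has_real_derivative - k * (inverse ((cos (k * (x - L / 2)))\<^sup>2) * k)) (at x within {0..L})"
      unfolding T_def using cos[OF that] by (auto intro!: derivative_eq_intros)
    moreover have "- k * (inverse ((cos (k * (x - L / 2)))\<^sup>2) * k) = T' x"
    proof -
      have "inverse ((cos (k * (x - L / 2)))\<^sup>2) = 1 + (tan (k * (x - L / 2)))\<^sup>2"
        using tan_sec[OF cos[OF that]] by (simp only: power_inverse)
      moreover have "- k * ((1 + t\<^sup>2) * k) = - (k\<^sup>2) - (- k * t)\<^sup>2" for t
        by (simp add: power2_eq_square algebra_simps)
      ultimately show ?thesis by (simp only: T'_def T_def)
    qed
    ultimately show ?thesis by simp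
  qed
  have Tc: "continuous_on {0..L} T" by (rule DERIV_continuous_on[OF Td])
  have T'c: "continuous_on {0..L} T'" unfolding T'_def by (intro continuous_intros Tc)
  have Tac: "ac 0 L T T'" by (rule ac_C1[OF Td T'c])
  note Tw = ac_mult[OF Tac w(1)]
  \<comment> \<open>The functions \<open>w\<close> and \<open>T w\<close> have derivatives \<open>g\<close> and \<open>T g + T' w\<close>.\<close>
  have ibp: "inner_L2 0 L w (\<lambda>x. T x * g x + T' x * w x) + inner_L2 0 L g (\<lambda>x. T x * w x) = 0"
    using ac_integration_by_parts[OF L w(1) Tw] w(2,3) by simp
  have gL: "g \<in> L2 0 L" and wL: "w \<in> L2 0 L" and TwL: "(\<lambda>x. T x * w x) \<in> L2 0 L"
    and DL: "(\<lambda>x. T x * g x + T' x * w x) \<in> L2 0 L"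
    using ac_L2[OF w(1)] ac_fun_L2[OF w(1)] ac_fun_L2[OF Tw] ac_L2[OF Tw] by auto
  have "0 \<le> inner_L2 0 L (\<lambda>x. g x - T x * w x) (\<lambda>x. g x - T x * w x)" by (rule inner_L2_nonneg)
  also have "\<dots> = integral\<^sup>L (lebesgue_on {0<..<L}) (\<lambda>x. g x * g x - k\<^sup>2 * (w x * w x)
      - (w x * (T x * g x + T' x * w x) + g x * (T x * w x)))"
    unfolding inner_L2_def
    by (rule Bochner_Integration.integral_cong) (simp_all add: T'_def power2_eq_square algebra_simps)
  also have "\<dots> = inner_L2 0 L g g - k\<^sup>2 * inner_L2 0 L w w
      - (inner_L2 0 L w (\<lambda>x. T x * g x + T' x * w x) + inner_L2 0 L g (\<lambda>x. T x * w x))"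
  proof -
    note i = L2_mult_integrable[OF gL gL] L2_mult_integrable[OF wL wL] L2_mult_integrable[OF wL DL] L2_mult_integrable[OF gL TwL]
    show ?thesis unfolding inner_L2_def
      by (simp only: Bochner_Integration.integral_diff Bochner_Integration.integral_add i
          Bochner_Integration.integrable_diff Bochner_Integration.integrable_add integrable_mult_right integral_mult_right_zero)
  qed
  finally show ?thesis using ibp by simp
qed

lemma wirtinger:
  assumes L: "0 < L" and w: "ac 0 L w g" "w 0 = 0" "w L = 0"
  shows "pi\<^sup>2 / L\<^sup>2 * inner_L2 0 L w w \<le> inner_L2 0 L g g"
proof -
  have "((\<lambda>k. k\<^sup>2 * inner_L2 0 L w w) \<longlongrightarrow> (pi / L)\<^sup>2 * inner_L2 0 L w w) (at_left (pi / L))"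
    by (intro tendsto_intros)
  moreover have "eventually (\<lambda>k. k\<^sup>2 * inner_L2 0 L w w \<le> inner_L2 0 L g g) (at_left (pi / L))"
    unfolding eventually_at_left_field using wirtinger_subcritical[OF L w] L by (intro exI[of _ 0]) auto
  ultimately have "(pi / L)\<^sup>2 * inner_L2 0 L w w \<le> inner_L2 0 L g g"
    by (rule tendsto_upperbound) simp
  then show ?thesis by (simp add: power_divide)
qed

section \<open>The Hilbert space of square integrable functions on the line\<close>

definition sq_integrable :: "(real \<Rightarrow> real) \<Rightarrow> bool" where
  "sq_integrable f \<longleftrightarrow> f \<in> borel_measurable lebesgue \<and> integrable lebesgue (\<lambda>x. (f x)\<^sup>2)"

lemma sq_integrable_mult:
  assumes "sq_integrable f" "sq_integrable g"
  shows "integrable lebesgue (\<lambda>x. f x * g x)"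
proof (rule Bochner_Integration.integrable_bound)
  show "integrable lebesgue (\<lambda>x. (f x)\<^sup>2 + (g x)\<^sup>2)" using assms by (auto simp: sq_integrable_def)
  show "(\<lambda>x. f x * g x) \<in> borel_measurable lebesgue" using assms by (auto simp: sq_integrable_def)
  show "AE x in lebesgue. norm (f x * g x) \<le> norm ((f x)\<^sup>2 + (g x)\<^sup>2)"
  proof (rule AE_I2)
    fix x
    have "2 * (\<bar>f x\<bar> * \<bar>g x\<bar>) \<le> (f x)\<^sup>2 + (g x)\<^sup>2" using sum_squares_bound[of "\<bar>f x\<bar>" "\<bar>g x\<bar>"] by simp
    moreover have "0 \<le> \<bar>f x\<bar> * \<bar>g x\<bar>" by simp
    ultimately have "\<bar>f x\<bar> * \<bar>g x\<bar> \<le> (f x)\<^sup>2 + (g x)\<^sup>2" by linarith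
    then show "norm (f x * g x) \<le> norm ((f x)\<^sup>2 + (g x)\<^sup>2)" by (simp add: abs_mult)
  qed
qed

lemma sq_integrable_add: "sq_integrable f \<Longrightarrow> sq_integrable g \<Longrightarrow> sq_integrable (\<lambda>x. f x + g x)"
  using sq_integrable_mult[of f g] by (auto simp: sq_integrable_def power2_sum mult.assoc)

lemma sq_integrable_cmult: "sq_integrable f \<Longrightarrow> sq_integrable (\<lambda>x. c * f x)"
  by (auto simp: sq_integrable_def power_mult_distrib)

lemma sq_integrable_zero: "sq_integrable (\<lambda>_. 0)"
  by (simp add: sq_integrable_def)

definition lsq_rel :: "(real \<Rightarrow> real) \<Rightarrow> (real \<Rightarrow> real) \<Rightarrow> bool" where
  "lsq_rel f g \<longleftrightarrow> sq_integrable f \<and> sq_integrable g \<and> (AE x in lebesgue. f x = g x)"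

text \<open>
  Square integrable functions on the real line modulo null sets.
\<close>

quotient_type lsq = "real \<Rightarrow> real" / partial: lsq_rel
proof (rule part_equivpI)
  show "\<exists>f. lsq_rel f f" using sq_integrable_zero by (auto simp: lsq_rel_def)
  show "symp lsq_rel" by (auto simp: lsq_rel_def symp_def elim: eventually_mono)
  show "transp lsq_rel" unfolding transp_def lsq_rel_def
    by (auto elim: eventually_elim2)
qed

instantiation lsq :: real_vector
begin

lift_definition zero_lsq :: lsq is "\<lambda>_. 0"
  by (simp add: lsq_rel_def sq_integrable_zero)

lift_definition plus_lsq :: "lsq \<Rightarrow> lsq \<Rightarrow> lsq" is "\<lambda>f g x. f x + g x"
  unfolding lsq_rel_def by (auto intro: sq_integrable_add elim: eventually_elim2)

lift_definition scaleR_lsq :: "real \<Rightarrow> lsq \<Rightarrow> lsq" is "\<lambda>c f x. c * f x"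
  unfolding lsq_rel_def by (auto intro: sq_integrable_cmult elim: eventually_mono)

definition uminus_lsq :: "lsq \<Rightarrow> lsq" where "- x = (- 1) *\<^sub>R (x :: lsq)"

definition minus_lsq :: "lsq \<Rightarrow> lsq \<Rightarrow> lsq" where "x - y = x + - (y :: lsq)"

instance
proof
  fix a b c :: lsq and r s :: real
  show "a + b + c = a + (b + c)" by transfer (auto simp: lsq_rel_def add.assoc sq_integrable_add)
  show "a + b = b + a" by transfer (auto simp: lsq_rel_def add.commute sq_integrable_add)
  show "0 + a = a" by transfer (auto simp: lsq_rel_def)
  show "- a + a = 0" unfolding uminus_lsq_def
    by transfer (auto simp: lsq_rel_def sq_integrable_zero)
  show "a - b = a + - b" by (simp add: minus_lsq_def)
  show "r *\<^sub>R (a + b) = r *\<^sub>R a + r *\<^sub>R b"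
    by transfer (auto simp: lsq_rel_def distrib_left sq_integrable_add sq_integrable_cmult)
  show "(r + s) *\<^sub>R a = r *\<^sub>R a + s *\<^sub>R a"
    by transfer (auto simp: lsq_rel_def distrib_right sq_integrable_add sq_integrable_cmult)
  show "r *\<^sub>R s *\<^sub>R a = (r * s) *\<^sub>R a"
    by transfer (auto simp: lsq_rel_def mult.assoc sq_integrable_cmult)
  show "1 *\<^sub>R a = a" by transfer (auto simp: lsq_rel_def)
qed

end

text \<open>
  Separate constants for representatives and classes keep these maps out of reach of the rewrite
  rules that belong to the quotient construction.
\<close>

definition rep :: "lsq \<Rightarrow> real \<Rightarrow> real" where "rep = rep_lsq"
definition cls :: "(real \<Rightarrow> real) \<Rightarrow> lsq" where "cls = abs_lsq"

lemma rep_sq_integrable: "sq_integrable (rep a)"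
  using Quotient_rep_reflp[OF Quotient_lsq, of a] by (simp add: lsq_rel_def rep_def)

lemma rep_cls: "sq_integrable f \<Longrightarrow> AE x in lebesgue. rep (cls f) x = f x"
  using Quotient_rep_abs[OF Quotient_lsq, of f] by (simp add: lsq_rel_def rep_def cls_def)

lemma cls_eqI: "sq_integrable f \<Longrightarrow> sq_integrable g \<Longrightarrow> AE x in lebesgue. f x = g x \<Longrightarrow> cls f = cls g"
  using Quotient_rel_abs[OF Quotient_lsq, of f g] by (simp add: lsq_rel_def cls_def)

lemma cls_rep: "cls (rep a) = a"
  using Quotient_abs_rep[OF Quotient_lsq, of a] by (simp add: rep_def cls_def)

lemma cls_add: "sq_integrable f \<Longrightarrow> sq_integrable g \<Longrightarrow> cls f + cls g = cls (\<lambda>x. f x + g x)"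
  unfolding cls_def by (rule plus_lsq.abs_eq) (simp_all add: lsq_rel_def)

lemma cls_scaleR: "sq_integrable f \<Longrightarrow> c *\<^sub>R cls f = cls (\<lambda>x. c * f x)"
  unfolding cls_def by (rule scaleR_lsq.abs_eq) (simp_all add: lsq_rel_def)

lemma rep_add: "AE x in lebesgue. rep (a + b) x = rep a x + rep b x"
proof -
  have "a + b = cls (\<lambda>x. rep a x + rep b x)"
    using cls_add[OF rep_sq_integrable rep_sq_integrable, of a b] by (simp add: cls_rep)
  then show ?thesis using rep_cls[OF sq_integrable_add[OF rep_sq_integrable rep_sq_integrable], of a b] by simp
qed

lemma rep_scaleR: "AE x in lebesgue. rep (c *\<^sub>R a) x = c * rep a x"
proof -
  have "c *\<^sub>R a = cls (\<lambda>x. c * rep a x)"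
    using cls_scaleR[OF rep_sq_integrable, of c a] by (simp add: cls_rep)
  then show ?thesis using rep_cls[OF sq_integrable_cmult[OF rep_sq_integrable], of c a] by simp
qed

lemma rep_diff: "AE x in lebesgue. rep (a - b) x = rep a x - rep b x"
proof -
  have "a - b = a + (-1) *\<^sub>R b" by simp
  then show ?thesis using rep_add[of a "(-1) *\<^sub>R b"] rep_scaleR[of "-1" b]
    by (auto elim: eventually_elim2)
qed

instantiation lsq :: real_inner
begin

definition inner_lsq :: "lsq \<Rightarrow> lsq \<Rightarrow> real" where
  "a \<bullet> b = integral\<^sup>L lebesgue (\<lambda>x. rep a x * rep b x)"
definition norm_lsq :: "lsq \<Rightarrow> real" where "norm a = sqrt (a \<bullet> (a :: lsq))"
definition sgn_lsq :: "lsq \<Rightarrow> lsq" where "sgn a = a /\<^sub>R norm (a :: lsq)"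
definition dist_lsq :: "lsq \<Rightarrow> lsq \<Rightarrow> real" where "dist a b = norm (a - (b :: lsq))"
definition uniformity_lsq :: "(lsq \<times> lsq) filter" where
  "uniformity_lsq = (INF e\<in>{0 <..}. principal {(x, y). dist x y < e})"
definition open_lsq :: "lsq set \<Rightarrow> bool" where
  "open_lsq U = (\<forall>x\<in>U. eventually (\<lambda>(x', y). x' = x \<longrightarrow> y \<in> U) uniformity)"

lemma rep_mult_integrable: "integrable lebesgue (\<lambda>x. rep a x * rep b x)"
  by (rule sq_integrable_mult[OF rep_sq_integrable rep_sq_integrable])

lemma rep_measurable: "rep a \<in> borel_measurable lebesgue"
  using rep_sq_integrable[of a] by (simp add: sq_integrable_def)

instance
proof
  fix x y z :: lsq and r :: real and U :: "lsq set"
  show "sgn x = inverse (norm x) *\<^sub>R x" by (simp add: sgn_lsq_def)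
  show "dist x y = norm (x - y)" by (simp add: dist_lsq_def)
  show "(uniformity :: (lsq \<times> lsq) filter) = (INF e\<in>{0 <..}. principal {(x, y). dist x y < e})"
    by (rule uniformity_lsq_def)
  show "open U = (\<forall>x\<in>U. \<forall>\<^sub>F (x', y) in uniformity. x' = x \<longrightarrow> y \<in> U)" by (rule open_lsq_def)
  show "norm x = sqrt (x \<bullet> x)" by (rule norm_lsq_def)
  show "x \<bullet> y = y \<bullet> x" by (simp add: inner_lsq_def mult.commute)
  show "(x + y) \<bullet> z = x \<bullet> z + y \<bullet> z"
  proof -
    have "(x + y) \<bullet> z = integral\<^sup>L lebesgue (\<lambda>t. rep x t * rep z t + rep y t * rep z t)"
      unfolding inner_lsq_def
    proof (rule integral_cong_AE)
      show "AE t in lebesgue. rep (x + y) t * rep z t = rep x t * rep z t + rep y t * rep z t"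
        using rep_add[of x y] by eventually_elim (simp add: distrib_right)
    qed (use rep_mult_integrable[of "x + y" z] rep_mult_integrable[of x z] rep_mult_integrable[of y z] in auto)
    then show ?thesis using rep_mult_integrable[of x z] rep_mult_integrable[of y z] by (simp add: inner_lsq_def)
  qed
  show "r *\<^sub>R x \<bullet> y = r * (x \<bullet> y)"
  proof -
    have "r *\<^sub>R x \<bullet> y = integral\<^sup>L lebesgue (\<lambda>t. r * (rep x t * rep y t))"
      unfolding inner_lsq_def
    proof (rule integral_cong_AE)
      show "AE t in lebesgue. rep (r *\<^sub>R x) t * rep y t = r * (rep x t * rep y t)"
        using rep_scaleR[of r x] by eventually_elim (simp add: mult.assoc)
    qed (use rep_mult_integrable[of "r *\<^sub>R x" y] rep_mult_integrable[of x y] in auto)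
    then show ?thesis by (simp add: inner_lsq_def)
  qed
  show "0 \<le> x \<bullet> x" unfolding inner_lsq_def by (rule integral_nonneg_AE) simp
  show "x \<bullet> x = 0 \<longleftrightarrow> x = 0"
  proof
    assume "x \<bullet> x = 0"
    then have "AE t in lebesgue. rep x t * rep x t = 0"
      unfolding inner_lsq_def by (subst (asm) integral_nonneg_eq_0_iff_AE) (auto intro: rep_mult_integrable)
    then have "AE t in lebesgue. rep x t = 0" by eventually_elim simp
    then have "cls (rep x) = cls (\<lambda>_. 0)" by (intro cls_eqI rep_sq_integrable sq_integrable_zero)
    then show "x = 0" by (simp add: cls_rep) (simp add: cls_def zero_lsq.abs_eq)
  next
    assume "x = 0"
    then have "rep x = rep (cls (\<lambda>_. 0))" by (simp add: cls_def zero_lsq.abs_eq)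
    then have "AE t in lebesgue. rep x t = 0" using rep_cls[OF sq_integrable_zero] by simp
    then have "AE t in lebesgue. rep x t * rep x t = 0" by eventually_elim simp
    then show "x \<bullet> x = 0" unfolding inner_lsq_def by (rule integral_eq_zero_AE)
  qed
qed

end

lemma inner_cls:
  assumes f: "sq_integrable f" and g: "sq_integrable g"
  shows "cls f \<bullet> cls g = integral\<^sup>L lebesgue (\<lambda>x. f x * g x)"
  unfolding inner_lsq_def
proof (rule integral_cong_AE)
  show "AE x in lebesgue. rep (cls f) x * rep (cls g) x = f x * g x"
    using rep_cls[OF f] rep_cls[OF g] by eventually_elim simp
qed (use rep_mult_integrable[of "cls f" "cls g"] sq_integrable_mult[OF f g] in auto)

text \<open>
  The integrals of \<open>2\<^sup>n d\<^sub>n\<^sup>2\<close>, where \<open>d\<^sub>n\<close> is the \<open>n\<close>-th increment, are summable. So the sum of these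
  functions is finite almost everywhere, which makes \<open>d\<^sub>n\<close> decay geometrically at almost every
  point.
\<close>

lemma fast_Cauchy_pointwise:
  fixes X :: "nat \<Rightarrow> lsq"
  assumes fast: "\<And>n. norm (X (Suc n) - X n) \<le> (1/2) ^ n"
  shows "AE x in lebesgue. convergent (\<lambda>n. rep (X n) x)"
proof -
  define d where "d n x = rep (X (Suc n) - X n) x" for n x
  have di: "integrable lebesgue (\<lambda>x. 2 ^ n * (d n x * d n x))" for n
    unfolding d_def by (intro integrable_mult_right rep_mult_integrable)
  have dn: "integral\<^sup>L lebesgue (\<lambda>x. 2 ^ n * (d n x * d n x)) \<le> (1/2) ^ n" for n
  proof -
    have "integral\<^sup>L lebesgue (\<lambda>x. d n x * d n x) = (norm (X (Suc n) - X n))\<^sup>2"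
      by (simp add: d_def power2_norm_eq_inner inner_lsq_def)
    also have "\<dots> \<le> ((1/2) ^ n)\<^sup>2" using fast[of n] by (intro power_mono) auto
    finally have "2 ^ n * integral\<^sup>L lebesgue (\<lambda>x. d n x * d n x) \<le> 2 ^ n * ((1/2) ^ n)\<^sup>2"
      by (intro mult_left_mono) auto
    also have "\<dots> = (1/2) ^ n" by (simp add: power2_eq_square power_mult_distrib[symmetric] mult.assoc[symmetric])
    finally show ?thesis by simp
  qed
  have fin: "(\<integral>\<^sup>+x. (\<Sum>n. ennreal (2 ^ n * (d n x * d n x))) \<partial>lebesgue) \<noteq> \<infinity>"
  proof -
    have "(\<integral>\<^sup>+x. (\<Sum>n. ennreal (2 ^ n * (d n x * d n x))) \<partial>lebesgue)
        = (\<Sum>n. \<integral>\<^sup>+x. ennreal (2 ^ n * (d n x * d n x)) \<partial>lebesgue)"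
      using di by (intro nn_integral_suminf) auto
    also have "\<dots> = (\<Sum>n. ennreal (integral\<^sup>L lebesgue (\<lambda>x. 2 ^ n * (d n x * d n x))))"
      by (intro suminf_cong nn_integral_eq_integral di) simp
    also have "\<dots> \<le> (\<Sum>n. ennreal ((1/2) ^ n))"
      by (intro suminf_le ennreal_leI dn) auto
    also have "\<dots> = ennreal (\<Sum>n. (1/2) ^ n)"
      by (intro suminf_ennreal2) (auto intro: summable_geometric)
    also have "\<dots> < \<infinity>" by simp
    finally show ?thesis by simp
  qed
  have "AE x in lebesgue. (\<Sum>n. ennreal (2 ^ n * (d n x * d n x))) \<noteq> \<infinity>"
    using fin di by (intro nn_integral_noteq_infinite borel_measurable_suminf) auto
  moreover have "AE x in lebesgue. \<forall>n. d n x = rep (X (Suc n)) x - rep (X n) x"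
    unfolding AE_all_countable d_def using rep_diff by blast
  ultimately show ?thesis
  proof eventually_elim
    case (elim x)
    let ?a = "\<lambda>n. 2 ^ n * (d n x * d n x)"
    have "summable ?a" using elim(1) by (intro summable_suminf_not_top) (auto simp: top_ennreal_def infinity_ennreal_def)
    then have "?a \<longlonglongrightarrow> 0" by (rule summable_LIMSEQ_zero)
    then obtain C where C: "\<And>n. \<bar>?a n\<bar> \<le> C"
      using convergent_imp_Bseq[of ?a] by (auto simp: convergent_def Bseq_def)
    have C0: "0 \<le> C" using C[of 0] by linarith
    have b: "norm (d n x) \<le> sqrt C * (sqrt (1/2)) ^ n" for n
    proof (rule power2_le_imp_le)
      have "(d n x)\<^sup>2 * 2 ^ n \<le> C" using C[of n] by (simp add: power2_eq_square mult_ac)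
      then have "(d n x)\<^sup>2 \<le> C * (1/2) ^ n" by (simp add: field_simps power_one_over)
      also have "\<dots> = (sqrt C * (sqrt (1/2)) ^ n)\<^sup>2"
        using C0 by (simp add: power_mult_distrib power_mult[symmetric] mult.commute[of n 2]) (simp add: power_mult)
      finally show "(norm (d n x))\<^sup>2 \<le> (sqrt C * (sqrt (1/2)) ^ n)\<^sup>2" by simp
    qed (use C0 in simp)
    have s: "summable (\<lambda>n. sqrt C * (sqrt (1/2)) ^ n)"
      by (intro summable_mult summable_geometric) (simp add: real_sqrt_divide)
    have "summable (\<lambda>n. d n x)" by (rule summable_comparison_test'[OF s, of 0]) (rule b)
    then have "summable (\<lambda>n. rep (X (Suc n)) x - rep (X n) x)" using elim(2) by simp
    then have "convergent (\<lambda>n. \<Sum>i<n. rep (X (Suc i)) x - rep (X i) x)"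
      by (simp add: summable_iff_convergent)
    then have "convergent (\<lambda>n. rep (X n) x - rep (X 0) x)"
      unfolding sum_lessThan_telescope[where f="\<lambda>n. rep (X n) x"] .
    then obtain l where "(\<lambda>n. rep (X n) x - rep (X 0) x) \<longlonglongrightarrow> l" by (auto simp: convergent_def)
    from tendsto_add[OF this tendsto_const[of "rep (X 0) x"]] show ?case by (auto simp: convergent_def)
  qed
qed

text \<open>
  The pointwise limit is also the limit in norm, by Fatou's lemma.
\<close>

lemma lsq_fast_Cauchy_convergent:
  fixes X :: "nat \<Rightarrow> lsq"
  assumes fast: "\<And>n. norm (X (Suc n) - X n) \<le> (1/2) ^ n"
  shows "convergent X"
proof -
  define F where "F x = lim (\<lambda>n. rep (X n) x)" for x
  have lim: "AE x in lebesgue. (\<lambda>n. rep (X n) x) \<longlonglongrightarrow> F x"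
    using fast_Cauchy_pointwise[OF fast] by eventually_elim (simp add: F_def convergent_LIMSEQ_iff)
  have Fm: "F \<in> borel_measurable lebesgue"
    unfolding F_def by (intro borel_measurable_lim_metric rep_measurable)
  have tele: "norm (X (n + k) - X n) \<le> 2 * (1/2) ^ n" for n k
  proof -
    have "norm (X (n + k) - X n) \<le> (1/2) ^ n * (2 - 2 * (1/2) ^ k)"
    proof (induction k)
      case (Suc k)
      have "norm (X (n + Suc k) - X n) \<le> norm (X (Suc (n + k)) - X (n + k)) + norm (X (n + k) - X n)"
        using norm_triangle_ineq[of "X (Suc (n + k)) - X (n + k)" "X (n + k) - X n"] by simp
      also have "\<dots> \<le> (1/2) ^ (n + k) + (1/2) ^ n * (2 - 2 * (1/2) ^ k)" using fast[of "n + k"] Suc by simp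
      also have "\<dots> = (1/2) ^ n * (2 - 2 * (1/2) ^ Suc k)" by (simp add: power_add algebra_simps)
      finally show ?case .
    qed simp
    also have "\<dots> \<le> (1/2) ^ n * 2" by (intro mult_left_mono) auto
    finally show ?thesis by simp
  qed
  have fatou: "(\<integral>\<^sup>+x. ennreal ((F x - rep (X n) x)\<^sup>2) \<partial>lebesgue) \<le> ennreal ((2 * (1/2) ^ n)\<^sup>2)" for n
  proof -
    have "(\<integral>\<^sup>+x. ennreal ((F x - rep (X n) x)\<^sup>2) \<partial>lebesgue)
       = (\<integral>\<^sup>+x. liminf (\<lambda>k. ennreal ((rep (X k) x - rep (X n) x)\<^sup>2)) \<partial>lebesgue)"
    proof (rule nn_integral_cong_AE)
      show "AE x in lebesgue. ennreal ((F x - rep (X n) x)\<^sup>2) = liminf (\<lambda>k. ennreal ((rep (X k) x - rep (X n) x)\<^sup>2))"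
        using lim
      proof eventually_elim
        case (elim x)
        have "(\<lambda>k. ennreal ((rep (X k) x - rep (X n) x)\<^sup>2)) \<longlonglongrightarrow> ennreal ((F x - rep (X n) x)\<^sup>2)"
          by (intro tendsto_ennrealI tendsto_intros elim)
        then show ?case by (rule lim_imp_Liminf[OF sequentially_bot, symmetric])
      qed
    qed
    also have "\<dots> \<le> liminf (\<lambda>k. \<integral>\<^sup>+x. ennreal ((rep (X k) x - rep (X n) x)\<^sup>2) \<partial>lebesgue)"
      by (intro nn_integral_liminf) (use rep_measurable in auto)
    also have "\<dots> \<le> ennreal ((2 * (1/2) ^ n)\<^sup>2)"
    proof (rule Liminf_le, simp)
      show "\<forall>\<^sub>F k in sequentially. (\<integral>\<^sup>+x. ennreal ((rep (X k) x - rep (X n) x)\<^sup>2) \<partial>lebesgue) \<le> ennreal ((2 * (1/2) ^ n)\<^sup>2)"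
        unfolding eventually_sequentially
      proof (intro exI allI impI)
        fix k assume "n \<le> k"
        then obtain j where j: "k = n + j" by (auto simp: le_iff_add)
        have "(\<integral>\<^sup>+x. ennreal ((rep (X k) x - rep (X n) x)\<^sup>2) \<partial>lebesgue) = (\<integral>\<^sup>+x. ennreal (rep (X k - X n) x * rep (X k - X n) x) \<partial>lebesgue)"
        proof (rule nn_integral_cong_AE)
          show "AE x in lebesgue. ennreal ((rep (X k) x - rep (X n) x)\<^sup>2) = ennreal (rep (X k - X n) x * rep (X k - X n) x)"
            using rep_diff[of "X k" "X n"] by eventually_elim (simp add: power2_eq_square)
        qed
        also have "\<dots> = ennreal ((norm (X k - X n))\<^sup>2)"
          by (subst nn_integral_eq_integral[OF rep_mult_integrable]) (auto simp: power2_norm_eq_inner inner_lsq_def)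
        also have "\<dots> \<le> ennreal ((2 * (1/2) ^ n)\<^sup>2)"
          using tele[of n j] j by (intro ennreal_leI power_mono) auto
        finally show "(\<integral>\<^sup>+x. ennreal ((rep (X k) x - rep (X n) x)\<^sup>2) \<partial>lebesgue) \<le> ennreal ((2 * (1/2) ^ n)\<^sup>2)" .
      qed
    qed
    finally show ?thesis .
  qed
  have sqd: "sq_integrable (\<lambda>x. F x - rep (X n) x)" for n
    unfolding sq_integrable_def integrable_iff_bounded
  proof (intro conjI)
    show "(\<lambda>x. F x - rep (X n) x) \<in> borel_measurable lebesgue" using Fm rep_measurable[of "X n"] by simp
    then show "(\<lambda>x. (F x - rep (X n) x)\<^sup>2) \<in> borel_measurable lebesgue" by simp
    show "(\<integral>\<^sup>+x. ennreal (norm ((F x - rep (X n) x)\<^sup>2)) \<partial>lebesgue) < \<infinity>"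
      using fatou[of n] by (simp add: order_le_less_trans)
  qed
  have sqF: "sq_integrable F"
    using sq_integrable_add[OF sqd[of 0] rep_sq_integrable[of "X 0"]] by simp
  have b: "norm (X n - cls F) \<le> 2 * (1/2) ^ n" for n
  proof -
    have "X n - cls F = cls (\<lambda>x. rep (X n) x + (- 1) * F x)"
    proof -
      have "X n - cls F = cls (rep (X n)) + (- 1) *\<^sub>R cls F" by (simp add: cls_rep)
      also have "\<dots> = cls (\<lambda>x. rep (X n) x + (- 1) * F x)"
        unfolding cls_scaleR[OF sqF] by (rule cls_add[OF rep_sq_integrable sq_integrable_cmult[OF sqF]])
      finally show ?thesis .
    qed
    then have "(norm (X n - cls F))\<^sup>2 = integral\<^sup>L lebesgue (\<lambda>x. (rep (X n) x + (- 1) * F x) * (rep (X n) x + (- 1) * F x))"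
      using sq_integrable_add[OF rep_sq_integrable sq_integrable_cmult[OF sqF]] by (simp only: power2_norm_eq_inner inner_cls)
    also have "\<dots> = integral\<^sup>L lebesgue (\<lambda>x. (F x - rep (X n) x)\<^sup>2)"
      by (rule Bochner_Integration.integral_cong) (simp_all add: power2_eq_square algebra_simps)
    also have "\<dots> \<le> (2 * (1/2) ^ n)\<^sup>2"
    proof -
      have i: "integrable lebesgue (\<lambda>x. (F x - rep (X n) x)\<^sup>2)" using sqd[of n] by (simp add: sq_integrable_def)
      have "ennreal (integral\<^sup>L lebesgue (\<lambda>x. (F x - rep (X n) x)\<^sup>2)) \<le> ennreal ((2 * (1/2) ^ n)\<^sup>2)"
        using fatou[of n] nn_integral_eq_integral[OF i] by simp
      then show ?thesis by (subst (asm) ennreal_le_iff) auto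
    qed
    finally show ?thesis by (rule power2_le_imp_le) simp
  qed
  have z: "(\<lambda>n. 2 * (1/2::real) ^ n) \<longlonglongrightarrow> 0"
    by (rule tendsto_mult_right_zero[OF LIMSEQ_realpow_zero]) auto
  have "(\<lambda>n. X n - cls F) \<longlonglongrightarrow> 0"
    by (rule Lim_null_comparison[OF always_eventually z]) (rule allI, rule b)
  then have "X \<longlonglongrightarrow> cls F" by (rule LIM_zero_cancel)
  then show ?thesis by (auto simp: convergent_def)
qed

instance lsq :: complete_space
proof
  fix X :: "nat \<Rightarrow> lsq" assume X: "Cauchy X"
  have "\<exists>N. \<forall>m\<ge>N. \<forall>n\<ge>N. norm (X m - X n) < (1/2) ^ k" for k
    using CauchyD[OF X, of "(1/2) ^ k"] by simp
  then have "\<forall>k. \<exists>N. \<forall>m\<ge>N. \<forall>n\<ge>N. norm (X m - X n) < (1/2) ^ k" by blast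
  from choice[OF this] obtain N where N: "\<forall>k. \<forall>m\<ge>N k. \<forall>n\<ge>N k. norm (X m - X n) < (1/2) ^ k" ..
  define r where "r k = k + (\<Sum>i\<le>k. N i)" for k
  have r: "strict_mono r" by (rule strict_monoI_Suc) (simp add: r_def)
  have rN: "N k \<le> r k" for k
  proof -
    have "N k \<le> (\<Sum>i\<le>k. N i)" by (rule member_le_sum) auto
    then show ?thesis by (simp add: r_def)
  qed
  have "norm (X (r (Suc k)) - X (r k)) \<le> (1/2) ^ k" for k
  proof -
    have "N k \<le> r (Suc k)" using rN[of k] strict_monoD[OF r, of k "Suc k"] by simp
    then show ?thesis using N rN[of k] by (intro less_imp_le) blast
  qed
  then have "convergent (X \<circ> r)" by (intro lsq_fast_Cauchy_convergent) simp
  then obtain l where "(X \<circ> r) \<longlonglongrightarrow> l" by (auto simp: convergent_def)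
  then have "X \<longlonglongrightarrow> l" using Cauchy_converges_subseq[OF X r] by simp
  then show "convergent X" by (auto simp: convergent_def)
qed

section \<open>The Dirichlet integral as a supremum\<close>

text \<open>
  Polynomials with rational coefficients form a countable type of lists, over which suprema can be
  exhausted by a sequence of finite maxima; \<open>dqpoly\<close> is the derivative.
\<close>

definition qpoly :: "rat list \<Rightarrow> real \<Rightarrow> real" where
  "qpoly l x = (\<Sum>k<length l. of_rat (l ! k) * x ^ k)"

definition dqpoly :: "rat list \<Rightarrow> real \<Rightarrow> real" where
  "dqpoly l x = (\<Sum>k<length l. of_rat (l ! k) * (real k * x ^ (k - 1)))"

lemma qpoly_deriv: "(qpoly l has_real_derivative dqpoly l x) (at x within S)"
  unfolding qpoly_def dqpoly_def by (auto intro!: derivative_eq_intros sum.cong simp: mult_ac)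

lemma dqpoly_continuous: "continuous_on S (dqpoly l)"
  unfolding dqpoly_def by (intro continuous_intros)

lemma qpoly_continuous: "continuous_on S (qpoly l)"
  unfolding qpoly_def by (intro continuous_intros)

text \<open>
  For \<open>u\<close> vanishing at both ends this is \<open>2 \<langle>u', p\<rangle> - \<parallel>p\<parallel>\<^sup>2 = \<parallel>u'\<parallel>\<^sup>2 - \<parallel>u' - p\<parallel>\<^sup>2\<close>, a lower bound of
  the Dirichlet integral that is continuous in \<open>u\<close> with respect to the norm of \<open>L\<^sup>2\<close>.
\<close>

definition dual_bound :: "real \<Rightarrow> (real \<Rightarrow> real) \<Rightarrow> (real \<Rightarrow> real) \<Rightarrow> (real \<Rightarrow> real) \<Rightarrow> real" where
  "dual_bound L u p p' = - 2 * inner_L2 0 L u p' - inner_L2 0 L p p"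

fun dirichlet_approx :: "real \<Rightarrow> nat \<Rightarrow> (real \<Rightarrow> real) \<Rightarrow> real" where
  "dirichlet_approx L 0 u = 0"
| "dirichlet_approx L (Suc j) u =
     max (dirichlet_approx L j u) (dual_bound L u (qpoly (from_nat j)) (dqpoly (from_nat j)))"

lemma dirichlet_approx_nonneg: "0 \<le> dirichlet_approx L j u"
  by (induction j) auto

lemma dirichlet_approx_mono: "i \<le> j \<Longrightarrow> dirichlet_approx L i u \<le> dirichlet_approx L j u"
  by (rule lift_Suc_mono_le[of "\<lambda>j. dirichlet_approx L j u"]) auto

lemma dirichlet_approx_AE_cong:
  assumes u: "u \<in> L2 0 L" and ae: "AE x in lebesgue_on {0<..<L}. u x = u' x"
  shows "dirichlet_approx L j u = dirichlet_approx L j u'"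
proof (induction j)
  case (Suc j)
  have "inner_L2 0 L u (dqpoly l) = inner_L2 0 L u' (dqpoly l)" for l
    by (rule inner_L2_AE_cong[OF u L2_continuous[OF dqpoly_continuous] ae]) simp
  then show ?case using Suc by (simp add: dual_bound_def)
qed simp

lemma dual_bound_le_approx: "\<exists>j. dual_bound L u (qpoly l) (dqpoly l) \<le> dirichlet_approx L j u"
  by (rule exI[of _ "Suc (to_nat l)"]) simp

lemma dirichlet_approx_le:
  assumes "\<And>l. dual_bound L u (qpoly l) (dqpoly l) \<le> C" "0 \<le> C"
  shows "dirichlet_approx L j u \<le> C"
  using assms by (induction j) auto

lemma inner_L2_sum_right:
  assumes "finite I" "f \<in> L2 a b" "\<And>i. i \<in> I \<Longrightarrow> g i \<in> L2 a b"
  shows "inner_L2 a b f (\<lambda>x. \<Sum>i\<in>I. c i * g i x) = (\<Sum>i\<in>I. c i * inner_L2 a b f (g i))"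
proof -
  have "inner_L2 a b f (\<lambda>x. \<Sum>i\<in>I. c i * g i x) = integral\<^sup>L (lebesgue_on {a<..<b}) (\<lambda>x. \<Sum>i\<in>I. c i * (f x * g i x))"
    unfolding inner_L2_def by (simp add: sum_distrib_left mult_ac)
  also have "\<dots> = (\<Sum>i\<in>I. integral\<^sup>L (lebesgue_on {a<..<b}) (\<lambda>x. c i * (f x * g i x)))"
    using assms by (intro Bochner_Integration.integral_sum integrable_mult_right L2_mult_integrable) auto
  finally show ?thesis by (simp add: inner_L2_def)
qed

lemma dual_bound_sum:
  assumes u: "u \<in> L2 0 L"
  shows "dual_bound L u (\<lambda>x. \<Sum>k<n. a k * x ^ k) (\<lambda>x. \<Sum>k<n. a k * (real k * x ^ (k - 1)))
    = - 2 * (\<Sum>k<n. a k * inner_L2 0 L u (\<lambda>x. real k * x ^ (k - 1)))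
      - (\<Sum>k<n. a k * (\<Sum>j<n. a j * inner_L2 0 L (\<lambda>x. x ^ k) (\<lambda>x. x ^ j)))"
proof -
  have P: "(\<lambda>x. x ^ k) \<in> L2 0 L" "(\<lambda>x. real k * x ^ (k - 1)) \<in> L2 0 L" for k
    by (rule L2_continuous, intro continuous_intros)+
  have S: "(\<lambda>x. \<Sum>k<n. a k * x ^ k) \<in> L2 0 L" by (rule L2_continuous, intro continuous_intros)
  have "inner_L2 0 L (\<lambda>x. \<Sum>k<n. a k * x ^ k) (\<lambda>x. \<Sum>k<n. a k * x ^ k)
      = (\<Sum>k<n. a k * inner_L2 0 L (\<lambda>x. \<Sum>k<n. a k * x ^ k) (\<lambda>x. x ^ k))"
    by (rule inner_L2_sum_right) (auto intro: S P)
  also have "\<dots> = (\<Sum>k<n. a k * (\<Sum>j<n. a j * inner_L2 0 L (\<lambda>x. x ^ k) (\<lambda>x. x ^ j)))"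
  proof (rule sum.cong[OF refl])
    fix k
    have "inner_L2 0 L (\<lambda>x. x ^ k) (\<lambda>x. \<Sum>k<n. a k * x ^ k) = (\<Sum>j<n. a j * inner_L2 0 L (\<lambda>x. x ^ k) (\<lambda>x. x ^ j))"
      by (rule inner_L2_sum_right) (auto intro: P)
    then show "a k * inner_L2 0 L (\<lambda>x. \<Sum>k<n. a k * x ^ k) (\<lambda>x. x ^ k) = a k * (\<Sum>j<n. a j * inner_L2 0 L (\<lambda>x. x ^ k) (\<lambda>x. x ^ j))"
      by (simp only: inner_L2_commute[of 0 L "\<lambda>x. \<Sum>k<n. a k * x ^ k"])
  qed
  finally show ?thesis
    unfolding dual_bound_def using inner_L2_sum_right[of "{..<n}" u 0 L "\<lambda>k x. real k * x ^ (k - 1)" a, OF finite_lessThan u P(2)] by simp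
qed

text \<open>
  For a fixed degree \<open>dual_bound\<close> is a continuous function of the coefficients, by
  \<open>dual_bound_sum\<close>, so real coefficients may be approximated by rational ones.
\<close>

lemma dual_bound_real_polynomial:
  assumes u: "u \<in> L2 0 L" and C: "\<And>l. dual_bound L u (qpoly l) (dqpoly l) \<le> C"
    and p: "real_polynomial_function p" "\<And>x. (p has_real_derivative p' x) (at x)"
  shows "dual_bound L u p p' \<le> C"
proof -
  obtain a n where "p = (\<lambda>x. \<Sum>i\<le>n. a i * x ^ i)" using p(1) real_polynomial_function_iff_sum by blast
  then have pa: "p = (\<lambda>x. \<Sum>k<Suc n. a k * x ^ k)" by (simp only: lessThan_Suc_atMost)
  have "p' x = (\<Sum>k<Suc n. a k * (real k * x ^ (k - 1)))" for x
  proof (rule DERIV_unique[OF p(2)])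
    show "(p has_real_derivative (\<Sum>k<Suc n. a k * (real k * x ^ (k - 1)))) (at x)"
      unfolding pa by (auto intro!: derivative_eq_intros sum.cong simp: mult_ac)
  qed
  then have pa': "p' = (\<lambda>x. \<Sum>k<Suc n. a k * (real k * x ^ (k - 1)))" by auto
  have "\<forall>km. \<exists>q::rat. \<bar>real_of_rat q - a (fst km)\<bar> < 1 / real (Suc (snd km))"
  proof
    fix km :: "nat \<times> nat"
    have "a (fst km) - 1 / real (Suc (snd km)) < a (fst km) + 1 / real (Suc (snd km))"
      by (simp add: add_pos_pos)
    from of_rat_dense[OF this] obtain q where "a (fst km) - 1 / real (Suc (snd km)) < real_of_rat q"
      "real_of_rat q < a (fst km) + 1 / real (Suc (snd km))" by blast
    then show "\<exists>q::rat. \<bar>real_of_rat q - a (fst km)\<bar> < 1 / real (Suc (snd km))"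
      by (intro exI[of _ q]) linarith
  qed
  from choice[OF this] obtain Q where Q: "\<forall>km. \<bar>real_of_rat (Q km) - a (fst km)\<bar> < 1 / real (Suc (snd km))" ..
  have lim: "(\<lambda>m. real_of_rat (Q (k, m))) \<longlonglongrightarrow> a k" for k
  proof (rule LIM_zero_cancel, rule Lim_null_comparison[OF always_eventually LIMSEQ_Suc[OF lim_1_over_n]], rule allI)
    fix m show "norm (real_of_rat (Q (k, m)) - a k) \<le> 1 / real (Suc m)"
      using Q[THEN spec, of "(k, m)"] by simp
  qed
  define b where "b m k = real_of_rat (Q (k, m))" for m k
  define l where "l m = map (\<lambda>k. Q (k, m)) [0..<Suc n]" for m
  have ll: "qpoly (l m) = (\<lambda>x. \<Sum>k<Suc n. b m k * x ^ k)" "dqpoly (l m) = (\<lambda>x. \<Sum>k<Suc n. b m k * (real k * x ^ (k - 1)))" for m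
    unfolding qpoly_def dqpoly_def l_def b_def by (auto intro!: sum.cong simp del: upt_Suc)
  have "dual_bound L u (qpoly (l m)) (dqpoly (l m)) =
      - 2 * (\<Sum>k<Suc n. b m k * inner_L2 0 L u (\<lambda>x. real k * x ^ (k - 1)))
      - (\<Sum>k<Suc n. b m k * (\<Sum>j<Suc n. b m j * inner_L2 0 L (\<lambda>x. x ^ k) (\<lambda>x. x ^ j)))" for m
    unfolding ll by (rule dual_bound_sum[OF u])
  moreover have "(\<lambda>m. - 2 * (\<Sum>k<Suc n. b m k * inner_L2 0 L u (\<lambda>x. real k * x ^ (k - 1)))
      - (\<Sum>k<Suc n. b m k * (\<Sum>j<Suc n. b m j * inner_L2 0 L (\<lambda>x. x ^ k) (\<lambda>x. x ^ j))))
    \<longlonglongrightarrow> - 2 * (\<Sum>k<Suc n. a k * inner_L2 0 L u (\<lambda>x. real k * x ^ (k - 1)))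
      - (\<Sum>k<Suc n. a k * (\<Sum>j<Suc n. a j * inner_L2 0 L (\<lambda>x. x ^ k) (\<lambda>x. x ^ j)))"
    unfolding b_def by (intro tendsto_intros lim)
  ultimately have "(\<lambda>m. dual_bound L u (qpoly (l m)) (dqpoly (l m))) \<longlonglongrightarrow> dual_bound L u p p'"
    unfolding pa pa' dual_bound_sum[OF u] by presburger
  then show ?thesis by (rule LIMSEQ_le_const2) (use C in blast)
qed

lemma dual_bound_ac:
  assumes L: "0 < L" and w: "ac 0 L w g" and p: "\<And>x. x \<in> {0..L} \<Longrightarrow> (p has_real_derivative p' x) (at x within {0..L})" "continuous_on {0..L} p'"
  shows "dual_bound L w p p' = 2 * inner_L2 0 L g p - inner_L2 0 L p p - 2 * (w L * p L - w 0 * p 0)"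
proof -
  have "ac 0 L p p'" by (rule ac_C1[OF p])
  from ac_integration_by_parts[OF L w this] show ?thesis by (simp add: dual_bound_def)
qed

lemma inner_L2_square_diff:
  assumes "f \<in> L2 a b" "g \<in> L2 a b"
  shows "inner_L2 a b (\<lambda>x. f x - g x) (\<lambda>x. f x - g x) = inner_L2 a b f f - 2 * inner_L2 a b f g + inner_L2 a b g g"
  using assms by (simp add: inner_L2_diff_left inner_L2_diff_right L2_diff inner_L2_commute[of a b g f])

text \<open>
  The defect in the lower bound is \<open>\<parallel>g - p\<parallel>\<^sup>2 \<ge> 0\<close>.
\<close>

lemma dirichlet_approx_le_dirichlet:
  assumes L: "0 < L" and w: "ac 0 L w g" "w 0 = 0" "w L = 0"
  shows "dirichlet_approx L j w \<le> inner_L2 0 L g g"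
proof (rule dirichlet_approx_le)
  fix l
  have "0 \<le> inner_L2 0 L (\<lambda>x. g x - qpoly l x) (\<lambda>x. g x - qpoly l x)" by (rule inner_L2_nonneg)
  then show "dual_bound L w (qpoly l) (dqpoly l) \<le> inner_L2 0 L g g"
    using dual_bound_ac[OF L w(1) qpoly_deriv dqpoly_continuous] w(2,3)
      inner_L2_square_diff[OF ac_L2[OF w(1)] L2_continuous[OF qpoly_continuous]] by simp
qed (rule inner_L2_nonneg)

text \<open>
  The defect \<open>\<parallel>g - p\<parallel>\<^sup>2\<close> can be made arbitrarily small by density of polynomials.
\<close>

lemma dirichlet_approx_tendsto:
  assumes L: "0 < L" and w: "ac 0 L w g" "w 0 = 0" "w L = 0"
  shows "(\<lambda>j. dirichlet_approx L j w) \<longlonglongrightarrow> inner_L2 0 L g g"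
proof (rule LIMSEQ_I)
  fix e :: real assume e: "0 < e"
  have "\<exists>j. inner_L2 0 L g g - e < dirichlet_approx L j w"
  proof (rule ccontr)
    assume "\<not> ?thesis"
    then have le: "dirichlet_approx L j w \<le> inner_L2 0 L g g - e" for j by (simp add: not_less)
    have C: "dual_bound L w (qpoly l) (dqpoly l) \<le> inner_L2 0 L g g - e" for l
      using dual_bound_le_approx[of L w l] le order_trans by blast
    obtain q where q: "real_polynomial_function q" "inner_L2 0 L (\<lambda>x. g x - q x) (\<lambda>x. g x - q x) < e"
      using polynomials_dense_L2[OF L ac_L2[OF w(1)] e] by blast
    obtain q' where q': "real_polynomial_function q'" "\<And>x. (q has_real_derivative q' x) (at x)"
      using has_real_derivative_polynomial_function[OF q(1)] by blast
    have "dual_bound L w q q' \<le> inner_L2 0 L g g - e"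
      by (rule dual_bound_real_polynomial[OF ac_fun_L2[OF w(1)] C q(1) q'(2)])
    moreover have "dual_bound L w q q' = 2 * inner_L2 0 L g q - inner_L2 0 L q q"
      using dual_bound_ac[OF L w(1) has_field_derivative_at_within[OF q'(2)] continuous_real_polynomial[OF q'(1)]] w(2,3) by simp
    ultimately show False
      using q(2) inner_L2_square_diff[OF ac_L2[OF w(1)] L2_continuous[OF continuous_real_polynomial[OF q(1)]]] by simp
  qed
  then obtain N where N: "inner_L2 0 L g g - e < dirichlet_approx L N w" by blast
  show "\<exists>no. \<forall>n\<ge>no. norm (dirichlet_approx L n w - inner_L2 0 L g g) < e"
  proof (intro exI allI impI)
    fix n assume "N \<le> n"
    then show "norm (dirichlet_approx L n w - inner_L2 0 L g g) < e"
      using N dirichlet_approx_mono[of N n L w] dirichlet_approx_le_dirichlet[OF L w, of n] by simp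
  qed
qed

lemma power_peak_L2_lim:
  assumes L: "0 < L" and y: "continuous_on {0..L} y" and y01: "\<And>x. x \<in> {0<..<L} \<Longrightarrow> 0 \<le> y x \<and> y x < 1"
  shows "L2_lim 0 L (\<lambda>n x. c * y x ^ n) (\<lambda>_. 0)"
proof (rule L2_lim_dominated[where g="\<lambda>_. \<bar>c\<bar>"])
  show "(\<lambda>x. c * y x ^ n) \<in> borel_measurable (lebesgue_on {0<..<L})" for n
    by (rule continuous_measurable_Ioo) (intro continuous_intros y)
  show "(\<lambda>_. 0) \<in> L2 0 L" "(\<lambda>_. \<bar>c\<bar>) \<in> L2 0 L" by (rule L2_continuous, simp)+
  show "AE x in lebesgue_on {0<..<L}. (\<lambda>n. c * y x ^ n) \<longlonglongrightarrow> 0"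
    using lebesgue_on_ae_space[of "{0<..<L}"]
  proof eventually_elim
    case (elim x)
    show ?case by (rule tendsto_mult_right_zero[OF LIMSEQ_realpow_zero]) (use y01[OF elim] in auto)
  qed
  show "AE x in lebesgue_on {0<..<L}. \<bar>c * y x ^ n - 0\<bar> \<le> \<bar>c\<bar>" for n
    using lebesgue_on_ae_space[of "{0<..<L}"]
  proof eventually_elim
    case (elim x)
    have "y x ^ n \<le> 1" "0 \<le> y x ^ n" using y01[OF elim] by (auto intro: power_le_one)
    then show ?case by (simp add: abs_mult mult_left_le)
  qed
qed

text \<open>
  Without boundary conditions \<open>dual_bound\<close> contains the boundary terms \<open>w(L) p(L) - w(0) p(0)\<close>.
  Polynomials that are concentrated at one end can have an arbitrarily large value there and an
  arbitrarily small norm, so a nonzero boundary value would make the supremum infinite.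
\<close>

lemma bounded_dirichlet_approx_trace:
  assumes L: "0 < L" and w: "ac 0 L w g" and C: "\<And>j. dirichlet_approx L j w \<le> C"
  shows "w 0 = 0" "w L = 0"
proof -
  have C': "dual_bound L w (qpoly l) (dqpoly l) \<le> C" for l
    using dual_bound_le_approx[of L w l] C order_trans by blast
  \<comment> \<open>Test with \<open>c y\<^sup>n\<close>, which tends to \<open>0\<close> in \<open>L\<^sup>2\<close> but not at the endpoint.\<close>
  have peak: "- 2 * c * (w L * k1 - w 0 * k0) \<le> C"
    if y: "real_polynomial_function y" "\<And>x. x \<in> {0<..<L} \<Longrightarrow> 0 \<le> y x \<and> y x < 1"
      and k: "(\<lambda>n. y L ^ n) \<longlonglongrightarrow> k1" "(\<lambda>n. y 0 ^ n) \<longlonglongrightarrow> k0" for y c k0 k1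
  proof -
    let ?p = "\<lambda>n x. c * y x ^ n"
    have rp: "real_polynomial_function (?p n)" for n
      using y(1) by (intro real_polynomial_function.intros(4) real_polynomial_function.intros(2) real_polynomial_function_power)
    have lim: "L2_lim 0 L ?p (\<lambda>_. 0)"
      by (rule power_peak_L2_lim[OF L continuous_real_polynomial[OF y(1)] y(2)])
    have bound: "2 * inner_L2 0 L g (?p n) - inner_L2 0 L (?p n) (?p n) - 2 * (w L * (c * y L ^ n) - w 0 * (c * y 0 ^ n)) \<le> C" for n
    proof -
      obtain p' where p': "real_polynomial_function p'" "\<And>x. (?p n has_real_derivative p' x) (at x)"
        using has_real_derivative_polynomial_function[OF rp] by blast
      have "dual_bound L w (?p n) p' \<le> C"
        by (rule dual_bound_real_polynomial[OF ac_fun_L2[OF w] C' rp p'(2)])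
      then show ?thesis
        using dual_bound_ac[OF L w has_field_derivative_at_within[OF p'(2)] continuous_real_polynomial[OF p'(1)]] by simp
    qed
    have "(\<lambda>n. 2 * inner_L2 0 L g (?p n) - inner_L2 0 L (?p n) (?p n) - 2 * (w L * (c * y L ^ n) - w 0 * (c * y 0 ^ n)))
      \<longlonglongrightarrow> 2 * inner_L2 0 L g (\<lambda>_. 0) - inner_L2 0 L (\<lambda>_. 0) (\<lambda>_. 0) - 2 * (w L * (c * k1) - w 0 * (c * k0))"
      by (intro tendsto_diff tendsto_mult tendsto_const L2_lim_inner lim L2_lim_const[OF ac_L2[OF w]] k)
    then have "2 * inner_L2 0 L g (\<lambda>_. 0) - inner_L2 0 L (\<lambda>_. 0) (\<lambda>_. 0) - 2 * (w L * (c * k1) - w 0 * (c * k0)) \<le> C"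
      by (rule LIMSEQ_le_const2) (use bound in blast)
    then show ?thesis by (simp add: inner_L2_def algebra_simps)
  qed
  have lin: "real_polynomial_function (\<lambda>x::real. x)"
    using real_polynomial_function.intros(1)[OF bounded_linear_ident] .
  have zero: "s = 0" if "\<And>c. - 2 * c * s \<le> C" for s :: real
  proof (rule ccontr)
    assume "s \<noteq> 0"
    \<comment> \<open>This choice of \<open>c\<close> gives \<open>\<bar>C\<bar> + 1 \<le> C\<close>.\<close>
    then show False using that[of "- (\<bar>C\<bar> + 1) / (2 * s)"] by simp
  qed
  show "w L = 0"
  proof (rule zero)
    fix c
    have "- 2 * c * (w L * 1 - w 0 * 0) \<le> C"
    proof (rule peak[of "\<lambda>x. (1 / L) * x"])
      show "real_polynomial_function (\<lambda>x. 1 / L * x)"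
        by (intro real_polynomial_function.intros(4) real_polynomial_function.intros(2) lin)
      show "(\<lambda>n. (1 / L * 0) ^ n) \<longlonglongrightarrow> 0" by (rule LIMSEQ_realpow_zero) auto
    qed (use L in auto)
    then show "- 2 * c * w L \<le> C" by simp
  qed
  show "w 0 = 0"
  proof (rule zero)
    fix c
    have "- 2 * (- c) * (w L * 0 - w 0 * 1) \<le> C"
    proof (rule peak[of "\<lambda>x. 1 - (1 / L) * x"])
      show "real_polynomial_function (\<lambda>x. 1 - 1 / L * x)"
        by (intro real_polynomial_function_diff real_polynomial_function.intros(4) real_polynomial_function.intros(2) lin)
      show "(\<lambda>n. (1 - 1 / L * L) ^ n) \<longlonglongrightarrow> 0" using L by (intro LIMSEQ_realpow_zero) auto
    qed (use L in auto)
    then show "- 2 * c * w 0 \<le> C" by simp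
  qed
qed

section \<open>States as elements of a Hilbert space\<close>

definition zero_ext :: "real \<Rightarrow> real \<Rightarrow> (real \<Rightarrow> real) \<Rightarrow> real \<Rightarrow> real" where
  "zero_ext a b f x = indicator {a<..<b} x * f x"

lemma zero_ext_square: "(zero_ext a b f x)\<^sup>2 = indicator {a<..<b} x * (f x)\<^sup>2"
  by (simp add: zero_ext_def indicator_def)

lemma zero_ext_sq_integrable: "f \<in> L2 a b \<Longrightarrow> sq_integrable (zero_ext a b f)"
  unfolding sq_integrable_def zero_ext_square
  by (auto simp: L2_iff zero_ext_def[abs_def] integrable_lebesgue_on_iff borel_measurable_lebesgue_on_iff)

lemma rep_L2: "rep x \<in> L2 a b"
proof -
  have m: "rep x \<in> borel_measurable lebesgue" by (rule rep_measurable)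
  have "integrable lebesgue (\<lambda>t. indicator {a<..<b} t *\<^sub>R (rep x t * rep x t))"
    by (intro integrable_mult_indicator rep_mult_integrable) simp
  moreover have "(\<lambda>t. indicator {a<..<b} t * rep x t) \<in> borel_measurable lebesgue"
    by (intro borel_measurable_times borel_measurable_indicator m) simp
  ultimately show ?thesis
    by (simp add: L2_iff integrable_lebesgue_on_iff borel_measurable_lebesgue_on_iff power2_eq_square)
qed

lemma rep_cls_zero_ext:
  assumes "f \<in> L2 a b"
  shows "AE x in lebesgue_on {a<..<b}. rep (cls (zero_ext a b f)) x = f x"
proof -
  have "AE x in lebesgue. x \<in> {a<..<b} \<longrightarrow> rep (cls (zero_ext a b f)) x = f x"
    using rep_cls[OF zero_ext_sq_integrable[OF assms]] by eventually_elim (simp add: zero_ext_def)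
  then show ?thesis by (simp add: AE_lebesgue_on_iff)
qed

lemma inner_cls_zero_ext:
  assumes f: "f \<in> L2 a b"
  shows "cls (zero_ext a b f) \<bullet> y = inner_L2 a b f (rep y)"
proof -
  have "cls (zero_ext a b f) \<bullet> y = cls (zero_ext a b f) \<bullet> cls (rep y)" by (simp add: cls_rep)
  also have "\<dots> = integral\<^sup>L lebesgue (\<lambda>x. zero_ext a b f x * rep y x)"
    by (rule inner_cls[OF zero_ext_sq_integrable[OF f] rep_sq_integrable])
  also have "\<dots> = inner_L2 a b f (rep y)"
    by (simp add: inner_L2_def integral_lebesgue_on_eq zero_ext_def mult.assoc)
  finally show ?thesis .
qed

lemma cls_zero_ext_lincomb:
  assumes "f \<in> L2 a b" "g \<in> L2 a b"
  shows "cls (zero_ext a b (\<lambda>x. c * f x + d * g x)) = c *\<^sub>R cls (zero_ext a b f) + d *\<^sub>R cls (zero_ext a b g)"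
proof -
  note f = zero_ext_sq_integrable[OF assms(1)] and g = zero_ext_sq_integrable[OF assms(2)]
  have "zero_ext a b (\<lambda>x. c * f x + d * g x) = (\<lambda>x. c * zero_ext a b f x + d * zero_ext a b g x)"
    by (auto simp: zero_ext_def algebra_simps)
  then show ?thesis
    using f g by (simp add: cls_scaleR cls_add sq_integrable_cmult)
qed

lemma AE_lebesgue_to_Ioo: "AE x in lebesgue. P x \<Longrightarrow> AE x in lebesgue_on {a<..<b::real}. P x"
  by (auto simp: AE_lebesgue_on_iff elim: eventually_mono)

text \<open>
  Restriction to the interval and multiplication by a continuous weight are bounded operators.
\<close>

lemma weighted_bilinear:
  assumes p: "continuous_on {a..b} p"
  shows "bounded_bilinear (\<lambda>x y. inner_L2 a b (\<lambda>t. p t * rep x t) (rep y))"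
proof -
  obtain K0 where K0: "\<forall>t\<in>{a..b}. \<bar>p t\<bar> \<le> K0" using continuous_bounded_Icc[OF p] by blast
  define K where "K = max 0 K0"
  have K: "0 \<le> K" "\<And>t. t \<in> {a<..<b} \<Longrightarrow> \<bar>p t\<bar> \<le> K" using K0 by (auto simp: K_def le_max_iff_disj)
  have pL: "(\<lambda>t. p t * rep x t) \<in> L2 a b" for x by (rule L2_continuous_mult[OF rep_L2 p])
  have nrm: "norm_L2 a b (rep x) \<le> norm x" for x
  proof -
    have "inner_L2 a b (rep x) (rep x) = integral\<^sup>L lebesgue (\<lambda>t. indicator {a<..<b} t * (rep x t * rep x t))"
      by (simp add: inner_L2_def integral_lebesgue_on_eq)
    also have "\<dots> \<le> integral\<^sup>L lebesgue (\<lambda>t. rep x t * rep x t)"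
    proof (rule Bochner_Integration.integral_mono)
      show "integrable lebesgue (\<lambda>t. indicator {a<..<b} t * (rep x t * rep x t))"
        using integrable_mult_indicator[of "{a<..<b}" lebesgue, OF _ rep_mult_integrable[of x x]] by simp
    qed (auto simp: indicator_def rep_mult_integrable)
    finally show ?thesis by (simp add: norm_L2_def norm_lsq_def inner_lsq_def)
  qed
  show ?thesis
  proof (rule bounded_bilinear.intro)
    fix x x' y :: lsq
    have "inner_L2 a b (\<lambda>t. p t * rep (x + x') t) (rep y) = inner_L2 a b (\<lambda>t. p t * rep x t + p t * rep x' t) (rep y)"
    proof (rule inner_L2_AE_cong[OF pL rep_L2])
      show "AE t in lebesgue_on {a<..<b}. p t * rep (x + x') t = p t * rep x t + p t * rep x' t"
        using AE_lebesgue_to_Ioo[OF rep_add[of x x']] by eventually_elim (simp add: distrib_left)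
    qed simp
    then show "inner_L2 a b (\<lambda>t. p t * rep (x + x') t) (rep y) = inner_L2 a b (\<lambda>t. p t * rep x t) (rep y) + inner_L2 a b (\<lambda>t. p t * rep x' t) (rep y)"
      by (simp add: inner_L2_add_left pL rep_L2)
  next
    fix x y y' :: lsq
    have "inner_L2 a b (\<lambda>t. p t * rep x t) (rep (y + y')) = inner_L2 a b (\<lambda>t. p t * rep x t) (\<lambda>t. rep y t + rep y' t)"
      by (rule inner_L2_AE_cong[OF pL rep_L2 _ AE_lebesgue_to_Ioo[OF rep_add]]) simp
    then show "inner_L2 a b (\<lambda>t. p t * rep x t) (rep (y + y')) = inner_L2 a b (\<lambda>t. p t * rep x t) (rep y) + inner_L2 a b (\<lambda>t. p t * rep x t) (rep y')"
      by (simp add: inner_L2_add_right pL rep_L2)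
  next
    fix c :: real and x y :: lsq
    have "inner_L2 a b (\<lambda>t. p t * rep (c *\<^sub>R x) t) (rep y) = inner_L2 a b (\<lambda>t. c * (p t * rep x t)) (rep y)"
    proof (rule inner_L2_AE_cong[OF pL rep_L2])
      show "AE t in lebesgue_on {a<..<b}. p t * rep (c *\<^sub>R x) t = c * (p t * rep x t)"
        using AE_lebesgue_to_Ioo[OF rep_scaleR[of c x]] by eventually_elim simp
    qed simp
    then show "inner_L2 a b (\<lambda>t. p t * rep (c *\<^sub>R x) t) (rep y) = c *\<^sub>R inner_L2 a b (\<lambda>t. p t * rep x t) (rep y)"
      by (simp add: inner_L2_cmult_left)
    have "inner_L2 a b (\<lambda>t. p t * rep x t) (rep (c *\<^sub>R y)) = inner_L2 a b (\<lambda>t. p t * rep x t) (\<lambda>t. c * rep y t)"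
      by (rule inner_L2_AE_cong[OF pL rep_L2 _ AE_lebesgue_to_Ioo[OF rep_scaleR]]) simp
    then show "inner_L2 a b (\<lambda>t. p t * rep x t) (rep (c *\<^sub>R y)) = c *\<^sub>R inner_L2 a b (\<lambda>t. p t * rep x t) (rep y)"
      by (simp add: inner_L2_cmult_right)
  next
    show "\<exists>K. \<forall>x y. norm (inner_L2 a b (\<lambda>t. p t * rep x t) (rep y)) \<le> norm x * norm y * K"
    proof (intro exI allI)
      fix x y :: lsq
      have "inner_L2 a b (\<lambda>t. p t * rep x t) (\<lambda>t. p t * rep x t) \<le> integral\<^sup>L (lebesgue_on {a<..<b}) (\<lambda>t. K\<^sup>2 * (rep x t * rep x t))"
        unfolding inner_L2_def
      proof (rule integral_mono_AE)
        show "AE t in lebesgue_on {a<..<b}. p t * rep x t * (p t * rep x t) \<le> K\<^sup>2 * (rep x t * rep x t)"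
          using lebesgue_on_ae_space[of "{a<..<b}"]
        proof eventually_elim
          case (elim t)
          have "\<bar>p t\<bar> \<le> \<bar>K\<bar>" using K(2)[OF elim] by simp
          then have "(p t)\<^sup>2 \<le> K\<^sup>2" by (simp add: abs_le_square_iff)
          then have "(p t)\<^sup>2 * (rep x t * rep x t) \<le> K\<^sup>2 * (rep x t * rep x t)" by (rule mult_right_mono) simp
          then show ?case by (simp add: power2_eq_square mult_ac)
        qed
      qed (auto intro!: L2_mult_integrable pL rep_L2)
      also have "\<dots> = (K * norm_L2 a b (rep x))\<^sup>2"
        by (simp add: power_mult_distrib norm_L2_power2) (simp add: inner_L2_def)
      finally have "norm_L2 a b (\<lambda>t. p t * rep x t) \<le> K * norm_L2 a b (rep x)"
        unfolding norm_L2_power2[symmetric] by (rule power2_le_imp_le) (simp add: K(1) norm_L2_nonneg)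
      also have "\<dots> \<le> K * norm x" using K(1) nrm by (rule mult_left_mono[rotated])
      finally have *: "norm_L2 a b (\<lambda>t. p t * rep x t) \<le> K * norm x" .
      have "norm (inner_L2 a b (\<lambda>t. p t * rep x t) (rep y)) \<le> norm_L2 a b (\<lambda>t. p t * rep x t) * norm_L2 a b (rep y)"
        using inner_L2_le_norms[OF pL rep_L2] by simp
      also have "\<dots> \<le> (K * norm x) * norm y"
        using * nrm[of y] K(1) by (intro mult_mono) (auto simp: norm_L2_nonneg)
      finally show "norm (inner_L2 a b (\<lambda>t. p t * rep x t) (rep y)) \<le> norm x * norm y * K" by (simp add: mult_ac)
    qed
  qed
qed

type_synonym hstate = "lsq \<times> lsq \<times> lsq"

locale state_space =
  fixes L h \<beta> :: real
  assumes L: "0 < L" and h: "0 < h" and \<beta>: "0 < \<beta>"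
begin

text \<open>
  Scaling the third component turns the weight \<open>\<beta> h\<close> of the inner product of the state space into
  the standard inner product of a product space.
\<close>

definition zscale :: real where "zscale = sqrt (\<beta> * h)"

lemma zscale: "0 < zscale" "zscale * zscale = \<beta> * h" using h \<beta> by (simp_all add: zscale_def)

fun emb :: "state \<Rightarrow> hstate" where
  "emb (u, v, z) = (cls (zero_ext 0 L u), cls (zero_ext 0 L v), zscale *\<^sub>R cls (zero_ext 0 1 z))"

text \<open>
  The adjoint of \<open>emb\<close> up to the identification of states that agree almost everywhere:
  \<open>emb \<circ> proj\<close> is the orthogonal projection onto the classes of functions supported in the
  intervals.
\<close>

fun proj :: "hstate \<Rightarrow> state" where
  "proj (x, y, z) = (rep x, rep y, (\<lambda>t. (1 / zscale) * rep z t))"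

lemma proj_H: "proj x \<in> H_space L"
  using L2_cmult[OF rep_L2, of "1 / zscale" _ 0 1] by (cases x) (simp add: H_space_def rep_L2)

lemma lincomb_H: "X \<in> H_space L \<Longrightarrow> Y \<in> H_space L \<Longrightarrow> lincomb a X b Y \<in> H_space L"
  by (cases X; cases Y) (auto simp: H_space_def intro!: L2_add L2_cmult)

lemma emb_lincomb:
  assumes "X \<in> H_space L" "Y \<in> H_space L"
  shows "emb (lincomb a X b Y) = a *\<^sub>R emb X + b *\<^sub>R emb Y"
  using assms by (cases X; cases Y) (auto simp: H_space_def cls_zero_ext_lincomb scaleR_add_right mult.commute[of zscale])

lemma inner_emb_proj:
  assumes "X \<in> H_space L"
  shows "emb X \<bullet> y = inner_H L h \<beta> X (proj y)"
proof (cases X; cases y)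
  fix u v z x1 x2 x3 assume X: "X = (u, v, z)" "y = (x1, x2, x3)"
  then have L2: "u \<in> L2 0 L" "v \<in> L2 0 L" "z \<in> L2 0 1" using assms by (auto simp: H_space_def)
  have "zscale * inner_L2 0 1 z (rep x3) = \<beta> * h * inner_L2 0 1 z (\<lambda>t. (1 / zscale) * rep x3 t)"
    unfolding inner_L2_cmult_right using zscale by (simp add: zscale(2)[symmetric])
  then show ?thesis
    unfolding X by (simp add: inner_prod_def inner_cls_zero_ext L2)
qed

lemma proj_emb_AE:
  assumes "X \<in> H_space L"
  shows "AE x in lebesgue_on {0<..<L}. fst (proj (emb X)) x = fst X x"
    "AE x in lebesgue_on {0<..<L}. fst (snd (proj (emb X))) x = fst (snd X) x"
    "AE x in lebesgue_on {0<..<1}. snd (snd (proj (emb X))) x = snd (snd X) x"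
proof -
  obtain u v z where X: "X = (u, v, z)" by (cases X)
  then have L2: "u \<in> L2 0 L" "v \<in> L2 0 L" "z \<in> L2 0 1" using assms by (auto simp: H_space_def)
  show "AE x in lebesgue_on {0<..<L}. fst (proj (emb X)) x = fst X x"
    "AE x in lebesgue_on {0<..<L}. fst (snd (proj (emb X))) x = fst (snd X) x"
    using rep_cls_zero_ext[OF L2(1)] rep_cls_zero_ext[OF L2(2)] by (simp_all add: X)
  show "AE x in lebesgue_on {0<..<1}. snd (snd (proj (emb X))) x = snd (snd X) x"
    using rep_cls_zero_ext[OF L2(3)] AE_lebesgue_to_Ioo[OF rep_scaleR[of zscale "cls (zero_ext 0 1 z)"]]
    by eventually_elim (use zscale(1) in \<open>simp add: X\<close>)
qed

lemma inner_H_AE_cong: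
  assumes "X \<in> H_space L" "Y \<in> H_space L"
    and "AE x in lebesgue_on {0<..<L}. fst Y x = fst Y' x" "AE x in lebesgue_on {0<..<L}. fst (snd Y) x = fst (snd Y') x"
      "AE x in lebesgue_on {0<..<1}. snd (snd Y) x = snd (snd Y') x"
  shows "inner_H L h \<beta> X Y = inner_H L h \<beta> X Y'"
proof -
  obtain u v z u' v' z' u'' v'' z'' where X: "X = (u, v, z)" "Y = (u', v', z')" "Y' = (u'', v'', z'')" by (metis prod_cases3)
  have "inner_L2 0 L u u' = inner_L2 0 L u u''" "inner_L2 0 L v v' = inner_L2 0 L v v''" "inner_L2 0 1 z z' = inner_L2 0 1 z z''"
    using assms unfolding X H_space_def by (auto intro!: inner_L2_AE_cong)
  then show ?thesis by (simp add: X)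
qed

lemma inner_emb:
  assumes "X \<in> H_space L" "Y \<in> H_space L"
  shows "emb X \<bullet> emb Y = inner_H L h \<beta> X Y"
  unfolding inner_emb_proj[OF assms(1)]
  by (rule inner_H_AE_cong[OF assms(1) proj_H proj_emb_AE[OF assms(2)]])

lemma norm_emb: "X \<in> H_space L \<Longrightarrow> norm (emb X) = norm_H L h \<beta> X"
  by (simp add: norm_eq_sqrt_inner norm_H_def inner_emb)

lemma dist_emb:
  assumes "X \<in> H_space L" "Y \<in> H_space L"
  shows "dist_H L h \<beta> X Y = norm (emb X - emb Y)"
  using norm_emb[OF lincomb_H[OF assms], of 1 "-1"] emb_lincomb[OF assms, of 1 "-1"]
  by (simp add: dist_H_def)

lemma emb_eqI:
  assumes "X \<in> H_space L" "Y \<in> H_space L" "\<And>Z. Z \<in> H_space L \<Longrightarrow> inner_H L h \<beta> Z X = inner_H L h \<beta> Z Y"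
  shows "emb X = emb Y"
proof -
  have "emb Z \<bullet> (emb X - emb Y) = 0" if "Z \<in> H_space L" for Z
    using assms(3)[OF that] by (simp add: inner_diff_right inner_emb assms that)
  from this[OF lincomb_H[OF assms(1,2)], of 1 "-1"]
  have "(emb X - emb Y) \<bullet> (emb X - emb Y) = 0" by (simp add: emb_lincomb assms)
  then show ?thesis by simp
qed

lemma emb_proj_emb:
  assumes X: "X \<in> H_space L" shows "emb (proj (emb X)) = emb X"
  by (rule emb_eqI[OF proj_H X]) (rule inner_H_AE_cong[OF _ proj_H proj_emb_AE[OF X]])

lemma inner_emb_proj_symmetric: "emb (proj x) \<bullet> y = x \<bullet> emb (proj y)"
  using inner_emb_proj[OF proj_H, of x y] inner_emb_proj[OF proj_H, of y x]
    inner_emb[OF proj_H proj_H, of x y] by (metis inner_commute inner_emb proj_H)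

text \<open>
  Representatives are chosen arbitrarily, so linearity is not visible from the definitions; it
  follows from the symmetry of the projection with respect to the inner product.
\<close>

lemma bounded_linear_emb_proj: "bounded_linear (\<lambda>x. emb (proj x))"
  and norm_emb_proj: "norm (emb (proj x)) \<le> norm x"
proof -
  have ext: "x = y" if "\<And>z. x \<bullet> z = y \<bullet> z" for x y :: hstate
  proof -
    have "(x - y) \<bullet> (x - y) = 0" using that[of "x - y"] by (simp add: inner_diff_left)
    then show ?thesis by simp
  qed
  have nb: "norm (emb (proj x)) \<le> norm x" for x
  proof -
    have "norm (emb (proj x)) * norm (emb (proj x)) = emb (proj x) \<bullet> emb (proj x)"
      by (simp add: dot_square_norm power2_eq_square)
    also have "\<dots> = emb (proj x) \<bullet> x"
      using inner_emb_proj[OF proj_H, of x x] inner_emb[OF proj_H proj_H, of x x] by simp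
    also have "\<dots> \<le> norm (emb (proj x)) * norm x" by (rule norm_cauchy_schwarz)
    finally show ?thesis by (cases "emb (proj x) = 0") auto
  qed
  show "bounded_linear (\<lambda>x. emb (proj x))"
  proof (rule bounded_linear_intro[where K=1])
    show "emb (proj (x + y)) = emb (proj x) + emb (proj y)" for x y
      by (rule ext) (simp add: inner_emb_proj_symmetric inner_add_left)
    show "emb (proj (r *\<^sub>R x)) = r *\<^sub>R emb (proj x)" for r x
      by (rule ext) (simp add: inner_emb_proj_symmetric)
    show "norm (emb (proj x)) \<le> norm x * 1" for x using nb by simp
  qed
  show "norm (emb (proj x)) \<le> norm x" by (rule nb)
qed

lemma dist_emb_proj_le:
  assumes "X \<in> H_space L" shows "norm (emb X - emb (proj y)) \<le> norm (emb X - y)"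
proof -
  have "emb X - emb (proj y) = emb (proj (emb X - y))"
    using linear_diff[OF bounded_linear.linear[OF bounded_linear_emb_proj], of "emb X" y] assms
    by (simp add: emb_proj_emb)
  then show ?thesis using norm_emb_proj by simp
qed

end

section \<open>Weighted energies and the semigroup on the Hilbert space\<close>

context state_space
begin

lemma emb_eq_iff_dist: "X \<in> H_space L \<Longrightarrow> Y \<in> H_space L \<Longrightarrow> dist_H L h \<beta> X Y = 0 \<longleftrightarrow> emb X = emb Y"
  by (simp add: dist_emb)

text \<open>
  For \<open>X = Y\<close> this is twice the Lyapunov functional; with zero weights it is the inner product of
  the state space.
\<close>

definition wform :: "real \<Rightarrow> real \<Rightarrow> state \<Rightarrow> state \<Rightarrow> real" where
  "wform m1 m2 X Y =
     inner_L2 0 L (\<lambda>x. (1 + m1 * (L - x)) * fst X x) (fst Y)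
     + inner_L2 0 L (\<lambda>x. (1 + m1 * x) * fst (snd X) x) (fst (snd Y))
     + \<beta> * h * inner_L2 0 1 (\<lambda>x. (1 + m2 * (1 - x)) * snd (snd X) x) (snd (snd Y))"

text \<open>
  The continuous lower bounds of the dissipation \<open>D\<close>.
\<close>

definition diss_approx :: "real \<Rightarrow> real \<Rightarrow> nat \<Rightarrow> state \<Rightarrow> real" where
  "diss_approx m1 m2 j X = 3 / 4 * m1 * dirichlet_approx L j (fst X) + 3 / 2 * m1 * dirichlet_approx L j (fst (snd X))
     + 1 / 2 * \<beta> * m2 * inner_L2 0 1 (snd (snd X)) (snd (snd X))"

definition ae_eq :: "state \<Rightarrow> state \<Rightarrow> bool" where
  "ae_eq X Y \<longleftrightarrow> (AE x in lebesgue_on {0<..<L}. fst X x = fst Y x) \<and>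
     (AE x in lebesgue_on {0<..<L}. fst (snd X) x = fst (snd Y) x) \<and>
     (AE x in lebesgue_on {0<..<1}. snd (snd X) x = snd (snd Y) x)"

lemma H_space_iff: "X \<in> H_space L \<longleftrightarrow> fst X \<in> L2 0 L \<and> fst (snd X) \<in> L2 0 L \<and> snd (snd X) \<in> L2 0 1"
  by (cases X) (simp add: H_space_def)

lemma emb_eq_ae:
  assumes X: "X \<in> H_space L" and Y: "Y \<in> H_space L" and eq: "emb X = emb Y"
  shows "ae_eq X Y"
  unfolding ae_eq_def
proof (intro conjI)
  show "AE x in lebesgue_on {0<..<L}. fst X x = fst Y x"
    using proj_emb_AE(1)[OF X] proj_emb_AE(1)[OF Y] unfolding eq by eventually_elim simp
  show "AE x in lebesgue_on {0<..<L}. fst (snd X) x = fst (snd Y) x"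
    using proj_emb_AE(2)[OF X] proj_emb_AE(2)[OF Y] unfolding eq by eventually_elim simp
  show "AE x in lebesgue_on {0<..<1}. snd (snd X) x = snd (snd Y) x"
    using proj_emb_AE(3)[OF X] proj_emb_AE(3)[OF Y] unfolding eq by eventually_elim simp
qed

lemma ae_eq_proj_emb: "X \<in> H_space L \<Longrightarrow> ae_eq (proj (emb X)) X"
  unfolding ae_eq_def by (intro conjI proj_emb_AE)

lemma wform_cong:
  assumes X: "X \<in> H_space L" and Y: "Y \<in> H_space L" and "ae_eq X X'" "ae_eq Y Y'"
  shows "wform m1 m2 X Y = wform m1 m2 X' Y'"
proof -
  have w: "continuous_on {0..L} (\<lambda>x. 1 + m1 * (L - x))" "continuous_on {0..L} (\<lambda>x. 1 + m1 * x)"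
    "continuous_on {0..1} (\<lambda>x. 1 + m2 * (1 - x))" by (intro continuous_intros)+
  have *: "inner_L2 a b (\<lambda>x. p x * f x) g = inner_L2 a b (\<lambda>x. p x * f' x) g'"
    if "continuous_on {a..b} p" "f \<in> L2 a b" "g \<in> L2 a b" "AE x in lebesgue_on {a<..<b}. f x = f' x"
      "AE x in lebesgue_on {a<..<b}. g x = g' x" for a b p f g f' g'
  proof (rule inner_L2_AE_cong[OF L2_continuous_mult[OF that(2,1)] that(3) _ that(5)])
    show "AE x in lebesgue_on {a<..<b}. p x * f x = p x * f' x" using that(4) by eventually_elim simp
  qed
  show ?thesis
    using assms unfolding wform_def ae_eq_def H_space_iff by (auto intro!: arg_cong2[where f="(+)"] * w)
qed

lemma diss_approx_cong:
  assumes X: "X \<in> H_space L" and "ae_eq X X'"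
  shows "diss_approx m1 m2 j X = diss_approx m1 m2 j X'"
proof -
  have H: "fst X \<in> L2 0 L" "fst (snd X) \<in> L2 0 L" "snd (snd X) \<in> L2 0 1" using X by (simp_all add: H_space_iff)
  have ae: "AE x in lebesgue_on {0<..<L}. fst X x = fst X' x" "AE x in lebesgue_on {0<..<L}. fst (snd X) x = fst (snd X') x"
    "AE x in lebesgue_on {0<..<1}. snd (snd X) x = snd (snd X') x" using assms(2) by (simp_all add: ae_eq_def)
  show ?thesis
    unfolding diss_approx_def dirichlet_approx_AE_cong[OF H(1) ae(1)] dirichlet_approx_AE_cong[OF H(2) ae(2)]
      inner_L2_AE_cong[OF H(3) H(3) ae(3) ae(3)] ..
qed

lemma wform_sym: "wform m1 m2 X Y = wform m1 m2 Y X"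
  by (simp add: wform_def inner_L2_def mult_ac)

lemma wform_0: "wform 0 0 X Y = inner_H L h \<beta> X Y"
  by (cases X; cases Y) (simp add: wform_def)

definition hform :: "real \<Rightarrow> real \<Rightarrow> hstate \<Rightarrow> hstate \<Rightarrow> real" where
  "hform m1 m2 x y = wform m1 m2 (proj x) (proj y)"

lemma hform_emb: "X \<in> H_space L \<Longrightarrow> Y \<in> H_space L \<Longrightarrow> hform m1 m2 (emb X) (emb Y) = wform m1 m2 X Y"
  unfolding hform_def by (rule wform_cong) (auto simp: proj_H ae_eq_proj_emb)

lemma ae_eq_refl: "ae_eq X X" by (simp add: ae_eq_def)

lemma hform_emb_left: "X \<in> H_space L \<Longrightarrow> hform m1 m2 (emb X) y = wform m1 m2 X (proj y)"
  unfolding hform_def by (rule wform_cong[OF proj_H proj_H ae_eq_proj_emb ae_eq_refl])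

lemma hform_0_emb: "X \<in> H_space L \<Longrightarrow> hform 0 0 (emb X) y = emb X \<bullet> y"
  by (simp add: hform_emb_left wform_0 inner_emb_proj)

lemma bounded_bilinear_add:
  assumes "bounded_bilinear f" "bounded_bilinear g"
  shows "bounded_bilinear (\<lambda>x y. f x y + g x y :: real)"
proof -
  interpret f: bounded_bilinear f by fact
  interpret g: bounded_bilinear g by fact
  obtain K1 where K1: "\<And>x y. norm (f x y) \<le> norm x * norm y * K1" using f.bounded by blast
  obtain K2 where K2: "\<And>x y. norm (g x y) \<le> norm x * norm y * K2" using g.bounded by blast
  show ?thesis
  proof (rule bounded_bilinear.intro)
    show "\<exists>K. \<forall>a b. norm (f a b + g a b) \<le> norm a * norm b * K"
    proof (intro exI allI)
      fix a b show "norm (f a b + g a b) \<le> norm a * norm b * (K1 + K2)"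
        using norm_triangle_ineq[of "f a b" "g a b"] K1[of a b] K2[of a b] unfolding distrib_left by linarith
    qed
  qed (simp_all add: f.add_left f.add_right g.add_left g.add_right f.scaleR_left f.scaleR_right g.scaleR_left g.scaleR_right distrib_left)
qed

lemma bounded_bilinear_hform: "bounded_bilinear (hform m1 m2)"
proof -
  have eq: "hform m1 m2 = (\<lambda>x y. inner_L2 0 L (\<lambda>t. (1 + m1 * (L - t)) * rep (fst x) t) (rep (fst y))
     + inner_L2 0 L (\<lambda>t. (1 + m1 * t) * rep (fst (snd x)) t) (rep (fst (snd y)))
     + inner_L2 0 1 (\<lambda>t. (1 + m2 * (1 - t)) * rep (snd (snd x)) t) (rep (snd (snd y))))"
  proof (intro ext)
    fix x y :: hstate
    obtain x1 x2 x3 y1 y2 y3 where xy: "x = (x1, x2, x3)" "y = (y1, y2, y3)" by (metis prod_cases3)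
    have "(\<lambda>t. (1 + m2 * (1 - t)) * (1 / zscale * rep x3 t)) = (\<lambda>t. (1 / zscale) * ((1 + m2 * (1 - t)) * rep x3 t))" by (auto simp: field_simps)
    then have "\<beta> * h * inner_L2 0 1 (\<lambda>t. (1 + m2 * (1 - t)) * (1 / zscale * rep x3 t)) (\<lambda>t. 1 / zscale * rep y3 t)
        = \<beta> * h * ((1 / zscale) * ((1 / zscale) * inner_L2 0 1 (\<lambda>t. (1 + m2 * (1 - t)) * rep x3 t) (rep y3)))"
      by (simp only: inner_L2_cmult_left inner_L2_cmult_right)
    also have "\<dots> = inner_L2 0 1 (\<lambda>t. (1 + m2 * (1 - t)) * rep x3 t) (rep y3)"
      using zscale by (simp add: zscale(2)[symmetric])
    finally show "hform m1 m2 x y = inner_L2 0 L (\<lambda>t. (1 + m1 * (L - t)) * rep (fst x) t) (rep (fst y))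
     + inner_L2 0 L (\<lambda>t. (1 + m1 * t) * rep (fst (snd x)) t) (rep (fst (snd y)))
     + inner_L2 0 1 (\<lambda>t. (1 + m2 * (1 - t)) * rep (snd (snd x)) t) (rep (snd (snd y)))"
      unfolding xy hform_def wform_def by simp
  qed
  note bl = bounded_linear_fst bounded_linear_compose[OF bounded_linear_fst bounded_linear_snd]
    bounded_linear_compose[OF bounded_linear_snd bounded_linear_snd]
  show ?thesis unfolding eq
    by (intro bounded_bilinear_add bounded_bilinear.comp[OF weighted_bilinear] bl continuous_intros)
qed

text \<open>
  Each competitor in the maximum is an affine function of \<open>u\<close>, represented by a fixed vector.
\<close>

lemma dirichlet_approx_rep_continuous: "continuous_on UNIV (\<lambda>a. dirichlet_approx L j (rep a))"
proof (induction j)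
  case (Suc j)
  have "inner_L2 0 L (rep a) (dqpoly l) = cls (zero_ext 0 L (dqpoly l)) \<bullet> a" for a l
    using inner_cls_zero_ext[OF L2_continuous[OF dqpoly_continuous]] by (simp add: inner_L2_commute)
  then show ?case using Suc by (simp add: dual_bound_def) (intro continuous_intros)
qed simp

lemma dirichlet_approx_rep_bounded: "\<exists>C. \<forall>a. norm a \<le> r \<longrightarrow> dirichlet_approx L j (rep a) \<le> C"
proof (induction j)
  case 0 show ?case by (intro exI[of _ 0]) simp
next
  case (Suc j)
  then obtain C where C: "\<forall>a. norm a \<le> r \<longrightarrow> dirichlet_approx L j (rep a) \<le> C" by blast
  let ?l = "from_nat j :: rat list"
  let ?c = "cls (zero_ext 0 L (dqpoly ?l))"
  show ?case
  proof (intro exI[of _ "max C (2 * (norm ?c * r))"] allI impI)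
    fix a :: lsq assume a: "norm a \<le> r"
    have eq: "inner_L2 0 L (rep a) (dqpoly ?l) = ?c \<bullet> a"
      using inner_cls_zero_ext[OF L2_continuous[OF dqpoly_continuous]] by (simp add: inner_L2_commute)
    have "\<bar>?c \<bullet> a\<bar> \<le> norm ?c * norm a" by (rule Cauchy_Schwarz_ineq2)
    also have "\<dots> \<le> norm ?c * r" using a by (intro mult_left_mono) auto
    finally have "- 2 * (?c \<bullet> a) \<le> 2 * (norm ?c * r)" by linarith
    then have "dual_bound L (rep a) (qpoly ?l) (dqpoly ?l) \<le> 2 * (norm ?c * r)"
      unfolding dual_bound_def eq using inner_L2_nonneg[of 0 L "qpoly ?l"] by linarith
    then show "dirichlet_approx L (Suc j) (rep a) \<le> max C (2 * (norm ?c * r))"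
      using C a by (auto simp: le_max_iff_disj)
  qed
qed

definition hdiss :: "real \<Rightarrow> real \<Rightarrow> nat \<Rightarrow> hstate \<Rightarrow> real" where
  "hdiss m1 m2 j x = diss_approx m1 m2 j (proj x)"

lemma hdiss_emb: "X \<in> H_space L \<Longrightarrow> hdiss m1 m2 j (emb X) = diss_approx m1 m2 j X"
  unfolding hdiss_def by (rule diss_approx_cong[OF proj_H ae_eq_proj_emb])

lemma hdiss_eq: "hdiss m1 m2 j x = 3 / 4 * m1 * dirichlet_approx L j (rep (fst x))
    + 3 / 2 * m1 * dirichlet_approx L j (rep (fst (snd x)))
    + m2 / (2 * h) * inner_L2 0 1 (\<lambda>t. 1 * rep (snd (snd x)) t) (rep (snd (snd x)))"
proof -
  obtain x1 x2 x3 where x: "x = (x1, x2, x3)" by (metis prod_cases3)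
  have "1 / 2 * \<beta> * m2 * inner_L2 0 1 (\<lambda>t. 1 / zscale * rep x3 t) (\<lambda>t. 1 / zscale * rep x3 t) = 1 / 2 * \<beta> * m2 * (1 / (zscale * zscale) * inner_L2 0 1 (rep x3) (rep x3))"
    by (simp only: inner_L2_cmult_left inner_L2_cmult_right) simp
  also have "\<dots> = m2 / (2 * h) * inner_L2 0 1 (rep x3) (rep x3)"
    unfolding zscale(2) using \<beta> h by simp
  finally show ?thesis unfolding x hdiss_def diss_approx_def by simp
qed

lemma hdiss_continuous: "continuous_on UNIV (hdiss m1 m2 j)"
  unfolding hdiss_eq[abs_def]
  by (intro continuous_intros continuous_on_compose2[OF dirichlet_approx_rep_continuous]
      bounded_bilinear.continuous_on[OF weighted_bilinear]) auto

lemma norm_fst_le_norm: "norm (fst y) \<le> norm y" by (cases y) (simp add: norm_fst_le)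

lemma norm_snd_le_norm: "norm (snd y) \<le> norm y" by (cases y) (simp add: norm_snd_le)

lemma hdiss_bounded: "\<exists>C. \<forall>x. norm x \<le> r \<longrightarrow> \<bar>hdiss m1 m2 j x\<bar> \<le> C"
proof -
  obtain C where C: "\<And>a. norm a \<le> r \<Longrightarrow> dirichlet_approx L j (rep a) \<le> C"
    using dirichlet_approx_rep_bounded by blast
  obtain K where K: "K > 0" "\<And>x y. norm (inner_L2 0 1 (\<lambda>t. 1 * rep x t) (rep y)) \<le> norm x * norm y * K"
    using bounded_bilinear.pos_bounded[OF weighted_bilinear[OF continuous_on_const, of 0 1 1]] by blast
  have d: "\<bar>m * dirichlet_approx L j (rep a)\<bar> \<le> \<bar>m\<bar> * C" if "norm a \<le> r" for a m
    using C[OF that] dirichlet_approx_nonneg[of L j "rep a"] by (simp add: abs_mult mult_left_mono)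
  show ?thesis
  proof (intro exI allI impI)
    fix x :: hstate assume x: "norm x \<le> r"
    have n: "norm (fst x) \<le> r" "norm (fst (snd x)) \<le> r" "norm (snd (snd x)) \<le> r"
    proof -
      show "norm (fst x) \<le> r" using norm_fst_le_norm[of x] x by linarith
      show "norm (fst (snd x)) \<le> r" using norm_fst_le_norm[of "snd x"] norm_snd_le_norm[of x] x by linarith
      show "norm (snd (snd x)) \<le> r" using norm_snd_le_norm[of "snd x"] norm_snd_le_norm[of x] x by linarith
    qed
    have r: "0 \<le> r" using x norm_ge_zero order_trans by blast
    have "norm (snd (snd x)) * norm (snd (snd x)) * K \<le> r * r * K"
      using n(3) r K(1) by (intro mult_right_mono mult_mono) auto
    then have i: "\<bar>inner_L2 0 1 (\<lambda>t. 1 * rep (snd (snd x)) t) (rep (snd (snd x)))\<bar> \<le> r * r * K"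
      using K(2)[of "snd (snd x)" "snd (snd x)"] by simp
    have "\<bar>m2 / (2 * h) * inner_L2 0 1 (\<lambda>t. 1 * rep (snd (snd x)) t) (rep (snd (snd x)))\<bar> \<le> \<bar>m2 / (2 * h)\<bar> * (r * r * K)"
      unfolding abs_mult[of "m2 / (2 * h)"] using i by (rule mult_left_mono) simp
    then show "\<bar>hdiss m1 m2 j x\<bar> \<le> \<bar>3 / 4 * m1\<bar> * C + \<bar>3 / 2 * m1\<bar> * C + \<bar>m2 / (2 * h)\<bar> * (r * r * K)"
      unfolding hdiss_eq using d[OF n(1), of "3 / 4 * m1"] d[OF n(2), of "3 / 2 * m1"] by linarith
  qed
qed

end

text \<open>
  A semigroup that is given by representatives: all its laws, linearity included, hold up to
  \<open>dist_H\<close>.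
\<close>

locale state_semigroup = state_space +
  fixes S :: "real \<Rightarrow> state \<Rightarrow> state" and Dom :: "state set" and A :: "state \<Rightarrow> state"
  assumes C0: "C0_semigroup L h \<beta> S" and generator: "has_generator L h \<beta> S Dom A"
    and Dom_H: "Dom \<subseteq> H_space L" and A_H: "X \<in> Dom \<Longrightarrow> A X \<in> H_space L"
begin

lemma S_H: "0 \<le> t \<Longrightarrow> X \<in> H_space L \<Longrightarrow> S t X \<in> H_space L"
  using C0 unfolding C0_semigroup_def by blast

lemma emb_S_lincomb:
  assumes t: "0 \<le> t" and X: "X \<in> H_space L" and Y: "Y \<in> H_space L"
  shows "emb (S t (lincomb a X b Y)) = a *\<^sub>R emb (S t X) + b *\<^sub>R emb (S t Y)"
proof -
  have "dist_H L h \<beta> (S t (lincomb a X b Y)) (lincomb a (S t X) b (S t Y)) = 0"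
    using C0 t X Y unfolding C0_semigroup_def by blast
  then have "emb (S t (lincomb a X b Y)) = emb (lincomb a (S t X) b (S t Y))"
    using emb_eq_iff_dist[OF S_H[OF t lincomb_H[OF X Y]] lincomb_H[OF S_H[OF t X] S_H[OF t Y]]] by simp
  then show ?thesis by (simp add: emb_lincomb S_H t X Y)
qed

lemma emb_S_bounded: "0 \<le> t \<Longrightarrow> \<exists>M. \<forall>X\<in>H_space L. norm (emb (S t X)) \<le> M * norm (emb X)"
proof -
  assume t: "0 \<le> t"
  then obtain M where "\<forall>X\<in>H_space L. norm_H L h \<beta> (S t X) \<le> M * norm_H L h \<beta> X"
    using C0 unfolding C0_semigroup_def by blast
  then show ?thesis using t by (intro exI[of _ M]) (simp add: norm_emb S_H)
qed

lemma emb_S_cong: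
  assumes t: "0 \<le> t" and X: "X \<in> H_space L" and Y: "Y \<in> H_space L" and eq: "emb X = emb Y"
  shows "emb (S t X) = emb (S t Y)"
proof -
  obtain M where "norm (emb (S t (lincomb 1 X (-1) Y))) \<le> M * norm (emb (lincomb 1 X (-1) Y))"
    using emb_S_bounded[OF t] lincomb_H[OF X Y] by blast
  then show ?thesis using eq by (simp add: emb_S_lincomb emb_lincomb t X Y)
qed

text \<open>
  The semigroup on the Hilbert space type, extended by zero from the range of \<open>emb\<close>.
\<close>

definition T :: "real \<Rightarrow> hstate \<Rightarrow> hstate" where "T t x = emb (S t (proj x))"

lemma T_emb: "0 \<le> t \<Longrightarrow> X \<in> H_space L \<Longrightarrow> T t (emb X) = emb (S t X)"
  unfolding T_def by (rule emb_S_cong) (simp_all add: proj_H emb_proj_emb)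

lemma emb_S_0: "X \<in> H_space L \<Longrightarrow> emb (S 0 X) = emb X"
  using C0 emb_eq_iff_dist[of "S 0 X" X] S_H[of 0 X] unfolding C0_semigroup_def by simp

lemma T_0_emb: "X \<in> H_space L \<Longrightarrow> T 0 (emb X) = emb X"
  by (simp add: T_emb emb_S_0)

lemma T_0: "T 0 x = emb (proj x)"
  by (simp add: T_def emb_S_0 proj_H)

lemma hilbert_semigroup_T: "hilbert_semigroup T"
proof (rule hilbert_semigroup.intro)
  fix t :: real assume t: "0 \<le> t"
  obtain M where M: "\<And>X. X \<in> H_space L \<Longrightarrow> norm (emb (S t X)) \<le> M * norm (emb X)"
    using emb_S_bounded[OF t] by blast
  note lin = bounded_linear.linear[OF bounded_linear_emb_proj]
  show "bounded_linear (T t)"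
  proof (rule bounded_linear_intro[where K="\<bar>M\<bar>"])
    fix x y
    have "T t (x + y) = emb (S t (lincomb 1 (proj x) 1 (proj y)))"
      unfolding T_def by (rule emb_S_cong) (simp_all add: t proj_H lincomb_H emb_lincomb linear_add[OF lin])
    then show "T t (x + y) = T t x + T t y" by (simp add: T_def emb_S_lincomb t proj_H)
  next
    fix r x
    have "T t (r *\<^sub>R x) = emb (S t (lincomb r (proj x) 0 (proj x)))"
      unfolding T_def by (rule emb_S_cong) (simp_all add: t proj_H lincomb_H emb_lincomb linear_scale[OF lin])
    then show "T t (r *\<^sub>R x) = r *\<^sub>R T t x" by (simp add: T_def emb_S_lincomb t proj_H)
  next
    fix x
    have "norm (T t x) \<le> M * norm (emb (proj x))" unfolding T_def by (rule M[OF proj_H])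
    also have "\<dots> \<le> \<bar>M\<bar> * norm x" using norm_emb_proj[of x] by (intro mult_mono) auto
    finally show "norm (T t x) \<le> norm x * \<bar>M\<bar>" by (simp add: mult.commute)
  qed
next
  fix s t :: real and x assume st: "0 \<le> s" "0 \<le> t"
  have "dist_H L h \<beta> (S (s + t) (proj x)) (S s (S t (proj x))) = 0"
    using C0[unfolded C0_semigroup_def, THEN conjunct2, THEN conjunct2, THEN conjunct2, THEN conjunct2, THEN conjunct1]
      st proj_H[of x] by simp
  then have "emb (S (s + t) (proj x)) = emb (S s (S t (proj x)))"
    using emb_eq_iff_dist[of "S (s + t) (proj x)" "S s (S t (proj x))"] st by (simp add: S_H proj_H)
  then show "T (s + t) x = T s (T t x)"
    using T_emb[of s "S t (proj x)"] st by (simp add: T_def S_H proj_H)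
next
  fix x
  have "((\<lambda>t. dist_H L h \<beta> (S t (proj x)) (proj x)) \<longlongrightarrow> 0) (at_right 0)"
    using C0[unfolded C0_semigroup_def, THEN conjunct2, THEN conjunct2, THEN conjunct2, THEN conjunct2, THEN conjunct2]
      proj_H[of x] by simp
  moreover have "eventually (\<lambda>t. dist_H L h \<beta> (S t (proj x)) (proj x) = norm (T t x - T 0 x)) (at_right 0)"
    unfolding eventually_at_right_field
    by (intro exI[of _ 1]) (auto simp: dist_emb S_H proj_H T_def[of _ x] emb_S_0)
  ultimately have "((\<lambda>t. norm (T t x - T 0 x)) \<longlongrightarrow> 0) (at_right 0)" by (rule Lim_transform_eventually)
  then show "((\<lambda>t. T t x) \<longlongrightarrow> T 0 x) (at_right 0)" using tendsto_norm_zero_iff LIM_zero_cancel by blast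
qed

sublocale hilbert_semigroup T by (rule hilbert_semigroup_T)

lemma difference_quotient_emb:
  assumes "0 \<le> t" "X \<in> H_space L"
  shows "emb (lincomb (1 / t) (S t X) (- 1 / t) X) = (1 / t) *\<^sub>R (T t (emb X) - emb X)"
  using assms by (simp add: emb_lincomb S_H T_emb scaleR_diff_right)

lemma generator_emb:
  assumes X: "X \<in> H_space L" and Y: "Y \<in> H_space L"
  shows "((\<lambda>t. norm ((1 / t) *\<^sub>R (T t (emb X) - emb X) - emb Y)) \<longlongrightarrow> 0) (at_right 0) \<longleftrightarrow> X \<in> Dom \<and> emb (A X) = emb Y"
proof -
  have ev: "eventually (\<lambda>t. norm ((1 / t) *\<^sub>R (T t (emb X) - emb X) - emb Y) = dist_H L h \<beta> (lincomb (1 / t) (S t X) (- 1 / t) X) Y) (at_right 0)"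
    unfolding eventually_at_right_field
  proof (intro exI[of _ 1] conjI allI impI)
    fix t :: real assume "0 < t"
    then show "norm ((1 / t) *\<^sub>R (T t (emb X) - emb X) - emb Y) = dist_H L h \<beta> (lincomb (1 / t) (S t X) (- 1 / t) X) Y"
      using dist_emb[OF lincomb_H[OF S_H[of t, OF _ X] X] Y, of "1 / t" "- 1 / t"] difference_quotient_emb[of t X] X by simp
  qed simp
  have "((\<lambda>t. norm ((1 / t) *\<^sub>R (T t (emb X) - emb X) - emb Y)) \<longlongrightarrow> 0) (at_right 0) \<longleftrightarrow>
     ((\<lambda>t. dist_H L h \<beta> (lincomb (1 / t) (S t X) (- 1 / t) X) Y) \<longlongrightarrow> 0) (at_right 0)"
    by (rule tendsto_cong[OF ev])
  also have "\<dots> \<longleftrightarrow> X \<in> Dom \<and> dist_H L h \<beta> (A X) Y = 0"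
    using generator X Y unfolding has_generator_def by blast
  also have "\<dots> \<longleftrightarrow> X \<in> Dom \<and> emb (A X) = emb Y" using emb_eq_iff_dist[OF A_H Y] by blast
  finally show ?thesis .
qed

lemma gen_emb_A:
  assumes X: "X \<in> Dom" shows "gen (emb X) (emb (A X))"
proof -
  have H: "X \<in> H_space L" using X Dom_H by blast
  have "((\<lambda>t. norm ((1 / t) *\<^sub>R (T t (emb X) - emb X) - emb (A X))) \<longlongrightarrow> 0) (at_right 0)"
    using generator_emb[OF H A_H[OF X]] X by simp
  then have "((\<lambda>t. (1 / t) *\<^sub>R (T t (emb X) - emb X)) \<longlongrightarrow> emb (A X)) (at_right 0)"
    using tendsto_norm_zero_iff LIM_zero_cancel by blast
  then show ?thesis by (simp add: gen_def T_0_emb H)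
qed

text \<open>
  Difference quotients of \<open>x\<close> lie in the range of the projection, so projecting their limit does
  not increase the distance to them; hence the given operator determines the abstract generator.
\<close>

lemma genD:
  assumes g: "gen x y"
  shows "proj x \<in> Dom" "emb (proj x) = x" "emb (A (proj x)) = emb (proj y)"
proof -
  show x: "emb (proj x) = x" using g by (simp add: gen_def T_0)
  have "((\<lambda>t. (1 / t) *\<^sub>R (T t x - x)) \<longlongrightarrow> y) (at_right 0)" using g by (simp add: gen_def)
  then have z: "((\<lambda>t. norm ((1 / t) *\<^sub>R (T t x - x) - y)) \<longlongrightarrow> 0) (at_right 0)"
    by (intro tendsto_norm_zero LIM_zero)
  have "((\<lambda>t. norm ((1 / t) *\<^sub>R (T t (emb (proj x)) - emb (proj x)) - emb (proj y))) \<longlongrightarrow> 0) (at_right 0)"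
  proof (rule Lim_null_comparison[OF _ z])
    show "eventually (\<lambda>t. norm (norm ((1 / t) *\<^sub>R (T t (emb (proj x)) - emb (proj x)) - emb (proj y))) \<le> norm ((1 / t) *\<^sub>R (T t x - x) - y)) (at_right 0)"
      unfolding eventually_at_right_field
    proof (intro exI[of _ 1] conjI allI impI)
      fix t :: real assume t: "0 < t"
      show "norm (norm ((1 / t) *\<^sub>R (T t (emb (proj x)) - emb (proj x)) - emb (proj y))) \<le> norm ((1 / t) *\<^sub>R (T t x - x) - y)"
        using dist_emb_proj_le[OF lincomb_H[OF S_H[of t, OF _ proj_H] proj_H], of "1 / t" x "- 1 / t" x y]
          difference_quotient_emb[of t "proj x", OF _ proj_H] t by (simp add: x)
    qed simp
  qed
  then show "proj x \<in> Dom" "emb (A (proj x)) = emb (proj y)"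
    using generator_emb[OF proj_H proj_H, of x y] by simp_all
qed

lemma dissipationI:
  assumes "\<And>X. X \<in> Dom \<Longrightarrow> wform m1 m2 (A X) X \<le> - diss_approx m1 m2 j X"
  shows "dissipation (hform m1 m2) (hdiss m1 m2 j)"
  unfolding dissipation_def
proof (intro conjI allI impI)
  fix x y show "hform m1 m2 x y = hform m1 m2 y x" by (simp add: hform_def wform_sym)
  fix r show "\<exists>C. \<forall>x. norm x \<le> r \<longrightarrow> \<bar>hdiss m1 m2 j x\<bar> \<le> C" by (rule hdiss_bounded)
next
  fix x y assume "gen x y"
  note g = genD[OF this]
  have "hform m1 m2 y x = wform m1 m2 (proj y) (proj x)" by (simp add: hform_def)
  also have "\<dots> = wform m1 m2 (A (proj x)) (proj x)"
    by (rule wform_cong[OF proj_H proj_H emb_eq_ae]) (use g A_H proj_H in \<open>auto simp: ae_eq_def\<close>)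
  also have "\<dots> \<le> - hdiss m1 m2 j x" using assms[OF g(1)] by (simp add: hdiss_def)
  finally show "hform m1 m2 y x \<le> - hdiss m1 m2 j x" .
qed (rule bounded_bilinear_hform, rule hdiss_continuous)

end

section \<open>Dissipativity and density of the domain\<close>

lemma ac_affine: "ac a b (\<lambda>x. c + d * x) (\<lambda>_. d)"
  by (rule ac_C1) (auto intro!: derivative_eq_intros)

text \<open>
  With \<open>p = c + d x\<close>, the function \<open>p w w'' - d w w' - p (w')\<^sup>2 / 2\<close> has derivative
  \<open>p w w''' - 3/2 d (w')\<^sup>2\<close>, and at the ends only \<open>- p (w')\<^sup>2 / 2\<close> survives, because \<open>w\<close> vanishes
  there.
\<close>

lemma third_order_identity:
  assumes ab: "a < b" and w: "ac a b w0 w1" "ac a b w1 w2" "ac a b w2 w3" and z: "w0 a = 0" "w0 b = 0"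
  shows "inner_L2 a b (\<lambda>x. (c + d * x) * w3 x) w0 =
    3 / 2 * d * inner_L2 a b w1 w1 - 1 / 2 * ((c + d * b) * (w1 b)\<^sup>2 - (c + d * a) * (w1 a)\<^sup>2)"
proof -
  define p where "p x = c + d * x" for x
  have p: "ac a b p (\<lambda>_. d)" unfolding p_def by (rule ac_affine)
  let ?\<Phi> = "\<lambda>x. (p x * (w0 x * w2 x) - d * (w0 x * w1 x)) - (1 / 2) * (p x * (w1 x * w1 x))"
  let ?E = "\<lambda>x. ((p x * (w0 x * w3 x + w1 x * w2 x) + d * (w0 x * w2 x)) - d * (w0 x * w2 x + w1 x * w1 x)) - (1 / 2) * (p x * (w1 x * w2 x + w2 x * w1 x) + d * (w1 x * w1 x))"
  have ac: "ac a b ?\<Phi> ?E"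
    by (rule ac_minus[OF ac_minus[OF ac_mult[OF p ac_mult[OF w(1,3)]] ac_cmult[OF ac_mult[OF w(1,2)]]] ac_cmult[OF ac_mult[OF p ac_mult[OF w(2,2)]]]])
  have L2: "(\<lambda>x. p x * w3 x) \<in> L2 a b" "w0 \<in> L2 a b" "w1 \<in> L2 a b"
    using L2_continuous_mult[OF ac_L2[OF w(3)] ac_continuous[OF p]] ac_fun_L2[OF w(1)] ac_fun_L2[OF w(2)] by auto
  have "?\<Phi> b - ?\<Phi> a = integral\<^sup>L (lebesgue_on {a<..<b}) ?E"
    by (rule ac_diff_integral[OF ac]) (use ab in auto)
  also have "\<dots> = integral\<^sup>L (lebesgue_on {a<..<b}) (\<lambda>x. (p x * w3 x) * w0 x - 3 / 2 * d * (w1 x * w1 x))"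
    by (rule Bochner_Integration.integral_cong) (auto simp: algebra_simps)
  also have "\<dots> = inner_L2 a b (\<lambda>x. p x * w3 x) w0 - 3 / 2 * d * inner_L2 a b w1 w1"
    unfolding inner_L2_def
    by (subst Bochner_Integration.integral_diff) (use L2_mult_integrable[OF L2(1,2)] L2_mult_integrable[OF L2(3,3)] in auto)
  finally have "inner_L2 a b (\<lambda>x. p x * w3 x) w0 = 3 / 2 * d * inner_L2 a b w1 w1 + (?\<Phi> b - ?\<Phi> a)" by simp
  also have "?\<Phi> b - ?\<Phi> a = - 1 / 2 * (p b * (w1 b)\<^sup>2 - p a * (w1 a)\<^sup>2)"
    using z by (simp add: power2_eq_square algebra_simps)
  finally show ?thesis by (simp add: p_def)
qed

text \<open>
  The derivative of \<open>p w\<^sup>2 / 2\<close> is \<open>p w w' + d w\<^sup>2 / 2\<close>, where \<open>p = c + d x\<close>.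
\<close>

lemma first_order_identity:
  assumes ab: "a < b" and w: "ac a b w g"
  shows "inner_L2 a b (\<lambda>x. (c + d * x) * g x) w =
    1 / 2 * ((c + d * b) * (w b)\<^sup>2 - (c + d * a) * (w a)\<^sup>2) - 1 / 2 * d * inner_L2 a b w w"
proof -
  define p where "p x = c + d * x" for x
  have p: "ac a b p (\<lambda>_. d)" unfolding p_def by (rule ac_affine)
  have ac: "ac a b (\<lambda>x. (1 / 2) * (p x * (w x * w x))) (\<lambda>x. (1 / 2) * (p x * (w x * g x + g x * w x) + d * (w x * w x)))"
    by (rule ac_cmult[OF ac_mult[OF p ac_mult[OF w w]]])
  have L2: "(\<lambda>x. p x * g x) \<in> L2 a b" "w \<in> L2 a b"
    using L2_continuous_mult[OF ac_L2[OF w] ac_continuous[OF p]] ac_fun_L2[OF w] by auto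
  have "(1 / 2) * (p b * (w b * w b)) - (1 / 2) * (p a * (w a * w a))
      = integral\<^sup>L (lebesgue_on {a<..<b}) (\<lambda>x. (1 / 2) * (p x * (w x * g x + g x * w x) + d * (w x * w x)))"
    by (rule ac_diff_integral[OF ac]) (use ab in auto)
  also have "\<dots> = integral\<^sup>L (lebesgue_on {a<..<b}) (\<lambda>x. (p x * g x) * w x + 1 / 2 * d * (w x * w x))"
    by (rule Bochner_Integration.integral_cong) (auto simp: algebra_simps)
  also have "\<dots> = inner_L2 a b (\<lambda>x. p x * g x) w + 1 / 2 * d * inner_L2 a b w w"
    unfolding inner_L2_def
    by (subst Bochner_Integration.integral_add) (use L2_mult_integrable[OF L2(1,2)] L2_mult_integrable[OF L2(2,2)] in auto)
  finally show ?thesis by (simp add: p_def power2_eq_square algebra_simps)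
qed

text \<open>
  The boundary terms of the weighted energy balance: \<open>a\<close> stands for \<open>u\<^sub>x(L)\<close>, \<open>b\<close> for the delayed
  value \<open>z(1)\<close>, \<open>k = 1 + \<mu>1 L\<close> for the weight of \<open>v\<close> and \<open>m = 1 + \<mu>2\<close> for that of \<open>z\<close>. Splitting
  \<open>(\<alpha> a + \<beta> b)\<^sup>2 \<le> 2 \<alpha>\<^sup>2 a\<^sup>2 + 2 \<beta>\<^sup>2 b\<^sup>2\<close> produces one condition for the coefficient of \<open>a\<^sup>2\<close> and one
  for that of \<open>b\<^sup>2\<close>.
\<close>

lemma boundary_feedback_estimate:
  fixes a b \<alpha> \<beta> k m :: real
  assumes \<beta>: "0 < \<beta>" and k: "0 \<le> k" and c1: "k * \<alpha>\<^sup>2 + \<beta> / 2 * m \<le> 1 / 4" and c2: "k * \<beta> \<le> 1 / 2"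
  shows "- 1 / 4 * a\<^sup>2 + 1 / 2 * (k * (\<alpha> * a + \<beta> * b)\<^sup>2) - \<beta> / 2 * b\<^sup>2 + \<beta> / 2 * (m * a\<^sup>2) \<le> 0"
proof -
  have "(\<alpha> * a + \<beta> * b)\<^sup>2 \<le> 2 * (\<alpha> * a)\<^sup>2 + 2 * (\<beta> * b)\<^sup>2"
    using sum_squares_bound[of "\<alpha> * a" "\<beta> * b"] by (simp add: power2_sum)
  then have "1 / 2 * (k * (\<alpha> * a + \<beta> * b)\<^sup>2) \<le> 1 / 2 * (k * (2 * (\<alpha> * a)\<^sup>2 + 2 * (\<beta> * b)\<^sup>2))"
    using k by (intro mult_left_mono) auto
  also have "\<dots> = (k * \<alpha>\<^sup>2) * a\<^sup>2 + (k * \<beta>) * (\<beta> * b\<^sup>2)" by (simp add: power_mult_distrib power2_eq_square algebra_simps)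
  also have "(k * \<beta>) * (\<beta> * b\<^sup>2) \<le> 1 / 2 * (\<beta> * b\<^sup>2)" using c2 \<beta> by (intro mult_right_mono) auto
  finally have 1: "1 / 2 * (k * (\<alpha> * a + \<beta> * b)\<^sup>2) \<le> (k * \<alpha>\<^sup>2) * a\<^sup>2 + 1 / 2 * (\<beta> * b\<^sup>2)" by simp
  have "(k * \<alpha>\<^sup>2 + \<beta> / 2 * m) * a\<^sup>2 \<le> 1 / 4 * a\<^sup>2" using c1 by (intro mult_right_mono) auto
  then have "(k * \<alpha>\<^sup>2) * a\<^sup>2 + \<beta> / 2 * (m * a\<^sup>2) \<le> 1 / 4 * a\<^sup>2" by (simp add: algebra_simps)
  then show ?thesis using 1 by simp
qed

lemma H3_L2: "u \<in> H3 a b \<Longrightarrow> u \<in> L2 a b"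
  by (simp add: H3_def H1_def)

context state_space
begin

lemma HS_domain_H: "HS_domain L \<alpha> \<beta> \<subseteq> H_space L"
  by (auto simp: HS_domain_def H_space_def H3_L2 H1_L2)

lemma HS_operator_H: "X \<in> HS_domain L \<alpha> \<beta> \<Longrightarrow> HS_operator L h X \<in> H_space L"
proof -
  assume X: "X \<in> HS_domain L \<alpha> \<beta>"
  obtain u v z where uvz: "X = (u, v, z)" by (cases X)
  have "u \<in> H3 0 L" "v \<in> H3 0 L" "z \<in> H1 0 1" using X by (auto simp: uvz HS_domain_def)
  then have "wderiv 0 L (wderiv 0 L (wderiv 0 L u)) \<in> L2 0 L" "wderiv 0 L (wderiv 0 L (wderiv 0 L v)) \<in> L2 0 L" "wderiv 0 1 z \<in> L2 0 1"
    using H3_ac(6)[OF L] wderiv_weak(1) by auto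
  then show ?thesis
    using L2_cmult[of _ 0 L "1 / 2"] L2_cmult[of _ 0 L "-1"] L2_cmult[of "wderiv 0 1 z" 0 1 "- (1 / h)"]
    by (simp add: uvz H_space_def)
qed

text \<open>
  Each component contributes its interior dissipation and boundary terms in \<open>u\<^sub>x(L)\<close>, \<open>v\<^sub>x(L)\<close> and
  \<open>z(1)\<close>. The feedback law expresses \<open>v\<^sub>x(L)\<close> by the other two, and the resulting quadratic form is
  nonpositive.
\<close>

lemma HS_dissipative:
  assumes X: "X \<in> HS_domain L \<alpha> \<beta>" and m: "0 \<le> m1" "0 \<le> m2"
    and c1: "(1 + m1 * L) * \<alpha>\<^sup>2 + \<beta> / 2 * (1 + m2) \<le> 1 / 4" and c2: "(1 + m1 * L) * \<beta> \<le> 1 / 2"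
  shows "wform m1 m2 (HS_operator L h X) X \<le> - diss_approx m1 m2 j X"
proof -
  obtain u v z where uvz: "X = (u, v, z)" by (cases X)
  define u0 u1 u2 u3 where "u0 = trace_at 0 L u" and "u1 = trace_at 0 L (wderiv 0 L u)"
    and "u2 = trace_at 0 L (wderiv 0 L (wderiv 0 L u))" and "u3 = wderiv 0 L (wderiv 0 L (wderiv 0 L u))"
  define v0 v1 v2 v3 where "v0 = trace_at 0 L v" and "v1 = trace_at 0 L (wderiv 0 L v)"
    and "v2 = trace_at 0 L (wderiv 0 L (wderiv 0 L v))" and "v3 = wderiv 0 L (wderiv 0 L (wderiv 0 L v))"
  define z0 z1 where "z0 = trace_at 0 1 z" and "z1 = wderiv 0 1 z"
  have H: "u \<in> H3 0 L" "v \<in> H3 0 L" "z \<in> H1 0 1" using X by (auto simp: uvz HS_domain_def)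
  have bc: "u0 0 = 0" "u0 L = 0" "v0 0 = 0" "v0 L = 0" "u1 0 = 0" "z0 0 = u1 L" "v1 L = \<alpha> * u1 L + \<beta> * z0 1"
    using X by (auto simp: uvz HS_domain_def u0_def u1_def v0_def v1_def z0_def)
  note u = H3_ac[OF L H(1), folded u0_def u1_def u2_def u3_def]
  note v = H3_ac[OF L H(2), folded v0_def v1_def v2_def v3_def]
  note z = H1_ac[OF zero_less_one H(3), folded z0_def z1_def]
  have uL: "u \<in> L2 0 L" and vL: "v \<in> L2 0 L" and zL: "z \<in> L2 0 1" using H by (auto intro: H3_L2 H1_L2)
  have w: "continuous_on S (\<lambda>x. 1 + m1 * (L - x))" "continuous_on S (\<lambda>x. 1 + m1 * x)" "continuous_on S (\<lambda>x. 1 + m2 * (1 - x))" for S :: "real set"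
    by (intro continuous_intros)+
  have U: "inner_L2 0 L (\<lambda>x. (1 + m1 * (L - x)) * (1 / 2 * u3 x)) u = - (3 / 4) * m1 * inner_L2 0 L u1 u1 - 1 / 4 * (u1 L)\<^sup>2"
  proof -
    have "inner_L2 0 L (\<lambda>x. (1 + m1 * (L - x)) * (1 / 2 * u3 x)) u = inner_L2 0 L (\<lambda>x. (1 + m1 * (L - x)) * (1 / 2 * u3 x)) u0"
      by (rule inner_L2_AE_cong[OF L2_continuous_mult[OF L2_cmult[OF u(6)] w(1)] uL _ u(4)]) simp
    also have "\<dots> = inner_L2 0 L (\<lambda>x. 1 / 2 * (((1 + m1 * L) + (- m1) * x) * u3 x)) u0"
      by (rule arg_cong[where f="\<lambda>f. inner_L2 0 L f u0"]) (auto simp: algebra_simps)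
    also have "\<dots> = 1 / 2 * inner_L2 0 L (\<lambda>x. ((1 + m1 * L) + (- m1) * x) * u3 x) u0" by (rule inner_L2_cmult_left)
    also have "\<dots> = - (3 / 4) * m1 * inner_L2 0 L u1 u1 - 1 / 4 * (u1 L)\<^sup>2"
      unfolding third_order_identity[OF L u(1-3) bc(1,2)] bc(5) by (simp add: algebra_simps)
    finally show ?thesis .
  qed
  have V: "inner_L2 0 L (\<lambda>x. (1 + m1 * x) * (- v3 x)) v = - (3 / 2) * m1 * inner_L2 0 L v1 v1 + 1 / 2 * ((1 + m1 * L) * (v1 L)\<^sup>2 - (v1 0)\<^sup>2)"
  proof -
    have nv: "(\<lambda>x. - v3 x) \<in> L2 0 L" using L2_cmult[OF v(6), of "-1"] by simp
    have "inner_L2 0 L (\<lambda>x. (1 + m1 * x) * (- v3 x)) v = inner_L2 0 L (\<lambda>x. (1 + m1 * x) * (- v3 x)) v0"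
      by (rule inner_L2_AE_cong[OF L2_continuous_mult[OF nv w(2)] vL _ v(4)]) simp
    also have "\<dots> = inner_L2 0 L (\<lambda>x. (- 1) * ((1 + m1 * x) * v3 x)) v0"
      by (rule arg_cong[where f="\<lambda>f. inner_L2 0 L f v0"]) auto
    also have "\<dots> = (- 1) * inner_L2 0 L (\<lambda>x. (1 + m1 * x) * v3 x) v0" by (rule inner_L2_cmult_left)
    also have "\<dots> = - (3 / 2) * m1 * inner_L2 0 L v1 v1 + 1 / 2 * ((1 + m1 * L) * (v1 L)\<^sup>2 - (v1 0)\<^sup>2)"
      unfolding third_order_identity[OF L v(1-3) bc(3,4)] by simp
    finally show ?thesis .
  qed
  have Z: "\<beta> * h * inner_L2 0 1 (\<lambda>x. (1 + m2 * (1 - x)) * (- (1 / h) * z1 x)) z =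
      - (\<beta> / 2) * ((z0 1)\<^sup>2 - (1 + m2) * (u1 L)\<^sup>2) - 1 / 2 * \<beta> * m2 * inner_L2 0 1 z z"
  proof -
    have "inner_L2 0 1 (\<lambda>x. (1 + m2 * (1 - x)) * (- (1 / h) * z1 x)) z = inner_L2 0 1 (\<lambda>x. (1 + m2 * (1 - x)) * (- (1 / h) * z1 x)) z0"
      by (rule inner_L2_AE_cong[OF L2_continuous_mult[OF L2_cmult[OF ac_L2[OF z(1)]] w(3)] zL _ z(2)]) simp
    also have "\<dots> = inner_L2 0 1 (\<lambda>x. (- (1 / h)) * (((1 + m2) + (- m2) * x) * z1 x)) z0"
      by (rule arg_cong[where f="\<lambda>f. inner_L2 0 1 f z0"]) (auto simp: algebra_simps diff_divide_distrib add_divide_distrib)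
    also have "\<dots> = (- (1 / h)) * inner_L2 0 1 (\<lambda>x. ((1 + m2) + (- m2) * x) * z1 x) z0" by (rule inner_L2_cmult_left)
    also have "\<dots> = (- (1 / h)) * (1 / 2 * ((z0 1)\<^sup>2 - (1 + m2) * (u1 L)\<^sup>2) + 1 / 2 * m2 * inner_L2 0 1 z0 z0)"
      unfolding first_order_identity[OF zero_less_one z(1)] bc(6) by simp
    also have "inner_L2 0 1 z0 z0 = inner_L2 0 1 z z"
      by (rule inner_L2_AE_cong[OF zL zL z(2) z(2), symmetric])
    finally have eq: "inner_L2 0 1 (\<lambda>x. (1 + m2 * (1 - x)) * (- (1 / h) * z1 x)) z =
        (- (1 / h)) * (1 / 2 * ((z0 1)\<^sup>2 - (1 + m2) * (u1 L)\<^sup>2) + 1 / 2 * m2 * inner_L2 0 1 z z)" .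
    show ?thesis unfolding eq using h by (simp add: algebra_simps)
  qed
  have du: "dirichlet_approx L j u \<le> inner_L2 0 L u1 u1"
    unfolding dirichlet_approx_AE_cong[OF uL u(4)] by (rule dirichlet_approx_le_dirichlet[OF L u(1) bc(1,2)])
  have dv: "dirichlet_approx L j v \<le> inner_L2 0 L v1 v1"
    unfolding dirichlet_approx_AE_cong[OF vL v(4)] by (rule dirichlet_approx_le_dirichlet[OF L v(1) bc(3,4)])
  have bd: "- 1 / 4 * (u1 L)\<^sup>2 + 1 / 2 * ((1 + m1 * L) * (\<alpha> * u1 L + \<beta> * z0 1)\<^sup>2) - \<beta> / 2 * (z0 1)\<^sup>2 + \<beta> / 2 * ((1 + m2) * (u1 L)\<^sup>2) \<le> 0"
    by (rule boundary_feedback_estimate[OF \<beta> _ c1 c2]) (use m L in simp)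
  have "wform m1 m2 (HS_operator L h X) X = (- (3 / 4) * m1 * inner_L2 0 L u1 u1 - 1 / 4 * (u1 L)\<^sup>2)
      + (- (3 / 2) * m1 * inner_L2 0 L v1 v1 + 1 / 2 * ((1 + m1 * L) * (v1 L)\<^sup>2 - (v1 0)\<^sup>2))
      + (- (\<beta> / 2) * ((z0 1)\<^sup>2 - (1 + m2) * (u1 L)\<^sup>2) - 1 / 2 * \<beta> * m2 * inner_L2 0 1 z z)"
    unfolding wform_def uvz HS_operator.simps fst_conv snd_conv u3_def[symmetric] v3_def[symmetric] z1_def[symmetric] U V Z ..
  also have "\<dots> \<le> - (3 / 4) * m1 * inner_L2 0 L u1 u1 - (3 / 2) * m1 * inner_L2 0 L v1 v1 - 1 / 2 * \<beta> * m2 * inner_L2 0 1 z z"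
    using bd zero_le_power2[of "v1 0"] unfolding bc(7) right_diff_distrib by linarith
  also have "\<dots> \<le> - diss_approx m1 m2 j X"
    using mult_left_mono[OF du, of "3 / 4 * m1"] mult_left_mono[OF dv, of "3 / 2 * m1"] m
    unfolding diss_approx_def uvz fst_conv snd_conv by linarith
  finally show ?thesis .
qed

text \<open>
  The function and its derivative vanish at both ends, so that all boundary conditions, the
  feedback law included, hold trivially.
\<close>

lemma flat_polynomial_H3:
  assumes ab: "a < b" and q: "real_polynomial_function q"
  defines "f \<equiv> \<lambda>x. ((x - a) * (b - x)) ^ 4 * q x"
  shows "f \<in> H3 a b" "trace_at a b f a = 0" "trace_at a b f b = 0"
    "trace_at a b (wderiv a b f) a = 0" "trace_at a b (wderiv a b f) b = 0" "f \<in> H1 a b"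
proof -
  have lin: "real_polynomial_function (\<lambda>x::real. x)"
    using real_polynomial_function.intros(1)[OF bounded_linear_ident] .
  define g where "g x = ((x - a) * (b - x)) ^ 3 * q x" for x
  have fp: "real_polynomial_function f" and gp: "real_polynomial_function g" unfolding f_def g_def
    by (intro real_polynomial_function.intros(2-4) real_polynomial_function_power real_polynomial_function_diff lin q)+
  obtain f1 where f1: "real_polynomial_function f1" "\<And>x. (f has_real_derivative f1 x) (at x)"
    using has_real_derivative_polynomial_function[OF fp] by blast
  obtain f2 where f2: "real_polynomial_function f2" "\<And>x. (f1 has_real_derivative f2 x) (at x)"
    using has_real_derivative_polynomial_function[OF f1(1)] by blast
  obtain f3 where f3: "real_polynomial_function f3" "\<And>x. (f2 has_real_derivative f3 x) (at x)"
    using has_real_derivative_polynomial_function[OF f2(1)] by blast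
  obtain g1 where g1: "\<And>x. (g has_real_derivative g1 x) (at x)"
    using has_real_derivative_polynomial_function[OF gp] by blast
  have ac: "ac a b f f1" "ac a b f1 f2" "ac a b f2 f3"
    by (rule ac_C1; simp add: has_field_derivative_at_within f1 f2 f3 continuous_real_polynomial)+
  have fg: "f = (\<lambda>x. ((x - a) * (b - x)) * g x)" by (auto simp: f_def g_def power_Suc[symmetric] mult.assoc[symmetric] simp flip: power_Suc)
  have "f1 x = (b - x - (x - a)) * g x + ((x - a) * (b - x)) * g1 x" for x
    by (rule DERIV_unique[OF f1(2)]) (auto simp: fg intro!: derivative_eq_intros g1)
  then have z: "f1 a = 0" "f1 b = 0" by (auto simp: g_def)
  have f0: "f a = 0" "f b = 0" by (auto simp: f_def)
  note H = ac_H3[OF ab ac]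
  show "f \<in> H3 a b" by (rule H(1))
  then show "f \<in> H1 a b" by (simp add: H3_def)
  show "trace_at a b f a = 0" "trace_at a b f b = 0"
    "trace_at a b (wderiv a b f) a = 0" "trace_at a b (wderiv a b f) b = 0"
    using H(2)[of a] H(2)[of b] H(3)[of a] H(3)[of b] z f0 ab by auto
qed

lemma norm_emb_diff:
  assumes "X \<in> H_space L" "Y \<in> H_space L"
  shows "(norm (emb X - emb Y))\<^sup>2 = inner_H L h \<beta> (lincomb 1 X (-1) Y) (lincomb 1 X (-1) Y)"
  using inner_emb[OF lincomb_H[OF assms] lincomb_H[OF assms], of 1 "-1" 1 "-1"] emb_lincomb[OF assms, of 1 "-1"]
  by (simp add: power2_norm_eq_inner)

text \<open>
  Flat polynomials satisfy all boundary conditions and are dense in each component.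
\<close>

lemma HS_domain_dense:
  assumes X: "X \<in> H_space L" and e: "0 < e"
  shows "\<exists>Y\<in>HS_domain L \<alpha> \<beta>. norm (emb X - emb Y) < e"
proof -
  obtain u v z where uvz: "X = (u, v, z)" by (cases X)
  have uL: "u \<in> L2 0 L" and vL: "v \<in> L2 0 L" and zL: "z \<in> L2 0 1" using X by (auto simp: uvz H_space_def)
  have e2: "0 < e\<^sup>2 / 4" "0 < e\<^sup>2 / 4 / (\<beta> * h)" using e \<beta> h by auto
  obtain q1 where q1: "real_polynomial_function q1" "inner_L2 0 L (\<lambda>x. u x - ((x - 0) * (L - x)) ^ 4 * q1 x) (\<lambda>x. u x - ((x - 0) * (L - x)) ^ 4 * q1 x) < e\<^sup>2 / 4"
    using vanishing_polynomials_dense_L2[OF L uL e2(1)] by blast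
  obtain q2 where q2: "real_polynomial_function q2" "inner_L2 0 L (\<lambda>x. v x - ((x - 0) * (L - x)) ^ 4 * q2 x) (\<lambda>x. v x - ((x - 0) * (L - x)) ^ 4 * q2 x) < e\<^sup>2 / 4"
    using vanishing_polynomials_dense_L2[OF L vL e2(1)] by blast
  obtain q3 where q3: "real_polynomial_function q3" "inner_L2 0 1 (\<lambda>x. z x - ((x - 0) * (1 - x)) ^ 4 * q3 x) (\<lambda>x. z x - ((x - 0) * (1 - x)) ^ 4 * q3 x) < e\<^sup>2 / 4 / (\<beta> * h)"
    using vanishing_polynomials_dense_L2[OF zero_less_one zL e2(2)] by blast
  define fu where "fu = (\<lambda>x. ((x - 0) * (L - x)) ^ 4 * q1 x)"
  define fv where "fv = (\<lambda>x. ((x - 0) * (L - x)) ^ 4 * q2 x)"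
  define fz where "fz = (\<lambda>x. ((x - 0) * (1 - x)) ^ 4 * q3 x)"
  note U = flat_polynomial_H3[OF L q1(1), folded fu_def] and V = flat_polynomial_H3[OF L q2(1), folded fv_def]
    and Z = flat_polynomial_H3[OF zero_less_one q3(1), folded fz_def]
  have Y: "(fu, fv, fz) \<in> HS_domain L \<alpha> \<beta>" unfolding HS_domain_def using U V Z by simp
  then have YH: "(fu, fv, fz) \<in> H_space L" using HS_domain_H by blast
  have "(norm (emb X - emb (fu, fv, fz)))\<^sup>2 = inner_H L h \<beta> (lincomb 1 X (-1) (fu, fv, fz)) (lincomb 1 X (-1) (fu, fv, fz))"
    by (rule norm_emb_diff[OF X YH])
  also have "\<dots> = inner_L2 0 L (\<lambda>x. u x - fu x) (\<lambda>x. u x - fu x) + inner_L2 0 L (\<lambda>x. v x - fv x) (\<lambda>x. v x - fv x)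
      + \<beta> * h * inner_L2 0 1 (\<lambda>x. z x - fz x) (\<lambda>x. z x - fz x)"
    by (simp add: uvz)
  also have "\<dots> < e\<^sup>2 / 4 + e\<^sup>2 / 4 + e\<^sup>2 / 4"
  proof -
    have "inner_L2 0 1 (\<lambda>x. z x - fz x) (\<lambda>x. z x - fz x) < e\<^sup>2 / 4 / (\<beta> * h)" using q3(2) by (simp only: fz_def)
    then have "\<beta> * h * inner_L2 0 1 (\<lambda>x. z x - fz x) (\<lambda>x. z x - fz x) < e\<^sup>2 / 4"
      using \<beta> h by (simp add: pos_less_divide_eq mult.commute)
    moreover have "inner_L2 0 L (\<lambda>x. u x - fu x) (\<lambda>x. u x - fu x) < e\<^sup>2 / 4" using q1(2) by (simp only: fu_def)
    moreover have "inner_L2 0 L (\<lambda>x. v x - fv x) (\<lambda>x. v x - fv x) < e\<^sup>2 / 4" using q2(2) by (simp only: fv_def)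
    ultimately show ?thesis by linarith
  qed
  also have "\<dots> \<le> e\<^sup>2" by simp
  finally have "norm (emb X - emb (fu, fv, fz)) < e" using e by (simp add: power2_less_imp_less)
  then show ?thesis using Y by blast
qed

end

text \<open>
  With zero weights the form \<open>wform\<close> is the inner product, and \<open>HS_dissipative\<close> says that the
  operator is dissipative.
\<close>

lemma HS_dissipative_semigroup:
  assumes "state_semigroup L h \<beta> S (HS_domain L \<alpha> \<beta>) (HS_operator L h)"
    and c: "\<alpha>\<^sup>2 + \<beta> / 2 \<le> 1 / 4" "\<beta> \<le> 1 / 2"
  shows "dissipative_semigroup (state_semigroup.T L h \<beta> S)"
proof -
  interpret state_semigroup L h \<beta> S "HS_domain L \<alpha> \<beta>" "HS_operator L h" by fact
  show ?thesis
  proof (rule dissipative_semigroup.intro[OF hilbert_semigroup_T dissipative_semigroup_axioms.intro])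
    fix x assume x: "T 0 x = x"
    show "x \<in> closure {x. \<exists>y. gen x y}"
      unfolding closure_approachable
    proof (intro allI impI)
      fix e :: real assume "0 < e"
      from HS_domain_dense[OF proj_H[of x] this, of \<alpha>] obtain Y where Y: "Y \<in> HS_domain L \<alpha> \<beta>" "norm (emb (proj x) - emb Y) < e" by blast
      have "dist (emb Y) x < e" using Y(2) x by (simp add: T_0 dist_norm norm_minus_commute)
      then show "\<exists>y\<in>{x. \<exists>y. gen x y}. dist y x < e" using gen_emb_A[OF Y(1)] by blast
    qed
  next
    fix x y assume g: "gen x y"
    have d: "dissipation (hform 0 0) (hdiss 0 0 0)"
      by (rule dissipationI, rule HS_dissipative) (use c in auto)
    have "hform 0 0 y x \<le> - hdiss 0 0 0 x" by (rule dissipationD(5)[OF d g])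
    also have "hdiss 0 0 0 x = 0" by (simp add: hdiss_def diss_approx_def)
    also have "hform 0 0 y x = hform 0 0 (emb (proj x)) y" using dissipationD(2)[OF d, of y x] genD(2)[OF g] by simp
    also have "\<dots> = x \<bullet> y" using hform_0_emb[OF proj_H, of x y] genD(2)[OF g] by simp
    finally show "y \<bullet> x \<le> 0" by (simp add: inner_commute)
  qed
qed

section \<open>Estimates for the nonlinearity\<close>

text \<open>
  Average the oscillation estimate over the second point. The bound has to cover functions with
  nonzero boundary values, since zero boundary values of solutions are derived from a bound of the
  nonlinearity.
\<close>

lemma H1_sup_bound:
  assumes L: "0 < L" and w: "ac 0 L w g" and x: "x \<in> {0..L}"
  shows "(w x)\<^sup>2 \<le> (2 / L + 2 * L) * (inner_L2 0 L w w + inner_L2 0 L g g)"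
proof -
  have wL: "w \<in> L2 0 L" by (rule ac_fun_L2[OF w])
  have "L * (w x)\<^sup>2 = integral\<^sup>L (lebesgue_on {0<..<L}) (\<lambda>y. (w x)\<^sup>2)"
    using continuous_integrable_Ioo(2)[of 0 L "\<lambda>_. (w x)\<^sup>2"] L by auto
  also have "\<dots> \<le> integral\<^sup>L (lebesgue_on {0<..<L}) (\<lambda>y. 2 * (w y * w y) + 2 * (L * inner_L2 0 L g g))"
  proof (rule integral_mono_AE)
    show "integrable (lebesgue_on {0<..<L}) (\<lambda>y. (w x)\<^sup>2)" by (rule continuous_integrable_Ioo) simp
    show "integrable (lebesgue_on {0<..<L}) (\<lambda>y. 2 * (w y * w y) + 2 * (L * inner_L2 0 L g g))"
      by (rule continuous_integrable_Ioo(1)) (intro continuous_intros ac_continuous[OF w])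
    show "AE y in lebesgue_on {0<..<L}. (w x)\<^sup>2 \<le> 2 * (w y * w y) + 2 * (L * inner_L2 0 L g g)"
      using lebesgue_on_ae_space[of "{0<..<L}"]
    proof eventually_elim
      case (elim y)
      have "(w x - w y)\<^sup>2 \<le> L * inner_L2 0 L g g" using ac_oscillation[OF w x, of y] elim by simp
      moreover have "(w x)\<^sup>2 \<le> 2 * (w y * w y) + 2 * (w x - w y)\<^sup>2"
      proof -
        have "0 \<le> (w x - 2 * w y)\<^sup>2" by simp
        then show ?thesis by (simp add: power2_eq_square algebra_simps)
      qed
      ultimately show ?case by linarith
    qed
  qed
  also have "\<dots> = 2 * inner_L2 0 L w w + L * (2 * (L * inner_L2 0 L g g))"
    using L2_mult_integrable[OF wL wL] continuous_integrable_Ioo[of 0 L "\<lambda>_. 2 * (L * inner_L2 0 L g g)"] L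
    by (simp add: inner_L2_def)
  finally have "(w x)\<^sup>2 \<le> (2 * inner_L2 0 L w w + L * (2 * (L * inner_L2 0 L g g))) / L"
    using L by (simp add: pos_le_divide_eq mult.commute)
  also have "\<dots> = 2 / L * inner_L2 0 L w w + 2 * L * inner_L2 0 L g g" using L by (simp add: field_simps)
  also have "\<dots> \<le> (2 / L + 2 * L) * (inner_L2 0 L w w + inner_L2 0 L g g)"
  proof -
    have "0 \<le> 2 * L * inner_L2 0 L w w" "0 \<le> 2 / L * inner_L2 0 L g g" using L inner_L2_nonneg by simp_all
    then show ?thesis by (simp add: algebra_simps)
  qed
  finally show ?thesis .
qed

lemma L2_product_bound:
  assumes w: "continuous_on {a..b} w" "\<And>x. x \<in> {a..b} \<Longrightarrow> (w x)\<^sup>2 \<le> K" and k: "k \<in> L2 a b"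
  shows "inner_L2 a b (\<lambda>x. w x * k x) (\<lambda>x. w x * k x) \<le> K * inner_L2 a b k k"
proof -
  have wk: "(\<lambda>x. w x * k x) \<in> L2 a b" by (rule L2_continuous_mult[OF k w(1)])
  have "inner_L2 a b (\<lambda>x. w x * k x) (\<lambda>x. w x * k x) \<le> integral\<^sup>L (lebesgue_on {a<..<b}) (\<lambda>x. K * (k x * k x))"
    unfolding inner_L2_def
  proof (rule integral_mono_AE)
    show "AE x in lebesgue_on {a<..<b}. w x * k x * (w x * k x) \<le> K * (k x * k x)"
      using lebesgue_on_ae_space[of "{a<..<b}"]
    proof eventually_elim
      case (elim x)
      have "(w x)\<^sup>2 * (k x * k x) \<le> K * (k x * k x)" using w(2)[of x] elim by (intro mult_right_mono) auto
      then show ?case by (simp add: power2_eq_square mult_ac)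
    qed
  qed (use L2_mult_integrable[OF wk wk] L2_mult_integrable[OF k k] in auto)
  then show ?thesis by (simp add: inner_L2_def)
qed

lemma inner_L2_sum_sq_le:
  assumes f: "f \<in> L2 a b" and g: "g \<in> L2 a b"
  shows "inner_L2 a b (\<lambda>x. f x + g x) (\<lambda>x. f x + g x) \<le> 2 * inner_L2 a b f f + 2 * inner_L2 a b g g"
proof -
  have "0 \<le> inner_L2 a b (\<lambda>x. f x - g x) (\<lambda>x. f x - g x)" by (rule inner_L2_nonneg)
  then show ?thesis using f g
    by (simp add: inner_L2_add_left inner_L2_add_right inner_L2_diff_left inner_L2_diff_right L2_add L2_diff)
qed

context state_space
begin

text \<open>
  The number under the root is the constant of the Sobolev inequality \<open>H1_sup_bound\<close>; the factor
  \<open>6\<close> has ample room for the coefficients of the nonlinearity.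
\<close>

definition nonlin_const :: real where "nonlin_const = 6 * sqrt (2 / L + 2 * L)"

text \<open>
  Products of an \<open>H\<^sup>1\<close> function and an \<open>L\<^sup>2\<close> function are in \<open>L\<^sup>2\<close>. The bound by the squared norm in
  \<open>H\<^sup>1\<close> makes the nonlinearity integrable in time along a mild solution.
\<close>

lemma nonlinearity_bound:
  assumes X: "(u, v, z) \<in> H_space L" and u: "u \<in> H1 0 L" and v: "v \<in> H1 0 L"
  shows "HS_nonlinearity L (u, v, z) \<in> H_space L"
    "norm (emb (HS_nonlinearity L (u, v, z))) \<le> nonlin_const * (norm_H1_sq 0 L u + norm_H1_sq 0 L v)"
proof -
  define u0 v0 g k where "u0 = trace_at 0 L u" and "v0 = trace_at 0 L v" and "g = wderiv 0 L u" and "k = wderiv 0 L v"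
  note U = H1_ac[OF L u, folded u0_def g_def] and V = H1_ac[OF L v, folded v0_def k_def]
  define K where "K = 2 / L + 2 * L"
  have K: "0 < K" using L by (simp add: K_def add_pos_pos)
  define Nu Nv where "Nu = norm_H1_sq 0 L u" and "Nv = norm_H1_sq 0 L v"
  have iu: "inner_L2 0 L u u = inner_L2 0 L u0 u0" by (rule inner_L2_AE_cong[OF H1_L2[OF u] H1_L2[OF u] U(2) U(2)])
  have iv: "inner_L2 0 L v v = inner_L2 0 L v0 v0" by (rule inner_L2_AE_cong[OF H1_L2[OF v] H1_L2[OF v] V(2) V(2)])
  have Nu: "inner_L2 0 L u0 u0 + inner_L2 0 L g g = Nu" and Nv: "inner_L2 0 L v0 v0 + inner_L2 0 L k k = Nv"
    by (simp_all add: Nu_def Nv_def norm_H1_sq_def iu iv g_def k_def)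
  have gN: "inner_L2 0 L g g \<le> Nu" and kN: "inner_L2 0 L k k \<le> Nv"
    using Nu Nv inner_L2_nonneg[of 0 L u0] inner_L2_nonneg[of 0 L v0] by linarith+
  have N0: "0 \<le> Nu" "0 \<le> Nv" using gN kN inner_L2_nonneg order_trans by blast+
  have su: "(u0 x)\<^sup>2 \<le> K * Nu" and sv: "(v0 x)\<^sup>2 \<le> K * Nv" if "x \<in> {0..L}" for x
    using H1_sup_bound[OF L U(1) that] H1_sup_bound[OF L V(1) that] by (simp_all add: Nu Nv K_def)
  have gL: "g \<in> L2 0 L" and kL: "k \<in> L2 0 L" using ac_L2[OF U(1)] ac_L2[OF V(1)] .
  have p: "inner_L2 0 L (\<lambda>x. u0 x * g x) (\<lambda>x. u0 x * g x) \<le> K * Nu * Nu"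
    "inner_L2 0 L (\<lambda>x. v0 x * k x) (\<lambda>x. v0 x * k x) \<le> K * Nv * Nv"
    "inner_L2 0 L (\<lambda>x. u0 x * k x) (\<lambda>x. u0 x * k x) \<le> K * Nu * Nv"
  proof -
    show "inner_L2 0 L (\<lambda>x. u0 x * g x) (\<lambda>x. u0 x * g x) \<le> K * Nu * Nu"
      by (rule order_trans[OF L2_product_bound[OF ac_continuous[OF U(1)] su gL] mult_left_mono[OF gN]]) (use K N0 in simp_all)
    show "inner_L2 0 L (\<lambda>x. v0 x * k x) (\<lambda>x. v0 x * k x) \<le> K * Nv * Nv"
      by (rule order_trans[OF L2_product_bound[OF ac_continuous[OF V(1)] sv kL] mult_left_mono[OF kN]]) (use K N0 in simp_all)
    show "inner_L2 0 L (\<lambda>x. u0 x * k x) (\<lambda>x. u0 x * k x) \<le> K * Nu * Nv"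
      by (rule order_trans[OF L2_product_bound[OF ac_continuous[OF U(1)] su kL] mult_left_mono[OF kN]]) (use K N0 in simp_all)
  qed
  have L2s: "(\<lambda>x. u0 x * g x) \<in> L2 0 L" "(\<lambda>x. v0 x * k x) \<in> L2 0 L" "(\<lambda>x. u0 x * k x) \<in> L2 0 L"
    by (intro L2_continuous_mult gL kL ac_continuous[OF U(1)] ac_continuous[OF V(1)])+
  define f1 f2 where "f1 x = 3 * (u0 x * g x) + 3 * (v0 x * k x)" and "f2 x = - 3 * (u0 x * k x)" for x
  have f1: "f1 \<in> L2 0 L" and f2: "f2 \<in> L2 0 L" unfolding f1_def f2_def by (intro L2_add L2_cmult L2s)+
  have F: "HS_nonlinearity L (u, v, z) = (\<lambda>x. 3 * u x * g x + 3 * v x * k x, \<lambda>x. - 3 * u x * k x, \<lambda>\<rho>. 0)"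
    by (simp add: g_def k_def)
  have a1: "AE x in lebesgue_on {0<..<L}. f1 x = 3 * u x * g x + 3 * v x * k x"
    using U(2) V(2) by eventually_elim (simp add: f1_def)
  have a2: "AE x in lebesgue_on {0<..<L}. f2 x = - 3 * u x * k x"
    using U(2) by eventually_elim (simp add: f2_def)
  have z0: "(\<lambda>\<rho>. 0) \<in> L2 0 1" by (rule L2_continuous) simp
  show H: "HS_nonlinearity L (u, v, z) \<in> H_space L"
    unfolding F H_space_def using L2_AE_cong[OF f1 a1] L2_AE_cong[OF f2 a2] z0 by simp
  have "(norm (emb (HS_nonlinearity L (u, v, z))))\<^sup>2 = inner_H L h \<beta> (HS_nonlinearity L (u, v, z)) (HS_nonlinearity L (u, v, z))"
    by (simp only: power2_norm_eq_inner inner_emb[OF H H])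
  also have "\<dots> = inner_L2 0 L f1 f1 + inner_L2 0 L f2 f2"
    unfolding F inner_H.simps inner_L2_AE_cong[OF f1 f1 a1 a1] inner_L2_AE_cong[OF f2 f2 a2 a2]
    by (simp add: inner_L2_def)
  also have "inner_L2 0 L f1 f1 \<le> 18 * (K * Nu * Nu) + 18 * (K * Nv * Nv)"
  proof -
    have "inner_L2 0 L f1 f1 \<le> 2 * inner_L2 0 L (\<lambda>x. 3 * (u0 x * g x)) (\<lambda>x. 3 * (u0 x * g x)) + 2 * inner_L2 0 L (\<lambda>x. 3 * (v0 x * k x)) (\<lambda>x. 3 * (v0 x * k x))"
      unfolding f1_def by (rule inner_L2_sum_sq_le) (intro L2_cmult L2s)+
    also have "\<dots> \<le> 18 * (K * Nu * Nu) + 18 * (K * Nv * Nv)"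
      unfolding inner_L2_cmult_left inner_L2_cmult_right using p by simp
    finally show ?thesis .
  qed
  also have "inner_L2 0 L f2 f2 \<le> 9 * (K * Nu * Nv)"
    unfolding f2_def inner_L2_cmult_left inner_L2_cmult_right using p by simp
  also have "18 * (K * Nu * Nu) + 18 * (K * Nv * Nv) + 9 * (K * Nu * Nv) \<le> (6 * sqrt K * (Nu + Nv))\<^sup>2"
  proof -
    have "(6 * sqrt K * (Nu + Nv))\<^sup>2 = 36 * (K * Nu * Nu) + 36 * (K * Nv * Nv) + 72 * (K * Nu * Nv)"
      using K by (simp add: power_mult_distrib) (simp add: power2_eq_square algebra_simps)
    moreover have "0 \<le> K * Nu * Nu" "0 \<le> K * Nv * Nv" "0 \<le> K * Nu * Nv" using K N0 by simp_all
    ultimately show ?thesis by linarith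
  qed
  finally have "(norm (emb (HS_nonlinearity L (u, v, z))))\<^sup>2 \<le> (6 * sqrt K * (Nu + Nv))\<^sup>2" by simp
  then show "norm (emb (HS_nonlinearity L (u, v, z))) \<le> nonlin_const * (norm_H1_sq 0 L u + norm_H1_sq 0 L v)"
    unfolding nonlin_const_def K_def[symmetric] Nu_def[symmetric] Nv_def[symmetric]
    by (rule power2_le_imp_le) (use K N0 in simp)
qed

text \<open>
  Let \<open>p = 1 + m1 (L - x)\<close>. The term \<open>3 p u\<^sup>2 u\<^sub>x\<close> is the derivative of \<open>p u\<^sup>3\<close> up to \<open>m1 u\<^sup>3\<close>, and
  the terms with \<open>u v v\<^sub>x\<close> carry the factor \<open>p - (1 + m1 x) = m1 (L - 2 x)\<close>. So the whole
  expression is of the order \<open>m1\<close> and vanishes in the unweighted energy.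
\<close>

lemma nonlinearity_form:
  assumes X: "(u, v, z) \<in> H_space L" and u: "u \<in> H1 0 L" and v: "v \<in> H1 0 L"
  defines "u0 \<equiv> trace_at 0 L u" and "v0 \<equiv> trace_at 0 L v"
  assumes bc: "u0 0 = 0" "u0 L = 0"
  shows "wform m1 m2 (HS_nonlinearity L (u, v, z)) (u, v, z) =
    m1 * (integral\<^sup>L (lebesgue_on {0<..<L}) (\<lambda>x. u0 x * u0 x * u0 x)
      + 3 * integral\<^sup>L (lebesgue_on {0<..<L}) (\<lambda>x. (L - 2 * x) * u0 x * v0 x * wderiv 0 L v x))"
proof -
  define g k where "g = wderiv 0 L u" and "k = wderiv 0 L v"
  note U = H1_ac[OF L u, folded u0_def g_def] and V = H1_ac[OF L v, folded v0_def k_def]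
  define p where "p x = (1 + m1 * L) + (- m1) * x" for x
  have p: "ac 0 L p (\<lambda>_. - m1)" unfolding p_def by (rule ac_affine)
  have uL: "u \<in> L2 0 L" and vL: "v \<in> L2 0 L" using u v by (auto intro: H1_L2)
  have H: "HS_nonlinearity L (u, v, z) \<in> H_space L" by (rule nonlinearity_bound[OF X u v])
  have gL: "g \<in> L2 0 L" and kL: "k \<in> L2 0 L" using ac_L2[OF U(1)] ac_L2[OF V(1)] .
  have cu: "continuous_on {0..L} u0" and cv: "continuous_on {0..L} v0" using ac_continuous[OF U(1)] ac_continuous[OF V(1)] .
  have "wform m1 m2 (HS_nonlinearity L (u, v, z)) (u, v, z) =
     wform m1 m2 (\<lambda>x. u0 x * (3 * g x) + v0 x * (3 * k x), \<lambda>x. u0 x * (- 3 * k x), \<lambda>\<rho>. 0) (u0, v0, z)"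
  proof (rule wform_cong[OF H X])
    show "ae_eq (u, v, z) (u0, v0, z)" using U(2) V(2) by (simp add: ae_eq_def)
    show "ae_eq (HS_nonlinearity L (u, v, z)) (\<lambda>x. u0 x * (3 * g x) + v0 x * (3 * k x), \<lambda>x. u0 x * (- 3 * k x), \<lambda>\<rho>. 0)"
      unfolding ae_eq_def HS_nonlinearity.simps fst_conv snd_conv g_def[symmetric] k_def[symmetric]
    proof (intro conjI)
      show "AE x in lebesgue_on {0<..<L}. 3 * u x * g x + 3 * v x * k x = u0 x * (3 * g x) + v0 x * (3 * k x)"
        using U(2) V(2) by eventually_elim simp
      show "AE x in lebesgue_on {0<..<L}. - 3 * u x * k x = u0 x * (- 3 * k x)"
        using U(2) by eventually_elim simp
    qed simp
  qed
  also have "\<dots> = integral\<^sup>L (lebesgue_on {0<..<L}) (\<lambda>x. (1 + m1 * (L - x)) * (u0 x * (3 * g x) + v0 x * (3 * k x)) * u0 x)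
     + integral\<^sup>L (lebesgue_on {0<..<L}) (\<lambda>x. (1 + m1 * x) * (u0 x * (- 3 * k x)) * v0 x)"
    by (simp add: wform_def inner_L2_def)
  also have "\<dots> = integral\<^sup>L (lebesgue_on {0<..<L}) (\<lambda>x. (1 + m1 * (L - x)) * (u0 x * (3 * g x) + v0 x * (3 * k x)) * u0 x
      + (1 + m1 * x) * (u0 x * (- 3 * k x)) * v0 x)"
  proof (rule Bochner_Integration.integral_add[symmetric])
    have i: "(\<lambda>x. (1 + m1 * (L - x)) * (u0 x * (3 * g x) + v0 x * (3 * k x))) \<in> L2 0 L"
      "(\<lambda>x. (1 + m1 * x) * (u0 x * (- 3 * k x))) \<in> L2 0 L"
      by (intro L2_continuous_mult L2_add L2_cmult gL kL cu cv continuous_intros)+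
    show "integrable (lebesgue_on {0<..<L}) (\<lambda>x. (1 + m1 * (L - x)) * (u0 x * (3 * g x) + v0 x * (3 * k x)) * u0 x)"
      "integrable (lebesgue_on {0<..<L}) (\<lambda>x. (1 + m1 * x) * (u0 x * (- 3 * k x)) * v0 x)"
      by (rule L2_mult_integrable[OF i(1) ac_fun_L2[OF U(1)]], rule L2_mult_integrable[OF i(2) ac_fun_L2[OF V(1)]])
  qed
  also have "\<dots> = integral\<^sup>L (lebesgue_on {0<..<L}) (\<lambda>x. (p x * (u0 x * (u0 x * g x + g x * u0 x) + g x * (u0 x * u0 x)) + (- m1) * (u0 x * (u0 x * u0 x)))
      + (m1 * (u0 x * u0 x * u0 x) + m1 * (3 * ((L - 2 * x) * u0 x * v0 x * k x))))"
    by (rule Bochner_Integration.integral_cong[OF refl]) (simp add: p_def algebra_simps)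
  also have "\<dots> = integral\<^sup>L (lebesgue_on {0<..<L}) (\<lambda>x. p x * (u0 x * (u0 x * g x + g x * u0 x) + g x * (u0 x * u0 x)) + (- m1) * (u0 x * (u0 x * u0 x)))
      + integral\<^sup>L (lebesgue_on {0<..<L}) (\<lambda>x. m1 * (u0 x * u0 x * u0 x) + m1 * (3 * ((L - 2 * x) * u0 x * v0 x * k x)))"
  proof (rule Bochner_Integration.integral_add)
    show "integrable (lebesgue_on {0<..<L}) (\<lambda>x. p x * (u0 x * (u0 x * g x + g x * u0 x) + g x * (u0 x * u0 x)) + (- m1) * (u0 x * (u0 x * u0 x)))"
      by (rule L2_integrable[OF ac_L2[OF ac_mult[OF p ac_mult[OF U(1) ac_mult[OF U(1) U(1)]]]]])
    have "(\<lambda>x. (L - 2 * x) * (u0 x * (v0 x * k x))) \<in> L2 0 L"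
      by (intro L2_continuous_mult kL cu cv continuous_intros)
    then have "integrable (lebesgue_on {0<..<L}) (\<lambda>x. (L - 2 * x) * u0 x * v0 x * k x)"
      using L2_integrable by (simp add: mult.assoc)
    moreover have "integrable (lebesgue_on {0<..<L}) (\<lambda>x. u0 x * u0 x * u0 x)"
      by (rule continuous_integrable_Ioo(1)) (intro continuous_intros cu)
    ultimately show "integrable (lebesgue_on {0<..<L}) (\<lambda>x. m1 * (u0 x * u0 x * u0 x) + m1 * (3 * ((L - 2 * x) * u0 x * v0 x * k x)))"
      by simp
  qed
  also have "integral\<^sup>L (lebesgue_on {0<..<L}) (\<lambda>x. p x * (u0 x * (u0 x * g x + g x * u0 x) + g x * (u0 x * u0 x)) + (- m1) * (u0 x * (u0 x * u0 x))) = 0"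
    using ac_diff_integral[OF ac_mult[OF p ac_mult[OF U(1) ac_mult[OF U(1) U(1)]]], of 0 L] L bc by simp
  also have "integral\<^sup>L (lebesgue_on {0<..<L}) (\<lambda>x. m1 * (u0 x * u0 x * u0 x) + m1 * (3 * ((L - 2 * x) * u0 x * v0 x * k x)))
      = m1 * (integral\<^sup>L (lebesgue_on {0<..<L}) (\<lambda>x. u0 x * u0 x * u0 x)
      + 3 * integral\<^sup>L (lebesgue_on {0<..<L}) (\<lambda>x. (L - 2 * x) * u0 x * v0 x * k x))"
  proof -
    have "(\<lambda>x. (L - 2 * x) * (u0 x * (v0 x * k x))) \<in> L2 0 L"
      by (intro L2_continuous_mult kL cu cv continuous_intros)
    then have "integrable (lebesgue_on {0<..<L}) (\<lambda>x. (L - 2 * x) * u0 x * v0 x * k x)"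
      using L2_integrable by (simp add: mult.assoc)
    moreover have "integrable (lebesgue_on {0<..<L}) (\<lambda>x. u0 x * u0 x * u0 x)"
      by (rule continuous_integrable_Ioo(1)) (intro continuous_intros cu)
    ultimately show ?thesis by (simp add: distrib_left)
  qed
  finally show ?thesis by (simp add: k_def)
qed

text \<open>
  Two factors are estimated by the maximum of \<open>w\<^sup>2\<close>, at most \<open>L \<parallel>g\<parallel>\<^sup>2\<close>, and the third one in \<open>L\<^sup>1\<close> by
  its norm in \<open>L\<^sup>2\<close>.
\<close>

lemma cubic_bound:
  assumes w: "ac 0 L w g" "w 0 = 0" and r: "norm_L2 0 L w \<le> r"
  shows "integral\<^sup>L (lebesgue_on {0<..<L}) (\<lambda>x. w x * w x * w x) \<le> L * sqrt L * r * inner_L2 0 L g g"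
proof -
  define G where "G = inner_L2 0 L g g"
  have G: "0 \<le> G" unfolding G_def by (rule inner_L2_nonneg)
  have cw: "continuous_on {0..L} w" by (rule ac_continuous[OF w(1)])
  have absw: "(\<lambda>x. \<bar>w x\<bar>) \<in> L2 0 L" and one: "(\<lambda>_. 1) \<in> L2 0 L"
    by (intro L2_continuous continuous_intros cw)+
  have "integral\<^sup>L (lebesgue_on {0<..<L}) (\<lambda>x. w x * w x * w x) \<le> integral\<^sup>L (lebesgue_on {0<..<L}) (\<lambda>x. L * G * (1 * \<bar>w x\<bar>))"
  proof (rule integral_mono_AE)
    show "AE x in lebesgue_on {0<..<L}. w x * w x * w x \<le> L * G * (1 * \<bar>w x\<bar>)"
      using lebesgue_on_ae_space[of "{0<..<L}"]
    proof eventually_elim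
      case (elim x)
      have "w x * w x * w x \<le> (w x)\<^sup>2 * \<bar>w x\<bar>" unfolding power2_eq_square by (rule mult_left_mono) auto
      also have "\<dots> \<le> L * G * \<bar>w x\<bar>"
        using ac_sup_bound[OF w, of x] elim by (intro mult_right_mono) (auto simp: G_def)
      finally show ?case by simp
    qed
  qed (rule continuous_integrable_Ioo(1), intro continuous_intros cw)+
  also have "\<dots> = L * G * inner_L2 0 L (\<lambda>_. 1) (\<lambda>x. \<bar>w x\<bar>)" by (simp add: inner_L2_def)
  also have "\<dots> \<le> L * G * (sqrt L * r)"
  proof (rule mult_left_mono)
    have "inner_L2 0 L (\<lambda>_. 1) (\<lambda>_. 1) = L" using continuous_integrable_Ioo(2)[of 0 L "\<lambda>_. 1"] L by (simp add: inner_L2_def)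
    then have "norm_L2 0 L (\<lambda>_. 1) = sqrt L" by (simp add: norm_L2_def)
    moreover have "norm_L2 0 L (\<lambda>x. \<bar>w x\<bar>) = norm_L2 0 L w" by (simp add: norm_L2_def inner_L2_def)
    ultimately have "inner_L2 0 L (\<lambda>_. 1) (\<lambda>x. \<bar>w x\<bar>) \<le> sqrt L * norm_L2 0 L w"
      using inner_L2_le_norms[OF one absw] by simp
    also have "\<dots> \<le> sqrt L * r" using r L by (intro mult_left_mono) auto
    finally show "inner_L2 0 L (\<lambda>_. 1) (\<lambda>x. \<bar>w x\<bar>) \<le> sqrt L * r" .
  qed (use L G in simp)
  finally show ?thesis by (simp add: G_def mult_ac)
qed

text \<open>
  Here \<open>\<bar>L - 2 x\<bar> \<le> L\<close>, \<open>w\<close> is bounded by \<open>sqrt L \<parallel>g\<parallel>\<close>, and \<open>v\<close> and \<open>k\<close> are paired in \<open>L\<^sup>2\<close>.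
\<close>

lemma transport_bound:
  assumes w: "ac 0 L w g" "w 0 = 0" and v: "v \<in> L2 0 L" "continuous_on {0..L} v" and k: "k \<in> L2 0 L" and r: "norm_L2 0 L v \<le> r" "0 \<le> r"
  shows "integral\<^sup>L (lebesgue_on {0<..<L}) (\<lambda>x. (L - 2 * x) * w x * v x * k x) \<le> L * sqrt L * r * ((inner_L2 0 L g g + inner_L2 0 L k k) / 2)"
proof -
  define G K where "G = inner_L2 0 L g g" and "K = inner_L2 0 L k k"
  have GK: "0 \<le> G" "0 \<le> K" unfolding G_def K_def by (rule inner_L2_nonneg)+
  have cw: "continuous_on {0..L} w" by (rule ac_continuous[OF w(1)])
  define f where "f x = ((L - 2 * x) * w x) * v x" for x
  have cf: "continuous_on {0..L} (\<lambda>x. (L - 2 * x) * w x)" by (intro continuous_intros cw)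
  have fL: "f \<in> L2 0 L" unfolding f_def by (rule L2_continuous_mult[OF v(1) cf])
  have "inner_L2 0 L f f \<le> (L\<^sup>2 * (L * G)) * inner_L2 0 L v v"
    unfolding f_def
  proof (rule L2_product_bound[OF cf _ v(1)])
    fix x assume x: "x \<in> {0..L}"
    have "\<bar>L - 2 * x\<bar> \<le> \<bar>L\<bar>" using x by auto
    then have "(L - 2 * x)\<^sup>2 \<le> L\<^sup>2" by (simp add: abs_le_square_iff)
    moreover have "(w x)\<^sup>2 \<le> L * G" using ac_sup_bound[OF w x] by (simp add: G_def)
    ultimately show "((L - 2 * x) * w x)\<^sup>2 \<le> L\<^sup>2 * (L * G)"
      unfolding power_mult_distrib by (intro mult_mono) auto
  qed
  then have "norm_L2 0 L f \<le> sqrt ((L\<^sup>2 * (L * G)) * inner_L2 0 L v v)" unfolding norm_L2_def by (rule real_sqrt_le_mono)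
  also have "\<dots> = L * sqrt L * sqrt G * norm_L2 0 L v" using L by (simp add: real_sqrt_mult norm_L2_def)
  also have "\<dots> \<le> L * sqrt L * sqrt G * r" using r L GK by (intro mult_left_mono) auto
  finally have nf: "norm_L2 0 L f \<le> L * sqrt L * sqrt G * r" .
  have "integral\<^sup>L (lebesgue_on {0<..<L}) (\<lambda>x. (L - 2 * x) * w x * v x * k x) = inner_L2 0 L f k"
    by (simp add: inner_L2_def f_def)
  also have "\<dots> \<le> norm_L2 0 L f * norm_L2 0 L k" using inner_L2_le_norms[OF fL k] by simp
  also have "\<dots> \<le> (L * sqrt L * sqrt G * r) * sqrt K"
  proof (rule mult_mono[OF nf])
    show "norm_L2 0 L k \<le> sqrt K" by (simp add: norm_L2_def K_def)
    show "0 \<le> L * sqrt L * sqrt G * r" using L GK r by simp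
  qed (rule norm_L2_nonneg)
  also have "\<dots> = L * sqrt L * r * (sqrt G * sqrt K)" by (simp add: mult_ac)
  also have "\<dots> \<le> L * sqrt L * r * ((G + K) / 2)"
  proof (rule mult_left_mono)
    show "sqrt G * sqrt K \<le> (G + K) / 2"
      using sum_squares_bound[of "sqrt G" "sqrt K"] GK by simp
  qed (use r L in simp)
  finally show ?thesis by (simp add: G_def K_def)
qed

end

text \<open>
  Dividing \<open>[0, t]\<close> into \<open>n\<close> steps gives \<open>V t (1 + l t / n)^n \<le> V 0\<close>. This replaces the Gronwall
  inequality and asks for no differentiability of \<open>V\<close>.
\<close>

lemma exp_decay_of_discrete_decay:
  fixes V :: "real \<Rightarrow> real"
  assumes l: "0 \<le> l" and t: "0 \<le> t" and V0: "0 \<le> V 0"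
    and step: "\<And>a b. 0 \<le> a \<Longrightarrow> a < b \<Longrightarrow> V b * (1 + l * (b - a)) \<le> V a"
  shows "V t \<le> V 0 * exp (- l * t)"
proof (cases "t = 0")
  case False
  then have t: "0 < t" using t by simp
  have it: "V (real k * (t / real n)) * (1 + l * t / real n) ^ k \<le> V 0" if n: "0 < n" for k n
  proof (induction k)
    case (Suc k)
    have q: "0 \<le> 1 + l * t / real n" using l t by simp
    have "V (real (Suc k) * (t / real n)) * (1 + l * (real (Suc k) * (t / real n) - real k * (t / real n))) \<le> V (real k * (t / real n))"
      by (rule step) (use t n in \<open>auto simp: divide_strict_right_mono\<close>)
    moreover have "real (Suc k) * (t / real n) - real k * (t / real n) = t / real n" by (simp add: distrib_right add_divide_distrib)
    ultimately have "V (real (Suc k) * (t / real n)) * (1 + l * t / real n) \<le> V (real k * (t / real n))" by simp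
    then have "V (real (Suc k) * (t / real n)) * (1 + l * t / real n) * (1 + l * t / real n) ^ k \<le> V (real k * (t / real n)) * (1 + l * t / real n) ^ k"
      using q by (intro mult_right_mono) auto
    then show ?case using Suc by (simp add: mult.assoc)
  qed simp
  have "(\<lambda>n. V t * (1 + l * t / real n) ^ n) \<longlonglongrightarrow> V t * exp (l * t)"
    by (intro tendsto_intros tendsto_exp_limit_sequentially)
  then have "V t * exp (l * t) \<le> V 0"
  proof (rule LIMSEQ_le_const2)
    show "\<exists>N. \<forall>n\<ge>N. V t * (1 + l * t / real n) ^ n \<le> V 0"
      using it[of n n for n] by (intro exI[of _ 1] allI impI) (metis (no_types, lifting) nonzero_mult_div_cancel_left of_nat_0_less_iff less_le_trans less_numeral_extra(3) of_nat_0_eq_iff times_divide_eq_right zero_less_one)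
  qed
  then show ?thesis by (simp add: exp_minus field_simps)
qed (use V0 in simp)

section \<open>Mild solutions\<close>

text \<open>
  The definition of a mild solution with its semigroup named, and the part of the gain condition
  that belongs to zero weights.
\<close>

locale hs_mild = state_space +
  fixes \<alpha> :: real and U0 :: state and U :: "real \<Rightarrow> state" and S :: "real \<Rightarrow> state \<Rightarrow> state"
  assumes U0_H: "U0 \<in> H_space L"
    and gain: "\<alpha>\<^sup>2 + \<beta> / 2 \<le> 1 / 4" "\<beta> \<le> 1 / 2"
    and U_H: "0 \<le> t \<Longrightarrow> U t \<in> H_space L"
    and U_cont: "0 \<le> t \<Longrightarrow> ((\<lambda>s. dist_H L h \<beta> (U s) (U t)) \<longlongrightarrow> 0) (at t within {0..})"
    and U_H1: "0 < t \<Longrightarrow> L2_time_H1 L t (\<lambda>s. fst (U s))" "0 < t \<Longrightarrow> L2_time_H1 L t (\<lambda>s. fst (snd (U s)))"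
    and S_C0: "C0_semigroup L h \<beta> S"
    and S_gen: "has_generator L h \<beta> S (HS_domain L \<alpha> \<beta>) (HS_operator L h)"
    and variation: "0 \<le> t \<Longrightarrow> \<exists>W. has_integral_H L h \<beta> (\<lambda>s. S (t - s) (HS_nonlinearity L (U s))) t W \<and>
             dist_H L h \<beta> (U t) (lincomb 1 (S t U0) 1 W) = 0"
begin

lemma is_state_semigroup: "state_semigroup L h \<beta> S (HS_domain L \<alpha> \<beta>) (HS_operator L h)"
  by (rule state_semigroup.intro[OF state_space_axioms state_semigroup_axioms.intro])
    (rule S_C0 S_gen HS_domain_H HS_operator_H, assumption?)+

sublocale state_semigroup L h \<beta> S "HS_domain L \<alpha> \<beta>" "HS_operator L h"
  by (rule is_state_semigroup)

sublocale dissipative_semigroup T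
  by (rule HS_dissipative_semigroup[OF is_state_semigroup gain])

definition F :: "real \<Rightarrow> hstate" where "F t = emb (HS_nonlinearity L (U t))"

definition h1sum :: "real \<Rightarrow> real" where
  "h1sum t = norm_H1_sq 0 L (fst (U t)) + norm_H1_sq 0 L (fst (snd (U t)))"

lemma H1_ae:
  assumes t: "0 \<le> t"
  shows "AE s in lebesgue_on {0<..<t}. 0 \<le> s \<and> U s \<in> H_space L \<and> fst (U s) \<in> H1 0 L \<and> fst (snd (U s)) \<in> H1 0 L"
proof (cases "t = 0")
  case True
  have "AE s in lebesgue_on {0<..<t}. s \<in> {0<..<t}" by (rule lebesgue_on_ae_space)
  then show ?thesis by eventually_elim (use True in simp)
next
  case False
  then have t: "0 < t" using t by simp
  have "AE s in lebesgue_on {0<..<t}. fst (U s) \<in> H1 0 L" "AE s in lebesgue_on {0<..<t}. fst (snd (U s)) \<in> H1 0 L"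
    using U_H1[OF t] by (auto simp: L2_time_H1_def)
  then show ?thesis using lebesgue_on_ae_space[of "{0<..<t}"]
    by eventually_elim (simp add: U_H)
qed

lemma h1sum_integrable: "0 \<le> t \<Longrightarrow> integrable (lebesgue_on {0<..<t}) h1sum"
proof (cases "t = 0")
  case True then show ?thesis by simp
next
  case False
  moreover assume "0 \<le> t"
  ultimately have "0 < t" by simp
  then show ?thesis unfolding h1sum_def using U_H1[of t] by (auto simp: L2_time_H1_def)
qed

lemma F_ae:
  assumes t: "0 \<le> t"
  shows "AE s in lebesgue_on {0<..<t}. HS_nonlinearity L (U s) \<in> H_space L \<and> norm (F s) \<le> nonlin_const * h1sum s"
  using H1_ae[OF t]
proof eventually_elim
  case (elim s)
  obtain u v z where uvz: "U s = (u, v, z)" by (cases "U s")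
  show ?case using nonlinearity_bound[of u v z] elim unfolding F_def h1sum_def uvz by simp
qed

lemma U_continuous: "continuous_on {0..} (\<lambda>t. emb (U t))"
  unfolding continuous_on_def
proof (intro ballI)
  fix t :: real assume t: "t \<in> {0..}"
  have "((\<lambda>s. dist_H L h \<beta> (U s) (U t)) \<longlongrightarrow> 0) (at t within {0..})" using U_cont t by simp
  moreover have "eventually (\<lambda>s. dist_H L h \<beta> (U s) (U t) = norm (emb (U s) - emb (U t))) (at t within {0..})"
    unfolding eventually_at using t by (intro exI[of _ 1]) (simp add: dist_emb U_H)
  ultimately have "((\<lambda>s. norm (emb (U s) - emb (U t))) \<longlongrightarrow> 0) (at t within {0..})" by (rule Lim_transform_eventually)
  then show "((\<lambda>t. emb (U t)) \<longlongrightarrow> emb (U t)) (at t within {0..})"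
    using tendsto_norm_zero_iff LIM_zero_cancel by blast
qed

lemma variation_weak:
  assumes t: "0 \<le> t"
  shows "integrable (lebesgue_on {0<..<t}) (\<lambda>s. T (t - s) (F s) \<bullet> \<Phi>)"
    "(emb (U t) - T t (emb U0)) \<bullet> \<Phi> = integral\<^sup>L (lebesgue_on {0<..<t}) (\<lambda>s. T (t - s) (F s) \<bullet> \<Phi>)"
proof -
  obtain W where W: "has_integral_H L h \<beta> (\<lambda>s. S (t - s) (HS_nonlinearity L (U s))) t W"
    "dist_H L h \<beta> (U t) (lincomb 1 (S t U0) 1 W) = 0" using variation[OF t] by blast
  have WH: "W \<in> H_space L" using W(1) by (simp add: has_integral_H_def)
  have SU: "S t U0 \<in> H_space L" by (rule S_H[OF t U0_H])
  have eW: "emb (U t) - T t (emb U0) = emb W"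
    using W(2) emb_eq_iff_dist[OF U_H[OF t] lincomb_H[OF SU WH]] emb_lincomb[OF SU WH, of 1 1]
    by (simp add: T_emb t U0_H)
  let ?f = "\<lambda>s. inner_H L h \<beta> (S (t - s) (HS_nonlinearity L (U s))) (proj \<Phi>)"
  have i: "integrable (lebesgue_on {0<..<t}) ?f" "inner_H L h \<beta> W (proj \<Phi>) = integral\<^sup>L (lebesgue_on {0<..<t}) ?f"
    using W(1) proj_H[of \<Phi>] by (auto simp: has_integral_H_def)
  have ae: "AE s in lebesgue_on {0<..<t}. ?f s = T (t - s) (F s) \<bullet> \<Phi>"
    using F_ae[OF t] lebesgue_on_ae_space[of "{0<..<t}"]
  proof eventually_elim
    case (elim s)
    have ts: "0 \<le> t - s" using elim by simp
    have N: "HS_nonlinearity L (U s) \<in> H_space L" using elim by blast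
    show ?case unfolding F_def T_emb[OF ts N] by (rule inner_emb_proj[OF S_H[OF ts N], symmetric])
  qed
  show "integrable (lebesgue_on {0<..<t}) (\<lambda>s. T (t - s) (F s) \<bullet> \<Phi>)"
    by (rule integrable_lebesgue_on_AE_cong(1)[OF _ i(1) ae]) simp
  show "(emb (U t) - T t (emb U0)) \<bullet> \<Phi> = integral\<^sup>L (lebesgue_on {0<..<t}) (\<lambda>s. T (t - s) (F s) \<bullet> \<Phi>)"
    unfolding eW inner_emb_proj[OF WH] i(2)
    by (rule integrable_lebesgue_on_AE_cong(2)[OF _ i(1) ae, symmetric]) simp
qed

text \<open>
  The dissipation is replaced by its \<open>j\<close>-th lower bound, because \<open>D\<close> itself is not continuous on
  the state space.
\<close>

lemma energy_inequality:
  assumes m: "0 \<le> m1" "0 \<le> m2"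
    and c1: "(1 + m1 * L) * \<alpha>\<^sup>2 + \<beta> / 2 * (1 + m2) \<le> 1 / 4" and c2: "(1 + m1 * L) * \<beta> \<le> 1 / 2"
    and ab: "0 \<le> a" "a < b"
  shows "integrable (lebesgue_on {a<..<b}) (\<lambda>s. hform m1 m2 (emb (U s)) (F s) - hdiss m1 m2 j (emb (U s)))"
    "hform m1 m2 (emb (U b)) (emb (U b)) / 2 - hform m1 m2 (emb (U a)) (emb (U a)) / 2
      \<le> integral\<^sup>L (lebesgue_on {a<..<b}) (\<lambda>s. hform m1 m2 (emb (U s)) (F s) - hdiss m1 m2 j (emb (U s)))"
proof -
  have d: "dissipation (hform m1 m2) (hdiss m1 m2 j)"
    by (rule dissipationI, rule HS_dissipative[OF _ m c1 c2])
  have F: "AE s in lebesgue_on {0<..<t}. T 0 (F s) = F s \<and> norm (F s) \<le> nonlin_const * h1sum s" if "0 \<le> t" for t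
    using F_ae[OF that] by eventually_elim (simp add: F_def T_0_emb)
  note E = mild_energy_inequality[OF d, where U="\<lambda>t. emb (U t)" and F=F and g="\<lambda>s. nonlin_const * h1sum s" and \<xi>="emb U0" and a=a and b=b,
      OF _ U_continuous _ F variation_weak ab]
  show "integrable (lebesgue_on {a<..<b}) (\<lambda>s. hform m1 m2 (emb (U s)) (F s) - hdiss m1 m2 j (emb (U s)))"
    by (rule E) (auto intro!: integrable_mult_right h1sum_integrable simp: T_0_emb U_H)
  show "hform m1 m2 (emb (U b)) (emb (U b)) / 2 - hform m1 m2 (emb (U a)) (emb (U a)) / 2
      \<le> integral\<^sup>L (lebesgue_on {a<..<b}) (\<lambda>s. hform m1 m2 (emb (U s)) (F s) - hdiss m1 m2 j (emb (U s)))"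
    by (rule E) (auto intro!: integrable_mult_right h1sum_integrable simp: T_0_emb U_H)
qed

definition in_H1_0 :: "state \<Rightarrow> bool" where
  "in_H1_0 X \<longleftrightarrow> X \<in> H_space L \<and> fst X \<in> H1 0 L \<and> fst (snd X) \<in> H1 0 L \<and>
     trace_at 0 L (fst X) 0 = 0 \<and> trace_at 0 L (fst X) L = 0 \<and>
     trace_at 0 L (fst (snd X)) 0 = 0 \<and> trace_at 0 L (fst (snd X)) L = 0"

lemma hdiss_nonneg: "0 \<le> m1 \<Longrightarrow> 0 \<le> m2 \<Longrightarrow> 0 \<le> hdiss m1 m2 j x"
  unfolding hdiss_def diss_approx_def using \<beta> by (intro add_nonneg_nonneg mult_nonneg_nonneg dirichlet_approx_nonneg inner_L2_nonneg) auto

lemma hdiss_mono: "0 \<le> m1 \<Longrightarrow> i \<le> j \<Longrightarrow> hdiss m1 m2 i x \<le> hdiss m1 m2 j x"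
  unfolding hdiss_def diss_approx_def
  by (intro add_right_mono add_mono mult_left_mono dirichlet_approx_mono) auto

text \<open>
  The energy inequality bounds the time integrals of the dissipation bounds uniformly in \<open>j\<close>. By
  monotone convergence their supremum is finite at almost every time, and at such a time the state
  has zero boundary values.
\<close>

lemma in_H1_0_ae:
  assumes m: "0 < m1" "0 \<le> m2"
    and c1: "(1 + m1 * L) * \<alpha>\<^sup>2 + \<beta> / 2 * (1 + m2) \<le> 1 / 4" and c2: "(1 + m1 * L) * \<beta> \<le> 1 / 2"
    and b: "0 < b"
  shows "AE s in lebesgue_on {0<..<b}. in_H1_0 (U s)"
proof -
  let ?M = "lebesgue_on {0<..<b}"
  let ?f = "\<lambda>j s. hdiss m1 m2 j (emb (U s))"
  have m1: "0 \<le> m1" using m by simp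
  note E = energy_inequality[OF m1 m(2) c1 c2 order_refl b]
  have fc: "continuous_on {0..b} (?f j)" for j
    by (intro continuous_on_compose2[OF hdiss_continuous] continuous_on_subset[OF U_continuous]) auto
  have fi: "integrable ?M (?f j)" for j by (rule continuous_integrable_Ioo(1)[OF fc])
  have hi: "integrable ?M (\<lambda>s. hform m1 m2 (emb (U s)) (F s))"
    using Bochner_Integration.integrable_add[OF E(1)[of 0] fi[of 0]] by simp
  \<comment> \<open>\<open>C\<close> does not depend on \<open>j\<close>.\<close>
  define C where "C = hform m1 m2 (emb (U 0)) (emb (U 0)) / 2 - hform m1 m2 (emb (U b)) (emb (U b)) / 2 + integral\<^sup>L ?M (\<lambda>s. hform m1 m2 (emb (U s)) (F s))"
  have fC: "integral\<^sup>L ?M (?f j) \<le> C" for j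
    using E(2)[of j] Bochner_Integration.integral_diff[OF hi fi[of j]] by (simp add: C_def)
  have "(\<integral>\<^sup>+s. (SUP j. ennreal (?f j s)) \<partial>?M) = (SUP j. \<integral>\<^sup>+s. ennreal (?f j s) \<partial>?M)"
  proof (rule nn_integral_monotone_convergence_SUP)
    show "incseq (\<lambda>j s. ennreal (?f j s))"
      by (intro incseq_SucI le_funI ennreal_leI hdiss_mono m1) simp
    show "(\<lambda>s. ennreal (?f j s)) \<in> borel_measurable ?M" for j using fi[of j] by simp
  qed
  also have "\<dots> = (SUP j. ennreal (integral\<^sup>L ?M (?f j)))"
    using nn_integral_eq_integral[OF fi] hdiss_nonneg[OF m1 m(2)] by simp
  also have "\<dots> \<le> ennreal C" by (intro SUP_least ennreal_leI fC)
  finally have fin: "(\<integral>\<^sup>+s. (SUP j. ennreal (?f j s)) \<partial>?M) \<noteq> \<infinity>" by (auto simp: top_unique)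
  have "AE s in ?M. (SUP j. ennreal (?f j s)) \<noteq> \<infinity>"
    by (rule nn_integral_noteq_infinite[OF _ fin]) (use fi in \<open>intro borel_measurable_SUP; simp\<close>)
  then show ?thesis using H1_ae[OF less_imp_le[OF b]]
  proof eventually_elim
    case (elim s)
    then obtain c where c: "(SUP j. ennreal (?f j s)) = ennreal c" "0 \<le> c"
      by (cases "SUP j. ennreal (?f j s)") auto
    have le: "?f j s \<le> c" for j
    proof -
      have "ennreal (?f j s) \<le> ennreal c" unfolding c(1)[symmetric] by (rule SUP_upper) simp
      then show ?thesis using c(2) by (simp add: ennreal_le_iff)
    qed
    obtain u v z where uvz: "U s = (u, v, z)" by (cases "U s")
    have H: "(u, v, z) \<in> H_space L" "u \<in> H1 0 L" "v \<in> H1 0 L" using elim(2) by (simp_all add: uvz)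
    have d: "3 / 4 * m1 * dirichlet_approx L j u + 3 / 2 * m1 * dirichlet_approx L j v + 1 / 2 * \<beta> * m2 * inner_L2 0 1 z z \<le> c" for j
      using le[of j] unfolding uvz hdiss_emb[OF H(1)] by (simp add: diss_approx_def)
    have z0: "0 \<le> 1 / 2 * \<beta> * m2 * inner_L2 0 1 z z" using \<beta> m inner_L2_nonneg by simp
    have du: "dirichlet_approx L j u \<le> c / (3 / 4 * m1)" and dv: "dirichlet_approx L j v \<le> c / (3 / 2 * m1)" for j
    proof -
      have n: "0 \<le> 3 / 4 * m1 * dirichlet_approx L j u" "0 \<le> 3 / 2 * m1 * dirichlet_approx L j v"
        using m1 dirichlet_approx_nonneg by simp_all
      have "3 / 4 * m1 * dirichlet_approx L j u \<le> c" "3 / 2 * m1 * dirichlet_approx L j v \<le> c" using d[of j] n z0 by linarith+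
      then show "dirichlet_approx L j u \<le> c / (3 / 4 * m1)" "dirichlet_approx L j v \<le> c / (3 / 2 * m1)"
        using m(1) by (simp_all add: field_simps)
    qed
    note A = H1_ac[OF L H(2)] and B = H1_ac[OF L H(3)]
    have tu: "dirichlet_approx L j (trace_at 0 L u) \<le> c / (3 / 4 * m1)" for j
      using du[of j] dirichlet_approx_AE_cong[OF H1_L2[OF H(2)] A(2), of j] by simp
    have tv: "dirichlet_approx L j (trace_at 0 L v) \<le> c / (3 / 2 * m1)" for j
      using dv[of j] dirichlet_approx_AE_cong[OF H1_L2[OF H(3)] B(2), of j] by simp
    show ?case
      unfolding in_H1_0_def uvz fst_conv snd_conv
      using H bounded_dirichlet_approx_trace[OF L A(1) tu] bounded_dirichlet_approx_trace[OF L B(1) tv] by blast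
  qed
qed

end

section \<open>Decay of the Lyapunov functional\<close>

context state_space
begin

text \<open>
  The dissipation \<open>D\<close>, for states with derivatives in \<open>L\<^sup>2\<close>.
\<close>

definition dissipated :: "real \<Rightarrow> real \<Rightarrow> state \<Rightarrow> real" where
  "dissipated m1 m2 X = 3 / 4 * m1 * inner_L2 0 L (wderiv 0 L (fst X)) (wderiv 0 L (fst X))
     + 3 / 2 * m1 * inner_L2 0 L (wderiv 0 L (fst (snd X))) (wderiv 0 L (fst (snd X)))
     + 1 / 2 * \<beta> * m2 * inner_L2 0 1 (snd (snd X)) (snd (snd X))"

lemma wform_bounds:
  assumes X: "X \<in> H_space L" and m: "0 \<le> m1" "0 \<le> m2"
  shows "inner_H L h \<beta> X X \<le> wform m1 m2 X X"
    "wform m1 m2 X X \<le> (1 + m1 * L) * (inner_L2 0 L (fst X) (fst X) + inner_L2 0 L (fst (snd X)) (fst (snd X)))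
       + (1 + m2) * (\<beta> * h * inner_L2 0 1 (snd (snd X)) (snd (snd X)))"
proof -
  obtain u v z where uvz: "X = (u, v, z)" by (cases X)
  have H: "u \<in> L2 0 L" "v \<in> L2 0 L" "z \<in> L2 0 1" using X by (auto simp: uvz H_space_def)
  have *: "inner_L2 a b f f \<le> inner_L2 a b (\<lambda>x. p x * f x) f \<and> inner_L2 a b (\<lambda>x. p x * f x) f \<le> K * inner_L2 a b f f"
    if f: "f \<in> L2 a b" and p: "continuous_on {a..b} p" "\<And>x. x \<in> {a<..<b} \<Longrightarrow> 1 \<le> p x \<and> p x \<le> K" for a b f p K
  proof
    note i = L2_mult_integrable[OF f f] and pi = L2_mult_integrable[OF L2_continuous_mult[OF f p(1)] f]
    have "AE x in lebesgue_on {a<..<b}. f x * f x \<le> p x * f x * f x \<and> p x * f x * f x \<le> K * (f x * f x)"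
      using lebesgue_on_ae_space[of "{a<..<b}"]
    proof eventually_elim
      case (elim x)
      show ?case using p(2)[OF elim] mult_right_mono[of 1 "p x" "f x * f x"] mult_right_mono[of "p x" K "f x * f x"]
        by (simp add: mult.assoc)
    qed
    then show "inner_L2 a b f f \<le> inner_L2 a b (\<lambda>x. p x * f x) f"
      unfolding inner_L2_def by (intro integral_mono_AE i pi) (auto elim: eventually_mono)
    have "integral\<^sup>L (lebesgue_on {a<..<b}) (\<lambda>x. p x * f x * f x) \<le> integral\<^sup>L (lebesgue_on {a<..<b}) (\<lambda>x. K * (f x * f x))"
      using \<open>AE x in lebesgue_on {a<..<b}. f x * f x \<le> p x * f x * f x \<and> p x * f x * f x \<le> K * (f x * f x)\<close> i
      by (intro integral_mono_AE pi) (auto elim: eventually_mono)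
    then show "inner_L2 a b (\<lambda>x. p x * f x) f \<le> K * inner_L2 a b f f" by (simp add: inner_L2_def)
  qed
  have 1: "inner_L2 0 L u u \<le> inner_L2 0 L (\<lambda>x. (1 + m1 * (L - x)) * u x) u \<and> inner_L2 0 L (\<lambda>x. (1 + m1 * (L - x)) * u x) u \<le> (1 + m1 * L) * inner_L2 0 L u u"
    by (rule *[OF H(1)]) (use m L in \<open>auto intro!: continuous_intros mult_left_mono\<close>)
  have 2: "inner_L2 0 L v v \<le> inner_L2 0 L (\<lambda>x. (1 + m1 * x) * v x) v \<and> inner_L2 0 L (\<lambda>x. (1 + m1 * x) * v x) v \<le> (1 + m1 * L) * inner_L2 0 L v v"
    by (rule *[OF H(2)]) (use m L in \<open>auto intro!: continuous_intros mult_left_mono\<close>)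
  have 3: "inner_L2 0 1 z z \<le> inner_L2 0 1 (\<lambda>x. (1 + m2 * (1 - x)) * z x) z \<and> inner_L2 0 1 (\<lambda>x. (1 + m2 * (1 - x)) * z x) z \<le> (1 + m2) * inner_L2 0 1 z z"
    by (rule *[OF H(3)]) (use m in \<open>auto intro!: continuous_intros simp: mult_left_le\<close>)
  have bh: "0 \<le> \<beta> * h" using \<beta> h by simp
  have 4: "\<beta> * h * inner_L2 0 1 z z \<le> \<beta> * h * inner_L2 0 1 (\<lambda>x. (1 + m2 * (1 - x)) * z x) z"
    using 3 bh by (intro mult_left_mono) auto
  have 5: "\<beta> * h * inner_L2 0 1 (\<lambda>x. (1 + m2 * (1 - x)) * z x) z \<le> (1 + m2) * (\<beta> * h * inner_L2 0 1 z z)"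
    using mult_left_mono[OF conjunct2[OF 3] bh] by (simp add: mult_ac)
  show "inner_H L h \<beta> X X \<le> wform m1 m2 X X" using 1 2 4 by (simp add: uvz wform_def)
  show "wform m1 m2 X X \<le> (1 + m1 * L) * (inner_L2 0 L (fst X) (fst X) + inner_L2 0 L (fst (snd X)) (fst (snd X)))
       + (1 + m2) * (\<beta> * h * inner_L2 0 1 (snd (snd X)) (snd (snd X)))"
    using 1 2 5 unfolding uvz wform_def fst_conv snd_conv distrib_left[of "1 + m1 * L"] by linarith
qed

lemma state_energy_inner: "X \<in> H_space L \<Longrightarrow> state_energy L h \<beta> X = inner_H L h \<beta> X X / 2"
proof -
  assume X: "X \<in> H_space L"
  obtain u v z where uvz: "X = (u, v, z)" by (cases X)
  have "u \<in> L2 0 L" "v \<in> L2 0 L" using X by (auto simp: uvz H_space_def)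
  then have "integral\<^sup>L (lebesgue_on {0<..<L}) (\<lambda>x. (u x)\<^sup>2 + (v x)\<^sup>2) = inner_L2 0 L u u + inner_L2 0 L v v"
    unfolding inner_L2_def power2_eq_square
    by (intro Bochner_Integration.integral_add L2_mult_integrable)
  then show ?thesis by (simp add: uvz inner_L2_def power2_eq_square)
qed

end

context hs_mild
begin

text \<open>
  The second bound provides a majorant that is integrable in time and independent of \<open>j\<close>.
\<close>

lemma diss_approx_in_H1_0:
  assumes X: "in_H1_0 X" and m: "0 \<le> m1"
  shows "(\<lambda>j. hdiss m1 m2 j (emb X)) \<longlonglongrightarrow> dissipated m1 m2 X"
    "hdiss m1 m2 j (emb X) - hdiss m1 m2 0 (emb X) \<le> 3 / 2 * m1 * (norm_H1_sq 0 L (fst X) + norm_H1_sq 0 L (fst (snd X)))"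
proof -
  obtain u v z where uvz: "X = (u, v, z)" by (cases X)
  have H: "(u, v, z) \<in> H_space L" "u \<in> H1 0 L" "v \<in> H1 0 L" using X by (simp_all add: in_H1_0_def uvz)
  note A = H1_ac[OF L H(2)] and B = H1_ac[OF L H(3)]
  have bc: "trace_at 0 L u 0 = 0" "trace_at 0 L u L = 0" "trace_at 0 L v 0 = 0" "trace_at 0 L v L = 0"
    using X by (simp_all add: in_H1_0_def uvz)
  note du = dirichlet_approx_AE_cong[OF H1_L2[OF H(2)] A(2)] and dv = dirichlet_approx_AE_cong[OF H1_L2[OF H(3)] B(2)]
  note hX = hdiss_emb[OF H(1)]
  show "(\<lambda>j. hdiss m1 m2 j (emb X)) \<longlonglongrightarrow> dissipated m1 m2 X"
    unfolding uvz hX diss_approx_def dissipated_def fst_conv snd_conv du dv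
    by (intro tendsto_intros dirichlet_approx_tendsto[OF L] A B bc)
  have u: "dirichlet_approx L j u \<le> norm_H1_sq 0 L u"
    using dirichlet_approx_le_dirichlet[OF L A(1) bc(1,2), of j] inner_L2_nonneg[of 0 L u] by (simp add: du norm_H1_sq_def)
  have v: "dirichlet_approx L j v \<le> norm_H1_sq 0 L v"
    using dirichlet_approx_le_dirichlet[OF L B(1) bc(3,4), of j] inner_L2_nonneg[of 0 L v] by (simp add: dv norm_H1_sq_def)
  have "3 / 4 * m1 * dirichlet_approx L j u \<le> 3 / 2 * m1 * norm_H1_sq 0 L u"
    using mult_left_mono[OF u, of "3 / 4 * m1"] dirichlet_approx_nonneg[of L j u] u m
      mult_nonneg_nonneg[OF m order_trans[OF dirichlet_approx_nonneg u]] by linarith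
  moreover have "3 / 2 * m1 * dirichlet_approx L j v \<le> 3 / 2 * m1 * norm_H1_sq 0 L v"
    using v m by (intro mult_left_mono) auto
  ultimately show "hdiss m1 m2 j (emb X) - hdiss m1 m2 0 (emb X) \<le> 3 / 2 * m1 * (norm_H1_sq 0 L (fst X) + norm_H1_sq 0 L (fst (snd X)))"
    unfolding uvz hX by (simp add: diss_approx_def distrib_left)
qed

lemma nonlinear_work:
  assumes X: "in_H1_0 X"
  shows "hform 0 0 (emb X) (emb (HS_nonlinearity L X)) = 0"
    "norm (emb X) \<le> r \<Longrightarrow> 0 \<le> m1 \<Longrightarrow> hform m1 m2 (emb X) (emb (HS_nonlinearity L X)) \<le>
      m1 * (L * sqrt L * r) * (5 / 2 * inner_L2 0 L (wderiv 0 L (fst X)) (wderiv 0 L (fst X))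
        + 3 / 2 * inner_L2 0 L (wderiv 0 L (fst (snd X))) (wderiv 0 L (fst (snd X))))"
proof -
  obtain u v z where uvz: "X = (u, v, z)" by (cases X)
  have H: "(u, v, z) \<in> H_space L" "u \<in> H1 0 L" "v \<in> H1 0 L" using X by (simp_all add: in_H1_0_def uvz)
  note A = H1_ac[OF L H(2)] and B = H1_ac[OF L H(3)]
  have bc: "trace_at 0 L u 0 = 0" "trace_at 0 L u L = 0" "trace_at 0 L v 0 = 0" "trace_at 0 L v L = 0"
    using X by (simp_all add: in_H1_0_def uvz)
  let ?u = "trace_at 0 L u" and ?v = "trace_at 0 L v"
  have N: "hform m1 m2 (emb X) (emb (HS_nonlinearity L X)) = m1 * (integral\<^sup>L (lebesgue_on {0<..<L}) (\<lambda>x. ?u x * ?u x * ?u x)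
      + 3 * integral\<^sup>L (lebesgue_on {0<..<L}) (\<lambda>x. (L - 2 * x) * ?u x * ?v x * wderiv 0 L v x))" for m1 m2
    unfolding uvz hform_emb[OF H(1) nonlinearity_bound(1)[OF H]] wform_sym[of m1 m2 "(u, v, z)"]
    by (rule nonlinearity_form[OF H bc(1,2)])
  show "hform 0 0 (emb X) (emb (HS_nonlinearity L X)) = 0" by (simp add: N)
  assume r: "norm (emb X) \<le> r" and m: "0 \<le> m1"
  have r0: "0 \<le> r" using r norm_ge_zero order_trans by blast
  have nX: "(norm (emb X))\<^sup>2 = inner_L2 0 L u u + inner_L2 0 L v v + \<beta> * h * inner_L2 0 1 z z"
    unfolding uvz by (simp only: power2_norm_eq_inner inner_emb[OF H(1) H(1)] inner_H.simps)
  have z0: "0 \<le> \<beta> * h * inner_L2 0 1 z z" using \<beta> h inner_L2_nonneg by simp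
  have iu: "inner_L2 0 L u u = inner_L2 0 L ?u ?u" by (rule inner_L2_AE_cong[OF H1_L2[OF H(2)] H1_L2[OF H(2)] A(2) A(2)])
  have iv: "inner_L2 0 L v v = inner_L2 0 L ?v ?v" by (rule inner_L2_AE_cong[OF H1_L2[OF H(3)] H1_L2[OF H(3)] B(2) B(2)])
  have "(norm_L2 0 L ?u)\<^sup>2 \<le> (norm (emb X))\<^sup>2" "(norm_L2 0 L ?v)\<^sup>2 \<le> (norm (emb X))\<^sup>2"
    unfolding norm_L2_power2 nX iu iv using z0 inner_L2_nonneg[of 0 L ?u] inner_L2_nonneg[of 0 L ?v] by linarith+
  note sq = this
  have "norm_L2 0 L ?u \<le> norm (emb X)" "norm_L2 0 L ?v \<le> norm (emb X)"
    by (rule power2_le_imp_le[OF sq(1) norm_ge_zero], rule power2_le_imp_le[OF sq(2) norm_ge_zero])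
  then have ur: "norm_L2 0 L ?u \<le> r" and vr: "norm_L2 0 L ?v \<le> r" using r by linarith+
  let ?\<rho> = "L * sqrt L * r" and ?G = "inner_L2 0 L (wderiv 0 L u) (wderiv 0 L u)" and ?K = "inner_L2 0 L (wderiv 0 L v) (wderiv 0 L v)"
  have 1: "integral\<^sup>L (lebesgue_on {0<..<L}) (\<lambda>x. ?u x * ?u x * ?u x) \<le> ?\<rho> * ?G"
    by (rule cubic_bound[OF A(1) bc(1) ur])
  have 2: "integral\<^sup>L (lebesgue_on {0<..<L}) (\<lambda>x. (L - 2 * x) * ?u x * ?v x * wderiv 0 L v x) \<le> ?\<rho> * ((?G + ?K) / 2)"
    by (rule transport_bound[OF A(1) bc(1) ac_fun_L2[OF B(1)] ac_continuous[OF B(1)] ac_L2[OF B(1)] vr r0])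
  have "?\<rho> * ?G + 3 * (?\<rho> * ((?G + ?K) / 2)) = ?\<rho> * (5 / 2 * ?G + 3 / 2 * ?K)" by (simp add: field_simps)
  then have "integral\<^sup>L (lebesgue_on {0<..<L}) (\<lambda>x. ?u x * ?u x * ?u x)
      + 3 * integral\<^sup>L (lebesgue_on {0<..<L}) (\<lambda>x. (L - 2 * x) * ?u x * ?v x * wderiv 0 L v x) \<le> ?\<rho> * (5 / 2 * ?G + 3 / 2 * ?K)"
    using 1 2 by linarith
  from mult_left_mono[OF this m]
  show "hform m1 m2 (emb X) (emb (HS_nonlinearity L X)) \<le>
      m1 * (L * sqrt L * r) * (5 / 2 * inner_L2 0 L (wderiv 0 L (fst X)) (wderiv 0 L (fst X))
        + 3 / 2 * inner_L2 0 L (wderiv 0 L (fst (snd X))) (wderiv 0 L (fst (snd X))))"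
    unfolding N unfolding uvz fst_conv snd_conv mult.assoc[of m1] .
qed

text \<open>
  Write \<open>\<rho> = L sqrt L r\<close>, \<open>G = \<parallel>u\<^sub>x\<parallel>\<^sup>2\<close> and \<open>K = \<parallel>v\<^sub>x\<parallel>\<^sup>2\<close>. By Wirtinger and the hypotheses on \<open>l\<close>,
  \<open>l V\<close> is at most \<open>3/4 m1 (G + K) - 4 m1 \<rho> (G + K)\<close> plus the part of the dissipation that belongs
  to \<open>z\<close>. The nonlinearity adds at most \<open>m1 \<rho> (5/2 G + 3/2 K)\<close>, which the negative term absorbs.
\<close>

lemma lyapunov_rate:
  assumes X: "in_H1_0 X" and r: "norm (emb X) \<le> r" and m: "0 \<le> m1" "0 \<le> m2" and l: "0 \<le> l"
    and l1: "l * (L\<^sup>2 * (1 + m1 * L)) \<le> pi\<^sup>2 * m1 * (3 - 16 * (L * sqrt L * r)) / 2"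
    and l2: "l * (h * (1 + m2)) \<le> m2"
  shows "hform m1 m2 (emb X) (emb (HS_nonlinearity L X)) - dissipated m1 m2 X \<le> - l * (hform m1 m2 (emb X) (emb X) / 2)"
proof -
  obtain u v z where uvz: "X = (u, v, z)" by (cases X)
  have H: "(u, v, z) \<in> H_space L" "u \<in> H1 0 L" "v \<in> H1 0 L" using X by (simp_all add: in_H1_0_def uvz)
  note A = H1_ac[OF L H(2)] and B = H1_ac[OF L H(3)]
  have bc: "trace_at 0 L u 0 = 0" "trace_at 0 L u L = 0" "trace_at 0 L v 0 = 0" "trace_at 0 L v L = 0"
    using X by (simp_all add: in_H1_0_def uvz)
  have r0: "0 \<le> r" using r norm_ge_zero order_trans by blast
  define \<rho> where "\<rho> = L * sqrt L * r"
  have \<rho>: "0 \<le> \<rho>" using L r0 by (simp add: \<rho>_def)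
  define G K Z where "G = inner_L2 0 L (wderiv 0 L u) (wderiv 0 L u)" and "K = inner_L2 0 L (wderiv 0 L v) (wderiv 0 L v)" and "Z = inner_L2 0 1 z z"
  have nn: "0 \<le> G" "0 \<le> K" "0 \<le> Z" unfolding G_def K_def Z_def by (rule inner_L2_nonneg)+
  have work: "hform m1 m2 (emb X) (emb (HS_nonlinearity L X)) \<le> m1 * \<rho> * (5 / 2 * G + 3 / 2 * K)"
    using nonlinear_work(2)[OF X r m(1)] by (simp add: uvz G_def K_def \<rho>_def)
  have P: "inner_L2 0 L u u \<le> L\<^sup>2 / pi\<^sup>2 * G" "inner_L2 0 L v v \<le> L\<^sup>2 / pi\<^sup>2 * K"
  proof -
    have "pi\<^sup>2 / L\<^sup>2 * inner_L2 0 L u u \<le> G"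
      unfolding inner_L2_AE_cong[OF H1_L2[OF H(2)] H1_L2[OF H(2)] A(2) A(2)] G_def by (rule wirtinger[OF L A(1) bc(1,2)])
    then show "inner_L2 0 L u u \<le> L\<^sup>2 / pi\<^sup>2 * G" using L by (simp add: field_simps)
    have "pi\<^sup>2 / L\<^sup>2 * inner_L2 0 L v v \<le> K"
      unfolding inner_L2_AE_cong[OF H1_L2[OF H(3)] H1_L2[OF H(3)] B(2) B(2)] K_def by (rule wirtinger[OF L B(1) bc(3,4)])
    then show "inner_L2 0 L v v \<le> L\<^sup>2 / pi\<^sup>2 * K" using L by (simp add: field_simps)
  qed
  have "l * (1 + m1 * L) * (L\<^sup>2 / pi\<^sup>2) = l * (L\<^sup>2 * (1 + m1 * L)) / pi\<^sup>2" by (simp add: mult_ac)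
  also have "\<dots> \<le> (pi\<^sup>2 * m1 * (3 - 16 * \<rho>) / 2) / pi\<^sup>2" using l1 unfolding \<rho>_def by (rule divide_right_mono) simp
  also have "\<dots> = m1 * (3 - 16 * \<rho>) / 2" by simp
  finally have c: "l * (1 + m1 * L) * (L\<^sup>2 / pi\<^sup>2) \<le> m1 * (3 - 16 * \<rho>) / 2" .
  have q: "0 \<le> l * (1 + m1 * L)" using l m L by simp
  have "l * (1 + m1 * L) * (inner_L2 0 L u u + inner_L2 0 L v v) \<le> l * (1 + m1 * L) * (L\<^sup>2 / pi\<^sup>2 * G + L\<^sup>2 / pi\<^sup>2 * K)"
    using q P by (intro mult_left_mono add_mono) auto
  also have "\<dots> = (l * (1 + m1 * L) * (L\<^sup>2 / pi\<^sup>2)) * (G + K)" by (simp only: distrib_left mult.assoc)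
  also have "\<dots> \<le> (m1 * (3 - 16 * \<rho>) / 2) * (G + K)" using c nn by (intro mult_right_mono) auto
  finally have c1: "l * (1 + m1 * L) * (inner_L2 0 L u u + inner_L2 0 L v v) \<le> (m1 * (3 - 16 * \<rho>) / 2) * (G + K)" .
  have "(l * (h * (1 + m2))) * (\<beta> * Z) \<le> m2 * (\<beta> * Z)" using l2 \<beta> nn by (intro mult_right_mono) auto
  then have c2: "l * ((1 + m2) * (\<beta> * h * Z)) \<le> \<beta> * m2 * Z" by (simp add: mult_ac)
  have "l * hform m1 m2 (emb X) (emb X) \<le> l * ((1 + m1 * L) * (inner_L2 0 L u u + inner_L2 0 L v v) + (1 + m2) * (\<beta> * h * Z))"
    using wform_bounds(2)[OF H(1) m] l unfolding uvz hform_emb[OF H(1) H(1)] by (intro mult_left_mono) (auto simp: Z_def)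
  also have "\<dots> = l * (1 + m1 * L) * (inner_L2 0 L u u + inner_L2 0 L v v) + l * ((1 + m2) * (\<beta> * h * Z))"
    by (rule trans[OF distrib_left]) (simp only: mult.assoc)
  finally have V: "l * hform m1 m2 (emb X) (emb X) \<le> (m1 * (3 - 16 * \<rho>) / 2) * (G + K) + \<beta> * m2 * Z" using c1 c2 by linarith
  have D: "dissipated m1 m2 X = 3 / 4 * m1 * G + 3 / 2 * m1 * K + 1 / 2 * \<beta> * m2 * Z"
    by (simp add: dissipated_def uvz G_def K_def Z_def)
  have "0 \<le> m1 * (\<rho> * G)" "0 \<le> m1 * (\<rho> * K)" "0 \<le> m1 * K" using m \<rho> nn by simp_all
  moreover have "m1 * \<rho> * (5 / 2 * G + 3 / 2 * K) = 5 / 2 * (m1 * (\<rho> * G)) + 3 / 2 * (m1 * (\<rho> * K))" by (simp add: algebra_simps)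
  moreover have "(m1 * (3 - 16 * \<rho>) / 2) * (G + K) = 3 / 2 * (m1 * G) + 3 / 2 * (m1 * K) - 8 * (m1 * (\<rho> * G)) - 8 * (m1 * (\<rho> * K))"
    by (simp add: field_simps)
  ultimately show ?thesis using work V D by linarith
qed

lemma emb_U_0: "emb (U 0) = emb U0"
proof -
  have "(emb (U 0) - emb U0) \<bullet> (emb (U 0) - emb U0) = 0"
    using variation_weak(2)[OF order_refl, of "emb (U 0) - emb U0"] T_0_emb[OF U0_H] by simp
  then show ?thesis by simp
qed

end

locale hs_weights = hs_mild +
  fixes m1 m2 :: real
  assumes m: "0 < m1" "0 \<le> m2"
    and c1: "(1 + m1 * L) * \<alpha>\<^sup>2 + \<beta> / 2 * (1 + m2) \<le> 1 / 4" and c2: "(1 + m1 * L) * \<beta> \<le> 1 / 2"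
begin

lemma in_H1_0_ae_Ioo: "0 \<le> a \<Longrightarrow> a < b \<Longrightarrow> AE s in lebesgue_on {a<..<b}. in_H1_0 (U s)"
  using AE_Ioo_subinterval[OF in_H1_0_ae[OF m c1 c2, of b], of a b] by simp

text \<open>
  For zero weights neither the nonlinearity nor the dissipation bounds contribute. That the former
  vanishes uses the zero boundary values, which were obtained with positive weights; hence the
  positive \<open>m1\<close> of the locale.
\<close>

lemma energy_decreasing:
  assumes ab: "0 \<le> a" "a < b" shows "norm (emb (U b)) \<le> norm (emb (U a))"
proof -
  have g: "(1 + 0 * L) * \<alpha>\<^sup>2 + \<beta> / 2 * (1 + 0) \<le> 1 / 4" "(1 + 0 * L) * \<beta> \<le> 1 / 2" using gain by simp_all
  note E = energy_inequality[OF order_refl order_refl g ab, of 0]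
  have "integral\<^sup>L (lebesgue_on {a<..<b}) (\<lambda>s. hform 0 0 (emb (U s)) (F s) - hdiss 0 0 0 (emb (U s))) = 0"
  proof (rule integral_eq_zero_AE)
    show "AE s in lebesgue_on {a<..<b}. hform 0 0 (emb (U s)) (F s) - hdiss 0 0 0 (emb (U s)) = 0"
      using in_H1_0_ae_Ioo[OF ab]
      by eventually_elim (simp add: F_def nonlinear_work(1) hdiss_def diss_approx_def)
  qed
  then have "hform 0 0 (emb (U b)) (emb (U b)) \<le> hform 0 0 (emb (U a)) (emb (U a))" using E(2) by simp
  then show ?thesis using hform_0_emb U_H ab by (simp add: norm_le)
qed

lemma norm_U_le: "0 \<le> t \<Longrightarrow> norm (emb (U t)) \<le> norm (emb U0)"
  using energy_decreasing[of 0 t] emb_U_0 by (cases "t = 0") auto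

text \<open>
  Let \<open>j\<close> tend to infinity in the energy inequality and use \<open>lyapunov_rate\<close> under the integral. As
  \<open>V\<close> is nonincreasing, the integral of \<open>- l V\<close> over \<open>(a, b)\<close> is at most \<open>- l (b - a) V b\<close>.
\<close>

lemma lyapunov_step:
  assumes r: "norm (emb U0) \<le> r" and l: "0 \<le> l"
    and l1: "l * (L\<^sup>2 * (1 + m1 * L)) \<le> pi\<^sup>2 * m1 * (3 - 16 * (L * sqrt L * r)) / 2"
    and l2: "l * (h * (1 + m2)) \<le> m2"
  defines "V \<equiv> \<lambda>t. hform m1 m2 (emb (U t)) (emb (U t)) / 2"
  assumes ab: "0 \<le> a" "a < b"
  shows "V b * (1 + l * (b - a)) \<le> V a"
proof -
  have m1: "0 \<le> m1" using m by simp
  have V0: "0 \<le> V t" if "0 \<le> t" for t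
  proof -
    have "0 \<le> inner_H L h \<beta> (U t) (U t)" using inner_emb[OF U_H U_H, OF that that] by (metis inner_ge_zero)
    also have "\<dots> \<le> wform m1 m2 (U t) (U t)" by (rule wform_bounds(1)[OF U_H[OF that] m1 m(2)])
    finally show ?thesis by (simp add: V_def hform_emb U_H that)
  qed
  have main: "\<exists>f. integrable (lebesgue_on {c<..<d}) f \<and> V d - V c \<le> integral\<^sup>L (lebesgue_on {c<..<d}) f \<and>
      (AE s in lebesgue_on {c<..<d}. f s \<le> - l * V s)" if cd: "0 \<le> c" "c < d" for c d
  proof -
    let ?M = "lebesgue_on {c<..<d}"
    let ?f = "\<lambda>j s. hform m1 m2 (emb (U s)) (F s) - hdiss m1 m2 j (emb (U s))"
    note E = energy_inequality[OF m1 m(2) c1 c2 cd]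
    define f where "f s = lim (\<lambda>j. ?f j s)" for s
    have reg: "AE s in ?M. in_H1_0 (U s) \<and> 0 \<le> s"
      using in_H1_0_ae_Ioo[OF cd] lebesgue_on_ae_space[of "{c<..<d}"] by eventually_elim (use cd in auto)
    have lim: "AE s in ?M. (\<lambda>j. ?f j s) \<longlonglongrightarrow> hform m1 m2 (emb (U s)) (F s) - dissipated m1 m2 (U s)"
      using reg by eventually_elim (intro tendsto_intros diss_approx_in_H1_0(1) m1; simp)
    have limf: "AE s in ?M. (\<lambda>j. ?f j s) \<longlonglongrightarrow> f s"
      using lim by eventually_elim (simp add: f_def limI)
    have fm: "f \<in> borel_measurable ?M"
      unfolding f_def by (intro borel_measurable_lim_metric) (use E(1) in auto)
    have "integrable ?M (\<lambda>s. 3 / 2 * m1 * h1sum s)"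
      using integrable_Ioo_subinterval[OF h1sum_integrable[of d], of c d] cd by (intro integrable_mult_right) auto
    then have wi: "integrable ?M (\<lambda>s. \<bar>?f 0 s\<bar> + 3 / 2 * m1 * h1sum s)"
      using E(1)[of 0] by (intro Bochner_Integration.integrable_add integrable_abs) auto
    have bd: "AE s in ?M. norm (?f j s) \<le> \<bar>?f 0 s\<bar> + 3 / 2 * m1 * h1sum s" for j
      using reg
    proof eventually_elim
      case (elim s)
      have "hdiss m1 m2 j (emb (U s)) - hdiss m1 m2 0 (emb (U s)) \<le> 3 / 2 * m1 * h1sum s"
        using diss_approx_in_H1_0(2)[of "U s" m1 m2 j] elim m1 by (simp add: h1sum_def)
      moreover have "hdiss m1 m2 0 (emb (U s)) \<le> hdiss m1 m2 j (emb (U s))" by (rule hdiss_mono[OF m1]) simp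
      ultimately show ?case unfolding real_norm_def by linarith
    qed
    have Em: "?f j \<in> borel_measurable ?M" for j using E(1)[of j] by simp
    have fi: "integrable ?M f" by (rule integrable_dominated_convergence[OF fm Em wi limf bd])
    have "(\<lambda>j. integral\<^sup>L ?M (?f j)) \<longlonglongrightarrow> integral\<^sup>L ?M f"
      by (rule integral_dominated_convergence[OF fm Em wi limf bd])
    then have "V d - V c \<le> integral\<^sup>L ?M f"
      by (rule LIMSEQ_le_const) (use E(2) in \<open>auto simp: V_def\<close>)
    moreover have "AE s in ?M. f s \<le> - l * V s"
      using reg lim limf
    proof eventually_elim
      case (elim s)
      have "f s = hform m1 m2 (emb (U s)) (F s) - dissipated m1 m2 (U s)" by (rule LIMSEQ_unique[OF elim(3,2)])
      also have "\<dots> \<le> - l * V s"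
        unfolding F_def V_def
        by (rule lyapunov_rate[OF _ _ m1 m(2) l l1 l2]) (use elim(1) norm_U_le[of s] r in auto)
      finally show ?case .
    qed
    ultimately show ?thesis using fi by blast
  qed
  have mono: "V d \<le> V c" if cd: "0 \<le> c" "c < d" for c d
  proof -
    from main[OF cd] obtain f where f: "integrable (lebesgue_on {c<..<d}) f" "V d - V c \<le> integral\<^sup>L (lebesgue_on {c<..<d}) f"
      "AE s in lebesgue_on {c<..<d}. f s \<le> - l * V s" by blast
    have "AE s in lebesgue_on {c<..<d}. f s \<le> 0"
      using f(3) lebesgue_on_ae_space[of "{c<..<d}"]
    proof eventually_elim
      case (elim s)
      have "0 \<le> l * V s" using l V0[of s] elim cd by simp
      then show ?case using elim by simp
    qed
    then have "integral\<^sup>L (lebesgue_on {c<..<d}) f \<le> 0"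
      using integral_mono_AE[OF f(1), of "\<lambda>_. 0"] by simp
    then show ?thesis using f(2) by simp
  qed
  from main[OF ab] obtain f where f: "integrable (lebesgue_on {a<..<b}) f" "V b - V a \<le> integral\<^sup>L (lebesgue_on {a<..<b}) f"
      "AE s in lebesgue_on {a<..<b}. f s \<le> - l * V s" by blast
  have "AE s in lebesgue_on {a<..<b}. f s \<le> - l * V b"
    using f(3) lebesgue_on_ae_space[of "{a<..<b}"]
  proof eventually_elim
    case (elim s)
    have "l * V b \<le> l * V s" using l mono[of s b] elim ab by (intro mult_left_mono) auto
    then show ?case using elim by simp
  qed
  then have "integral\<^sup>L (lebesgue_on {a<..<b}) f \<le> integral\<^sup>L (lebesgue_on {a<..<b}) (\<lambda>_. - l * V b)"
    by (intro integral_mono_AE f(1) continuous_integrable_Ioo(1)) auto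
  also have "\<dots> = (- l * V b) * (b - a)" using continuous_integrable_Ioo(2)[of a b "\<lambda>_. - l * V b"] ab by auto
  finally show ?thesis using f(2) by (simp add: algebra_simps)
qed

lemma energy_decay:
  assumes r: "norm_H L h \<beta> U0 \<le> r" and l: "0 \<le> l"
    and l1: "l * (L\<^sup>2 * (1 + m1 * L)) \<le> pi\<^sup>2 * m1 * (3 - 16 * (L * sqrt L * r)) / 2"
    and l2: "l * (h * (1 + m2)) \<le> m2" and t: "0 \<le> t"
  shows "state_energy L h \<beta> (U t) \<le> (1 + max (m1 * L) m2) * state_energy L h \<beta> (U 0) * exp (- l * t)"
proof -
  define V where "V t = hform m1 m2 (emb (U t)) (emb (U t)) / 2" for t
  have m1: "0 \<le> m1" using m by simp
  have r': "norm (emb U0) \<le> r" using r by (simp add: norm_emb U0_H)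
  have E_V: "state_energy L h \<beta> (U s) \<le> V s" if "0 \<le> s" for s
    using wform_bounds(1)[OF U_H[OF that] m1 m(2)] by (simp add: V_def state_energy_inner hform_emb U_H that)
  have E0: "0 \<le> state_energy L h \<beta> (U 0)"
    using inner_emb[OF U_H U_H, of 0 0] inner_ge_zero[of "emb (U 0)"] by (simp add: state_energy_inner U_H)
  have V_E: "V 0 \<le> (1 + max (m1 * L) m2) * state_energy L h \<beta> (U 0)"
  proof -
    obtain u v z where uvz: "U 0 = (u, v, z)" by (cases "U 0")
    have H: "(u, v, z) \<in> H_space L" using U_H[of 0] by (simp add: uvz)
    have "wform m1 m2 (u, v, z) (u, v, z) \<le> (1 + m1 * L) * (inner_L2 0 L u u + inner_L2 0 L v v) + (1 + m2) * (\<beta> * h * inner_L2 0 1 z z)"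
      using wform_bounds(2)[OF H m1 m(2)] by simp
    also have "\<dots> \<le> (1 + max (m1 * L) m2) * (inner_L2 0 L u u + inner_L2 0 L v v) + (1 + max (m1 * L) m2) * (\<beta> * h * inner_L2 0 1 z z)"
      using \<beta> h by (intro add_mono mult_right_mono) (auto simp: inner_L2_nonneg)
    also have "\<dots> = (1 + max (m1 * L) m2) * inner_H L h \<beta> (u, v, z) (u, v, z)" by (simp only: inner_H.simps distrib_left)
    finally have W: "wform m1 m2 (u, v, z) (u, v, z) \<le> (1 + max (m1 * L) m2) * inner_H L h \<beta> (u, v, z) (u, v, z)" .
    show ?thesis unfolding V_def uvz state_energy_inner[OF H] hform_emb[OF H H] times_divide_eq_right
      by (rule divide_right_mono[OF W]) simp
  qed
  have "state_energy L h \<beta> (U t) \<le> V t" by (rule E_V[OF t])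
  also have "\<dots> \<le> V 0 * exp (- l * t)"
  proof (rule exp_decay_of_discrete_decay[OF l t])
    show "0 \<le> V 0" using E_V[of 0] E0 by simp
    show "V b * (1 + l * (b - a)) \<le> V a" if "0 \<le> a" "a < b" for a b
      unfolding V_def by (rule lyapunov_step[OF r' l l1 l2 that])
  qed
  also have "\<dots> \<le> (1 + max (m1 * L) m2) * state_energy L h \<beta> (U 0) * exp (- l * t)"
    using V_E by (rule mult_right_mono) simp
  finally show ?thesis .
qed

end

section \<open>The theorem\<close>

lemma mild_solution_hs_mild:
  assumes L: "0 < L" and h: "0 < h" and \<beta>: "0 < \<beta>" and gain: "\<alpha>\<^sup>2 + \<beta> / 2 \<le> 1 / 4" "\<beta> \<le> 1 / 2"
    and U0: "U0 \<in> H_space L" and U: "mild_solution L h \<alpha> \<beta> U0 U"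
  shows "\<exists>S. hs_mild L h \<beta> \<alpha> U0 U S"
proof -
  note D = U[unfolded mild_solution_def]
  obtain S where S: "C0_semigroup L h \<beta> S \<and>
          has_generator L h \<beta> S (HS_domain L \<alpha> \<beta>) (HS_operator L h) \<and>
          (\<forall>t\<ge>0. \<exists>W.
             has_integral_H L h \<beta> (\<lambda>s. S (t - s) (HS_nonlinearity L (U s))) t W \<and>
             dist_H L h \<beta> (U t) (lincomb 1 (S t U0) 1 W) = 0)"
    using D[THEN conjunct2, THEN conjunct2, THEN conjunct2] ..
  have "hs_mild_axioms L h \<beta> \<alpha> U0 U S"
    by (rule hs_mild_axioms.intro[OF U0 gain])
      (use D[THEN conjunct1] D[THEN conjunct2, THEN conjunct1] D[THEN conjunct2, THEN conjunct2, THEN conjunct1]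
        S[THEN conjunct1] S[THEN conjunct2, THEN conjunct1] S[THEN conjunct2, THEN conjunct2] in simp_all)
  then show ?thesis
    by (intro exI[of _ S] hs_mild.intro state_space.intro L h \<beta>)
qed

theorem theorem1p1:
  fixes L h \<alpha> \<beta> :: real
  assumes "L > 0" and "h > 0" and "\<beta> > 0"
    and "0 < 2 * \<alpha>\<^sup>2 + 3 / 2 * \<beta>" and "2 * \<alpha>\<^sup>2 + 3 / 2 * \<beta> < 1 / 2"
  shows "\<exists>r. 0 < r \<and> r < 3 / (16 * L powr (3 / 2)) \<and>
    (\<exists>\<mu>0>0. \<forall>\<mu>1 \<mu>2 \<kappa> lam.
       0 < \<mu>1 \<and> \<mu>1 < \<mu>0 \<and> 0 < \<mu>2 \<and> \<mu>2 < \<mu>0 \<and>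
       \<kappa> = 1 + max (\<mu>1 * L) \<mu>2 \<and>
       0 < lam \<and>
       lam \<le> min (pi\<^sup>2 * \<mu>1 * (3 - 16 * L powr (3 / 2) * r) / (2 * L\<^sup>2 * (1 + L * \<mu>1)))
               (\<mu>2 / (h * (1 + \<mu>2)))
       \<longrightarrow>
       (\<forall>u0 v0 z0 U.
          initial_state h u0 v0 z0 \<in> H_space L \<and>
          norm_H L h \<beta> (initial_state h u0 v0 z0) \<le> r \<and>
          mild_solution L h \<alpha> \<beta> (initial_state h u0 v0 z0) U
          \<longrightarrow>
          (\<forall>t\<ge>0. state_energy L h \<beta> (U t)
                  \<le> \<kappa> * state_energy L h \<beta> (U 0) * exp (- lam * t))))"
proof -
  define P where "P = L powr (3 / 2)"
  have P: "0 < P" using assms(1) by (simp add: P_def)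
  have PL: "P = L * sqrt L"
    using powr_add[of L 1 "1 / 2"] assms(1) by (simp add: P_def powr_half_sqrt)
  define q where "q = \<alpha>\<^sup>2 + \<beta> / 2"
  have q: "0 < q" "q < 1 / 4" and \<beta>3: "\<beta> < 1 / 3"
    using assms zero_le_power2[of \<alpha>] unfolding q_def by linarith+
  \<comment> \<open>If \<open>\<mu>1 L\<close> and \<open>\<mu>2\<close> are at most \<open>\<delta>\<close>, then the first condition of the weighted energy balance
      follows from \<open>(1 + \<delta>) q \<le> q + \<delta> \<le> 1 / 4\<close>, and the second one from
      \<open>(1 + \<delta>) \<beta> \<le> 3 / 2 * (1 / 3)\<close>.\<close>
  define \<delta> where "\<delta> = min (1 / 2) (1 / 4 - q)"
  have \<delta>: "0 < \<delta>" "\<delta> \<le> 1 / 2" "\<delta> \<le> 1 / 4 - q" using q by (auto simp: \<delta>_def)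
  show ?thesis
    unfolding P_def[symmetric]
  proof (rule exI[of _ "1 / (16 * P)"], intro conjI)
    show "0 < 1 / (16 * P)" "1 / (16 * P) < 3 / (16 * P)" using P by (auto intro: divide_strict_right_mono)
  next
    show "\<exists>\<mu>0>0. \<forall>\<mu>1 \<mu>2 \<kappa> lam.
       0 < \<mu>1 \<and> \<mu>1 < \<mu>0 \<and> 0 < \<mu>2 \<and> \<mu>2 < \<mu>0 \<and> \<kappa> = 1 + max (\<mu>1 * L) \<mu>2 \<and> 0 < lam \<and>
       lam \<le> min (pi\<^sup>2 * \<mu>1 * (3 - 16 * P * (1 / (16 * P))) / (2 * L\<^sup>2 * (1 + L * \<mu>1))) (\<mu>2 / (h * (1 + \<mu>2)))
       \<longrightarrow> (\<forall>u0 v0 z0 U. initial_state h u0 v0 z0 \<in> H_space L \<and> norm_H L h \<beta> (initial_state h u0 v0 z0) \<le> 1 / (16 * P) \<and>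
          mild_solution L h \<alpha> \<beta> (initial_state h u0 v0 z0) U
          \<longrightarrow> (\<forall>t\<ge>0. state_energy L h \<beta> (U t) \<le> \<kappa> * state_energy L h \<beta> (U 0) * exp (- lam * t)))"
    proof (rule exI[of _ "min (\<delta> / L) \<delta>"], intro conjI allI impI)
      show "0 < min (\<delta> / L) \<delta>" using \<delta> assms(1) by simp
    next
      fix \<mu>1 \<mu>2 \<kappa> lam :: real and u0 v0 z0 :: "real \<Rightarrow> real" and U :: "real \<Rightarrow> state" and t :: real
      assume A: "0 < \<mu>1 \<and> \<mu>1 < min (\<delta> / L) \<delta> \<and> 0 < \<mu>2 \<and> \<mu>2 < min (\<delta> / L) \<delta> \<and> \<kappa> = 1 + max (\<mu>1 * L) \<mu>2 \<and> 0 < lam \<and>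
         lam \<le> min (pi\<^sup>2 * \<mu>1 * (3 - 16 * P * (1 / (16 * P))) / (2 * L\<^sup>2 * (1 + L * \<mu>1))) (\<mu>2 / (h * (1 + \<mu>2)))"
        and B: "initial_state h u0 v0 z0 \<in> H_space L \<and> norm_H L h \<beta> (initial_state h u0 v0 z0) \<le> 1 / (16 * P) \<and>
            mild_solution L h \<alpha> \<beta> (initial_state h u0 v0 z0) U"
        and t: "0 \<le> t"
      have \<mu>: "0 < \<mu>1" "0 < \<mu>2" "\<mu>1 * L \<le> \<delta>" "\<mu>2 \<le> \<delta>"
      proof -
        have d: "\<mu>1 < \<delta> / L" "\<mu>2 < \<delta>" using A[THEN conjunct2, THEN conjunct1] A[THEN conjunct2, THEN conjunct2, THEN conjunct2, THEN conjunct1] by (simp_all only: min_less_iff_conj)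
        show "0 < \<mu>1" by (rule A[THEN conjunct1])
        show "0 < \<mu>2" by (rule A[THEN conjunct2, THEN conjunct2, THEN conjunct1])
        show "\<mu>1 * L \<le> \<delta>" using d(1) assms(1) by (simp add: field_simps)
        show "\<mu>2 \<le> \<delta>" using d(2) by simp
      qed
      have "(1 + \<mu>1 * L) * \<alpha>\<^sup>2 + \<beta> / 2 * (1 + \<mu>2) \<le> (1 + \<delta>) * \<alpha>\<^sup>2 + \<beta> / 2 * (1 + \<delta>)"
        using \<mu> assms(3) by (intro add_mono mult_right_mono mult_left_mono) auto
      also have "\<dots> = q + \<delta> * q" by (simp add: q_def algebra_simps)
      also have "\<dots> \<le> q + \<delta> * 1" using q \<delta> by (intro add_left_mono mult_left_mono) auto
      finally have c1: "(1 + \<mu>1 * L) * \<alpha>\<^sup>2 + \<beta> / 2 * (1 + \<mu>2) \<le> 1 / 4" using \<delta>(3) by simp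
      have "(1 + \<mu>1 * L) * \<beta> \<le> (3 / 2) * (1 / 3)" using \<mu> \<delta> \<beta>3 assms(1,3) by (intro mult_mono) auto
      then have c2: "(1 + \<mu>1 * L) * \<beta> \<le> 1 / 2" by simp
      have "\<exists>S. hs_mild L h \<beta> \<alpha> (initial_state h u0 v0 z0) U S"
        by (rule mild_solution_hs_mild[OF assms(1-3) _ _ B[THEN conjunct1] B[THEN conjunct2, THEN conjunct2]])
          (use q(2) \<beta>3 in \<open>simp_all add: q_def\<close>)
      then obtain S where "hs_mild L h \<beta> \<alpha> (initial_state h u0 v0 z0) U S" ..
      then have W: "hs_weights L h \<beta> \<alpha> (initial_state h u0 v0 z0) U S \<mu>1 \<mu>2"
        by (rule hs_weights.intro) (rule hs_weights_axioms.intro[OF \<mu>(1) less_imp_le[OF \<mu>(2)] c1 c2])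
      have lam: "lam \<le> pi\<^sup>2 * \<mu>1 * (3 - 16 * P * (1 / (16 * P))) / (2 * L\<^sup>2 * (1 + L * \<mu>1))" "lam \<le> \<mu>2 / (h * (1 + \<mu>2))" "0 \<le> lam" and \<kappa>: "\<kappa> = 1 + max (\<mu>1 * L) \<mu>2"
        using A[THEN conjunct2, THEN conjunct2, THEN conjunct2, THEN conjunct2] by (simp_all only: min.bounded_iff less_imp_le)
      have p: "0 < 2 * L\<^sup>2 * (1 + L * \<mu>1)" "0 < h * (1 + \<mu>2)" using assms \<mu> by (auto intro!: mult_pos_pos add_pos_pos)
      have "lam * (L\<^sup>2 * (1 + \<mu>1 * L)) = lam * (2 * L\<^sup>2 * (1 + L * \<mu>1)) / 2" by (simp add: mult_ac)
      also have "\<dots> \<le> pi\<^sup>2 * \<mu>1 * (3 - 16 * P * (1 / (16 * P))) / 2"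
        using lam(1) unfolding pos_le_divide_eq[OF p(1)] by (rule divide_right_mono) simp
      finally have l1: "lam * (L\<^sup>2 * (1 + \<mu>1 * L)) \<le> pi\<^sup>2 * \<mu>1 * (3 - 16 * (L * sqrt L * (1 / (16 * P)))) / 2"
        unfolding PL mult.assoc[of 16] .
      have l2: "lam * (h * (1 + \<mu>2)) \<le> \<mu>2" using lam(2) unfolding pos_le_divide_eq[OF p(2)] .
      show "state_energy L h \<beta> (U t) \<le> \<kappa> * state_energy L h \<beta> (U 0) * exp (- lam * t)"
        using hs_weights.energy_decay[OF W B[THEN conjunct2, THEN conjunct1] lam(3) l1 l2 t] unfolding \<kappa> .
    qed
  qed
qed

end
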